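(* Let $\mathbb{K}$ be a perfect field, and let $X$ be an eventually coconnective noetherian DG-scheme over $\mathbb{K}$. Suppose that the classical scheme underlying $X$ is an algebraic variety over $\mathbb{K}$. Then $X$ is generically sequence-regular, that is, there is a dense open subset $U\subseteq X$ such that for every point $x\in U$ the local DG-ring of $X$ at $x$ is sequence-regular.
   Context: All DG-rings are unital, non-positively graded, $A=\bigoplus_{n\le 0}A^n$ with differential of degree $+1$ satisfying the graded Leibniz rule, and commutative: $ba=(-1)^{\deg(a)\deg(b)}ab$ for homogeneous $a,b$, and $a^2=0$ for $a$ of odd degree. There is a natural surjection $\pi_A^0:A^0\to \mathrm{H}^0(A)$. For a DG-module $M$, $\inf(M)=\inf\{n\mid \mathrm{H}^n(M)\neq 0\}$. $\mathsf{D}(A)$ is the derived category of DG-modules over $A$, and $\mathsf{D}^+(A)$ is its full subcategory of DG-modules with bounded below cohomology. $A$ is noetherian if $\mathrm{H}^0(A)$ is a noetherian ring and each $\mathrm{H}^i(A)$, $i<0$, is a finitely generated $\mathrm{H}^0(A)$-module. $A$ has bounded cohomology if $\mathrm{H}^i(A)=0$ for $i\ll 0$. A noetherian local DG-ring $(A,\bar{\mathfrak{m}})$ is a noetherian DG-ring such that $\mathrm{H}^0(A)$ is a local ring with maximal ideal $\bar{\mathfrak{m}}$. Localization: for $\bar{\mathfrak{p}}\in\operatorname{Spec}(\mathrm{H}^0(A))$ put $\mathfrak{p}=(\pi_A^0)^{-1}(\bar{\mathfrak{p}})$ and $A_{\bar{\mathfrak{p}}}=A\otimes_{A^0}A^0_{\mathfrak{p}}$;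 then $\mathrm{H}^0(A_{\bar{\mathfrak{p}}})=\mathrm{H}^0(A)_{\bar{\mathfrak{p}}}$. Koszul complex: for $\bar a_1,\dots,\bar a_n\in \mathrm{H}^0(A)$ choose lifts $a_i\in A^0$ and set $K(A;\bar a_1,\dots,\bar a_n)=K(A^0;a_1,\dots,a_n)\otimes_{A^0}A$ (independent of the lifts up to isomorphism in the homotopy category of DG-rings); for $M\in\mathsf{D}(A)$, $K(M;\bar a_1,\dots,\bar a_n)=K(A;\bar a_1,\dots,\bar a_n)\otimes_A M$. Regular sequences: for a noetherian local DG-ring $(A,\bar{\mathfrak{m}})$ and $M\in\mathsf{D}^+(A)$, an element $\bar x\in\bar{\mathfrak{m}}$ is $M$-regular if multiplication by $\bar x$ on $\mathrm{H}^{\inf(M)}(M)$ is injective. A sequence $\bar a_1,\dots,\bar a_n\in\bar{\mathfrak{m}}$ is $M$-regular if $\bar a_1$ is $M$-regular and $\bar a_2,\dots,\bar a_n$ is $K(M;\bar a_1)$-regular. A noetherian local DG-ring $(A,\bar{\mathfrak{m}})$ with bounded cohomology is sequence-regular if $\bar{\mathfrak{m}}$ can be generated by an $A$-regular sequence. DG-schemes: for a commutative DG-algebra $A$ over $\mathbb{K}$, the affine DG-scheme of $A$ is the topological space $\operatorname{Spec}(\mathrm{H}^0(A))$, viewed as a closed subset of $\operatorname{Spec}(A^0)$, equipped with the restriction (inverse image) of the quasi-coherent sheaf of DG-algebras on $\operatorname{Spec}(A^0)$ associated to $A$; its stalk at $\bar{\mathfrak{p}}$ is $A_{\bar{\mathfrak{p}}}$.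 A DG-scheme over $\mathbb{K}$ is a topological space with a sheaf $\mathcal{O}_X$ of commutative non-positive DG-algebras over $\mathbb{K}$ that is locally equivalent (up to quasi-isomorphism of sheaves of DG-algebras) to affine DG-schemes. The classical scheme underlying $X$ is $(X,\mathrm{H}^0(\mathcal{O}_X))$. $X$ is noetherian and eventually coconnective if it has a finite cover by affine open DG-subschemes given by noetherian DG-rings with bounded cohomology. The local DG-ring at $x$ is the stalk $\mathcal{O}_{X,x}$ (so it is $A_{\bar{\mathfrak{p}}}$ if $x$ corresponds to $\bar{\mathfrak{p}}$ in an affine open given by $A$). An algebraic variety over $\mathbb{K}$ is an integral separated scheme of finite type over $\mathbb{K}$. *)

theory Defs
  imports "HOL-Algebra.Ring_Divisibility" "HOL-Algebra.Generated_Rings"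
    "HOL-Algebra.Elementary_Groups" "HOL-Computational_Algebra.Primes" "HOL-Analysis.Abstract_Topology"
begin

section \<open>Cochain complexes and DG-rings\<close>

text \<open>
  As in HOL-Homology, abelian groups are commutative groups in the sense of HOL-Algebra and are
  written multiplicatively: the product of \<^term>\<open>cpt C n\<close> is the addition of the degree \<open>n\<close> part,
  and its unit element is zero.  Gradings are external, i.e. families indexed by the integers, so
  that a sheaf of graded objects is a sheaf in each degree.
\<close>

record 'a cochain =
  cpt :: "int \<Rightarrow> 'a monoid"
  dif :: "int \<Rightarrow> 'a \<Rightarrow> 'a"

definition cochain_complex :: "('a, 'z) cochain_scheme \<Rightarrow> bool" where
  "cochain_complex C \<longleftrightarrow> (\<forall>n.
     comm_group (cpt C n) \<and>
     dif C n \<in> hom (cpt C n) (cpt C (n + 1)) \<and>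
     (\<forall>x \<in> carrier (cpt C n). dif C (n + 1) (dif C n x) = \<one>\<^bsub>cpt C (n + 1 + 1)\<^esub>))"

definition cocycles :: "('a, 'z) cochain_scheme \<Rightarrow> int \<Rightarrow> 'a set" where
  "cocycles C n = kernel (cpt C n) (cpt C (n + 1)) (dif C n)"

definition coboundaries :: "('a, 'z) cochain_scheme \<Rightarrow> int \<Rightarrow> 'a set" where
  "coboundaries C n = dif C (n - 1) ` carrier (cpt C (n - 1))"

definition cohomology :: "('a, 'z) cochain_scheme \<Rightarrow> int \<Rightarrow> 'a set monoid" where
  "cohomology C n = (cpt C n)\<lparr>carrier := cocycles C n\<rparr> Mod coboundaries C n"

definition coh_class :: "('a, 'z) cochain_scheme \<Rightarrow> int \<Rightarrow> 'a \<Rightarrow> 'a set" where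
  "coh_class C n z = coboundaries C n #>\<^bsub>cpt C n\<^esub> z"

definition signed :: "'a monoid \<Rightarrow> int \<Rightarrow> 'a \<Rightarrow> 'a" where
  "signed G k x = (if even k then x else inv\<^bsub>G\<^esub> x)"

record 'a dg_ring = "'a cochain" +
  dmul :: "int \<Rightarrow> int \<Rightarrow> 'a \<Rightarrow> 'a \<Rightarrow> 'a"
  dunit :: 'a

text \<open>\<^term>\<open>dmul A i j\<close> is the product of degree \<open>i\<close> elements with degree \<open>j\<close> elements.\<close>

locale dg_ring =
  fixes A :: "('a, 'z) dg_ring_scheme"
  assumes cochain: "cochain_complex A"
    and nonpositive: "0 < n \<Longrightarrow> carrier (cpt A n) = {\<one>\<^bsub>cpt A n\<^esub>}"
    and dunit_closed: "dunit A \<in> carrier (cpt A 0)"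
    and dmul_left_hom: "b \<in> carrier (cpt A j) \<Longrightarrow>
          (\<lambda>a. dmul A i j a b) \<in> hom (cpt A i) (cpt A (i + j))"
    and dmul_right_hom: "a \<in> carrier (cpt A i) \<Longrightarrow>
          (\<lambda>b. dmul A i j a b) \<in> hom (cpt A j) (cpt A (i + j))"
    and dmul_assoc: "\<lbrakk>a \<in> carrier (cpt A i); b \<in> carrier (cpt A j); c \<in> carrier (cpt A k)\<rbrakk> \<Longrightarrow>
          dmul A (i + j) k (dmul A i j a b) c = dmul A i (j + k) a (dmul A j k b c)"
    and dmul_dunit_left: "a \<in> carrier (cpt A i) \<Longrightarrow> dmul A 0 i (dunit A) a = a"
    and dmul_dunit_right: "a \<in> carrier (cpt A i) \<Longrightarrow> dmul A i 0 a (dunit A) = a"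
    and leibniz: "\<lbrakk>a \<in> carrier (cpt A i); b \<in> carrier (cpt A j)\<rbrakk> \<Longrightarrow>
          dif A (i + j) (dmul A i j a b) =
            dmul A (i + 1) j (dif A i a) b \<otimes>\<^bsub>cpt A (i + j + 1)\<^esub>
            signed (cpt A (i + j + 1)) i (dmul A i (j + 1) a (dif A j b))"
    and graded_comm: "\<lbrakk>a \<in> carrier (cpt A i); b \<in> carrier (cpt A j)\<rbrakk> \<Longrightarrow>
          dmul A j i b a = signed (cpt A (i + j)) (i * j) (dmul A i j a b)"
    and odd_square: "\<lbrakk>odd i; a \<in> carrier (cpt A i)\<rbrakk> \<Longrightarrow> dmul A i i a a = \<one>\<^bsub>cpt A (i + i)\<^esub>"

definition ring0 :: "('a, 'z) dg_ring_scheme \<Rightarrow> 'a ring" where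
  "ring0 A = \<lparr>carrier = carrier (cpt A 0), monoid.mult = dmul A 0 0, one = dunit A,
              ring.zero = \<one>\<^bsub>cpt A 0\<^esub>, ring.add = monoid.mult (cpt A 0)\<rparr>"

text \<open>Since \<open>A\<close> vanishes in degree 1, every element of degree 0 is a cocycle.\<close>

definition H0 :: "('a, 'z) dg_ring_scheme \<Rightarrow> 'a set ring" where
  "H0 A = ring0 A Quot coboundaries A 0"

definition H0_proj :: "('a, 'z) dg_ring_scheme \<Rightarrow> 'a \<Rightarrow> 'a set" where
  "H0_proj A a = coboundaries A 0 +>\<^bsub>ring0 A\<^esub> a"

definition dg_hom :: "('a, 'z) dg_ring_scheme \<Rightarrow> ('b, 'y) dg_ring_scheme \<Rightarrow> (int \<Rightarrow> 'a \<Rightarrow> 'b) \<Rightarrow> bool"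
  where
  "dg_hom A B f \<longleftrightarrow>
     (\<forall>n. f n \<in> hom (cpt A n) (cpt B n)) \<and>
     (\<forall>n. \<forall>a \<in> carrier (cpt A n). f (n + 1) (dif A n a) = dif B n (f n a)) \<and>
     (\<forall>i j. \<forall>a \<in> carrier (cpt A i). \<forall>b \<in> carrier (cpt A j).
        f (i + j) (dmul A i j a b) = dmul B i j (f i a) (f j b)) \<and>
     f 0 (dunit A) = dunit B"

definition coh_map :: "('b, 'y) cochain_scheme \<Rightarrow> (int \<Rightarrow> 'a \<Rightarrow> 'b) \<Rightarrow> int \<Rightarrow> 'a set \<Rightarrow> 'b set" where
  "coh_map B f n c = (\<Union>z \<in> c. coh_class B n (f n z))"

definition quasi_iso :: "('a, 'z) cochain_scheme \<Rightarrow> ('b, 'y) cochain_scheme \<Rightarrow> (int \<Rightarrow> 'a \<Rightarrow> 'b) \<Rightarrow> bool"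
  where
  "quasi_iso A B f \<longleftrightarrow>
     (\<forall>n. bij_betw (coh_map B f n) (carrier (cohomology A n)) (carrier (cohomology B n)))"

text \<open>
  DG-algebras over a ring \<open>K\<close> are DG-rings with a structure map from \<open>K\<close>, placed in degree 0.
  The image of \<open>K\<close> is automatically central and annihilated by the differential.
\<close>

record ('a, 'k) dg_alg = "'a dg_ring" +
  dstr :: "'k \<Rightarrow> 'a"

definition dg_algebra :: "'k ring \<Rightarrow> ('a, 'k) dg_alg \<Rightarrow> bool" where
  "dg_algebra K A \<longleftrightarrow> dg_ring A \<and> dstr A \<in> ring_hom K (ring0 A)"

definition dg_alg_hom :: "'k ring \<Rightarrow> ('a, 'k) dg_alg \<Rightarrow> ('b, 'k) dg_alg \<Rightarrow> (int \<Rightarrow> 'a \<Rightarrow> 'b) \<Rightarrow> bool"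
  where
  "dg_alg_hom K A B f \<longleftrightarrow> dg_hom A B f \<and> (\<forall>k \<in> carrier K. f 0 (dstr A k) = dstr B k)"


section \<open>DG-modules, Koszul complexes and regular sequences\<close>

record ('a, 'm) dg_module = "'m cochain" +
  dact :: "int \<Rightarrow> int \<Rightarrow> 'a \<Rightarrow> 'm \<Rightarrow> 'm"

locale dg_module = dg_ring A for A :: "('a, 'z) dg_ring_scheme" +
  fixes M :: "('a, 'm) dg_module"
  assumes module_cochain: "cochain_complex M"
    and dact_left_hom: "m \<in> carrier (cpt M j) \<Longrightarrow>
          (\<lambda>a. dact M i j a m) \<in> hom (cpt A i) (cpt M (i + j))"
    and dact_right_hom: "a \<in> carrier (cpt A i) \<Longrightarrow>
          (\<lambda>m. dact M i j a m) \<in> hom (cpt M j) (cpt M (i + j))"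
    and dact_assoc: "\<lbrakk>a \<in> carrier (cpt A i); b \<in> carrier (cpt A j); m \<in> carrier (cpt M k)\<rbrakk> \<Longrightarrow>
          dact M (i + j) k (dmul A i j a b) m = dact M i (j + k) a (dact M j k b m)"
    and dact_dunit: "m \<in> carrier (cpt M j) \<Longrightarrow> dact M 0 j (dunit A) m = m"
    and module_leibniz: "\<lbrakk>a \<in> carrier (cpt A i); m \<in> carrier (cpt M j)\<rbrakk> \<Longrightarrow>
          dif M (i + j) (dact M i j a m) =
            dact M (i + 1) j (dif A i a) m \<otimes>\<^bsub>cpt M (i + j + 1)\<^esub>
            signed (cpt M (i + j + 1)) i (dact M i (j + 1) a (dif M j m))"

definition dg_self :: "('a, 'z) dg_ring_scheme \<Rightarrow> ('a, 'a) dg_module" where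
  "dg_self A = \<lparr>cpt = cpt A, dif = dif A, dact = dmul A\<rparr>"

text \<open>
  The cohomology of a DG-module, as a module over \<^term>\<open>H0 A\<close>.  The ring multiplication and unit
  of a HOL-Algebra module record are irrelevant.
\<close>

definition coh_module :: "('a, 'm) dg_module \<Rightarrow> int \<Rightarrow> ('a set, 'm set) module" where
  "coh_module M n =
     \<lparr>carrier = carrier (cohomology M n), monoid.mult = undefined, one = undefined,
      ring.zero = \<one>\<^bsub>cohomology M n\<^esub>, ring.add = monoid.mult (cohomology M n),
      module.smult = (\<lambda>x c. \<Union>a \<in> x. \<Union>z \<in> c. coh_class M n (dact M 0 n a z))\<rparr>"

definition bounded_below :: "('a, 'z) cochain_scheme \<Rightarrow> bool" where
  "bounded_below C \<longleftrightarrow> (\<exists>N. \<forall>n < N. trivial_group (cohomology C n))"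

definition acyclic_complex :: "('a, 'z) cochain_scheme \<Rightarrow> bool" where
  "acyclic_complex C \<longleftrightarrow> (\<forall>n. trivial_group (cohomology C n))"

text \<open>Only meaningful if \<open>C\<close> is bounded below and not acyclic.\<close>

definition coh_inf :: "('a, 'z) cochain_scheme \<Rightarrow> int" where
  "coh_inf C = Inf {n. \<not> trivial_group (cohomology C n)}"

text \<open>
  The complex \<open>K(A\<^sup>0; a)\<close> is free over \<open>A\<^sup>0\<close> on the basis \<open>1\<close>, \<open>e\<close> with \<open>e\<close> in degree \<open>-1\<close> and
  \<open>d e = a\<close>.  Hence the degree \<open>n\<close> part of \<open>K(A; a) \<otimes> M\<close> (tensor product over \<open>A\<close>) consists of the
  elements \<open>1 \<otimes> m + e \<otimes> m'\<close> with \<open>m\<close> in \<open>M\<^sup>n\<close> and \<open>m'\<close> in \<open>M\<^sup>n\<^sup>+\<^sup>1\<close>, written \<open>KPair m m'\<close>; moreover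
  \<open>d (e \<otimes> m') = a m' - e \<otimes> d m'\<close> and \<open>b (e \<otimes> m') = (-1)\<^sup>i e \<otimes> b m'\<close> for \<open>b\<close> in \<open>A\<^sup>i\<close>.
  The datatype makes all iterated Koszul complexes of a DG-module live in one type.
\<close>

datatype 'm koszul_elt =
    KBase (kbase: 'm)
  | KPair (kfst: "'m koszul_elt") (ksnd: "'m koszul_elt")

definition koszul_base :: "('a, 'm) dg_module \<Rightarrow> ('a, 'm koszul_elt) dg_module" where
  "koszul_base M =
     \<lparr>cpt = (\<lambda>n. \<lparr>carrier = KBase ` carrier (cpt M n),
                  monoid.mult = (\<lambda>u v. KBase (kbase u \<otimes>\<^bsub>cpt M n\<^esub> kbase v)),
                  one = KBase \<one>\<^bsub>cpt M n\<^esub>\<rparr>),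
      dif = (\<lambda>n u. KBase (dif M n (kbase u))),
      dact = (\<lambda>i n b u. KBase (dact M i n b (kbase u)))\<rparr>"

definition koszul :: "('a, 'm koszul_elt) dg_module \<Rightarrow> 'a \<Rightarrow> ('a, 'm koszul_elt) dg_module" where
  "koszul M a =
     \<lparr>cpt = (\<lambda>n. \<lparr>carrier = {KPair m m' | m m'. m \<in> carrier (cpt M n) \<and> m' \<in> carrier (cpt M (n + 1))},
                  monoid.mult = (\<lambda>u v. KPair (kfst u \<otimes>\<^bsub>cpt M n\<^esub> kfst v) (ksnd u \<otimes>\<^bsub>cpt M (n + 1)\<^esub> ksnd v)),
                  one = KPair \<one>\<^bsub>cpt M n\<^esub> \<one>\<^bsub>cpt M (n + 1)\<^esub>\<rparr>),
      dif = (\<lambda>n u. KPair (dif M n (kfst u) \<otimes>\<^bsub>cpt M (n + 1)\<^esub> dact M 0 (n + 1) a (ksnd u))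
                         (inv\<^bsub>cpt M (n + 1 + 1)\<^esub> (dif M (n + 1) (ksnd u)))),
      dact = (\<lambda>i n b u. KPair (dact M i n b (kfst u))
                              (signed (cpt M (i + n + 1)) i (dact M i (n + 1) b (ksnd u))))\<rparr>"

text \<open>
  An element of \<^term>\<open>H0 A\<close> is the set of its lifts to degree 0, so \<open>koszul_H0\<close> chooses a lift.
\<close>

definition koszul_H0 :: "('a, 'm koszul_elt) dg_module \<Rightarrow> 'a set \<Rightarrow> ('a, 'm koszul_elt) dg_module" where
  "koszul_H0 M x = koszul M (SOME a. a \<in> x)"

text \<open>If \<open>M\<close> is acyclic, its infimum is infinite and there is no condition on the element.\<close>

definition regular_element :: "('a, 'm) dg_module \<Rightarrow> 'a set \<Rightarrow> bool" where
  "regular_element M x \<longleftrightarrow> bounded_below M \<and>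
     (\<not> acyclic_complex M \<longrightarrow>
        inj_on (\<lambda>c. x \<odot>\<^bsub>coh_module M (coh_inf M)\<^esub> c) (carrier (coh_module M (coh_inf M))))"

fun regular_sequence :: "('a, 'm koszul_elt) dg_module \<Rightarrow> 'a set list \<Rightarrow> bool" where
  "regular_sequence M [] \<longleftrightarrow> True"
| "regular_sequence M (x # xs) \<longleftrightarrow> regular_element M x \<and> regular_sequence (koszul_H0 M x) xs"


section \<open>Noetherian local DG-rings\<close>

definition fin_gen_module :: "('r, 'y) ring_scheme \<Rightarrow> ('r, 'm) module \<Rightarrow> bool" where
  "fin_gen_module R M \<longleftrightarrow>
     (\<exists>S. finite S \<and> S \<subseteq> carrier M \<and> (\<forall>N. submodule N R M \<and> S \<subseteq> N \<longrightarrow> N = carrier M))"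

definition noetherian_dg_ring :: "('a, 'z) dg_ring_scheme \<Rightarrow> bool" where
  "noetherian_dg_ring A \<longleftrightarrow> dg_ring A \<and> noetherian_ring (H0 A) \<and>
     (\<forall>i < 0. fin_gen_module (H0 A) (coh_module (dg_self A) i))"

definition bounded_cohomology :: "('a, 'z) dg_ring_scheme \<Rightarrow> bool" where
  "bounded_cohomology A \<longleftrightarrow> (\<exists>N. \<forall>i < N. trivial_group (cohomology A i))"

definition local_ring :: "('a, 'z) ring_scheme \<Rightarrow> bool" where
  "local_ring R \<longleftrightarrow> cring R \<and> (\<exists>!\<mm>. maximalideal \<mm> R)"

definition noetherian_local_dg_ring :: "('a, 'z) dg_ring_scheme \<Rightarrow> 'a set set \<Rightarrow> bool" where
  "noetherian_local_dg_ring A \<mm> \<longleftrightarrow>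
     noetherian_dg_ring A \<and> local_ring (H0 A) \<and> maximalideal \<mm> (H0 A)"

definition sequence_regular :: "('a, 'z) dg_ring_scheme \<Rightarrow> bool" where
  "sequence_regular A \<longleftrightarrow> (\<exists>\<mm>. noetherian_local_dg_ring A \<mm> \<and> bounded_cohomology A \<and>
     (\<exists>xs. set xs \<subseteq> \<mm> \<and> Idl\<^bsub>H0 A\<^esub> (set xs) = \<mm> \<and>
           regular_sequence (koszul_base (dg_self A)) xs))"


section \<open>Sheaves and germs\<close>

text \<open>
  A presheaf of sets on a topological space \<open>T\<close> is given by its sets of sections \<open>S U\<close> and its
  restriction maps \<open>r U V\<close> for \<open>V \<subseteq> U\<close>; only the values at open sets matter.
\<close>

definition sheaf_on ::
  "'p topology \<Rightarrow> ('p set \<Rightarrow> 'a set) \<Rightarrow> ('p set \<Rightarrow> 'p set \<Rightarrow> 'a \<Rightarrow> 'a) \<Rightarrow> bool" where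
  "sheaf_on T S r \<longleftrightarrow>
     (\<forall>U V. openin T U \<and> openin T V \<and> V \<subseteq> U \<longrightarrow> r U V \<in> S U \<rightarrow> S V) \<and>
     (\<forall>U. openin T U \<longrightarrow> (\<forall>s \<in> S U. r U U s = s)) \<and>
     (\<forall>U V W. openin T U \<and> openin T V \<and> openin T W \<and> W \<subseteq> V \<and> V \<subseteq> U \<longrightarrow>
        (\<forall>s \<in> S U. r V W (r U V s) = r U W s)) \<and>
     (\<forall>C s. (\<forall>V \<in> C. openin T V \<and> s V \<in> S V) \<and>
        (\<forall>V \<in> C. \<forall>W \<in> C. r V (V \<inter> W) (s V) = r W (V \<inter> W) (s W)) \<longrightarrow>
        (\<exists>!t. t \<in> S (\<Union>C) \<and> (\<forall>V \<in> C. r (\<Union>C) V t = s V)))"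

definition germ ::
  "'p topology \<Rightarrow> ('p set \<Rightarrow> 'a set) \<Rightarrow> ('p set \<Rightarrow> 'p set \<Rightarrow> 'a \<Rightarrow> 'a) \<Rightarrow> 'p \<Rightarrow> 'p set \<Rightarrow> 'a
     \<Rightarrow> ('p set \<times> 'a) set" where
  "germ T S r x U s = {(V, t). openin T V \<and> x \<in> V \<and> t \<in> S V \<and>
     (\<exists>W. openin T W \<and> x \<in> W \<and> W \<subseteq> U \<inter> V \<and> r U W s = r V W t)}"

definition germs ::
  "'p topology \<Rightarrow> ('p set \<Rightarrow> 'a set) \<Rightarrow> ('p set \<Rightarrow> 'p set \<Rightarrow> 'a \<Rightarrow> 'a) \<Rightarrow> 'p
     \<Rightarrow> ('p set \<times> 'a) set set" where
  "germs T S r x = {germ T S r x U s | U s. openin T U \<and> x \<in> U \<and> s \<in> S U}"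


section \<open>Prime spectra\<close>

definition Spec :: "('a, 'z) ring_scheme \<Rightarrow> 'a set set" where
  "Spec R = {\<pp>. primeideal \<pp> R}"

definition zariski :: "('a, 'z) ring_scheme \<Rightarrow> 'a set topology" where
  "zariski R = topology (\<lambda>U. \<exists>E \<subseteq> carrier R. U = {\<pp> \<in> Spec R. \<not> E \<subseteq> \<pp>})"


section \<open>Spaces with a sheaf of DG-algebras\<close>

record ('p, 'a, 'k) dg_space =
  dsp :: "'p topology"
  dsec :: "'p set \<Rightarrow> ('a, 'k) dg_alg"
  dres :: "'p set \<Rightarrow> 'p set \<Rightarrow> int \<Rightarrow> 'a \<Rightarrow> 'a"

definition dg_ringed_space :: "'k ring \<Rightarrow> ('p, 'a, 'k) dg_space \<Rightarrow> bool" where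
  "dg_ringed_space K X \<longleftrightarrow>
     (\<forall>U. openin (dsp X) U \<longrightarrow> dg_algebra K (dsec X U)) \<and>
     (\<forall>U V. openin (dsp X) U \<and> openin (dsp X) V \<and> V \<subseteq> U \<longrightarrow>
        dg_alg_hom K (dsec X U) (dsec X V) (dres X U V)) \<and>
     (\<forall>n. sheaf_on (dsp X) (\<lambda>U. carrier (cpt (dsec X U) n)) (\<lambda>U V. dres X U V n))"

definition dg_germ :: "('p, 'a, 'k) dg_space \<Rightarrow> 'p \<Rightarrow> int \<Rightarrow> 'p set \<Rightarrow> 'a \<Rightarrow> ('p set \<times> 'a) set" where
  "dg_germ X x n = germ (dsp X) (\<lambda>U. carrier (cpt (dsec X U) n)) (\<lambda>U V. dres X U V n) x"

definition dg_stalk :: "('p, 'a, 'k) dg_space \<Rightarrow> 'p \<Rightarrow> (('p set \<times> 'a) set, 'k) dg_alg" where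
  "dg_stalk X x =
     \<lparr>cpt = (\<lambda>n. \<lparr>carrier = germs (dsp X) (\<lambda>U. carrier (cpt (dsec X U) n)) (\<lambda>U V. dres X U V n) x,
                  monoid.mult = (\<lambda>g h. \<Union>(U, s) \<in> g. \<Union>(V, t) \<in> h. dg_germ X x n (U \<inter> V)
                            (dres X U (U \<inter> V) n s \<otimes>\<^bsub>cpt (dsec X (U \<inter> V)) n\<^esub> dres X V (U \<inter> V) n t)),
                  one = dg_germ X x n (topspace (dsp X)) \<one>\<^bsub>cpt (dsec X (topspace (dsp X))) n\<^esub>\<rparr>),
      dif = (\<lambda>n g. \<Union>(U, s) \<in> g. dg_germ X x (n + 1) U (dif (dsec X U) n s)),
      dmul = (\<lambda>i j g h. \<Union>(U, s) \<in> g. \<Union>(V, t) \<in> h. dg_germ X x (i + j) (U \<inter> V)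
                (dmul (dsec X (U \<inter> V)) i j (dres X U (U \<inter> V) i s) (dres X V (U \<inter> V) j t))),
      dunit = dg_germ X x 0 (topspace (dsp X)) (dunit (dsec X (topspace (dsp X)))),
      dstr = (\<lambda>k. dg_germ X x 0 (topspace (dsp X)) (dstr (dsec X (topspace (dsp X))) k))\<rparr>"

definition dg_sheaf_hom ::
  "'k ring \<Rightarrow> ('p, 'a, 'k) dg_space \<Rightarrow> ('p, 'b, 'k) dg_space \<Rightarrow> ('p set \<Rightarrow> int \<Rightarrow> 'a \<Rightarrow> 'b) \<Rightarrow> bool"
  where
  "dg_sheaf_hom K F G \<phi> \<longleftrightarrow>
     (\<forall>U. openin (dsp F) U \<longrightarrow> dg_alg_hom K (dsec F U) (dsec G U) (\<phi> U)) \<and>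
     (\<forall>U V n. openin (dsp F) U \<and> openin (dsp F) V \<and> V \<subseteq> U \<longrightarrow>
        (\<forall>s \<in> carrier (cpt (dsec F U) n). \<phi> V n (dres F U V n s) = dres G U V n (\<phi> U n s)))"

definition dg_stalk_map ::
  "('p, 'b, 'k) dg_space \<Rightarrow> ('p set \<Rightarrow> int \<Rightarrow> 'a \<Rightarrow> 'b) \<Rightarrow> 'p \<Rightarrow> int
     \<Rightarrow> ('p set \<times> 'a) set \<Rightarrow> ('p set \<times> 'b) set" where
  "dg_stalk_map G \<phi> x n g = (\<Union>(U, s) \<in> g. dg_germ G x n U (\<phi> U n s))"

text \<open>
  A map of complexes of sheaves is a quasi-isomorphism iff it is one on all stalks.
\<close>

definition sheaf_quasi_iso ::
  "'k ring \<Rightarrow> ('p, 'a, 'k) dg_space \<Rightarrow> ('p, 'b, 'k) dg_space \<Rightarrow> bool" where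
  "sheaf_quasi_iso K F G \<longleftrightarrow>
     dg_ringed_space K F \<and> dg_ringed_space K G \<and> dsp F = dsp G \<and>
     (\<exists>\<phi>. dg_sheaf_hom K F G \<phi> \<and>
        (\<forall>x \<in> topspace (dsp F). quasi_iso (dg_stalk F x) (dg_stalk G x) (dg_stalk_map G \<phi> x)))"

definition qis_linked ::
  "'k ring \<Rightarrow> ('p, 'a, 'k) dg_space \<Rightarrow> ('p, 'b, 'k) dg_space \<Rightarrow> bool" where
  "qis_linked K F G \<longleftrightarrow> sheaf_quasi_iso K F G \<or> sheaf_quasi_iso K G F"

text \<open>
  Zigzags of quasi-isomorphisms.  HOL has no quantification over types inside a formula, so the
  intermediate sheaves take their sections in a type \<open>'u\<close> that is passed as a parameter.  In the
  same way, in all definitions below \<open>'u\<close> is the type in which the existentially quantified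
  algebras and spaces live (a universe); a theorem that is polymorphic in \<open>'u\<close> holds for types
  \<open>'u\<close> of any size.
\<close>

definition qis_equivalent ::
  "'u itself \<Rightarrow> 'k ring \<Rightarrow> ('p, 'a, 'k) dg_space \<Rightarrow> ('p, 'b, 'k) dg_space \<Rightarrow> bool" where
  "qis_equivalent TU K F G \<longleftrightarrow>
     (\<exists>F' G' :: ('p, 'u, 'k) dg_space.
        qis_linked K F F' \<and> (qis_linked K)\<^sup>*\<^sup>* F' G' \<and> qis_linked K G' G)"


section \<open>Localization of DG-rings and affine DG-schemes\<close>

text \<open>
  The tensor product of \<open>A\<^sup>n\<close> with the localization of \<open>A\<^sup>0\<close> at a multiplicative set \<open>S\<close> is the module
  of fractions \<open>a / f\<close>, \<open>a\<close> in \<open>A\<^sup>n\<close> and \<open>f\<close> in \<open>S\<close>.  The differential acts on numerators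
  since elements of degree 0 are cocycles.
\<close>

definition dg_frac :: "('a, 'z) dg_ring_scheme \<Rightarrow> 'a set \<Rightarrow> int \<Rightarrow> 'a \<Rightarrow> 'a \<Rightarrow> ('a \<times> 'a) set" where
  "dg_frac A S n a f = {(b, g). b \<in> carrier (cpt A n) \<and> g \<in> S \<and>
     (\<exists>h \<in> S. dmul A 0 n h (dmul A 0 n g a) = dmul A 0 n h (dmul A 0 n f b))}"

definition dg_localization :: "('a, 'k) dg_alg \<Rightarrow> 'a set \<Rightarrow> (('a \<times> 'a) set, 'k) dg_alg" where
  "dg_localization A S =
     \<lparr>cpt = (\<lambda>n. \<lparr>carrier = {dg_frac A S n a f | a f. a \<in> carrier (cpt A n) \<and> f \<in> S},
                  monoid.mult = (\<lambda>u v. \<Union>(a, f) \<in> u. \<Union>(b, g) \<in> v.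
                            dg_frac A S n (dmul A 0 n g a \<otimes>\<^bsub>cpt A n\<^esub> dmul A 0 n f b) (dmul A 0 0 f g)),
                  one = dg_frac A S n \<one>\<^bsub>cpt A n\<^esub> (dunit A)\<rparr>),
      dif = (\<lambda>n u. \<Union>(a, f) \<in> u. dg_frac A S (n + 1) (dif A n a) f),
      dmul = (\<lambda>i j u v. \<Union>(a, f) \<in> u. \<Union>(b, g) \<in> v.
                dg_frac A S (i + j) (dmul A i j a b) (dmul A 0 0 f g)),
      dunit = dg_frac A S 0 (dunit A) (dunit A),
      dstr = (\<lambda>k. dg_frac A S 0 (dstr A k) (dunit A))\<rparr>"

definition prime_compl :: "('a, 'z) dg_ring_scheme \<Rightarrow> 'a set set \<Rightarrow> 'a set" where
  "prime_compl A \<pp> = {f \<in> carrier (cpt A 0). H0_proj A f \<notin> \<pp>}"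

definition dg_local :: "('a, 'k) dg_alg \<Rightarrow> 'a set set \<Rightarrow> (('a \<times> 'a) set, 'k) dg_alg" where
  "dg_local A \<pp> = dg_localization A (prime_compl A \<pp>)"

text \<open>
  The inverse image on \<open>Spec (H0 A)\<close> of the quasi-coherent sheaf on \<open>Spec A\<^sup>0\<close> attached to \<open>A\<close>:
  its sections over \<open>V\<close> are the families of elements of the stalks \<^term>\<open>dg_local A \<pp>\<close> that are
  locally induced by sections of that sheaf, i.e. are locally given by a single fraction.
\<close>

definition affine_sections :: "('a, 'k) dg_alg \<Rightarrow> int \<Rightarrow> 'a set set set
     \<Rightarrow> ('a set set \<Rightarrow> ('a \<times> 'a) set) set" where
  "affine_sections A n V = {s \<in> extensional V. \<forall>\<pp> \<in> V.
     \<exists>W a f. openin (zariski (H0 A)) W \<and> \<pp> \<in> W \<and> W \<subseteq> V \<and> a \<in> carrier (cpt A n) \<and>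
       (\<forall>\<qq> \<in> W. f \<in> prime_compl A \<qq> \<and> s \<qq> = dg_frac A (prime_compl A \<qq>) n a f)}"

definition affine_dg_scheme :: "('a, 'k) dg_alg
     \<Rightarrow> ('a set set, 'a set set \<Rightarrow> ('a \<times> 'a) set, 'k) dg_space" where
  "affine_dg_scheme A =
     \<lparr>dsp = zariski (H0 A),
      dsec = (\<lambda>V.
        \<lparr>cpt = (\<lambda>n. \<lparr>carrier = affine_sections A n V,
                     monoid.mult = (\<lambda>s t. \<lambda>\<pp> \<in> V. s \<pp> \<otimes>\<^bsub>cpt (dg_local A \<pp>) n\<^esub> t \<pp>),
                     one = (\<lambda>\<pp> \<in> V. \<one>\<^bsub>cpt (dg_local A \<pp>) n\<^esub>)\<rparr>),
         dif = (\<lambda>n s. \<lambda>\<pp> \<in> V. dif (dg_local A \<pp>) n (s \<pp>)),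
         dmul = (\<lambda>i j s t. \<lambda>\<pp> \<in> V. dmul (dg_local A \<pp>) i j (s \<pp>) (t \<pp>)),
         dunit = (\<lambda>\<pp> \<in> V. dunit (dg_local A \<pp>)),
         dstr = (\<lambda>k. \<lambda>\<pp> \<in> V. dstr (dg_local A \<pp>) k)\<rparr>),
      dres = (\<lambda>U V n s. restrict s V)\<rparr>"


section \<open>DG-schemes\<close>

text \<open>The direct image of \<open>X\<close> restricted to \<open>U\<close> under a map \<open>h\<close> from \<open>U\<close> to the space \<open>T\<close>.\<close>

definition dg_transport ::
  "('p, 'a, 'k) dg_space \<Rightarrow> 'p set \<Rightarrow> ('p \<Rightarrow> 'q) \<Rightarrow> 'q topology \<Rightarrow> ('q, 'a, 'k) dg_space" where
  "dg_transport X U h T =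
     \<lparr>dsp = T,
      dsec = (\<lambda>V. dsec X {x \<in> U. h x \<in> V}),
      dres = (\<lambda>V W. dres X {x \<in> U. h x \<in> V} {x \<in> U. h x \<in> W})\<rparr>"

definition affine_open :: "'k ring \<Rightarrow> ('p, 'a, 'k) dg_space \<Rightarrow> 'p set \<Rightarrow> ('u, 'k) dg_alg \<Rightarrow> bool" where
  "affine_open K X U A \<longleftrightarrow> openin (dsp X) U \<and> dg_algebra K A \<and>
     (\<exists>h. homeomorphic_map (subtopology (dsp X) U) (zariski (H0 A)) h \<and>
          qis_equivalent TYPE('u) K (dg_transport X U h (zariski (H0 A))) (affine_dg_scheme A))"

definition dg_scheme :: "'u itself \<Rightarrow> 'k ring \<Rightarrow> ('p, 'a, 'k) dg_space \<Rightarrow> bool" where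
  "dg_scheme TU K X \<longleftrightarrow> dg_ringed_space K X \<and>
     (\<forall>x \<in> topspace (dsp X). \<exists>U. \<exists>A :: ('u, 'k) dg_alg. x \<in> U \<and> affine_open K X U A)"

definition noetherian_eventually_coconnective ::
  "'u itself \<Rightarrow> 'k ring \<Rightarrow> ('p, 'a, 'k) dg_space \<Rightarrow> bool" where
  "noetherian_eventually_coconnective TU K X \<longleftrightarrow>
     (\<exists>C. finite C \<and> \<Union>C = topspace (dsp X) \<and>
        (\<forall>U \<in> C. \<exists>A :: ('u, 'k) dg_alg.
           affine_open K X U A \<and> noetherian_dg_ring A \<and> bounded_cohomology A))"


section \<open>Schemes and varieties over a field\<close>

record ('a, 'k) kalg = "'a ring" +
  kstr :: "'k \<Rightarrow> 'a"

definition kalgebra :: "'k ring \<Rightarrow> ('a, 'k) kalg \<Rightarrow> bool" where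
  "kalgebra K R \<longleftrightarrow> cring R \<and> kstr R \<in> ring_hom K R"

definition kalg_hom :: "'k ring \<Rightarrow> ('a, 'k) kalg \<Rightarrow> ('b, 'k) kalg \<Rightarrow> ('a \<Rightarrow> 'b) set" where
  "kalg_hom K R R' = {f \<in> ring_hom R R'. \<forall>k \<in> carrier K. f (kstr R k) = kstr R' k}"

definition fin_gen_algebra :: "'k ring \<Rightarrow> ('a, 'k) kalg \<Rightarrow> bool" where
  "fin_gen_algebra K R \<longleftrightarrow> kalgebra K R \<and>
     (\<exists>S. finite S \<and> S \<subseteq> carrier R \<and> generate_ring R (kstr R ` carrier K \<union> S) = carrier R)"

record ('p, 'a, 'k) ringed_space =
  rsp :: "'p topology"
  rsec :: "'p set \<Rightarrow> ('a, 'k) kalg"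
  rres :: "'p set \<Rightarrow> 'p set \<Rightarrow> 'a \<Rightarrow> 'a"

definition kringed_space :: "'k ring \<Rightarrow> ('p, 'a, 'k) ringed_space \<Rightarrow> bool" where
  "kringed_space K X \<longleftrightarrow>
     (\<forall>U. openin (rsp X) U \<longrightarrow> kalgebra K (rsec X U)) \<and>
     (\<forall>U V. openin (rsp X) U \<and> openin (rsp X) V \<and> V \<subseteq> U \<longrightarrow>
        rres X U V \<in> kalg_hom K (rsec X U) (rsec X V)) \<and>
     sheaf_on (rsp X) (\<lambda>U. carrier (rsec X U)) (rres X)"

definition rgerm :: "('p, 'a, 'k) ringed_space \<Rightarrow> 'p \<Rightarrow> 'p set \<Rightarrow> 'a \<Rightarrow> ('p set \<times> 'a) set" where
  "rgerm X x = germ (rsp X) (\<lambda>U. carrier (rsec X U)) (rres X) x"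

definition rstalk :: "('p, 'a, 'k) ringed_space \<Rightarrow> 'p \<Rightarrow> (('p set \<times> 'a) set, 'k) kalg" where
  "rstalk X x =
     \<lparr>carrier = germs (rsp X) (\<lambda>U. carrier (rsec X U)) (rres X) x,
      monoid.mult = (\<lambda>g h. \<Union>(U, s) \<in> g. \<Union>(V, t) \<in> h. rgerm X x (U \<inter> V)
                (rres X U (U \<inter> V) s \<otimes>\<^bsub>rsec X (U \<inter> V)\<^esub> rres X V (U \<inter> V) t)),
      one = rgerm X x (topspace (rsp X)) \<one>\<^bsub>rsec X (topspace (rsp X))\<^esub>,
      ring.zero = rgerm X x (topspace (rsp X)) \<zero>\<^bsub>rsec X (topspace (rsp X))\<^esub>,
      ring.add = (\<lambda>g h. \<Union>(U, s) \<in> g. \<Union>(V, t) \<in> h. rgerm X x (U \<inter> V)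
                (rres X U (U \<inter> V) s \<oplus>\<^bsub>rsec X (U \<inter> V)\<^esub> rres X V (U \<inter> V) t)),
      kstr = (\<lambda>k. rgerm X x (topspace (rsp X)) (kstr (rsec X (topspace (rsp X))) k))\<rparr>"

text \<open>Sheafification: families of germs that are locally induced by sections of the presheaf.\<close>

definition sheafify :: "('p, 'a, 'k) ringed_space \<Rightarrow> ('p, 'p \<Rightarrow> ('p set \<times> 'a) set, 'k) ringed_space"
  where
  "sheafify P =
     \<lparr>rsp = rsp P,
      rsec = (\<lambda>V.
        \<lparr>carrier = {s \<in> extensional V. \<forall>x \<in> V. \<exists>W t. openin (rsp P) W \<and> x \<in> W \<and> W \<subseteq> V \<and>
                      t \<in> carrier (rsec P W) \<and> (\<forall>y \<in> W. s y = rgerm P y W t)},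
         monoid.mult = (\<lambda>s t. \<lambda>x \<in> V. s x \<otimes>\<^bsub>rstalk P x\<^esub> t x),
         one = (\<lambda>x \<in> V. \<one>\<^bsub>rstalk P x\<^esub>),
         ring.zero = (\<lambda>x \<in> V. \<zero>\<^bsub>rstalk P x\<^esub>),
         ring.add = (\<lambda>s t. \<lambda>x \<in> V. s x \<oplus>\<^bsub>rstalk P x\<^esub> t x),
         kstr = (\<lambda>k. \<lambda>x \<in> V. kstr (rstalk P x) k)\<rparr>),
      rres = (\<lambda>U V s. restrict s V)\<rparr>"

definition H0_presheaf :: "('p, 'a, 'k) dg_space \<Rightarrow> ('p, 'a set, 'k) ringed_space" where
  "H0_presheaf X =
     \<lparr>rsp = dsp X,
      rsec = (\<lambda>U. ring.extend (H0 (dsec X U))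
                    (kalg.fields (\<lambda>k. H0_proj (dsec X U) (dstr (dsec X U) k)))),
      rres = (\<lambda>U V. coh_map (dsec X V) (dres X U V) 0)\<rparr>"

definition underlying_scheme ::
  "('p, 'a, 'k) dg_space \<Rightarrow> ('p, 'p \<Rightarrow> ('p set \<times> 'a set) set, 'k) ringed_space" where
  "underlying_scheme X = sheafify (H0_presheaf X)"

definition ring_frac :: "('a, 'z) ring_scheme \<Rightarrow> 'a set \<Rightarrow> 'a \<Rightarrow> 'a \<Rightarrow> ('a \<times> 'a) set" where
  "ring_frac R S a f = {(b, g). b \<in> carrier R \<and> g \<in> S \<and>
     (\<exists>h \<in> S. h \<otimes>\<^bsub>R\<^esub> (g \<otimes>\<^bsub>R\<^esub> a) = h \<otimes>\<^bsub>R\<^esub> (f \<otimes>\<^bsub>R\<^esub> b))}"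

definition localization :: "('a, 'k) kalg \<Rightarrow> 'a set \<Rightarrow> (('a \<times> 'a) set, 'k) kalg" where
  "localization R S =
     \<lparr>carrier = {ring_frac R S a f | a f. a \<in> carrier R \<and> f \<in> S},
      monoid.mult = (\<lambda>u v. \<Union>(a, f) \<in> u. \<Union>(b, g) \<in> v. ring_frac R S (a \<otimes>\<^bsub>R\<^esub> b) (f \<otimes>\<^bsub>R\<^esub> g)),
      one = ring_frac R S \<one>\<^bsub>R\<^esub> \<one>\<^bsub>R\<^esub>,
      ring.zero = ring_frac R S \<zero>\<^bsub>R\<^esub> \<one>\<^bsub>R\<^esub>,
      ring.add = (\<lambda>u v. \<Union>(a, f) \<in> u. \<Union>(b, g) \<in> v.
               ring_frac R S ((g \<otimes>\<^bsub>R\<^esub> a) \<oplus>\<^bsub>R\<^esub> (f \<otimes>\<^bsub>R\<^esub> b)) (f \<otimes>\<^bsub>R\<^esub> g)),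
      kstr = (\<lambda>k. ring_frac R S (kstr R k) \<one>\<^bsub>R\<^esub>)\<rparr>"

definition spec_sections :: "('a, 'k) kalg \<Rightarrow> 'a set set \<Rightarrow> ('a set \<Rightarrow> ('a \<times> 'a) set) set" where
  "spec_sections R V = {s \<in> extensional V. \<forall>\<pp> \<in> V.
     \<exists>W a f. openin (zariski R) W \<and> \<pp> \<in> W \<and> W \<subseteq> V \<and> a \<in> carrier R \<and> f \<in> carrier R \<and>
       (\<forall>\<qq> \<in> W. f \<notin> \<qq> \<and> s \<qq> = ring_frac R (carrier R - \<qq>) a f)}"

definition spec_scheme :: "('a, 'k) kalg \<Rightarrow> ('a set, 'a set \<Rightarrow> ('a \<times> 'a) set, 'k) ringed_space" where
  "spec_scheme R =
     \<lparr>rsp = zariski R,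
      rsec = (\<lambda>V.
        \<lparr>carrier = spec_sections R V,
         monoid.mult = (\<lambda>s t. \<lambda>\<pp> \<in> V. s \<pp> \<otimes>\<^bsub>localization R (carrier R - \<pp>)\<^esub> t \<pp>),
         one = (\<lambda>\<pp> \<in> V. \<one>\<^bsub>localization R (carrier R - \<pp>)\<^esub>),
         ring.zero = (\<lambda>\<pp> \<in> V. \<zero>\<^bsub>localization R (carrier R - \<pp>)\<^esub>),
         ring.add = (\<lambda>s t. \<lambda>\<pp> \<in> V. s \<pp> \<oplus>\<^bsub>localization R (carrier R - \<pp>)\<^esub> t \<pp>),
         kstr = (\<lambda>k. \<lambda>\<pp> \<in> V. kstr (localization R (carrier R - \<pp>)) k)\<rparr>),
      rres = (\<lambda>U V s. restrict s V)\<rparr>"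

text \<open>The open subspace \<open>U\<close> of \<open>X\<close> is isomorphic, as a ringed space over \<open>K\<close>, to the spectrum of \<open>R\<close>.\<close>

definition affine_open_subscheme ::
  "'k ring \<Rightarrow> ('p, 'a, 'k) ringed_space \<Rightarrow> 'p set \<Rightarrow> ('u, 'k) kalg \<Rightarrow> bool" where
  "affine_open_subscheme K X U R \<longleftrightarrow> openin (rsp X) U \<and> kalgebra K R \<and>
     (\<exists>h \<phi>. homeomorphic_map (subtopology (rsp X) U) (zariski R) h \<and>
        (\<forall>V. openin (zariski R) V \<longrightarrow>
           \<phi> V \<in> kalg_hom K (rsec (spec_scheme R) V) (rsec X {x \<in> U. h x \<in> V}) \<and>
           bij_betw (\<phi> V) (carrier (rsec (spec_scheme R) V)) (carrier (rsec X {x \<in> U. h x \<in> V}))) \<and>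
        (\<forall>V W. openin (zariski R) V \<and> openin (zariski R) W \<and> W \<subseteq> V \<longrightarrow>
           (\<forall>s \<in> carrier (rsec (spec_scheme R) V).
              \<phi> W (rres (spec_scheme R) V W s) = rres X {x \<in> U. h x \<in> V} {x \<in> U. h x \<in> W} (\<phi> V s))))"

definition scheme_over :: "'u itself \<Rightarrow> 'k ring \<Rightarrow> ('p, 'a, 'k) ringed_space \<Rightarrow> bool" where
  "scheme_over TU K X \<longleftrightarrow> kringed_space K X \<and>
     (\<forall>x \<in> topspace (rsp X). \<exists>U. \<exists>R :: ('u, 'k) kalg. x \<in> U \<and> affine_open_subscheme K X U R)"

definition finite_type_over :: "'u itself \<Rightarrow> 'k ring \<Rightarrow> ('p, 'a, 'k) ringed_space \<Rightarrow> bool" where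
  "finite_type_over TU K X \<longleftrightarrow>
     (\<exists>C. finite C \<and> \<Union>C = topspace (rsp X) \<and>
        (\<forall>U \<in> C. \<exists>R :: ('u, 'k) kalg. affine_open_subscheme K X U R \<and> fin_gen_algebra K R))"

definition integral_scheme :: "('p, 'a, 'k) ringed_space \<Rightarrow> bool" where
  "integral_scheme X \<longleftrightarrow> topspace (rsp X) \<noteq> {} \<and>
     (\<forall>U. openin (rsp X) U \<and> U \<noteq> {} \<longrightarrow> domain (rsec X U))"

subsection \<open>Morphisms, fibre products and separatedness\<close>

text \<open>
  A morphism from \<open>X\<close> to \<open>Y\<close> is a pair of a continuous map and a family of maps from the sections
  of \<open>Y\<close> over \<open>V\<close> to the sections of \<open>X\<close> over the preimage of \<open>V\<close>.
\<close>

type_synonym ('p, 'q, 'a, 'b) mor = "('p \<Rightarrow> 'q) \<times> ('q set \<Rightarrow> 'b \<Rightarrow> 'a)"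

definition preimg :: "('p, 'a, 'k) ringed_space \<Rightarrow> ('p \<Rightarrow> 'q) \<Rightarrow> 'q set \<Rightarrow> 'p set" where
  "preimg X f V = {x \<in> topspace (rsp X). f x \<in> V}"

definition morphism :: "'k ring \<Rightarrow> ('p, 'a, 'k) ringed_space \<Rightarrow> ('q, 'b, 'k) ringed_space
     \<Rightarrow> ('p, 'q, 'a, 'b) mor \<Rightarrow> bool" where
  "morphism K X Y = (\<lambda>(f, \<phi>).
     continuous_map (rsp X) (rsp Y) f \<and>
     (\<forall>V. openin (rsp Y) V \<longrightarrow> \<phi> V \<in> kalg_hom K (rsec Y V) (rsec X (preimg X f V))) \<and>
     (\<forall>V W. openin (rsp Y) V \<and> openin (rsp Y) W \<and> W \<subseteq> V \<longrightarrow>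
        (\<forall>s \<in> carrier (rsec Y V). \<phi> W (rres Y V W s) = rres X (preimg X f V) (preimg X f W) (\<phi> V s))) \<and>
     (\<forall>x \<in> topspace (rsp X). \<forall>V. openin (rsp Y) V \<and> f x \<in> V \<longrightarrow>
        (\<forall>s \<in> carrier (rsec Y V). rgerm X x (preimg X f V) (\<phi> V s) \<in> Units (rstalk X x) \<longrightarrow>
           rgerm Y (f x) V s \<in> Units (rstalk Y (f x)))))"

definition mor_eq :: "('p, 'a, 'k) ringed_space \<Rightarrow> ('q, 'b, 'k) ringed_space
     \<Rightarrow> ('p, 'q, 'a, 'b) mor \<Rightarrow> ('p, 'q, 'a, 'b) mor \<Rightarrow> bool" where
  "mor_eq X Y = (\<lambda>(f, \<phi>) (g, \<psi>).
     (\<forall>x \<in> topspace (rsp X). f x = g x) \<and>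
     (\<forall>V. openin (rsp Y) V \<longrightarrow> (\<forall>s \<in> carrier (rsec Y V). \<phi> V s = \<psi> V s)))"

definition mor_id :: "('p, 'p, 'a, 'a) mor" where
  "mor_id = (\<lambda>x. x, \<lambda>V s. s)"

definition mor_comp :: "('q, 'b, 'k) ringed_space
     \<Rightarrow> ('q, 'r, 'b, 'c) mor \<Rightarrow> ('p, 'q, 'a, 'b) mor \<Rightarrow> ('p, 'r, 'a, 'c) mor" where
  "mor_comp Y = (\<lambda>(g, \<psi>) (f, \<phi>). (g \<circ> f, \<lambda>V s. \<phi> (preimg Y g V) (\<psi> V s)))"

text \<open>
  The universal property of the fibre product of \<open>X\<close> with itself over \<open>K\<close>.  The test schemes \<open>T\<close>
  have points and sections in the same universe \<open>'u\<close> as the product \<open>P\<close>.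
\<close>

definition fibre_square :: "'k ring \<Rightarrow> ('p, 'a, 'k) ringed_space \<Rightarrow> ('u, 'u, 'k) ringed_space
     \<Rightarrow> ('u, 'p, 'u, 'a) mor \<Rightarrow> ('u, 'p, 'u, 'a) mor \<Rightarrow> bool" where
  "fibre_square K X P p q \<longleftrightarrow>
     scheme_over TYPE('u) K P \<and> morphism K P X p \<and> morphism K P X q \<and>
     (\<forall>(T :: ('u, 'u, 'k) ringed_space) a b.
        scheme_over TYPE('u) K T \<and> morphism K T X a \<and> morphism K T X b \<longrightarrow>
        (\<exists>c. morphism K T P c \<and> mor_eq T X (mor_comp P p c) a \<and> mor_eq T X (mor_comp P q c) b \<and>
           (\<forall>c'. morphism K T P c' \<and> mor_eq T X (mor_comp P p c') a \<and> mor_eq T X (mor_comp P q c') b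
              \<longrightarrow> mor_eq T P c' c)))"

definition closed_immersion :: "'k ring \<Rightarrow> ('p, 'a, 'k) ringed_space \<Rightarrow> ('q, 'b, 'k) ringed_space
     \<Rightarrow> ('p, 'q, 'a, 'b) mor \<Rightarrow> bool" where
  "closed_immersion K X Y = (\<lambda>(f, \<phi>).
     morphism K X Y (f, \<phi>) \<and>
     embedding_map (rsp X) (rsp Y) f \<and> closedin (rsp Y) (f ` topspace (rsp X)) \<and>
     (\<forall>V. openin (rsp Y) V \<longrightarrow> (\<forall>s \<in> carrier (rsec X (preimg X f V)). \<forall>y \<in> V.
        \<exists>W t. openin (rsp Y) W \<and> y \<in> W \<and> W \<subseteq> V \<and> t \<in> carrier (rsec Y W) \<and>
          \<phi> W t = rres X (preimg X f V) (preimg X f W) s)))"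

definition separated_over :: "'u itself \<Rightarrow> 'k ring \<Rightarrow> ('p, 'a, 'k) ringed_space \<Rightarrow> bool" where
  "separated_over TU K X \<longleftrightarrow>
     (\<exists>(P :: ('u, 'u, 'k) ringed_space) p q \<delta>.
        fibre_square K X P p q \<and> closed_immersion K X P \<delta> \<and>
        mor_eq X X (mor_comp P p \<delta>) mor_id \<and> mor_eq X X (mor_comp P q \<delta>) mor_id)"

definition algebraic_variety :: "'u itself \<Rightarrow> 'k ring \<Rightarrow> ('p, 'a, 'k) ringed_space \<Rightarrow> bool" where
  "algebraic_variety TU K X \<longleftrightarrow>
     scheme_over TU K X \<and> integral_scheme X \<and> separated_over TU K X \<and> finite_type_over TU K X"


section \<open>Perfect fields\<close>

text \<open>
  Every element is a \<open>p\<close>-th power if the characteristic is a prime \<open>p\<close>; there is no condition in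
  characteristic 0.
\<close>

definition perfect_field :: "'k ring \<Rightarrow> bool" where
  "perfect_field K \<longleftrightarrow> field K \<and>
     (\<forall>p :: nat. Factorial_Ring.prime p \<and> [p] \<cdot>\<^bsub>K\<^esub> \<one>\<^bsub>K\<^esub> = \<zero>\<^bsub>K\<^esub> \<longrightarrow>
        (\<forall>x \<in> carrier K. \<exists>y \<in> carrier K. y [^]\<^bsub>K\<^esub> p = x))"

end

theory Submission
  imports Defs "HOL-Algebra.UnivPoly"
begin

text \<open>
  Let \<open>R\<close> be the image in the function ring of a nonempty affine open of the underlying variety.  It is
  a finitely generated domain over a perfect field, and generically its prime ideals are generated,
  after localization, by regular sequences: adding generators one at a time, either the new generator
  is transcendental or, as the field is perfect, generically etale over the previous ring.  On the
  derived side let \<open>A\<close> be a noetherian DG-ring with bounded cohomology describing an affine open.  By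
  generic freeness over the quotient of \<open>H0 A\<close> by the prime ideal of the generic point, which is
  generically the zero ideal, there is a nonempty open set on which the finitely many nonzero
  \<open>H\<^sup>n(A)\<close> become free over the local rings of the variety.  At such a point a regular sequence
  generating the maximal ideal is regular on every cohomology module, so the iterated Koszul
  complexes have cohomology \<open>H\<^sup>n(A) / (x\<^sub>1, \<dots>, x\<^sub>i)\<close> and the sequence is regular for \<open>A\<close>.
\<close>

text \<open>The coordinate ring of a chart of the variety and the ring \<open>H0 A\<close> of a
  derived chart are a priori unrelated: DG-charts are given only up to zigzags of
  quasi-isomorphisms. They meet in the ring \<open>H0\<close> of the stalk at a common point, which
  is a localization of both. A zigzag has no inverse on the level of DG-rings, but it does give
  isomorphisms of the cohomology modules of stalks; so regularity of a sequence has to be tested on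
  cohomology alone. The Koszul step in degree n uses injectivity in degree n + 1, which is why all
  cohomology modules, and not only the lowest, have to be made free. Localizations are described by
  properties of a map, and regularity at a prime by saturations of ideals, so the algebra of regular
  sequences takes place inside fixed rings. Perfectness enters through p-th roots: a polynomial
  relation of least degree all of whose partial derivatives vanish is a p-th power, and its root is
  a smaller relation.\<close>

abbreviation elts :: "('a, 'z) cochain_scheme \<Rightarrow> int \<Rightarrow> 'a set" where "elts C n \<equiv> carrier (cpt C n)"

abbreviation (input) mult_in ("(_ \<otimes>[_]/ _)" [70, 0, 71] 70) where "a \<otimes>[G] b \<equiv> a \<otimes>\<^bsub>G\<^esub> b"
abbreviation (input) add_in ("(_ \<oplus>[_]/ _)" [65, 0, 66] 65) where "a \<oplus>[R] b \<equiv> a \<oplus>\<^bsub>R\<^esub> b"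
abbreviation (input) smult_in ("(_ \<odot>[_]/ _)" [76, 0, 75] 75) where "a \<odot>[M] b \<equiv> a \<odot>\<^bsub>M\<^esub> b"
abbreviation (input) one_in ("\<one>[_]") where "\<one>[G] \<equiv> \<one>\<^bsub>G\<^esub>"
abbreviation (input) zero_in ("\<zero>[_]") where "\<zero>[R] \<equiv> \<zero>\<^bsub>R\<^esub>"

section \<open>Regular sequences at a prime\<close>

text \<open>The ideal I + xR. Regular sequences are followed through growing ideals of one fixed
  ring, so that no tower of quotient rings arises.\<close>

definition adj :: "('a, 'z) ring_scheme \<Rightarrow> 'a set \<Rightarrow> 'a \<Rightarrow> 'a set" where
 "adj R I x = {i \<oplus>[R] x \<otimes>[R] a | i a. i : I \<and> a : carrier R}"

fun adjoin :: "('a, 'z) ring_scheme \<Rightarrow> 'a set \<Rightarrow> 'a list \<Rightarrow> 'a set" where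
 "adjoin R I [] = I"
| "adjoin R I (x # xs) = adjoin R (adj R I x) xs"

text \<open>The saturation of an ideal \<open>I\<close> at a prime \<open>q\<close> is the preimage of its localization at \<open>q\<close>, so
 these predicates express regularity in the local ring at \<open>q\<close> without forming it.\<close>

definition saturation :: "('a, 'z) ring_scheme \<Rightarrow> 'a set \<Rightarrow> 'a set \<Rightarrow> 'a set" where
 "saturation R q I = {a : carrier R. \<exists>t \<in> carrier R - q. t \<otimes>[R] a : I}"

text \<open>The image of x is a nonzerodivisor modulo I in the local ring at q. Testing products
  that lie in I itself suffices: if t x a is in I with t outside q, the condition applies to t
  a.\<close>

definition regular_at :: "('a, 'z) ring_scheme \<Rightarrow> 'a set \<Rightarrow> 'a set \<Rightarrow> 'a \<Rightarrow> bool" where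
 "regular_at R q I x \<longleftrightarrow> (\<forall>a \<in> carrier R. x \<otimes>[R] a : I --> a : saturation R q I)"

fun regseq_at :: "('a, 'z) ring_scheme \<Rightarrow> 'a set \<Rightarrow> 'a set \<Rightarrow> 'a list \<Rightarrow> bool" where
 "regseq_at R q I [] = True"
| "regseq_at R q I (x # xs) = (regular_at R q I x \<and> regseq_at R q (adj R I x) xs)"

text \<open>In the localization at q the maximal ideal is generated by the regular sequence
  \<open>xs\<close>. The last inclusion expresses the generation: every element of q becomes a
  combination of \<open>xs\<close> after multiplication by an element outside q.\<close>

definition reg_at :: "('a, 'z) ring_scheme \<Rightarrow> 'a set \<Rightarrow> bool" where
 "reg_at R q \<longleftrightarrow> (\<exists>xs. set xs \<subseteq> q \<and> regseq_at R q {\<zero>[R]} xs \<and>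
   q \<subseteq> saturation R q (adjoin R {\<zero>[R]} xs))"

definition gen_reg :: "('a, 'z) ring_scheme \<Rightarrow> bool" where
 "gen_reg R \<longleftrightarrow> (\<exists>f \<in> carrier R - {\<zero>[R]}. \<forall>q. primeideal q R \<and> f ~: q --> reg_at R q)"

lemma adjoin_append: "adjoin R I (xs @ ys) = adjoin R (adjoin R I xs) ys"
 by (induction xs arbitrary: I) auto

lemma regseq_at_append:
 "regseq_at R q I (xs @ ys) \<longleftrightarrow> regseq_at R q I xs \<and> regseq_at R q (adjoin R I xs) ys"
 by (induction xs arbitrary: I) auto

section \<open>Ideals and prime ideals in terms of elements\<close>

lemma (in cring) ideal_if:
 assumes "I \<subseteq> carrier R" "\<zero> : I" "!!a b. a : I ==> b : I ==> a \<oplus> b : I"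
  "!!a r. a : I ==> r : carrier R ==> r \<otimes> a : I"
 shows "ideal I R"
proof (rule idealI)
 show "ring R" by (rule ring_axioms)
 show "subgroup I (add_monoid R)"
 proof (rule add.subgroupI)
  fix a assume a: "a : I"
  then have "\<ominus> \<one> \<otimes> a : I" using assms by simp
  moreover have "\<ominus> \<one> \<otimes> a = \<ominus> a" using a assms(1) l_minus[of \<one> a] by auto
  ultimately show "\<ominus> a : I" by simp
 next
  show "I \<subseteq> carrier R" "I ~= {}" using assms(1,2) by blast+
  show "a : I ==> b : I ==> a \<oplus> b : I" for a b using assms(3) by simp
 qed
 show l: "x \<otimes> a : I" if "a : I" "x : carrier R" for a x using assms(4) that by blast
 show "a \<otimes> x : I" if "a : I" "x : carrier R" for a x
  using l[OF that] m_comm[of a x] that assms(1) by auto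
qed

lemma ideal_facts:
 fixes R (structure)
 assumes "ideal I R"
 shows "I \<subseteq> carrier R" "\<zero> : I" "!!a b. a : I ==> b : I ==> a \<oplus> b : I"
  "!!a r. a : I ==> r : carrier R ==> r \<otimes> a : I"
  "!!a r. a : I ==> r : carrier R ==> a \<otimes> r : I"
  "!!a. a : I ==> \<ominus> a : I" "!!a b. a : I ==> b : I ==> a \<ominus> b : I"
proof -
 interpret ideal I R by fact
 show "I \<subseteq> carrier R" using a_subset .
 show "\<zero> : I" by (rule additive_subgroup.zero_closed[OF is_additive_subgroup])
 show add: "a \<oplus> b : I" if "a : I" "b : I" for a b
  using that by (rule additive_subgroup.a_closed[OF is_additive_subgroup])
 show "!!a r. a : I ==> r : carrier R ==> r \<otimes> a : I" by (rule I_l_closed)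
 show "!!a r. a : I ==> r : carrier R ==> a \<otimes> r : I" by (rule I_r_closed)
 show inv: "\<ominus> a : I" if "a : I" for a
  using that by (rule additive_subgroup.a_inv_closed[OF is_additive_subgroup])
 show "a \<ominus> b : I" if "a : I" "b : I" for a b unfolding a_minus_def using add inv that by auto
qed

lemma primeideal_facts:
 fixes R (structure)
 assumes "primeideal q R"
 shows "ideal q R" "cring R" "q ~= carrier R" "\<one> ~: q"
  "!!a b. a : carrier R ==> b : carrier R ==> a \<otimes> b : q ==> a : q \<or> b : q"
  "!!a b. a : carrier R - q ==> b : carrier R - q ==> a \<otimes> b : carrier R - q"
proof -
 interpret primeideal q R by fact
 show "ideal q R" by unfold_locales
 show "cring R" by unfold_locales
 show "q ~= carrier R" using I_notcarr by auto
 then show "\<one> ~: q" using one_imp_carrier by auto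
 show *: "a : q \<or> b : q" if "a : carrier R" "b : carrier R" "a \<otimes> b : q" for a b
  using that by (rule I_prime)
 show "a \<otimes> b : carrier R - q" if "a : carrier R - q" "b : carrier R - q" for a b
  using * that by auto
qed

lemma primeideal_pow:
 assumes "primeideal q R" "a : carrier R - q"
 shows "a [^]\<^bsub>R\<^esub> (n::nat) : carrier R - q"
proof -
 interpret primeideal q R by fact
 show ?thesis using primeideal_facts(4,6)[OF assms(1)] assms(2) by (induction n) auto
qed

lemma adjI: "i : I ==> a : carrier R ==> i \<oplus>[R] x \<otimes>[R] a : adj R I x"
 unfolding adj_def by blast

lemma adjE:
 assumes "b : adj R I x"
 obtains i a where "i : I" "a : carrier R" "b = i \<oplus>[R] x \<otimes>[R] a"
 using assms unfolding adj_def by blast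

lemma (in cring) adj_ideal:
 assumes I: "ideal I R" and x: "x : carrier R"
 shows "ideal (adj R I x) R" "I \<subseteq> adj R I x" "x : adj R I x"
proof -
 note f = ideal_facts[OF I]
 show incl: "I \<subseteq> adj R I x"
 proof
  fix i assume i: "i : I"
  then have "i \<oplus> x \<otimes> \<zero> = i" using f(1) x by auto
  then show "i : adj R I x" using adjI[OF i zero_closed, of x] by simp
 qed
 show "ideal (adj R I x) R"
 proof (rule ideal_if)
  show "adj R I x \<subseteq> carrier R" unfolding adj_def using f(1) x by auto
  show "\<zero> : adj R I x" using incl f(2) by auto
 next
  fix a b assume a: "a : adj R I x" and b: "b : adj R I x"
  obtain i r where 1: "i : I" "r : carrier R" "a = i \<oplus> x \<otimes> r" by (rule adjE[OF a])
  obtain j s where 2: "j : I" "s : carrier R" "b = j \<oplus> x \<otimes> s" by (rule adjE[OF b])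
  have ij: "i : carrier R" "j : carrier R" using 1 2 f(1) by auto
  have "a \<oplus> b = (i \<oplus> x \<otimes> r) \<oplus> (j \<oplus> x \<otimes> s)" using 1 2 by simp
  also have "\<dots> = (i \<oplus> j) \<oplus> x \<otimes> (r \<oplus> s)"
   using ij 1(2) 2(2) x by algebra
  finally show "a \<oplus> b : adj R I x" using adjI[OF f(3)[OF 1(1) 2(1)], of "r \<oplus> s"] 1 2 by auto
 next
  fix a r assume a: "a : adj R I x" and r: "r : carrier R"
  obtain i s where 1: "i : I" "s : carrier R" "a = i \<oplus> x \<otimes> s" by (rule adjE[OF a])
  have i: "i : carrier R" using 1 f(1) by auto
  have "r \<otimes> (i \<oplus> x \<otimes> s) = r \<otimes> i \<oplus> x \<otimes> (r \<otimes> s)" using 1(2) i x r by algebra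
  then show "r \<otimes> a : adj R I x" using adjI[OF f(4)[OF 1(1) r], of "r \<otimes> s"] 1 r by auto
 qed
 have "\<zero> \<oplus> x \<otimes> \<one> = x" using x by simp
 then show "x : adj R I x" using adjI[OF f(2) one_closed, of x] by simp
qed

lemma (in cring) adj_least:
 assumes "ideal J R" "I \<subseteq> J" "x : J"
 shows "adj R I x \<subseteq> J"
proof
 fix b assume "b : adj R I x"
 then obtain i a where "i : I" "a : carrier R" "b = i \<oplus> x \<otimes> a" by (rule adjE)
 then show "b : J" using ideal_facts(3,5)[OF assms(1)] assms(2,3) by auto
qed

lemma (in cring) adjoin_ideal:
 assumes "ideal I R" "set xs \<subseteq> carrier R"
 shows "ideal (adjoin R I xs) R \<and> I \<subseteq> adjoin R I xs \<and> set xs \<subseteq> adjoin R I xs"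
 using assms
proof (induction xs arbitrary: I)
 case (Cons x xs)
 then have "ideal (adj R I x) R" "I \<subseteq> adj R I x" "x : adj R I x" using adj_ideal by auto
 with Cons.IH[of "adj R I x"] Cons.prems show ?case by auto
qed auto

lemma (in cring) adjoin_least:
 assumes "ideal J R" "I \<subseteq> J" "set xs \<subseteq> J"
 shows "adjoin R I xs \<subseteq> J"
 using assms(2,3)
proof (induction xs arbitrary: I)
 case (Cons x xs)
 then show ?case using adj_least[OF assms(1)] by auto
qed auto

lemma finsum_in_ideal:
 assumes "cring R" "ideal I R" "f : A \<rightarrow> I"
 shows "finsum R f A : I"
 using assms(3)
proof -
 interpret cring R by fact
 note i = ideal_facts[OF assms(2)]
 show ?thesis using assms(3)
 proof (induction A rule: infinite_finite_induct)
  case (insert a A)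
  have "f : A \<rightarrow> carrier R" "f a : carrier R" using insert.prems i(1) by auto
  then show ?case using insert i(3) by simp
 qed (use i in auto)
qed

section \<open>Ideals of polynomials and pseudo-division\<close>

context UP_cring
begin

text \<open>The extended ideal I R[X], described through coefficients. It stands in for reduction
  modulo I: \<open>H : cfs I\<close> says that H is zero as a polynomial over R/I.\<close>

definition cfs :: "'a set \<Rightarrow> (nat \<Rightarrow> 'a) set" where
 "cfs I = {H : carrier P. \<forall>n. coeff P H n : I}"

lemma bounded_coeff: "H : carrier P ==> \<exists>n. \<forall>k\<ge>n. coeff P H k = \<zero>"
 by (metis deg_aboveD Suc_le_eq)

lemma cfs_carrier [simp]: "cfs (carrier R) = carrier P"
 unfolding cfs_def by auto

lemma cfs_ideal:
 assumes "ideal I R" shows "ideal (cfs I) P"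
proof (rule cring.ideal_if)
 note i = ideal_facts[OF assms]
 show "cring P" by (rule UP_cring)
 show "cfs I \<subseteq> carrier P" unfolding cfs_def by auto
 show "\<zero>[P] : cfs I" unfolding cfs_def using i by auto
 show "a : cfs I ==> b : cfs I ==> a \<oplus>[P] b : cfs I" for a b unfolding cfs_def using i by auto
 fix a r assume a: "a : cfs I" and r: "r : carrier P"
 then have aP: "a : carrier P" unfolding cfs_def by auto
 have "(\<Oplus>i \<in> {..n}. coeff P r i \<otimes> coeff P a (n - i)) : I" for n
  by (rule finsum_in_ideal[OF R.is_cring assms]) (use a r i in \<open>auto simp: cfs_def\<close>)
 then show "r \<otimes>[P] a : cfs I" unfolding cfs_def using aP r by auto
qed

lemma monom_in_cfs: "ideal I R ==> c : I ==> monom P c n : cfs I"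
 unfolding cfs_def using ideal_facts[of I R] by auto

lemma cfs_mono: "I \<subseteq> J ==> cfs I \<subseteq> cfs J"
 unfolding cfs_def by auto

lemma coeff_const_mult:
 assumes "c : carrier R" "p : carrier P"
 shows "coeff P (monom P c 0 \<otimes>[P] p) n = c \<otimes> coeff P p n"
 using assms by (simp add: monom_mult_is_smult del: coeff_mult)

lemma coeff_monom_mult':
 assumes "c : carrier R" "p : carrier P"
 shows "coeff P (monom P c m \<otimes>[P] p) k = (if m \<le> k then c \<otimes> coeff P p (k - m) else \<zero>)"
proof -
 have [simp]: "(if b then c else \<zero>) \<otimes> y = (if b then c \<otimes> y else \<zero>)" if "y : carrier R" for b y
  using that by simp
 have "coeff P (monom P c m \<otimes>[P] p) k
   = (\<Oplus>i\<in>{..k}. (if m = i then c \<otimes> coeff P p (k - i) else \<zero>))"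
  using assms by (auto intro!: R.finsum_cong')
 also have "\<dots> = (if m \<le> k then c \<otimes> coeff P p (k - m) else \<zero>)"
 proof (cases "m \<le> k")
  case True
  then show ?thesis using R.finsum_singleton[of m "{..k}" "%i. c \<otimes> coeff P p (k - i)"] assms
   by auto
 next
  case False
  then have "(\<Oplus>i\<in>{..k}. (if m = i then c \<otimes> coeff P p (k - i) else \<zero>)) = (\<Oplus>i\<in>{..k}. \<zero>)"
   by (intro R.finsum_cong') auto
  then show ?thesis using False by simp
 qed
 finally show ?thesis .
qed

lemma poly_eqI:
 assumes "p : carrier P" "q : carrier P" "!!n. coeff P p n = coeff P q n"
 shows "p = q"
 using assms up_eqI by blast

lemma remove_top:
 assumes "H : carrier P" "\<forall>k\<ge>Suc n. coeff P H k = \<zero>"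
 defines "H' \<equiv> H \<ominus>\<^bsub>P\<^esub> monom P (coeff P H n) n"
 shows "H' : carrier P" "\<forall>k\<ge>n. coeff P H' k = \<zero>" "!!k. k < n ==> coeff P H' k = coeff P H k"
  "H = H' \<oplus>[P] monom P (coeff P H n) n"
proof -
 interpret P: cring P by (rule UP_cring)
 show H': "H' : carrier P" unfolding H'_def using assms(1) by simp
 have c: "coeff P H' k = coeff P H k \<ominus> (if n = k then coeff P H n else \<zero>)" for k
  unfolding H'_def using assms(1) by simp
 show "\<forall>k\<ge>n. coeff P H' k = \<zero>"
  using assms(1,2) by (auto simp: c R.minus_eq R.r_neg)
 show "!!k. k < n ==> coeff P H' k = coeff P H k"
  using assms(1) by (auto simp: c R.minus_eq)
 show "H = H' \<oplus>[P] monom P (coeff P H n) n"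
  unfolding H'_def using assms(1) by (simp add: P.minus_eq P.a_assoc P.l_neg)
qed

text \<open>The leading monomial is removed repeatedly. The induction runs over a bound for the
  degree, so the degree of the zero polynomial needs no separate treatment.\<close>

lemma cfs_induct:
 assumes "ideal I R" "H : cfs I" "Q \<zero>[P]"
  "!!H c n. H : cfs I ==> Q H ==> c : I ==> Q (H \<oplus>[P] monom P c n)"
 shows "Q H"
proof -
 have "H : cfs I ==> \<forall>k\<ge>n. coeff P H k = \<zero> ==> Q H" for n H
 proof (induction n arbitrary: H)
  case 0
  then have "H = \<zero>[P]" by (intro poly_eqI) (auto simp: cfs_def)
  then show ?case using assms(3) by simp
 next
  case (Suc n)
  have HP: "H : carrier P" using Suc.prems unfolding cfs_def by auto
  note r = remove_top[OF HP Suc.prems(2)]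
  let ?H = "H \<ominus>\<^bsub>P\<^esub> monom P (coeff P H n) n"
  have "coeff P ?H k : I" for k
   using r(2) r(3)[of k] Suc.prems(1) ideal_facts(2)[OF assms(1)]
   by (cases "k < n") (auto simp: cfs_def simp del: coeff_minus)
  then have H': "?H : cfs I" unfolding cfs_def using r(1) by blast
  then have "Q ?H" using Suc.IH r(2) by blast
  moreover have "coeff P H n : I" using Suc.prems unfolding cfs_def by auto
  ultimately have "Q (?H \<oplus>[P] monom P (coeff P H n) n)" using assms(4) H' by blast
  then show ?case using r(4) by simp
 qed
 moreover have "H : carrier P" using assms(2) unfolding cfs_def by auto
 ultimately show ?thesis using bounded_coeff assms(2) by blast
qed

text \<open>Division by g when its leading coefficient l need not be invertible: one factor l is
  multiplied in for each reduction. The multiples of g that are subtracted have cofactors in I[X],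
  so the remainder of an element of I[X] stays in I[X].\<close>

lemma pseudo_division:
 assumes g: "g : carrier P" "\<forall>k>d. coeff P g k = \<zero>" and I: "ideal I R" and H: "H : cfs I"
 obtains N U r where "U : carrier P" "r : cfs I" "\<forall>k\<ge>d. coeff P r k = \<zero>"
  "monom P (coeff P g d [^] (N::nat)) 0 \<otimes>[P] H = U \<otimes>[P] g \<oplus>[P] r"
proof -
 interpret P: cring P by (rule UP_cring)
 let ?l = "coeff P g d"
 have l: "?l : carrier R" using g by simp
 note ci = ideal_facts[OF cfs_ideal[OF I]]
 have "H : cfs I ==> \<forall>k\<ge>n. coeff P H k = \<zero> ==> \<exists>N U r. U : carrier P \<and> r : cfs I \<and>
   (\<forall>k\<ge>d. coeff P r k = \<zero>) \<and> monom P (?l [^] (N::nat)) 0 \<otimes>[P] H = U \<otimes>[P] g \<oplus>[P] r" for n H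
 proof (induction n arbitrary: H)
  case 0
  then have "H : carrier P" using ci(1) by auto
  then have "monom P (?l [^] (0::nat)) 0 \<otimes>[P] H = \<zero>[P] \<otimes>[P] g \<oplus>[P] H" using g by simp
  then show ?case using 0 by blast
 next
  case (Suc m)
  have HP: "H : carrier P" using Suc.prems ci(1) by auto
  show ?case
  proof (cases "d \<le> m")
   case False
   have "monom P (?l [^] (0::nat)) 0 \<otimes>[P] H = \<zero>[P] \<otimes>[P] g \<oplus>[P] H" using g HP by simp
   moreover have "\<forall>k\<ge>d. coeff P H k = \<zero>" using False Suc.prems by auto
   ultimately show ?thesis using Suc.prems(1) by blast
  next
   case True
   define c where "c = coeff P H m"
   have cI: "c : I" and c: "c : carrier R"
    using Suc.prems(1) HP unfolding c_def cfs_def by auto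
   define M where "M = monom P c (m - d)"
   have M: "M : carrier P" "M : cfs I" unfolding M_def using c monom_in_cfs[OF I cI] by auto
   define L where "L = monom P ?l 0"
   have L: "L : carrier P" unfolding L_def using l by simp
   \<comment> \<open>With c the coefficient of H at m and M = c X^(m - d), the terms of degree m in
     l H and M g cancel, and above m both polynomials have no terms.\<close>
   define H1 where "H1 = L \<otimes>[P] H \<ominus>\<^bsub>P\<^esub> M \<otimes>[P] g"
   have H1I: "H1 : cfs I" unfolding H1_def using ci(4,5,7) Suc.prems(1) M(2) g(1) L by simp
   have H1P: "H1 : carrier P" using H1I ci(1) by auto
   have "coeff P H1 k = \<zero>" if "k \<ge> m" for k
   proof -
    have "coeff P H1 k = ?l \<otimes> coeff P H k \<ominus> c \<otimes> coeff P g (k - (m - d))"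
     unfolding H1_def L_def M_def using HP g(1) c l that
     by (auto simp add: coeff_const_mult coeff_monom_mult' simp del: coeff_mult)
    also have "\<dots> = \<zero>"
    proof (cases "k = m")
     case True
     then have "k - (m - d) = d" "coeff P H k = c" using \<open>d \<le> m\<close> by (auto simp: c_def)
     then show ?thesis using R.m_comm[OF c l] c l by (simp only: R.minus_eq) (simp add: R.r_neg)
    next
     case False
     then have "k - (m - d) > d" "k \<ge> Suc m" using that \<open>d \<le> m\<close> by auto
     then show ?thesis using g(2) Suc.prems(2) c l by (simp add: R.minus_eq)
    qed
    finally show ?thesis .
   qed
   then obtain N U r where *: "U : carrier P" "r : cfs I" "\<forall>k\<ge>d. coeff P r k = \<zero>"
    "monom P (?l [^] (N::nat)) 0 \<otimes>[P] H1 = U \<otimes>[P] g \<oplus>[P] r" using Suc.IH[OF H1I] by blast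
   define LN where "LN = monom P (?l [^] N) 0"
   have LN: "LN : carrier P" unfolding LN_def using l by simp
   have LS: "monom P (?l [^] Suc N) 0 = LN \<otimes>[P] L"
    unfolding LN_def L_def using l monom_mult[of "?l [^] N" ?l 0 0] by simp
   have rP: "r : carrier P" using *(2) ci(1) by auto
   have "L \<otimes>[P] H = H1 \<oplus>[P] M \<otimes>[P] g"
    unfolding H1_def using L HP M g(1) by (simp add: P.minus_eq P.a_assoc P.l_neg)
   then have "monom P (?l [^] Suc N) 0 \<otimes>[P] H = LN \<otimes>[P] (H1 \<oplus>[P] M \<otimes>[P] g)"
    using LS LN L HP by (simp add: P.m_assoc)
   also have "\<dots> = (U \<otimes>[P] g \<oplus>[P] r) \<oplus>[P] LN \<otimes>[P] (M \<otimes>[P] g)"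
    using *(4) LN H1P M g(1) by (simp add: P.r_distr LN_def[symmetric])
   also have "\<dots> = (U \<oplus>[P] LN \<otimes>[P] M) \<otimes>[P] g \<oplus>[P] r"
    using LN M(1) g(1) *(1) rP by (simp add: P.l_distr P.m_assoc P.a_ac)
   finally show ?thesis using *(1,2,3) LN M(1)
    by (intro exI[of _ "Suc N"] exI[of _ "U \<oplus>[P] LN \<otimes>[P] M"] exI[of _ r] conjI) (assumption | simp)+
  qed
 qed
 note * = this
 have "H : carrier P" using H ci(1) by auto
 then obtain n where "\<forall>k\<ge>n. coeff P H k = \<zero>" using bounded_coeff by blast
 from *[OF H this] that show ?thesis by metis
qed

end

lemma primeideal_vimage:
 assumes "cring R" "cring S" "f : ring_hom R S" "primeideal q S"
 shows "primeideal {a : carrier R. f a : q} R"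
proof -
 interpret R: cring R by fact
 interpret S: cring S by fact
 interpret f: ring_hom_cring R S f by unfold_locales fact
 note i = ideal_facts[OF primeideal_facts(1)[OF assms(4)]] and p = primeideal_facts(4,5)[OF assms(4)]
 show ?thesis
 proof (rule primeidealI)
  show "ideal {a : carrier R. f a : q} R" using i by (intro R.ideal_if) auto
  show "cring R" by fact
  show "carrier R ~= {a : carrier R. f a : q}" using p(1) f.hom_one R.one_closed by (metis (mono_tags, lifting) mem_Collect_eq)
 next
  fix a b assume "a : carrier R" "b : carrier R" "a \<otimes>[R] b : {a : carrier R. f a : q}"
  then show "a : {a : carrier R. f a : q} \<or> b : {a : carrier R. f a : q}"
   using p(2)[of "f a" "f b"] by auto
 qed
qed

context UP_cring
begin

text \<open>Only finitely many coefficients lie outside q, and d is the largest index among them: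
  the degree of H modulo q.\<close>

lemma top_outside:
 assumes "ideal q R" "H : carrier P" "H ~: cfs q"
 obtains d where "coeff P H d ~: q" "\<forall>k>d. coeff P H k : q"
proof -
 obtain n where n: "\<forall>k\<ge>n. coeff P H k = \<zero>" using bounded_coeff assms(2) by blast
 let ?B = "{k. coeff P H k ~: q}"
 have "?B \<subseteq> {..n}" using n ideal_facts(2)[OF assms(1)] by (auto simp: not_le intro: leI)
 then have f: "finite ?B" using finite_subset by blast
 have "?B ~= {}" using assms(2,3) unfolding cfs_def by auto
 then have "Max ?B : ?B" using Max_in[OF f] by blast
 moreover have "\<forall>k>Max ?B. coeff P H k : q" using Max_ge[OF f] by (meson mem_Collect_eq not_le)
 ultimately show ?thesis using that by blast
qed

text \<open>Gauss's lemma: a polynomial ring over the domain R/q is a domain. With d and D the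
  degrees of g and H modulo q, all summands of the coefficient of g H at d + D lie in q except the
  product of the two leading coefficients.\<close>

lemma cfs_prime:
 assumes q: "primeideal q R" and g: "g : carrier P" "g ~: cfs q" and H: "H : carrier P"
  and gH: "g \<otimes>[P] H : cfs q"
 shows "H : cfs q"
proof (rule ccontr)
 note qi = primeideal_facts(1)[OF q] and i = ideal_facts[OF primeideal_facts(1)[OF q]]
 assume "H ~: cfs q"
 then obtain D where D: "coeff P H D ~: q" "\<forall>k>D. coeff P H k : q" using top_outside[OF qi H] by metis
 obtain d where d: "coeff P g d ~: q" "\<forall>k>d. coeff P g k : q" using top_outside[OF qi g] by metis
 let ?f = "%i. coeff P g i \<otimes> coeff P H (d + D - i)"
 have fc: "?f k : carrier R" for k using g(1) H by simp
 have "?f k : q" if "k ~= d" "k \<le> d + D" for k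
 proof (cases "k < d")
  case True
  then have "coeff P H (d + D - k) : q" using D(2) by auto
  then show ?thesis using i(4) g(1) by simp
 next
  case False
  then have "coeff P g k : q" using d(2) that by auto
  then show ?thesis using i(5) H by simp
 qed
 then have rest: "finsum R ?f ({..d + D} - {d}) : q"
  by (intro finsum_in_ideal[OF R.is_cring qi]) auto
 have "finsum R ?f {..d + D} = finsum R ?f (insert d ({..d + D} - {d}))"
  by (simp add: insert_absorb)
 also have "\<dots> = ?f d \<oplus> finsum R ?f ({..d + D} - {d})"
  using g(1) H by (intro R.finsum_insert) auto
 finally have eq: "finsum R ?f {..d + D} = ?f d \<oplus> finsum R ?f ({..d + D} - {d})" .
 have "coeff P (g \<otimes>[P] H) (d + D) : q" using gH unfolding cfs_def by blast
 then have tot: "finsum R ?f {..d + D} : q" using g(1) H by simp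
 have rc: "finsum R ?f ({..d + D} - {d}) : carrier R" using rest i(1) by auto
 have "?f d = (?f d \<oplus> finsum R ?f ({..d + D} - {d})) \<ominus> finsum R ?f ({..d + D} - {d})"
  using rc g(1) H by (simp add: R.minus_eq R.a_assoc R.r_neg)
 then have "?f d : q" using i(7)[OF tot rest] eq by simp
 then have "coeff P g d \<otimes> coeff P H D : q" by simp
 then show False
  using primeideal_facts(5)[OF q coeff_closed[OF g(1)] coeff_closed[OF H]] d(1) D(1) by blast
qed

text \<open>A polynomial has only finitely many nonzero coefficients, so the product of their
  individual multipliers serves all of them.\<close>

lemma common_multiplier:
 assumes q: "primeideal q R" and J: "ideal J R" and H: "H : carrier P"
  and sat: "!!n. coeff P H n : saturation R q J"
 obtains t where "t : carrier R - q" "monom P t 0 \<otimes>[P] H : cfs J"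
proof -
 note jf = ideal_facts[OF J]
 have "\<exists>t \<in> carrier R - q. \<forall>k<n. t \<otimes> coeff P H k : J" for n
 proof (induction n)
  case 0
  have "\<one> : carrier R - q" using primeideal_facts(4)[OF q] by simp
  then show ?case by blast
 next
  case (Suc n)
  then obtain t where t: "t : carrier R - q" "\<forall>k<n. t \<otimes> coeff P H k : J" by blast
  obtain s where s: "s : carrier R - q" "s \<otimes> coeff P H n : J"
   using sat[of n] unfolding saturation_def by blast
  have "(t \<otimes> s) \<otimes> coeff P H k : J" if "k < Suc n" for k
  proof (cases "k = n")
   case True
   have "(t \<otimes> s) \<otimes> coeff P H n = t \<otimes> (s \<otimes> coeff P H n)" using t s H by (simp add: R.m_assoc)
   then show ?thesis using True jf(4)[OF s(2)] t by simp
  next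
   case False
   then have "t \<otimes> coeff P H k : J" using that t by simp
   moreover have "(t \<otimes> s) \<otimes> coeff P H k = s \<otimes> (t \<otimes> coeff P H k)" using t s H by (simp add: R.m_ac)
   ultimately show ?thesis using jf(4) s by simp
  qed
  then show ?case using primeideal_facts(6)[OF q t(1) s(1)] by blast
 qed
 note * = this
 obtain n where n: "\<forall>k\<ge>n. coeff P H k = \<zero>" using bounded_coeff H by blast
 obtain t where t: "t : carrier R - q" "\<forall>k<n. t \<otimes> coeff P H k : J" using *[of n] by blast
 have "t \<otimes> coeff P H k : J" for k using t n jf(2) by (cases "k < n") auto
 then have "monom P t 0 \<otimes>[P] H : cfs J" using t(1) H by (simp add: cfs_def coeff_const_mult del: coeff_mult)
 then show ?thesis using that t(1) by blast
qed

lemma cfs_contraction_sub: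
 assumes Z: "ideal Z P" and q: "ideal q R" "!!c. c : q ==> monom P c 0 : Z"
 shows "cfs q \<subseteq> Z"
proof
 note z = ideal_facts[OF Z]
 fix H assume H: "H : cfs q"
 show "H : Z"
 proof (rule cfs_induct[OF q(1) H])
  show "\<zero>[P] : Z" by (rule z(2))
  fix H c n assume *: "H : Z" "c : q"
  then have c: "c : carrier R" using ideal_facts(1)[OF q(1)] by auto
  have "monom P c n = monom P c 0 \<otimes>[P] monom P \<one> n"
   using c monom_mult[of c \<one> 0 n] by simp
  then have "monom P c n : Z" using z(5)[OF q(2)[OF *(2)], of "monom P \<one> n"] by simp
  then show "H \<oplus>[P] monom P c n : Z" using z(3) * by simp
 qed
qed

text \<open>For prime q, the ideal Z becomes principal in the polynomial ring over the residue field
  of q. The polynomial g represents its generator and d is the degree of that generator; the last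
  clause is the minimality of d, stated for honest polynomials of degree below d.\<close>

lemma fibre_generator:
 assumes Z: "ideal Z P" and q: "ideal q R" "!!c. c : q ==> monom P c 0 : Z"
  and not: "\<not> Z \<subseteq> cfs q"
 obtains g d where "g : Z" "coeff P g d ~: q" "\<forall>k>d. coeff P g k = \<zero>"
  "!!r. r : Z ==> \<forall>k\<ge>d. coeff P r k = \<zero> ==> r : cfs q"
proof -
 interpret P: cring P by (rule UP_cring)
 note z = ideal_facts[OF Z] and qf = ideal_facts[OF q(1)]
 note cz = cfs_contraction_sub[OF Z q]
 define A where "A = {d. \<exists>g\<in>Z. coeff P g d ~: q \<and> (\<forall>k>d. coeff P g k : q)}"
 have top: "\<exists>d\<in>A. \<forall>n. coeff P H n ~: q --> n \<le> d" "\<exists>d\<in>A. coeff P H d ~: q" if H: "H : Z" "H ~: cfs q" for H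
 proof -
  have HP: "H : carrier P" using H z(1) by auto
  obtain d where "coeff P H d ~: q" "\<forall>k>d. coeff P H k : q" using top_outside[OF q(1) HP H(2)] by metis
  then show "\<exists>d\<in>A. \<forall>n. coeff P H n ~: q --> n \<le> d" "\<exists>d\<in>A. coeff P H d ~: q"
   unfolding A_def using H(1) by (auto simp: not_less[symmetric])
 qed
 obtain H0 where "H0 : Z" "H0 ~: cfs q" using not by blast
 then have "A ~= {}" using top(1) by blast
 then have L: "(LEAST d. d : A) : A" by (metis LeastI_ex ex_in_conv)
 define d where "d = (LEAST d. d : A)"
 obtain g where g: "g : Z" "coeff P g d ~: q" "\<forall>k>d. coeff P g k : q"
  using L unfolding A_def d_def by blast
 have gP: "g : carrier P" using g z(1) by auto
 obtain n where n: "\<forall>k\<ge>n. coeff P g k = \<zero>" using bounded_coeff gP by blast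
 \<comment> \<open>The coefficients of g above d lie in q, and q[X] is contained in Z. Cutting them
   off therefore gives an element of Z whose coefficients above d vanish exactly and not only modulo
   q.\<close>
 define g' where "g' = (%k. if k \<le> d then coeff P g k else \<zero>)"
 have g'P: "g' : carrier P"
 proof -
  have "!!n. g' n : carrier R" "bound \<zero> d g'" unfolding g'_def using gP by (auto intro!: bound.intro)
  then have "g' : up R" by auto
  then show ?thesis by (simp add: P_def UP_def)
 qed
 have cg': "coeff P g' k = g' k" for k using g'P by (simp add: P_def UP_def)
 have "g \<ominus>\<^bsub>P\<^esub> g' : cfs q"
 proof -
  have "coeff P (g \<ominus>\<^bsub>P\<^esub> g') k : q" for k
  proof -
   have "coeff P (g \<ominus>\<^bsub>P\<^esub> g') k = coeff P g k \<ominus> g' k" using gP g'P cg' by simp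
   moreover have "\<dots> : q"
    using g(3) gP qf(2) unfolding g'_def by (auto simp: R.minus_eq R.r_neg)
   ultimately show ?thesis by simp
  qed
  then show ?thesis unfolding cfs_def using gP g'P by auto
 qed
 then have "g \<ominus>\<^bsub>P\<^esub> (g \<ominus>\<^bsub>P\<^esub> g') : Z" using z(7) g(1) cz by blast
 moreover have "g \<ominus>\<^bsub>P\<^esub> (g \<ominus>\<^bsub>P\<^esub> g') = g'"
  using gP g'P by (simp add: P.minus_eq P.minus_add P.a_assoc[symmetric] P.r_neg)
 ultimately have g'Z: "g' : Z" by simp
 show ?thesis
 proof (rule that[OF g'Z])
  show "coeff P g' d ~: q" "\<forall>k>d. coeff P g' k = \<zero>" unfolding cg' using g(2) by (auto simp: g'_def)
  fix r assume r: "r : Z" "\<forall>k\<ge>d. coeff P r k = \<zero>"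
  show "r : cfs q"
  proof (rule ccontr)
   assume "r ~: cfs q"
   then obtain e where e: "e : A" "coeff P r e ~: q" using top(2)[OF r(1)] by blast
   then have "d \<le> e" unfolding d_def by (simp add: Least_le)
   then show False using e(2) r(2) qf(2) by simp
  qed
 qed
qed

end

section \<open>Adjoining one generator\<close>

text \<open>The ring \<open>T\<close> is generated over the image of \<open>R\<close> by the value of the indeterminate under
 \<open>ev\<close>, and \<open>dv H\<close> is the value of the formal derivative of \<open>H\<close>.\<close>

locale poly_ext = UP_cring R P for R (structure) and P +
 fixes T :: "('t, 'm) ring_scheme" and ev dv :: "(nat \<Rightarrow> 'a) \<Rightarrow> 't"
 assumes T_domain: "domain T"
  and ev_hom: "ev : ring_hom P T"
  and ev_surj: "ev ` carrier P = carrier T"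
  and dv_closed: "H : carrier P ==> dv H : carrier T"
  and dv_add: "H : carrier P ==> G : carrier P ==> dv (H \<oplus>[P] G) = dv H \<oplus>[T] dv G"
  and dv_mult: "H : carrier P ==> G : carrier P ==>
    dv (H \<otimes>[P] G) = dv H \<otimes>[T] ev G \<oplus>[T] ev H \<otimes>[T] dv G"
  and dv_const: "c : carrier R ==> dv (monom P c 0) = \<zero>[T]"
begin

sublocale P: cring P by (rule UP_cring)
sublocale T: domain T by (rule T_domain)
sublocale ev: ring_hom_cring P T ev by unfold_locales (rule ev_hom)

definition incl :: "'a \<Rightarrow> 't" where "incl c = ev (monom P c 0)"
text \<open>As \<open>ev\<close> is onto, the image of I[X] is the ideal of T generated by the image
  of I. In this form its elements come with a polynomial whose coefficients can be
  inspected.\<close>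

definition ext :: "'a set \<Rightarrow> 't set" where "ext I = ev ` cfs I"
definition contr :: "'t set \<Rightarrow> 'a set" where "contr q = {c : carrier R. incl c : q}"

lemma incl_hom: "incl : ring_hom R T"
 using ring_hom_trans[OF const_ring_hom ev_hom] unfolding incl_def comp_def .

sublocale incl: ring_hom_cring R T incl by unfold_locales (rule incl_hom)

lemma contr_prime: "primeideal q T ==> primeideal (contr q) R"
 unfolding contr_def using primeideal_vimage[OF R.is_cring T.is_cring incl_hom] .

lemma ext_ideal:
 assumes I: "ideal I R" shows "ideal (ext I) T"
proof (rule T.ideal_if)
 note i = ideal_facts[OF cfs_ideal[OF I]]
 show "ext I \<subseteq> carrier T" unfolding ext_def using i(1) by auto
 show "\<zero>[T] : ext I" unfolding ext_def using i(2) ev.hom_zero by (metis imageI)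
 show "a \<oplus>[T] b : ext I" if ab: "a : ext I" "b : ext I" for a b
 proof -
  obtain A B where AB: "A : cfs I" "B : cfs I" "a = ev A" "b = ev B" using ab unfolding ext_def by blast
  then have "A : carrier P" "B : carrier P" using i(1) by auto
  then have "ev (A \<oplus>[P] B) = a \<oplus>[T] b" using AB by simp
  then show ?thesis unfolding ext_def using i(3) AB by (metis imageI)
 qed
 show "r \<otimes>[T] a : ext I" if ab: "a : ext I" "r : carrier T" for a r
 proof -
  obtain A B where AB: "A : cfs I" "B : carrier P" "a = ev A" "r = ev B"
   using ab ev_surj unfolding ext_def by blast
  then have "A : carrier P" using i(1) by auto
  then have "ev (B \<otimes>[P] A) = r \<otimes>[T] a" using AB by simp
  then show ?thesis unfolding ext_def using i(4) AB by (metis imageI)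
 qed
qed

lemma incl_in_ext: "ideal I R ==> c : I ==> incl c : ext I"
 unfolding ext_def incl_def using monom_in_cfs by blast

lemma ev_monom: "c : carrier R ==> ev (monom P c n) = incl c \<otimes>[T] ev (monom P \<one> n)"
 using monom_mult[of c \<one> 0 n] ev.hom_mult[of "monom P c 0" "monom P \<one> n"] unfolding incl_def by simp

lemma ext_least:
 assumes I: "ideal I R" and J: "ideal J T" and sub: "!!c. c : I ==> incl c : J"
 shows "ext I \<subseteq> J"
proof
 note j = ideal_facts[OF J]
 fix a assume "a : ext I"
 then obtain A where A: "A : cfs I" "a = ev A" unfolding ext_def by blast
 have "ev A : J"
 proof (rule cfs_induct[OF I A(1)])
  show "ev \<zero>[P] : J" using j(2) by simp
  fix H c n assume *: "H : cfs I" "ev H : J" "c : I"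
  then have "c : carrier R" "H : carrier P"
   using ideal_facts(1)[OF I] ideal_facts(1)[OF cfs_ideal[OF I]] by auto
  then have "ev (H \<oplus>[P] monom P c n) = ev H \<oplus>[T] incl c \<otimes>[T] ev (monom P \<one> n)"
   by (simp add: ev_monom[of c])
  moreover have "incl c \<otimes>[T] ev (monom P \<one> n) : J"
   using j(5)[OF sub[OF *(3)], of "ev (monom P \<one> n)"] by simp
  ultimately show "ev (H \<oplus>[P] monom P c n) : J" using j(3) *(2) by simp
 qed
 then show "a : J" using A by simp
qed

lemma ext_adj:
 assumes I: "ideal I R" and y: "y : carrier R"
 shows "ext (adj R I y) = adj T (ext I) (incl y)"
proof
 note ai = R.adj_ideal[OF I y] and ti = T.adj_ideal[OF ext_ideal[OF I] incl.hom_closed[OF y]]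
 show "adj T (ext I) (incl y) \<subseteq> ext (adj R I y)"
 proof (rule T.adj_least[OF ext_ideal[OF ai(1)]])
  show "ext I \<subseteq> ext (adj R I y)" unfolding ext_def using cfs_mono[OF ai(2)] by blast
  show "incl y : ext (adj R I y)" using incl_in_ext[OF ai(1) ai(3)] .
 qed
 show "ext (adj R I y) \<subseteq> adj T (ext I) (incl y)"
 proof (rule ext_least[OF ai(1) ti(1)])
  note t = ideal_facts[OF ti(1)]
  fix c assume "c : adj R I y"
  then obtain i a where *: "i : I" "a : carrier R" "c = i \<oplus> y \<otimes> a" by (rule adjE)
  then have "i : carrier R" using ideal_facts(1)[OF I] by auto
  then have "incl c = incl i \<oplus>[T] incl y \<otimes>[T] incl a" using * y by simp
  moreover have "incl i : adj T (ext I) (incl y)" using incl_in_ext[OF I *(1)] ti(2) by auto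
  moreover have "incl y \<otimes>[T] incl a : adj T (ext I) (incl y)"
   using t(5)[OF ti(3) incl.hom_closed[OF *(2)]] .
  ultimately show "incl c : adj T (ext I) (incl y)" using t(3) by simp
 qed
qed

lemma ext_zero: "ext {\<zero>} = {\<zero>[T]}"
proof
 show "ext {\<zero>} \<subseteq> {\<zero>[T]}" by (rule ext_least[OF R.zeroideal T.zeroideal]) simp
 show "{\<zero>[T]} \<subseteq> ext {\<zero>}" using ideal_facts(2)[OF ext_ideal[OF R.zeroideal]] by simp
qed

text \<open>The consequence of flatness of T at q over R that regular sequences call for: a
  nonzerodivisor modulo I stays a nonzerodivisor modulo the extension of I, for every ideal
  I.\<close>

definition flat_at :: "'t set \<Rightarrow> bool" where
 "flat_at q \<longleftrightarrow> (\<forall>I y. ideal I R --> y : carrier R --> regular_at R (contr q) I y -->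
   regular_at T q (ext I) (incl y))"

lemma regseq_ext:
 assumes "flat_at q" "ideal I R" "set xs \<subseteq> carrier R" "regseq_at R (contr q) I xs"
 shows "regseq_at T q (ext I) (map incl xs) \<and> adjoin T (ext I) (map incl xs) = ext (adjoin R I xs)"
 using assms(2-)
proof (induction xs arbitrary: I)
 case (Cons x xs)
 then have x: "x : carrier R" by simp
 have "regular_at T q (ext I) (incl x)" using assms(1) Cons.prems x unfolding flat_at_def by auto
 then show ?case using Cons.IH[OF R.adj_ideal(1)[OF Cons.prems(1) x]] Cons.prems
  by (simp add: ext_adj[OF Cons.prems(1) x])
qed auto

text \<open>After multiplication by a common multiplier of the coefficients, H itself lies in J[X].
  Membership in a localized extended ideal is thus reduced to a condition on coefficients over
  R.\<close>

lemma ext_saturation: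
 assumes q: "primeideal q T" and J: "ideal J R" and H: "H : carrier P"
  and sat: "!!n. coeff P H n : saturation R (contr q) J"
 shows "ev H : saturation T q (ext J)"
proof -
 obtain t where t: "t : carrier R - contr q" "monom P t 0 \<otimes>[P] H : cfs J"
  using common_multiplier[OF contr_prime[OF q] J H sat] by metis
 have "incl t : carrier T - q" using t(1) unfolding contr_def by auto
 moreover have "incl t \<otimes>[T] ev H = ev (monom P t 0 \<otimes>[P] H)" unfolding incl_def using t(1) H by auto
 ultimately show ?thesis unfolding saturation_def using t(2) H unfolding ext_def by auto
qed

lemma saturation_trans:
 assumes q: "primeideal q T" and "t : carrier T - q" "a : carrier T" "t \<otimes>[T] a : saturation T q J"
 shows "a : saturation T q J"
proof -
 obtain s where s: "s : carrier T - q" "s \<otimes>[T] (t \<otimes>[T] a) : J" using assms(4) unfolding saturation_def by blast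
 then have "(s \<otimes>[T] t) \<otimes>[T] a : J" using assms by (simp add: T.m_assoc)
 then show ?thesis unfolding saturation_def using primeideal_facts(6)[OF q s(1) assms(2)] assms(3) by blast
qed

text \<open>Up to a multiplier, h is the value of a polynomial with coefficients in
  \<open>contr q\<close>, and each of these lies in J up to a further multiplier.\<close>

lemma ext_contr_saturation:
 assumes q: "primeideal q T" and J: "ideal J R" and c: "contr q \<subseteq> saturation R (contr q) J"
  and h: "h : saturation T q (ext (contr q))"
 shows "h : saturation T q (ext J)"
proof -
 obtain t where t: "t : carrier T - q" "t \<otimes>[T] h : ext (contr q)" using h unfolding saturation_def by blast
 then obtain H where H: "H : cfs (contr q)" "t \<otimes>[T] h = ev H" unfolding ext_def by blast
 have "ev H : saturation T q (ext J)"
  by (rule ext_saturation[OF q J]) (use H(1) c in \<open>auto simp: cfs_def\<close>)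
 then show ?thesis using saturation_trans[OF q t(1), of h] h H(2) unfolding saturation_def by auto
qed

text \<open>The derivation kills constants, so it is R-linear: it maps c X^n to c times the image of
  X^n and cannot leave the extension of I.\<close>

lemma dv_cfs:
 assumes I: "ideal I R" and H: "H : cfs I"
 shows "dv H : ext I"
proof (rule cfs_induct[OF I H])
 note e = ideal_facts[OF ext_ideal[OF I]]
 show "dv \<zero>[P] : ext I" using dv_const[of \<zero>] e(2) by simp
 fix H c n assume *: "H : cfs I" "dv H : ext I" "c : I"
 then have c: "c : carrier R" and HP: "H : carrier P"
  using ideal_facts(1)[OF I] ideal_facts(1)[OF cfs_ideal[OF I]] by auto
 have "monom P c n = monom P c 0 \<otimes>[P] monom P \<one> n" using c monom_mult[of c \<one> 0 n] by simp
 then have "dv (monom P c n) = incl c \<otimes>[T] dv (monom P \<one> n)"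
  using dv_mult[of "monom P c 0" "monom P \<one> n"] c dv_const[OF c] dv_closed[of "monom P \<one> n"]
  by (simp add: incl_def)
 moreover have "\<dots> : ext I" using e(5)[OF incl_in_ext[OF I *(3)] dv_closed[of "monom P \<one> n"]] by simp
 ultimately show "dv (H \<oplus>[P] monom P c n) : ext I"
  using dv_add[OF HP, of "monom P c n"] c e(3) *(2) by simp
qed

end

section \<open>Regular sequences at the primes of an extension by one generator\<close>

context poly_ext
begin

lemma in_saturation: "primeideal q T ==> J \<subseteq> carrier T ==> J \<subseteq> saturation T q J"
 unfolding saturation_def using primeideal_facts(4)[of q T] T.one_closed T.l_one
 by (smt (verit, best) Diff_iff mem_Collect_eq subset_iff)

text \<open>If the maximal ideal at q is generated by the contraction of q, the fibre contributes no
  new generator: a regular sequence for the contraction stays regular by flatness and generates the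
  maximal ideal at q.\<close>

lemma reg_at_ext:
 assumes q: "primeideal q T" and flat: "flat_at q" and reg: "reg_at R (contr q)"
  and sub: "q \<subseteq> saturation T q (ext (contr q))"
 shows "reg_at T q"
proof -
 obtain xs where xs: "set xs \<subseteq> contr q" "regseq_at R (contr q) {\<zero>} xs"
  "contr q \<subseteq> saturation R (contr q) (adjoin R {\<zero>} xs)" using reg unfolding reg_at_def by blast
 have xR: "set xs \<subseteq> carrier R" using xs(1) unfolding contr_def by auto
 note * = regseq_ext[OF flat R.zeroideal xR xs(2), unfolded ext_zero]
 have J: "ideal (adjoin R {\<zero>} xs) R" using R.adjoin_ideal[OF R.zeroideal xR] by simp
 have "q \<subseteq> saturation T q (ext (adjoin R {\<zero>} xs))"
  using ext_contr_saturation[OF q J xs(3)] sub by blast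
 moreover have "set (map incl xs) \<subseteq> q" using xs(1) unfolding contr_def by auto
 ultimately show ?thesis unfolding reg_at_def using * by metis
qed

lemma kernel_ideal: "primeideal q T ==> primeideal {H : carrier P. ev H : q} P"
 using primeideal_vimage[OF P.is_cring T.is_cring ev_hom] .

lemma contr_monom: "c : contr q ==> monom P c 0 : {H : carrier P. ev H : q}"
 unfolding contr_def incl_def by simp

text \<open>Here T is a polynomial ring over R, and the open set is pulled back from R. A prime q is
  either extended from its contraction, or its fibre has one further generator g, whose value is
  appended to the regular sequence.\<close>

theorem transcendental_step:
 assumes inj: "!!H. H : carrier P ==> ev H = \<zero>[T] ==> H = \<zero>[P]" and reg: "gen_reg R"
 shows "gen_reg T"
proof -
 have inj': "H = G" if "H : carrier P" "G : carrier P" "ev H = ev G" for H G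
 proof -
  have "ev (H \<ominus>\<^bsub>P\<^esub> G) = \<zero>[T]" using that by (simp add: P.minus_eq T.r_neg)
  then show ?thesis using inj[of "H \<ominus>\<^bsub>P\<^esub> G"] that P.r_right_minus_eq by simp
 qed
 obtain f where f: "f : carrier R" "f ~= \<zero>" and fq: "!!q. primeideal q R ==> f ~: q ==> reg_at R q"
  using reg unfolding gen_reg_def by blast
 have f0: "incl f ~= \<zero>[T]"
  using inj[of "monom P f 0"] f monom_inj[of 0] unfolding incl_def inj_on_def
  by (metis R.zero_closed monom_closed monom_zero)
 have "reg_at T q" if q: "primeideal q T" and fnq: "incl f ~: q" for q
 proof -
  note cq = contr_prime[OF q] and qi = primeideal_facts(1)[OF q]
  note ci = primeideal_facts(1)[OF cq]
  have reg: "reg_at R (contr q)" using fq[OF cq] fnq unfolding contr_def by blast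
  have flat: "flat_at q"
   unfolding flat_at_def
  proof (intro allI impI)
   fix I y assume I: "ideal I R" and y: "y : carrier R" and ry: "regular_at R (contr q) I y"
   show "regular_at T q (ext I) (incl y)" unfolding regular_at_def
   proof (intro ballI impI)
    fix a assume a: "a : carrier T" "incl y \<otimes>[T] a : ext I"
    obtain H where H: "H : carrier P" "a = ev H" using a(1) ev_surj by blast
    obtain G where G: "G : cfs I" "incl y \<otimes>[T] a = ev G" using a(2) unfolding ext_def by blast
    have GP: "G : carrier P" using G(1) unfolding cfs_def by simp
    \<comment> \<open>By injectivity of \<open>ev\<close> the equation y H = G holds between
      polynomials and can be read off coefficient by coefficient; this is the freeness of R[X] over
      R.\<close>
    have "ev (monom P y 0 \<otimes>[P] H) = ev G" using G(2) H y unfolding incl_def by simp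
    then have "monom P y 0 \<otimes>[P] H = G" using inj' H(1) GP y by simp
    then have "y \<otimes> coeff P H n : I" for n
     using coeff_const_mult[OF y H(1), of n] G(1) unfolding cfs_def mem_Collect_eq by metis
    then have "coeff P H n : saturation R (contr q) I" for n
     using ry H(1) unfolding regular_at_def by simp
    then show "a : saturation T q (ext I)" using ext_saturation[OF q I H(1)] H(2) by simp
   qed
  qed
  define Z where "Z = {H : carrier P. ev H : q}"
  have Zp: "primeideal Z P" unfolding Z_def by (rule kernel_ideal[OF q])
  note Zi = primeideal_facts(1)[OF Zp]
  show ?thesis
  proof (cases "Z \<subseteq> cfs (contr q)")
   case True
   have "q \<subseteq> ext (contr q)"
   proof
    fix h assume h: "h : q"
    then obtain H where "H : carrier P" "h = ev H" using ideal_facts(1)[OF qi] ev_surj by blast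
    then show "h : ext (contr q)" using True h unfolding Z_def ext_def by blast
   qed
   then have "q \<subseteq> saturation T q (ext (contr q))"
    using in_saturation[OF q, of "ext (contr q)"] ideal_facts(1)[OF ext_ideal[OF ci]] by blast
   then show ?thesis by (rule reg_at_ext[OF q flat reg])
  next
   case False
   then obtain g d where g: "g : Z" "coeff P g d ~: contr q" "\<forall>k>d. coeff P g k = \<zero>"
    "!!r. r : Z ==> \<forall>k\<ge>d. coeff P r k = \<zero> ==> r : cfs (contr q)"
    using fibre_generator[OF Zi ci contr_monom[of _ q, folded Z_def]] by metis
   have gP: "g : carrier P" and gq: "ev g : q" using g(1) unfolding Z_def by auto
   have gT: "ev g : carrier T" using gP by simp
   obtain xs where xs: "set xs \<subseteq> contr q" "regseq_at R (contr q) {\<zero>} xs"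
    "contr q \<subseteq> saturation R (contr q) (adjoin R {\<zero>} xs)" using reg unfolding reg_at_def by blast
   have xR: "set xs \<subseteq> carrier R" using xs(1) unfolding contr_def by auto
   define J where "J = adjoin R {\<zero>} xs"
   have J: "ideal J R" using R.adjoin_ideal[OF R.zeroideal xR] unfolding J_def by simp
   have Jq: "J \<subseteq> contr q" unfolding J_def
    by (rule R.adjoin_least[OF ci]) (use xs(1) ideal_facts(2)[OF ci] in auto)
   note * = regseq_ext[OF flat R.zeroideal xR xs(2), unfolded ext_zero, folded J_def]
   \<comment> \<open>The ideal of polynomials over \<open>contr q\<close> is prime and does not
     contain g, so if g H has coefficients in J then H has coefficients in \<open>contr q\<close>.
     Locally \<open>contr q\<close> and J agree.\<close>
   have "regular_at T q (ext J) (ev g)" unfolding regular_at_def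
   proof (intro ballI impI)
    fix a assume a: "a : carrier T" "ev g \<otimes>[T] a : ext J"
    obtain H where H: "H : carrier P" "a = ev H" using a(1) ev_surj by blast
    obtain G where G: "G : cfs J" "ev g \<otimes>[T] a = ev G" using a(2) unfolding ext_def by blast
    have GP: "G : carrier P" using G(1) unfolding cfs_def by simp
    have "g \<otimes>[P] H = G" using inj'[of "g \<otimes>[P] H" G] G(2) H gP GP by simp
    then have "g \<otimes>[P] H : cfs (contr q)" using cfs_mono[OF Jq] G(1) by blast
    moreover have "g ~: cfs (contr q)" using g(2) unfolding cfs_def by blast
    ultimately have "H : cfs (contr q)" using cfs_prime[OF cq gP _ H(1)] by blast
    then have "coeff P H n : saturation R (contr q) J" for n
     using xs(3) unfolding cfs_def J_def by blast
    then show "a : saturation T q (ext J)" using ext_saturation[OF q J H(1)] H(2) by simp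
   qed
   then have rs: "regseq_at T q {\<zero>[T]} (map incl xs @ [ev g])"
    unfolding regseq_at_append using * by simp
   define J' where "J' = adjoin T {\<zero>[T]} (map incl xs @ [ev g])"
   have J'_eq: "J' = adj T (ext J) (ev g)" unfolding J'_def adjoin_append using * by simp
   note eJ = ext_ideal[OF J]
   note J' = T.adj_ideal[OF eJ gT, folded J'_eq]
   note j' = ideal_facts[OF J'(1)]
   have "q \<subseteq> saturation T q J'"
   proof
    fix h assume h: "h : q"
    then have hT: "h : carrier T" using ideal_facts(1)[OF qi] by blast
    then obtain H where H: "H : carrier P" "h = ev H" using ev_surj by blast
    have HZ: "H : Z" using H h unfolding Z_def by simp
    \<comment> \<open>Pseudo-division by g: the remainder lies in Z and has degree below d, so its
      coefficients are in \<open>contr q\<close>; the power of the leading coefficient that is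
      multiplied in is a unit at q.\<close>
    obtain N U r where r: "U : carrier P" "r : cfs (carrier R)" "\<forall>k\<ge>d. coeff P r k = \<zero>"
     "monom P (coeff P g d [^] (N::nat)) 0 \<otimes>[P] H = U \<otimes>[P] g \<oplus>[P] r"
     using pseudo_division[OF gP g(3) R.oneideal, of H] H(1) by (metis cfs_carrier)
    have rP: "r : carrier P" using r(2) by simp
    let ?l = "coeff P g d [^] N"
    have lR: "?l : carrier R" using gP by simp
    have lq: "?l : carrier R - contr q" using primeideal_pow[OF cq, of "coeff P g d" N] g(2) gP by simp
    have M: "monom P ?l 0 \<otimes>[P] H : Z" "U \<otimes>[P] g : Z"
     using ideal_facts(4)[OF Zi HZ, of "monom P ?l 0"] ideal_facts(4)[OF Zi g(1) r(1)] lR by auto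
    have req: "r = monom P ?l 0 \<otimes>[P] H \<ominus>\<^bsub>P\<^esub> U \<otimes>[P] g"
     unfolding r(4) using r(1) gP rP by (simp add: P.minus_eq P.a_ac P.r_neg P.r_neg2 P.r_neg1)
    have "r : Z" using ideal_facts(7)[OF Zi M] req by simp
    then have "r : cfs (contr q)" using g(4) r(3) by blast
    then have "coeff P r n : saturation R (contr q) J" for n using xs(3) unfolding cfs_def J_def by blast
    then have "ev r : saturation T q (ext J)" using ext_saturation[OF q J rP] by simp
    then obtain t where t: "t : carrier T - q" "t \<otimes>[T] ev r : ext J" unfolding saturation_def by blast
    have "incl ?l \<otimes>[T] h = ev U \<otimes>[T] ev g \<oplus>[T] ev r"
     using arg_cong[OF r(4), of ev] H r(1) gP rP lR unfolding incl_def by simp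
    then have "t \<otimes>[T] (incl ?l \<otimes>[T] h) = (t \<otimes>[T] ev U) \<otimes>[T] ev g \<oplus>[T] t \<otimes>[T] ev r"
     using t(1) r(1) gP rP by (simp add: T.r_distr T.m_assoc)
    moreover have "(t \<otimes>[T] ev U) \<otimes>[T] ev g : J'" using j'(4)[OF J'(3), of "t \<otimes>[T] ev U"] t(1) r(1) by simp
    moreover have "t \<otimes>[T] ev r : J'" using t(2) J'(2) by blast
    ultimately have "t \<otimes>[T] (incl ?l \<otimes>[T] h) : J'" using j'(3) by simp
    then have s1: "incl ?l \<otimes>[T] h : saturation T q J'"
     unfolding saturation_def using t(1) hT incl.hom_closed[OF lR] by blast
    have "incl ?l : carrier T - q" using lq lR unfolding contr_def by simp
    then show "h : saturation T q J'" using saturation_trans[OF q _ hT s1] by blast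
   qed
   moreover have "set (map incl xs @ [ev g]) \<subseteq> q" using xs(1) gq unfolding contr_def by auto
   ultimately show ?thesis unfolding reg_at_def J'_def using rs by blast
  qed
 qed
 then show ?thesis unfolding gen_reg_def using f0 incl.hom_closed[OF f(1)] by blast
qed

text \<open>If \<open>G\<close> vanishes at the new generator but its derivative does not, then so does a relation
 \<open>F\<close> of minimal degree.  Away from its leading coefficient \<open>T\<close> is free over \<open>R\<close>, and away from
 \<open>dv F\<close> the fibres are reduced.\<close>

theorem separable_step:
 assumes incl0: "!!c. c : carrier R ==> incl c = \<zero>[T] ==> c = \<zero>"
  and G: "G : carrier P" "ev G = \<zero>[T]" "dv G ~= \<zero>[T]" and reg: "gen_reg R"
 shows "gen_reg T"
proof -
 have dv0: "dv \<zero>[P] = \<zero>[T]" using dv_const[of \<zero>] by simp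
 define K where "K = {H : carrier P. ev H : {\<zero>[T]}}"
 have Kp: "primeideal K P" unfolding K_def using kernel_ideal T.zeroprimeideal by blast
 note Ki = primeideal_facts(1)[OF Kp]
 have "\<not> K \<subseteq> cfs {\<zero>}"
 proof
  assume "K \<subseteq> cfs {\<zero>}"
  then have "G : cfs {\<zero>}" using G unfolding K_def by auto
  then have "G = \<zero>[P]" using G(1) by (intro poly_eqI) (auto simp: cfs_def)
  then show False using G(3) dv0 by simp
 qed
 \<comment> \<open>Taken over the zero ideal of R, the generator of the fibre is the minimal
   polynomial of the new generator over the fraction field of R, with denominators cleared; m is its
   degree.\<close>
 then obtain F m where F: "F : K" "coeff P F m ~= \<zero>" "\<forall>k>m. coeff P F k = \<zero>"
  and min: "!!r. r : K ==> \<forall>k\<ge>m. coeff P r k = \<zero> ==> r : cfs {\<zero>}"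
  using fibre_generator[OF Ki R.zeroideal] ideal_facts(2)[OF Ki]
  by (metis empty_iff insert_iff monom_zero)
 have min: "r = \<zero>[P]" if "r : carrier P" "ev r = \<zero>[T]" "\<forall>k\<ge>m. coeff P r k = \<zero>" for r
  using min[of r] that by (intro poly_eqI) (auto simp: cfs_def K_def)
 have FP: "F : carrier P" and evF: "ev F = \<zero>[T]" using F(1) unfolding K_def by auto
 define l where "l = coeff P F m"
 have l: "l : carrier R" "l ~= \<zero>" unfolding l_def using F(2) FP by auto
 have lp: "l [^] (n::nat) : carrier R" for n using l by simp
 note pd = pseudo_division[OF FP F(3), folded l_def]
 \<comment> \<open>By minimality of m the remainder of G on division by F is zero, so l^N G = U F.
   If \<open>dv F\<close> vanished, applying \<open>dv\<close> would give l^N times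
   \<open>dv G\<close> equal to zero in the domain T.\<close>
 have dvF: "dv F ~= \<zero>[T]"
 proof
  assume d0: "dv F = \<zero>[T]"
  obtain N U r where r: "U : carrier P" "r : cfs (carrier R)" "\<forall>k\<ge>m. coeff P r k = \<zero>"
   "monom P (l [^] (N::nat)) 0 \<otimes>[P] G = U \<otimes>[P] F \<oplus>[P] r"
   using pd[OF R.oneideal, of G] G(1) by (metis cfs_carrier)
  have rP: "r : carrier P" using r(2) by simp
  have "ev r = \<zero>[T]" using arg_cong[OF r(4), of ev] G(1,2) r(1) rP FP evF lp by simp
  then have "r = \<zero>[P]" using min rP r(3) by blast
  then have "dv (monom P (l [^] N) 0 \<otimes>[P] G) = dv (U \<otimes>[P] F)" using r(4) r(1) FP by simp
  then have "incl (l [^] N) \<otimes>[T] dv G = \<zero>[T]"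
   using dv_mult[of "monom P (l [^] N) 0" G] dv_mult[OF r(1) FP] dv_const[OF lp] lp G FP r(1) evF d0
    dv_closed by (simp add: incl_def)
  then have "incl (l [^] N) = \<zero>[T]" using T.integral[of "incl (l [^] N)" "dv G"] G(3) dv_closed[OF G(1)]
    incl.hom_closed[OF lp] by blast
  moreover have "incl (l [^] N) = incl l [^]\<^bsub>T\<^esub> N" using l(1) incl.hom_pow by simp
  moreover have "incl l ~= \<zero>[T]" using incl0 l by blast
  ultimately show False
   using primeideal_pow[OF T.zeroprimeideal, of "incl l" N] incl.hom_closed[OF l(1)] by simp
 qed
 obtain f where f: "f : carrier R" "f ~= \<zero>" and fq: "!!q. primeideal q R ==> f ~: q ==> reg_at R q"
  using reg unfolding gen_reg_def by blast
 \<comment> \<open>Three loci are intersected: R is regular where f is invertible, T is locally free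
   over R where l is invertible, and the fibres are reduced where \<open>dv F\<close> is
   invertible.\<close>
 define f' where "f' = incl f \<otimes>[T] (incl l \<otimes>[T] dv F)"
 have nz: "incl f ~= \<zero>[T]" "incl l ~= \<zero>[T]" using incl0 f l by auto
 have cl: "incl f : carrier T" "incl l : carrier T" "dv F : carrier T" using f l dv_closed FP by auto
 have f'0: "f' ~= \<zero>[T]" unfolding f'_def using T.integral_iff nz dvF cl by simp
 have "reg_at T q" if q: "primeideal q T" and fnq: "f' ~: q" for q
 proof -
  note cq = contr_prime[OF q] and qi = primeideal_facts(1)[OF q]
  note ci = primeideal_facts(1)[OF cq] and qf = ideal_facts[OF qi]
  have nq: "incl f ~: q" "incl l ~: q" "dv F ~: q"
   using fnq qf(4,5) cl unfolding f'_def by (meson T.m_closed)+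
  have reg: "reg_at R (contr q)" using fq[OF cq] nq unfolding contr_def by blast
  have lq: "l [^] (n::nat) : carrier R - contr q" for n
   using primeideal_pow[OF cq] nq(2) l(1) unfolding contr_def by blast
  \<comment> \<open>Where l is invertible, every element of T is the value of a polynomial of degree
    below m up to a power of l, and such a polynomial is unique by minimality of F. The relation
    between y a and \<open>ev A\<close> therefore lifts to remainders and is compared
    coefficientwise.\<close>
  have flat: "flat_at q"
   unfolding flat_at_def
  proof (intro allI impI)
   fix I y assume I: "ideal I R" and y: "y : carrier R" and ry: "regular_at R (contr q) I y"
   show "regular_at T q (ext I) (incl y)" unfolding regular_at_def
   proof (intro ballI impI)
    fix a assume a: "a : carrier T" "incl y \<otimes>[T] a : ext I"
    obtain H where H: "H : carrier P" "a = ev H" using a(1) ev_surj by blast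
    obtain A where A: "A : cfs I" "incl y \<otimes>[T] a = ev A" using a(2) unfolding ext_def by blast
    have AP: "A : carrier P" using A(1) unfolding cfs_def by simp
    obtain N U r where r: "U : carrier P" "r : cfs (carrier R)" "\<forall>k\<ge>m. coeff P r k = \<zero>"
     "monom P (l [^] (N::nat)) 0 \<otimes>[P] H = U \<otimes>[P] F \<oplus>[P] r"
     using pd[OF R.oneideal, of H] H(1) by (metis cfs_carrier)
    obtain M V s where s: "V : carrier P" "s : cfs I" "\<forall>k\<ge>m. coeff P s k = \<zero>"
     "monom P (l [^] (M::nat)) 0 \<otimes>[P] A = V \<otimes>[P] F \<oplus>[P] s"
     using pd[OF I A(1)] by metis
    have rP: "r : carrier P" and sP: "s : carrier P" using r(2) s(2) unfolding cfs_def by auto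
    have er: "incl (l [^] N) \<otimes>[T] a = ev r"
     using arg_cong[OF r(4), of ev] H r(1) rP FP evF lp by (simp add: incl_def)
    have es: "incl (l [^] M) \<otimes>[T] ev A = ev s"
     using arg_cong[OF s(4), of ev] AP s(1) sP FP evF lp by (simp add: incl_def)
    define r' where "r' = monom P (l [^] M) 0 \<otimes>[P] r"
    define s' where "s' = monom P (l [^] N) 0 \<otimes>[P] s"
    have r'P: "r' : carrier P" and s'P: "s' : carrier P" unfolding r'_def s'_def using rP sP lp by auto
    have cr': "coeff P r' k = l [^] M \<otimes> coeff P r k" for k unfolding r'_def using lp rP by (rule coeff_const_mult)
    have cs': "coeff P s' k = l [^] N \<otimes> coeff P s k" for k unfolding s'_def using lp sP by (rule coeff_const_mult)
    have s'I: "s' : cfs I" unfolding s'_def using ideal_facts(4)[OF cfs_ideal[OF I] s(2)] lp by simp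
    have er': "ev r' = incl (l [^] M) \<otimes>[T] (incl (l [^] N) \<otimes>[T] a)"
     unfolding er r'_def using lp rP by (simp add: incl_def)
    have es': "ev s' = incl (l [^] N) \<otimes>[T] (incl (l [^] M) \<otimes>[T] (incl y \<otimes>[T] a))"
     unfolding A(2) es s'_def using lp sP by (simp add: incl_def)
    define D where "D = monom P y 0 \<otimes>[P] r' \<ominus>\<^bsub>P\<^esub> s'"
    have DP: "D : carrier P" unfolding D_def using y r'P s'P by simp
    have evyr: "ev (monom P y 0 \<otimes>[P] r') = ev s'"
     using y r'P a(1) incl.hom_closed[OF lp] unfolding es'
     by (simp add: er' incl_def[symmetric] T.m_ac)
    have "ev D = \<zero>[T]" unfolding D_def using evyr y r'P s'P by (simp add: P.minus_eq T.r_neg)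
    moreover have "coeff P D k = \<zero>" if "k \<ge> m" for k
    proof -
     have "coeff P D k = y \<otimes> coeff P r' k \<ominus> coeff P s' k"
      unfolding D_def using y r'P s'P by (simp add: coeff_const_mult del: coeff_mult)
     then show ?thesis using that r(3) s(3) lp y by (simp add: cr' cs' R.minus_eq)
    qed
    ultimately have D0: "D = \<zero>[P]" using min DP by blast
    then have "monom P y 0 \<otimes>[P] r' = s'" unfolding D_def using y r'P s'P P.r_right_minus_eq by simp
    then have "y \<otimes> coeff P r' n : I" for n
     using coeff_const_mult[OF y r'P, of n] s'I unfolding cfs_def mem_Collect_eq by metis
    then have "coeff P r' n : saturation R (contr q) I" for n
     using ry r'P unfolding regular_at_def by simp
    then have e1: "ev r' : saturation T q (ext I)" using ext_saturation[OF q I r'P] by simp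
    have iq: "incl (l [^] n) : carrier T - q" for n :: nat using lq lp unfolding contr_def by auto
    have "incl (l [^] N) \<otimes>[T] a : saturation T q (ext I)"
     using saturation_trans[OF q iq _ e1[unfolded er']] a(1) iq by simp
    then show "a : saturation T q (ext I)" using saturation_trans[OF q iq a(1)] by blast
   qed
  qed
  define Z where "Z = {H : carrier P. ev H : q}"
  have Zp: "primeideal Z P" unfolding Z_def by (rule kernel_ideal[OF q])
  note Zi = primeideal_facts(1)[OF Zp]
  note ei = ideal_facts[OF ext_ideal[OF ci]]
  have extq: "ext (contr q) \<subseteq> q" by (rule ext_least[OF ci qi]) (simp add: contr_def)
  have "q \<subseteq> saturation T q (ext (contr q))"
  proof (cases "Z \<subseteq> cfs (contr q)")
   case True
   have "q \<subseteq> ext (contr q)"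
   proof
    fix h assume h: "h : q"
    then obtain H where "H : carrier P" "h = ev H" using qf(1) ev_surj by blast
    then show "h : ext (contr q)" using True h unfolding Z_def ext_def by blast
   qed
   then show ?thesis using in_saturation[OF q ei(1)] by blast
  next
   case False
   then obtain g d where g: "g : Z" "coeff P g d ~: contr q" "\<forall>k>d. coeff P g k = \<zero>"
    "!!r. r : Z ==> \<forall>k\<ge>d. coeff P r k = \<zero> ==> r : cfs (contr q)"
    using fibre_generator[OF Zi ci contr_monom[of _ q, folded Z_def]] by metis
   have gP: "g : carrier P" and gq: "ev g : q" using g(1) unfolding Z_def by auto
   have division: "\<exists>N U r. U : carrier P \<and> r : cfs (contr q) \<and>
     monom P (coeff P g d [^] (N::nat)) 0 \<otimes>[P] H = U \<otimes>[P] g \<oplus>[P] r" if HZ: "H : Z" for H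
   proof -
    have H: "H : carrier P" using HZ unfolding Z_def by simp
    obtain N U r where r: "U : carrier P" "r : cfs (carrier R)" "\<forall>k\<ge>d. coeff P r k = \<zero>"
     "monom P (coeff P g d [^] (N::nat)) 0 \<otimes>[P] H = U \<otimes>[P] g \<oplus>[P] r"
     using pseudo_division[OF gP g(3) R.oneideal, of H] H by (metis cfs_carrier)
    have rP: "r : carrier P" using r(2) by simp
    let ?l = "coeff P g d [^] N"
    have lR: "?l : carrier R" using gP by simp
    have M: "monom P ?l 0 \<otimes>[P] H : Z" "U \<otimes>[P] g : Z"
     using ideal_facts(4)[OF Zi HZ, of "monom P ?l 0"] ideal_facts(4)[OF Zi g(1) r(1)] lR by auto
    have req: "r = monom P ?l 0 \<otimes>[P] H \<ominus>\<^bsub>P\<^esub> U \<otimes>[P] g"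
     unfolding r(4) using r(1) gP rP by (simp add: P.minus_eq P.a_ac P.r_neg P.r_neg2 P.r_neg1)
    have "r : Z" using ideal_facts(7)[OF Zi M] req by simp
    then have "r : cfs (contr q)" using g(4) r(3) by blast
    then show ?thesis using r(1,4) by metis
   qed
   have ilq: "incl (coeff P g d [^] n) : carrier T - q" for n :: nat
    using primeideal_pow[OF cq, of "coeff P g d" n] g(2) gP unfolding contr_def by auto
   have FZ: "F : Z" unfolding Z_def using FP evF qf(2) by simp
   obtain N U r where r: "U : carrier P" "r : cfs (contr q)"
    "monom P (coeff P g d [^] (N::nat)) 0 \<otimes>[P] F = U \<otimes>[P] g \<oplus>[P] r" using division[OF FZ] by metis
   define b where "b = coeff P g d [^] N"
   have bR: "b : carrier R" unfolding b_def using gP by simp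
   have rP: "r : carrier P" using r(2) unfolding cfs_def by simp
   have T3: "ev U : carrier T" "ev g : carrier T" "ev r : carrier T"
    "dv U : carrier T" "dv g : carrier T" "dv r : carrier T" using r(1) gP rP dv_closed by auto
   have "\<zero>[T] = ev U \<otimes>[T] ev g \<oplus>[T] ev r"
    using arg_cong[OF r(3)[folded b_def], of ev] r(1) gP rP FP evF bR by simp
   then have "ev U \<otimes>[T] ev g = \<ominus>\<^bsub>T\<^esub> ev r" using T3 by (metis T.m_closed T.minus_equality)
   moreover have "ev r : ext (contr q)" using r(2) unfolding ext_def by blast
   ultimately have Ug: "ev U \<otimes>[T] ev g : ext (contr q)" using ei(6) by simp
   \<comment> \<open>Modulo \<open>contr q\<close> the polynomial F is U g up to the unit b. If U
     vanished at q as g does, every term in the derivative of U g + r would lie in q, while b times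
     \<open>dv F\<close> does not. So g is a simple factor.\<close>
   have Uq: "ev U ~: q"
   proof
    assume Uq: "ev U : q"
    have "dv (monom P b 0 \<otimes>[P] F) = dv (U \<otimes>[P] g) \<oplus>[T] dv r"
     using r(3)[folded b_def] dv_add[of "U \<otimes>[P] g" r] r(1) gP rP by simp
    moreover have "dv (monom P b 0 \<otimes>[P] F) = incl b \<otimes>[T] dv F"
     using dv_mult[of "monom P b 0" F] dv_const[OF bR] bR FP evF cl(3) by (simp add: incl_def)
    moreover have "dv (U \<otimes>[P] g) = dv U \<otimes>[T] ev g \<oplus>[T] ev U \<otimes>[T] dv g"
     using dv_mult r(1) gP by simp
    moreover have "dv r : q" using dv_cfs[OF ci r(2)] extq by blast
    moreover have "dv U \<otimes>[T] ev g : q" using qf(4)[OF gq T3(4)] .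
    moreover have "ev U \<otimes>[T] dv g : q" using qf(5)[OF Uq T3(5)] .
    ultimately have "incl b \<otimes>[T] dv F : q" using qf(3) by metis
    moreover have "incl b : carrier T - q" unfolding b_def using ilq by simp
    ultimately show False using primeideal_facts(5)[OF q, of "incl b" "dv F"] cl(3) nq(3) by blast
   qed
   show ?thesis
   proof
    fix h assume h: "h : q"
    then have hT: "h : carrier T" using qf(1) by blast
    then obtain H where H: "H : carrier P" "h = ev H" using ev_surj by blast
    have HZ: "H : Z" using H h unfolding Z_def by simp
    obtain N' V s where s: "V : carrier P" "s : cfs (contr q)"
     "monom P (coeff P g d [^] (N'::nat)) 0 \<otimes>[P] H = V \<otimes>[P] g \<oplus>[P] s" using division[OF HZ] by metis
    define c where "c = coeff P g d [^] N'"
    have cR: "c : carrier R" unfolding c_def using gP by simp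
    have sP: "s : carrier P" using s(2) unfolding cfs_def by simp
    have VT: "ev V : carrier T" "ev s : carrier T" using s(1) sP by auto
    have "incl c \<otimes>[T] h = ev V \<otimes>[T] ev g \<oplus>[T] ev s"
     using arg_cong[OF s(3)[folded c_def], of ev] H s(1) gP sP cR by (simp add: incl_def)
    \<comment> \<open>Multiplication by \<open>ev U\<close>, a unit at q, turns the multiple of g
      into one of U g, which already lies in the extended ideal.\<close>
    then have "ev U \<otimes>[T] (incl c \<otimes>[T] h) = ev V \<otimes>[T] (ev U \<otimes>[T] ev g) \<oplus>[T] ev U \<otimes>[T] ev s"
     using T3 VT by (simp add: T.r_distr T.m_lcomm)
    moreover have "ev V \<otimes>[T] (ev U \<otimes>[T] ev g) : ext (contr q)" using ei(4)[OF Ug VT(1)] .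
    moreover have "ev U \<otimes>[T] ev s : ext (contr q)"
     using ei(4)[of "ev s" "ev U"] s(2) T3(1) unfolding ext_def by blast
    ultimately have "ev U \<otimes>[T] (incl c \<otimes>[T] h) : ext (contr q)" using ei(3) by simp
    then have s1: "incl c \<otimes>[T] h : saturation T q (ext (contr q))"
     unfolding saturation_def using T3(1) Uq hT cR by blast
    have "incl c : carrier T - q" unfolding c_def using ilq by simp
    then show "h : saturation T q (ext (contr q))" using saturation_trans[OF q _ hT s1] by blast
   qed
  qed
  then show ?thesis by (rule reg_at_ext[OF q flat reg])
 qed
 then show ?thesis unfolding gen_reg_def using f'0 cl unfolding f'_def by blast
qed

end

section \<open>Dual numbers\<close>

text \<open>The pair (a, b) stands for a + b e with e squared equal to zero; the second component of
  the multiplication is the product rule.\<close>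

definition dual :: "('a, 'z) ring_scheme \<Rightarrow> ('a \<times> 'a) ring" where
 "dual R = \<lparr>carrier = carrier R \<times> carrier R,
   monoid.mult = (%(a, b) (c, d). (a \<otimes>[R] c, a \<otimes>[R] d \<oplus>[R] b \<otimes>[R] c)), one = (\<one>[R], \<zero>[R]),
   ring.zero = (\<zero>[R], \<zero>[R]), ring.add = (%(a, b) (c, d). (a \<oplus>[R] c, b \<oplus>[R] d))\<rparr>"

lemma dual_cring:
 assumes "cring R" shows "cring (dual R)"
proof -
 interpret R: cring R by fact
 show ?thesis
 proof (rule cringI)
  show "abelian_group (dual R)"
  proof (rule abelian_groupI)
   fix x assume "x : carrier (dual R)"
   then show "\<exists>y\<in>carrier (dual R). y \<oplus>[dual R] x = \<zero>[dual R]"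
    by (intro bexI[of _ "(\<ominus>\<^bsub>R\<^esub> fst x, \<ominus>\<^bsub>R\<^esub> snd x)"]) (auto simp: dual_def R.l_neg)
  qed (auto simp: dual_def R.a_ac)
  show "comm_monoid (dual R)"
   by (rule comm_monoidI) (auto simp: dual_def R.m_ac R.r_distr R.l_distr R.a_ac)
 qed (auto simp: dual_def R.m_ac R.r_distr R.l_distr R.a_ac)
qed

context domain
begin

text \<open>Evaluation at x + e, the pair (x, 1), is a single ring homomorphism into the dual
  numbers; its components are the value and the derivative of a polynomial at x. The derivation laws
  are then just the homomorphism property.\<close>

lemma adjoin_generator:
 assumes B: "subring B R" and x: "x : carrier R"
 defines "S \<equiv> R\<lparr>carrier := B\<rparr>" and "T \<equiv> R\<lparr>carrier := generate_ring R (insert x B)\<rparr>"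
 obtains ev dv where "poly_ext S T ev dv" "!!c. c : B ==> ev (monom (UP S) c 0) = c"
  "!!c n. c : B ==> ev (monom (UP S) c n) = c \<otimes> x [^] n"
  "!!c n. c : B ==> dv (monom (UP S) c n) = c \<otimes> ([n] \<cdot> (x [^] (n - 1 :: nat)))"
proof -
 note b = subringE[OF B]
 let ?C = "generate_ring R (insert x B)"
 have insR: "insert x B \<subseteq> carrier R" using b(1) x by auto
 have C: "subring ?C R" by (rule generate_ring_is_subring[OF insR])
 note c = subringE[OF C]
 have BC: "B \<subseteq> ?C" and xC: "x : ?C" using generate_ringE(2)[OF insR refl] by auto
 have domS: "domain S" and domT: "domain T" unfolding S_def T_def using subring_is_domain B C by auto
 interpret S: domain S by (rule domS)
 interpret T: domain T by (rule domT)
 interpret D: cring "dual R" by (rule dual_cring) (rule is_cring)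
 have iota: "(%a. (a, \<zero>)) : ring_hom S (dual R)"
  by (rule ring_hom_memI) (use b in \<open>auto simp: S_def dual_def subset_iff\<close>)
 interpret E: UP_pre_univ_prop S "dual R" "%a. (a, \<zero>)" "UP S"
  by (rule UP_pre_univ_propI) (use S.is_cring D.is_cring iota in auto)
 have xd: "(x, \<one>) : carrier (dual R)" using x by (simp add: dual_def)
 define e where "e = eval S (dual R) (%a. (a, \<zero>)) (x, \<one>)"
 have e: "e : ring_hom (UP S) (dual R)" unfolding e_def by (rule E.eval_ring_hom[OF xd])
 \<comment> \<open>For n = 0 the truncated exponent n - 1 does no harm, since its coefficient is
   zero.\<close>
 have xpow: "(x, \<one>) [^]\<^bsub>dual R\<^esub> n = (x [^] n, [n] \<cdot> (x [^] (n - 1)))" for n :: nat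
 proof (induction n)
  case 0
  show ?case unfolding D.nat_pow_0 by (simp add: dual_def)
 next
  case (Suc n)
  have "x [^] n \<oplus> [n] \<cdot> (x [^] (n - 1)) \<otimes> x = [(Suc n)] \<cdot> (x [^] n)"
  proof (cases n)
   case (Suc m)
   then show ?thesis using x by (simp add: add_pow_ldistr add.nat_pow_Suc a_comm l_distr)
  qed (use x in simp)
  then show ?case unfolding D.nat_pow_Suc Suc using x by (simp add: dual_def)
 qed
 have em: "e (monom (UP S) a n) = (a \<otimes> x [^] n, a \<otimes> ([n] \<cdot> (x [^] (n - 1))))" if "a : B" for a n
 proof -
  have "e (monom (UP S) a n) = (a, \<zero>) \<otimes>[dual R] (x, \<one>) [^]\<^bsub>dual R\<^esub> n"
   unfolding e_def using E.eval_monom[OF _ xd] that by (simp add: S_def)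
  then show ?thesis unfolding xpow using that x b(1) by (auto simp: dual_def)
 qed
 define ev where "ev = fst \<circ> e"
 define dv where "dv = snd \<circ> e"
 have UPm: "ring_hom_cring (UP S) (dual R) e"
  by (intro ring_hom_cring.intro ring_hom_cring_axioms.intro E.UP_cring D.is_cring e)
 have hm: "e (H \<otimes>[UP S] G) = e H \<otimes>[dual R] e G" "e (H \<oplus>[UP S] G) = e H \<oplus>[dual R] e G"
  "e H : carrier (dual R)" if "H : carrier (UP S)" "G : carrier (UP S)" for H G
  using e that unfolding ring_hom_def by auto
 have xC_pow: "x [^] (n::nat) : ?C" for n by (induction n) (use c xC in auto)
 have C_mult: "[n] \<cdot> a : ?C" if "a : ?C" for a and n :: nat
  by (induction n) (use c that in auto)
 have eC: "e H : ?C \<times> ?C" if H: "H : carrier (UP S)" for H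
 proof -
  have H': "H : E.cfs (carrier S)" using H by simp
  show ?thesis
  proof (rule E.cfs_induct[OF S.oneideal H'])
   show "e \<zero>[UP S] : ?C \<times> ?C" using c(2) ring_hom_cring.hom_zero[OF UPm] by (simp add: dual_def)
   fix H a n assume *: "H : E.cfs (carrier S)" "e H : ?C \<times> ?C" "a : carrier S"
   then have "a : B" "a : ?C" using BC by (auto simp: S_def)
   then have "e (monom (UP S) a n) : ?C \<times> ?C" using em c(6) xC_pow C_mult by simp
   moreover have "e (H \<oplus>[UP S] monom (UP S) a n) = e H \<oplus>[dual R] e (monom (UP S) a n)"
    using hm(2) * by simp
   ultimately show "e (H \<oplus>[UP S] monom (UP S) a n) : ?C \<times> ?C" using *(2) c(7) by (auto simp: dual_def)
  qed
 qed
 have fst_hom: "fst : ring_hom (dual R) R" by (rule ring_hom_memI) (auto simp: dual_def)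
 have evR: "ev : ring_hom (UP S) R" unfolding ev_def using ring_hom_trans[OF e fst_hom] .
 have evC: "ev H : ?C" if "H : carrier (UP S)" for H using eC[OF that] unfolding ev_def by (auto simp: mem_Times_iff)
 have evT: "ev : ring_hom (UP S) T"
  by (rule ring_hom_memI)
   (simp_all add: T_def evC ring_hom_mult[OF evR] ring_hom_add[OF evR] ring_hom_one[OF evR])
 interpret UPm: ring_hom_cring "UP S" R ev
  by (intro ring_hom_cring.intro ring_hom_cring_axioms.intro E.UP_cring is_cring evR)
 have img: "ev ` carrier (UP S) = ?C"
 proof
  show "ev ` carrier (UP S) \<subseteq> ?C" using eC unfolding ev_def by (auto simp: mem_Times_iff)
  have "subring (ev ` carrier (UP S)) R"
  proof (rule subringI)
   show "\<ominus> h : ev ` carrier (UP S)" if "h : ev ` carrier (UP S)" for h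
   proof -
    obtain H where "H : carrier (UP S)" "h = ev H" using \<open>h : ev ` carrier (UP S)\<close> by blast
    then show ?thesis using UPm.hom_a_inv[of H] E.UP_a_inv_closed[of H] by (metis imageI)
   qed
   show "\<one> : ev ` carrier (UP S)" using UPm.hom_one by (metis E.UP_one_closed imageI)
   show "h1 \<otimes> h2 : ev ` carrier (UP S)" "h1 \<oplus> h2 : ev ` carrier (UP S)"
    if h12: "h1 : ev ` carrier (UP S)" "h2 : ev ` carrier (UP S)" for h1 h2
   proof -
    obtain H where H: "h1 = ev H" "H : carrier (UP S)" using h12(1) by (rule imageE)
    obtain G where G: "h2 = ev G" "G : carrier (UP S)" using h12(2) by (rule imageE)
    have "h1 \<otimes> h2 = ev (H \<otimes>[UP S] G)" "h1 \<oplus> h2 = ev (H \<oplus>[UP S] G)"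
     using H G ring_hom_mult[OF evR] ring_hom_add[OF evR] by auto
    then show "h1 \<otimes> h2 : ev ` carrier (UP S)" "h1 \<oplus> h2 : ev ` carrier (UP S)"
     using E.UP_mult_closed[OF H(2) G(2)] E.UP_a_closed[OF H(2) G(2)] by (simp_all only: imageI)
   qed
  qed auto
  moreover have "insert x B \<subseteq> ev ` carrier (UP S)"
  proof
   fix y assume "y : insert x B"
   then consider "y = x" | "y : B" by blast
   then show "y : ev ` carrier (UP S)"
   proof cases
    case 1
    have "ev (monom (UP S) \<one> 1) = x" using em[OF b(3), of 1] x by (simp add: ev_def)
    moreover have "monom (UP S) \<one> 1 : carrier (UP S)"
     using b(3) by (intro E.monom_closed) (simp add: S_def)
    ultimately show ?thesis using 1 by (metis imageI)
   next
    case 2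
    have "ev (monom (UP S) y 0) = y" using em[OF 2, of 0] 2 b(1) by (auto simp: ev_def)
    moreover have "monom (UP S) y 0 : carrier (UP S)"
     using 2 by (intro E.monom_closed) (simp add: S_def)
    ultimately show ?thesis by (metis imageI)
   qed
  qed
  ultimately show "?C \<subseteq> ev ` carrier (UP S)" using generate_ring_min_subring1[OF insR] by blast
 qed
 have "poly_ext S T ev dv"
 proof (unfold_locales)
  show "ev : ring_hom (UP S) T" by fact
  show "ev ` carrier (UP S) = carrier T" using img by (simp add: T_def)
  fix H assume H: "H : carrier (UP S)"
  show "dv H : carrier T" using eC[OF H] by (auto simp: dv_def T_def mem_Times_iff)
  fix G assume G: "G : carrier (UP S)"
  show "dv (H \<oplus>[UP S] G) = dv H \<oplus>[T] dv G"
   using hm(2)[OF H G] by (auto simp: dv_def T_def dual_def split: prod.splits)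
  show "dv (H \<otimes>[UP S] G) = dv H \<otimes>[T] ev G \<oplus>[T] ev H \<otimes>[T] dv G"
   using hm(1)[OF H G] hm(3)[OF H G] hm(3)[OF G H]
   by (auto simp: ev_def dv_def T_def dual_def a_comm split: prod.splits)
 next
  fix a assume "a : carrier S"
  then have "a : B" by (simp add: S_def)
  then show "dv (monom (UP S) a 0) = \<zero>[T]" using em[of a 0] b(1) by (auto simp: dv_def T_def)
 qed
 moreover have "ev (monom (UP S) a 0) = a" if "a : B" for a using em[OF that, of 0] that b(1) by (auto simp: ev_def)
 ultimately show ?thesis using that em by (simp add: ev_def dv_def)
qed

end

section \<open>The characteristic and the Frobenius map\<close>

context cring
begin

lemma binomial_expansion:
 assumes a: "a : carrier R" and b: "b : carrier R"
 shows "(a \<oplus> b) [^] (n::nat) = (\<Oplus>i\<in>{..n}. [(n choose i)] \<cdot> (a [^] i \<otimes> b [^] (n - i)))"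
proof (induction n)
 case 0
 show ?case by simp
next
 case (Suc n)
 define t where "t = (%i. [(n choose i)] \<cdot> (a [^] i \<otimes> b [^] (n - i)))"
 define u where "u = (%i. [(n choose Suc i)] \<cdot> (a [^] Suc i \<otimes> b [^] (n - i)))"
 have tc: "t i : carrier R" and uc: "u i : carrier R" for i unfolding t_def u_def using a b by auto
 \<comment> \<open>Pascal's rule splits each term of the new sum into a t and u. The sum of the u is
   b t shifted by one: at the top u n = 0, and the missing bottom term is the power of b
   alone.\<close>
 have 1: "[(Suc n choose Suc i)] \<cdot> (a [^] Suc i \<otimes> b [^] (Suc n - Suc i)) = a \<otimes> t i \<oplus> u i" for i
  unfolding t_def u_def using a b
  by (simp add: add.nat_pow_mult[symmetric] add_pow_rdistr m_ac)
 have u: "u i = b \<otimes> t (Suc i)" if "i < n" for i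
 proof -
  have "n - i = Suc (n - Suc i)" using that by simp
  then show ?thesis unfolding t_def u_def using a b by (simp add: add_pow_rdistr m_ac)
 qed
 have "(\<Oplus>i\<in>{..Suc n}. [(Suc n choose i)] \<cdot> (a [^] i \<otimes> b [^] (Suc n - i)))
   = (\<Oplus>i\<in>{..n}. a \<otimes> t i \<oplus> u i) \<oplus> b [^] Suc n"
  by (subst finsum_Suc2) (use a b in \<open>auto simp only: 1 Pi_iff\<close>, use a b in auto)
 also have "(\<Oplus>i\<in>{..n}. a \<otimes> t i \<oplus> u i) = (\<Oplus>i\<in>{..n}. a \<otimes> t i) \<oplus> (\<Oplus>i\<in>{..n}. u i)"
  using a tc uc by (intro finsum_addf) auto
 also have "(\<Oplus>i\<in>{..n}. a \<otimes> t i) = a \<otimes> (\<Oplus>i\<in>{..n}. t i)"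
  using finsum_rdistr[of "{..n}" a t] a tc by auto
 also have "a \<otimes> finsum R t {..n} \<oplus> finsum R u {..n} \<oplus> b [^] Suc n
   = a \<otimes> finsum R t {..n} \<oplus> (finsum R u {..n} \<oplus> b [^] Suc n)"
  using a b tc uc by (simp add: a_assoc)
 also have "finsum R u {..n} \<oplus> b [^] Suc n = b \<otimes> finsum R t {..n}"
 proof (cases n)
  case 0
  then show ?thesis unfolding u_def t_def using a b by (simp add: binomial_eq_0)
 next
  case (Suc m)
  have un: "u n = \<zero>" unfolding u_def using a b by (simp add: binomial_eq_0)
  have "finsum R u {..n} = u n \<oplus> finsum R u {..m}" using Suc uc by (simp add: finsum_Suc)
  also have "\<dots> = (\<Oplus>i\<in>{..m}. b \<otimes> t (Suc i))"
   using un uc u Suc tc b by (auto intro!: finsum_cong')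
  finally have "finsum R u {..n} \<oplus> b [^] Suc n = (\<Oplus>i\<in>{..m}. b \<otimes> t (Suc i)) \<oplus> b \<otimes> t 0"
   unfolding t_def using a b by (simp add: m_comm)
  also have "\<dots> = (\<Oplus>i\<in>{..n}. b \<otimes> t i)" unfolding Suc
   by (subst finsum_Suc2) (use b tc in auto)
  also have "\<dots> = b \<otimes> finsum R t {..n}" using finsum_rdistr[of "{..n}" b t] b tc by auto
  finally show ?thesis .
 qed
 also have "a \<otimes> finsum R t {..n} \<oplus> b \<otimes> finsum R t {..n} = (a \<oplus> b) \<otimes> finsum R t {..n}"
  using a b tc by (simp add: l_distr)
 also have "\<dots> = (a \<oplus> b) [^] Suc n" using Suc a b unfolding t_def by (simp add: m_comm)
 finally show ?case by simp
qed

lemma add_pow_dvd: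
 assumes p: "[p] \<cdot> \<one> = \<zero>" and "p dvd (n::nat)" and a: "a : carrier R"
 shows "[n] \<cdot> a = \<zero>"
proof -
 obtain m where "n = p * m" using assms(2) by blast
 have "[p] \<cdot> a = [p] \<cdot> \<one> \<otimes> a" using a by (simp add: add_pow_ldistr)
 then have "[p] \<cdot> a = \<zero>" using p a by simp
 then show ?thesis using add.nat_pow_pow[OF a, of m p] \<open>n = p * m\<close> by (simp add: mult.commute)
qed

text \<open>All inner binomial coefficients are divisible by p, and multiples of p annihilate
  R.\<close>

lemma frobenius_add:
 assumes p: "Factorial_Ring.prime (p::nat)" "[p] \<cdot> \<one> = \<zero>" and a: "a : carrier R" and b: "b : carrier R"
 shows "(a \<oplus> b) [^] p = a [^] p \<oplus> b [^] p"
proof -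
 have p1: "p > 1" using p(1) prime_gt_1_nat by blast
 then obtain m where m: "p = Suc m" by (cases p) auto
 let ?t = "%i. [(p choose i)] \<cdot> (a [^] i \<otimes> b [^] (p - i))"
 have tc: "?t i : carrier R" for i using a b by simp
 have z: "?t i = \<zero>" if "0 < i" "i < p" for i
 proof -
  have "p dvd (p choose i)" using that p(1) by (intro dvd_choose_prime) auto
  then show ?thesis using add_pow_dvd[OF p(2)] a b by simp
 qed
 have "(a \<oplus> b) [^] p = ?t (Suc m) \<oplus> finsum R ?t {..m}"
  unfolding binomial_expansion[OF a b] m using a b by (subst finsum_Suc) auto
 also have "finsum R ?t {..m} = (\<Oplus>i\<in>{..m}. if 0 = i then b [^] p else \<zero>)"
  using a b z m by (intro finsum_cong') auto
 also have "\<dots> = b [^] p" using finsum_singleton[of 0 "{..m}" "%_. b [^] p"] b by simp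
 also have "?t (Suc m) = a [^] p" using m a b by simp
 finally show ?thesis .
qed

lemma frobenius_finsum:
 assumes p: "Factorial_Ring.prime (p::nat)" "[p] \<cdot> \<one> = \<zero>" and f: "f : A \<rightarrow> carrier R" and "finite A"
 shows "(finsum R f A) [^] p = (\<Oplus>i\<in>A. f i [^] p)"
 using assms(4,3)
proof (induction A)
 case empty
 have "p > 0" using p(1) prime_gt_0_nat by blast
 then show ?case by (simp add: nat_pow_zero)
next
 case (insert x A)
 then have "finsum R f (insert x A) = f x \<oplus> finsum R f A" by (intro finsum_insert) auto
 moreover have "finsum R (%i. f i [^] p) (insert x A) = f x [^] p \<oplus> finsum R (%i. f i [^] p) A"
  using insert by (intro finsum_insert) auto
 ultimately show ?case using insert frobenius_add[OF p] by (simp add: Pi_iff)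
qed

end

text \<open>The least positive integer that annihilates 1 divides every other one, by division with
  remainder, and it is prime because a domain has no zero divisors.\<close>

lemma (in domain) characteristic_prime:
 assumes n: "(n::nat) > 0" "[n] \<cdot> \<one> = \<zero>"
 obtains p :: nat where "Factorial_Ring.prime p" "[p] \<cdot> \<one> = \<zero>" "!!m :: nat. [m] \<cdot> \<one> = \<zero> ==> p dvd m"
proof -
 define p :: nat where "p = (LEAST n. n > 0 \<and> [n] \<cdot> \<one> = \<zero>)"
 have p: "p > 0" "[p] \<cdot> \<one> = \<zero>" using LeastI[of "%n::nat. n > 0 \<and> [n] \<cdot> \<one> = \<zero>" n] n unfolding p_def by auto
 have least: "p \<le> m" if "m > 0" "[m] \<cdot> \<one> = \<zero>" for m unfolding p_def using that by (simp add: Least_le)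
 have dvd: "p dvd m" if "[m] \<cdot> \<one> = \<zero>" for m
 proof -
  have "[m] \<cdot> \<one> = [(p * (m div p))] \<cdot> \<one> \<oplus> [(m mod p)] \<cdot> \<one>"
   using add.nat_pow_mult[of \<one> "p * (m div p)" "m mod p"] by simp
  moreover have "[(p * (m div p))] \<cdot> \<one> = \<zero>" using add_pow_dvd[OF p(2)] by simp
  ultimately have "[(m mod p)] \<cdot> \<one> = \<zero>" using that by simp
  then have "m mod p = 0" using least[of "m mod p"] p(1) mod_less_divisor[of p m] by (meson gr0I not_less)
  then show ?thesis by presburger
 qed
 have "Factorial_Ring.prime p"
 proof (rule prime_natI)
  have "p ~= 1" using p(2) by auto
  then show "p \<ge> 2" using p(1) by simp
  fix d e assume "p dvd d * e"
  then have z: "[(d * e)] \<cdot> \<one> = \<zero>" using add_pow_dvd[OF p(2)] by simp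
  have "[d] \<cdot> \<one> \<otimes> [e] \<cdot> \<one> = [d] \<cdot> ([e] \<cdot> \<one>)" by (simp add: add_pow_ldistr)
  also have "\<dots> = \<zero>" using add.nat_pow_pow[OF one_closed, of d e] z by (simp add: mult.commute)
  finally have "[d] \<cdot> \<one> = \<zero> \<or> [e] \<cdot> \<one> = \<zero>" using integral by simp
  then show "p dvd d \<or> p dvd e" using dvd by blast
 qed
 then show ?thesis using that p(2) dvd by blast
qed

section \<open>Monomial relations over a perfect field\<close>

text \<open>Exponents are total functions that vanish off X. Equality of functions is then equality
  of formal monomials, so a set of exponents lists distinct monomials.\<close>

definition expo :: "'a set \<Rightarrow> ('a \<Rightarrow> nat) set" where
 "expo X = {e. \<forall>y. y ~: X --> e y = 0}"

lemma expo_mono: "Y \<subseteq> X ==> expo Y \<subseteq> expo X"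
 unfolding expo_def by blast

lemma expo_upd: "x : X ==> e : expo X ==> e(x := n) : expo X"
 unfolding expo_def by auto

locale perfect_subfield = domain R for R (structure) +
 fixes k X
 assumes k: "subring k R"
  and k_inv: "a : k ==> a ~= \<zero> ==> \<exists>b \<in> k. a \<otimes> b = \<one>"
  and perfect: "Factorial_Ring.prime (p::nat) ==> [p] \<cdot> \<one> = \<zero> ==> a : k ==> \<exists>b \<in> k. b [^] p = a"
  and X: "finite X" "X \<subseteq> carrier R"
begin

lemmas kE = subringE[OF k]

lemma k_carrier: "a : k ==> a : carrier R" using kE(1) by blast

definition mnm :: "('a \<Rightarrow> nat) \<Rightarrow> 'a" where
 "mnm e = finprod R (%y. y [^] e y) X"

lemma pow_closed: "(%y. y [^] (e y :: nat)) : X \<rightarrow> carrier R" using X(2) by auto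

lemma mnm_closed [simp]: "mnm e : carrier R"
 unfolding mnm_def by (rule finprod_closed[OF pow_closed])

lemma mnm_zero: "mnm (%_. 0) = \<one>"
 unfolding mnm_def by (simp add: finprod_one_eqI)

lemma mnm_add: "mnm e \<otimes> mnm f = mnm (%y. e y + f y)"
proof -
 have "mnm (%y. e y + f y) = finprod R (%y. y [^] e y \<otimes> y [^] f y) X"
  unfolding mnm_def using X(2) by (intro finprod_cong') (auto simp: nat_pow_mult subset_iff)
 then show ?thesis unfolding mnm_def using finprod_multf[OF pow_closed[of e] pow_closed[of f]] by simp
qed

lemma mnm_pow: "mnm e [^] (p::nat) = mnm (%y. e y * p)"
 by (induction p) (simp_all add: mnm_zero mnm_add add.commute)

lemma mnm_split:
 assumes "x : X" shows "mnm (e(x := n)) = mnm (e(x := 0)) \<otimes> x [^] n"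
proof -
 have x: "x : carrier R" using assms X by auto
 have *: "mnm (e(x := n)) = x [^] n \<otimes> finprod R (%y. y [^] e y) (X - {x})" for n
 proof -
  have "mnm (e(x := n)) = finprod R (%y. y [^] (e(x := n)) y) (insert x (X - {x}))"
   unfolding mnm_def using assms by (simp add: insert_absorb)
  also have "\<dots> = x [^] n \<otimes> finprod R (%y. y [^] (e(x := n)) y) (X - {x})"
   using X assms by (subst finprod_insert) auto
  also have "finprod R (%y. y [^] (e(x := n)) y) (X - {x}) = finprod R (%y. y [^] e y) (X - {x})"
   using X by (intro finprod_cong') auto
  finally show ?thesis .
 qed
 have "finprod R (%y. y [^] e y) (X - {x}) : carrier R" using X by (intro finprod_closed) auto
 then show ?thesis unfolding *[of n] *[of 0] using x by (simp add: m_comm)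
qed

lemma mnm_split': "x : X ==> mnm e = mnm (e(x := 0)) \<otimes> x [^] e x"
 using mnm_split[of x e "e x"] by simp

lemma finprod_in_subring:
 assumes B: "subring B R" and f: "f : A \<rightarrow> B"
 shows "finprod R f A : B"
 using f
proof (induction A rule: infinite_finite_induct)
 case (insert x A)
 then have "finprod R f (insert x A) = f x \<otimes> finprod R f A"
  using subringE(1)[OF B] by (intro finprod_insert) auto
 then show ?case using insert subringE(6)[OF B] by simp
qed (use subringE(3)[OF B] in simp_all)

lemma pow_in_subring: "subring B R ==> a : B ==> a [^] (n::nat) : B"
 by (induction n) (auto simp: subringE(3,6))

lemma mnm_in_subring:
 assumes B: "subring B R" and Y: "Y \<subseteq> B" and e: "e : expo Y"
 shows "mnm e : B"
 unfolding mnm_def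
proof (rule finprod_in_subring[OF B], rule Pi_I)
 fix y assume "y : X"
 show "y [^] e y : B"
  using pow_in_subring[OF B, of y "e y"] Y e subringE(3)[OF B] by (cases "y : Y") (auto simp: expo_def)
qed

text \<open>The k-span of the monomials in Y. Adding one term at a time, with repeated exponents
  allowed, makes closure under sums and products easy; like terms are collected afterwards in
  \<open>mspan_representation\<close>.\<close>

inductive_set mspan :: "'a set \<Rightarrow> 'a set" for Y where
 zero: "\<zero> : mspan Y"
| add: "b : mspan Y ==> c : k ==> e : expo Y ==> b \<oplus> c \<otimes> mnm e : mspan Y"

lemma mspan_carrier: "b : mspan Y ==> b : carrier R"
 by (induction rule: mspan.induct) (auto simp: k_carrier)

lemma mspan_add: "b : mspan Y ==> a : mspan Y ==> a \<oplus> b : mspan Y"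
proof (induction rule: mspan.induct)
 case zero
 then show ?case using mspan_carrier by simp
next
 case (add b c e)
 have "a \<oplus> (b \<oplus> c \<otimes> mnm e) = (a \<oplus> b) \<oplus> c \<otimes> mnm e"
  using add mspan_carrier k_carrier by (simp add: a_assoc)
 then show ?case using mspan.add[OF add.IH[OF add.prems] add.hyps(2,3)] by simp
qed

lemma mspan_term: "c : k ==> e : expo Y ==> c \<otimes> mnm e : mspan Y"
 using mspan.add[OF mspan.zero, of c e Y] k_carrier by simp

lemma mspan_mult_term:
 assumes c': "c' : k" and e': "e' : expo Y" and "b : mspan Y"
 shows "b \<otimes> (c' \<otimes> mnm e') : mspan Y"
 using assms(3)
proof (induction rule: mspan.induct)
 case zero
 then show ?case using k_carrier[OF c'] mspan.zero by simp
next
 case (add b c e)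
 have b: "b : carrier R" "c : carrier R" "c' : carrier R" using add c' mspan_carrier k_carrier by auto
 then have "(b \<oplus> c \<otimes> mnm e) \<otimes> (c' \<otimes> mnm e')
   = b \<otimes> (c' \<otimes> mnm e') \<oplus> (c \<otimes> c') \<otimes> (mnm e \<otimes> mnm e')"
  by (simp add: l_distr m_assoc) (simp add: m_ac)
 moreover have "(%y. e y + e' y) : expo Y" using add(3) e' unfolding expo_def by simp
 ultimately show ?case using mspan.add[OF add.IH kE(6)[OF add(2) c'], of "%y. e y + e' y"] by (simp add: mnm_add)
qed

lemma mspan_mult: "b : mspan Y ==> a : mspan Y ==> a \<otimes> b : mspan Y"
proof (induction rule: mspan.induct)
 case zero
 then show ?case using mspan_carrier mspan.zero by simp
next
 case (add b c e)
 then have "a \<otimes> (b \<oplus> c \<otimes> mnm e) = a \<otimes> b \<oplus> a \<otimes> (c \<otimes> mnm e)"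
  using mspan_carrier k_carrier by (simp add: r_distr)
 then show ?case using mspan_add[OF mspan_mult_term[OF add(2,3) add.prems] add.IH[OF add.prems]] by simp
qed

text \<open>Monomials multiply to monomials, so the span is a subring, and it contains k and
  Y.\<close>

lemma generate_mspan:
 assumes Y: "Y \<subseteq> X" shows "generate_ring R (k \<union> Y) \<subseteq> mspan Y"
proof (rule generate_ring_min_subring1)
 show "k \<union> Y \<subseteq> carrier R" using kE(1) X(2) Y by auto
 have z: "(%_. 0) : expo Y" unfolding expo_def by simp
 have kk: "c : mspan Y" if "c : k" for c
  using mspan_term[OF that z] k_carrier[OF that] by (simp add: mnm_zero)
 show "subring (mspan Y) R"
 proof (rule subringI)
  show "mspan Y \<subseteq> carrier R" using mspan_carrier by blast
  show "\<one> : mspan Y" using kk kE(3) by blast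
  show "a \<otimes> b : mspan Y" if "a : mspan Y" "b : mspan Y" for a b using mspan_mult that by blast
  show "a \<oplus> b : mspan Y" if "a : mspan Y" "b : mspan Y" for a b using mspan_add that by blast
  show "\<ominus> a : mspan Y" if a: "a : mspan Y" for a
  proof -
   have "\<ominus> \<one> : mspan Y" using kk kE(3,5) by blast
   then have "\<ominus> \<one> \<otimes> a : mspan Y" using mspan_mult a by blast
   then show ?thesis using l_minus[of \<one> a] mspan_carrier[OF a] by simp
  qed
 qed
 have "y : mspan Y" if y: "y : Y" for y
 proof -
  have yX: "y : X" and yR: "y : carrier R" using y Y X(2) by auto
  have "(%_. 0)(y := 1) : expo Y" using y unfolding expo_def by simp
  moreover have "mnm ((%_. 0)(y := 1)) = y"
  proof -
   have "(%_. 0)(y := 0) = (%_. 0 :: nat)" by auto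
   then show ?thesis using mnm_split[OF yX, of "%_. 0" 1] yR by (simp add: mnm_zero)
  qed
  ultimately show ?thesis using mspan_term[OF kE(3), of "(%_. 0)(y := 1)" Y] yR by simp
 qed
 then show "k \<union> Y \<subseteq> mspan Y" using kk by blast
qed

lemma finsum_remove:
 assumes "finite E" "e : E" "f : E \<rightarrow> carrier R"
 shows "finsum R f E = f e \<oplus> finsum R f (E - {e})"
proof -
 have "finsum R f E = finsum R f (insert e (E - {e}))" using assms(2) by (simp add: insert_absorb)
 also have "\<dots> = f e \<oplus> finsum R f (E - {e})" using assms by (intro finsum_insert) auto
 finally show ?thesis .
qed

lemma term_closed: "c : E \<rightarrow> k - A ==> (%e. c e \<otimes> mnm (f e)) : E \<rightarrow> carrier R"
 using k_carrier by fastforce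

text \<open>Like terms are collected: the new coefficient is added to the one already present at e,
  and e is dropped if they cancel. Coefficients are kept nonzero so that a nonempty E means a
  formally nonzero polynomial.\<close>

lemma mspan_representation:
 "b : mspan Y ==> \<exists>E c. finite E \<and> E \<subseteq> expo Y \<and> c : E \<rightarrow> k - {\<zero>} \<and> b = (\<Oplus>e\<in>E. c e \<otimes> mnm e)"
proof (induction rule: mspan.induct)
 case zero
 show ?case by (intro exI[of _ "{}"]) simp
next
 case (add b a e)
 then obtain E c where E: "finite E" "E \<subseteq> expo Y" "c : E \<rightarrow> k - {\<zero>}" and b: "b = (\<Oplus>e\<in>E. c e \<otimes> mnm e)"
  by metis
 have aR: "a : carrier R" using add k_carrier by blast
 define c0 where "c0 = (if e : E then c e else \<zero>)"
 define a' where "a' = c0 \<oplus> a"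
 have c0k: "c0 : k" unfolding c0_def using E(3) kE(2) by auto
 have a'k: "a' : k" unfolding a'_def using kE(7)[OF c0k add(2)] .
 let ?E = "E - {e}"
 have cl: "(%e. c e \<otimes> mnm e) : ?E \<rightarrow> carrier R" using term_closed[of c ?E "{\<zero>}" "%e. e"] E(3) by auto
 have cl': "(%e. c e \<otimes> mnm e) : E \<rightarrow> carrier R" using term_closed[of c E "{\<zero>}" "%e. e"] E(3) by auto
 define r where "r = (\<Oplus>e\<in>?E. c e \<otimes> mnm e)"
 have rR: "r : carrier R" unfolding r_def by (rule finsum_closed[OF cl])
 have "b = c0 \<otimes> mnm e \<oplus> r"
 proof (cases "e : E")
  case True
  then show ?thesis using finsum_remove[OF E(1) True cl'] by (simp add: b r_def c0_def)
 next
  case False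
  then show ?thesis using rR by (simp add: b r_def c0_def)
 qed
 then have eq: "b \<oplus> a \<otimes> mnm e = a' \<otimes> mnm e \<oplus> r"
  unfolding a'_def using aR k_carrier[OF c0k] rR by (simp add: l_distr a_ac)
 show ?case
 proof (cases "a' = \<zero>")
  case True
  then have "b \<oplus> a \<otimes> mnm e = r" using eq rR by simp
  then show ?thesis unfolding r_def using E by (intro exI[of _ ?E] exI[of _ c]) auto
 next
  case False
  have "(\<Oplus>x\<in>insert e ?E. (c(e := a')) x \<otimes> mnm x) = a' \<otimes> mnm e \<oplus> (\<Oplus>x\<in>?E. (c(e := a')) x \<otimes> mnm x)"
   using E(1) cl k_carrier[OF a'k] by (subst finsum_insert) (auto simp: Pi_iff)
  also have "(\<Oplus>x\<in>?E. (c(e := a')) x \<otimes> mnm x) = r"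
   unfolding r_def using cl by (intro finsum_cong') auto
  finally show ?thesis using eq E False a'k add(3)
   by (intro exI[of _ "insert e ?E"] exI[of _ "c(e := a')"]) (auto simp: Pi_iff split: if_splits)
 qed
qed

definition relation :: "('a \<Rightarrow> nat) set \<Rightarrow> (('a \<Rightarrow> nat) \<Rightarrow> 'a) \<Rightarrow> bool" where
 "relation E c \<longleftrightarrow> finite E \<and> E ~= {} \<and> E \<subseteq> expo X \<and> c : E \<rightarrow> k - {\<zero>} \<and> (\<Oplus>e\<in>E. c e \<otimes> mnm e) = \<zero>"

text \<open>A relation of minimal total degree has only exponents divisible by the characteristic,
 so that its \<open>p\<close>-th root is a smaller relation.\<close>

lemma no_relation:
 assumes deriv: "!!x E c. x : X ==> finite E ==> E \<subseteq> expo X ==> c : E \<rightarrow> k ==> (\<Oplus>e\<in>E. c e \<otimes> mnm e) = \<zero> ==>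
   (\<Oplus>e\<in>E. ([(e x)] \<cdot> c e) \<otimes> mnm (e(x := e x - 1))) = \<zero>"
 shows "\<not> relation E c"
proof (induction "\<Sum>e\<in>E. \<Sum>y\<in>X. e y" arbitrary: E c rule: less_induct)
 case less
 show ?case
 proof
  assume rel: "relation E c"
  then have E: "finite E" "E ~= {}" "E \<subseteq> expo X" "c : E \<rightarrow> k - {\<zero>}" "(\<Oplus>e\<in>E. c e \<otimes> mnm e) = \<zero>"
   unfolding relation_def by auto
  have ck: "c e : k" "c e ~= \<zero>" "c e : carrier R" if "e : E" for e using E(4) that k_carrier by auto
  have k_mult: "[n] \<cdot> a : k" if "a : k" for a and n :: nat
   by (induction n) (use kE that in auto)
  \<comment> \<open>Otherwise the partial derivative in x is a relation of smaller total degree.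
    \<open>E1\<close> collects the terms that survive differentiation, and h lowers their exponent
    at x by one; h is injective there because that exponent is positive.\<close>
  have zero: "[(e x)] \<cdot> c e = \<zero>" if x: "x : X" and e: "e : E" for x e
  proof (rule ccontr)
   assume ne: "[(e x)] \<cdot> c e ~= \<zero>"
   define E1 where "E1 = {e : E. [(e x)] \<cdot> c e ~= \<zero>}"
   define h where "h = (%e::'a \<Rightarrow> nat. e(x := e x - 1))"
   define c' where "c' = (%e. [(Suc (e x))] \<cdot> c (e(x := Suc (e x))))"
   have E1: "E1 \<subseteq> E" "e : E1" "finite E1" using E(1) e ne unfolding E1_def by auto
   have pos: "e x > 0" if "e : E1" for e
    using that unfolding E1_def by (cases "e x") auto
   have hS: "(h e)(x := Suc (h e x)) = e" if "e : E1" for e using pos[OF that] unfolding h_def by auto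
   have inj: "inj_on h E1" by (rule inj_onI) (metis hS)
   have c'h: "c' (h e) = [(e x)] \<cdot> c e" if "e : E1" for e
    unfolding c'_def hS[OF that] using pos[OF that] by (simp add: h_def)
   have c'k: "c' : h ` E1 \<rightarrow> k - {\<zero>}"
    using c'h k_mult ck(1) E1(1) by (auto simp: E1_def)
   have t: "(%e. c' e \<otimes> mnm e) : h ` E1 \<rightarrow> carrier R" using term_closed[OF c'k, of "%e. e"] by simp
   have "(\<Oplus>e\<in>h ` E1. c' e \<otimes> mnm e) = (\<Oplus>e\<in>E1. c' (h e) \<otimes> mnm (h e))"
    by (rule finsum_reindex[OF t inj])
   also have "\<dots> = (\<Oplus>e\<in>E. ([(e x)] \<cdot> c e) \<otimes> mnm (e(x := e x - 1)))"
    by (rule add.finprod_mono_neutral_cong_left[OF E(1) E1(1)])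
     (use ck c'h in \<open>auto simp: E1_def h_def\<close>)
   also have "\<dots> = \<zero>" using deriv[OF x E(1,3) _ E(5)] E(4) by blast
   finally have "relation (h ` E1) c'"
    unfolding relation_def using c'k E1 E(3) x by (auto simp: h_def intro!: expo_upd)
   moreover have "(\<Sum>e\<in>h ` E1. \<Sum>y\<in>X. e y) < (\<Sum>e\<in>E. \<Sum>y\<in>X. e y)"
   proof -
    have "(\<Sum>e\<in>h ` E1. \<Sum>y\<in>X. e y) = (\<Sum>e\<in>E1. \<Sum>y\<in>X. h e y)" by (simp add: sum.reindex[OF inj])
    also have "\<dots> < (\<Sum>e\<in>E1. \<Sum>y\<in>X. e y)"
    proof (rule sum_strict_mono[OF E1(3)])
     show "E1 ~= {}" using E1(2) by blast
     fix e assume "e : E1"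
     then have "h e x < e x" using pos[of e] by (simp add: h_def)
     then show "(\<Sum>y\<in>X. h e y) < (\<Sum>y\<in>X. e y)"
      by (intro sum_strict_mono_ex1[OF X(1)]) (use x in \<open>auto simp: h_def\<close>)
    qed
    also have "\<dots> \<le> (\<Sum>e\<in>E. \<Sum>y\<in>X. e y)" by (rule sum_mono2[OF E(1) E1(1)]) simp
    finally show ?thesis .
   qed
   ultimately show False using less.hyps by blast
  qed
  show False
  proof (cases "\<forall>e\<in>E. \<forall>x\<in>X. e x = 0")
   case True
   have "E \<subseteq> {%_. 0}"
   proof
    fix e assume "e : E"
    then have "e y = 0" for y using True E(3) unfolding expo_def by blast
    then show "e : {%_. 0}" by auto
   qed
   then have "E = {%_. 0}" using E(2) by blast
   then show False using E(5) ck by (simp add: mnm_zero)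
  next
   case False
   then obtain e0 x0 where e0: "e0 : E" "x0 : X" "e0 x0 > 0" by auto
   have one0: "[(e x)] \<cdot> \<one> = \<zero>" if "e : E" "x : X" for e x
   proof -
    have "[(e x)] \<cdot> \<one> \<otimes> c e = [(e x)] \<cdot> c e" using ck[OF that(1)] by (simp add: add_pow_ldistr)
    then show ?thesis using zero[OF that(2,1)] integral[of "[(e x)] \<cdot> \<one>" "c e"] ck[OF that(1)] by simp
   qed
   \<comment> \<open>Some exponent is positive and annihilates 1, so the characteristic is a prime
     p, and p divides every exponent that occurs.\<close>
   obtain p :: nat where p: "Factorial_Ring.prime p" "[p] \<cdot> \<one> = \<zero>" "!!m :: nat. [m] \<cdot> \<one> = \<zero> ==> p dvd m"
    using characteristic_prime[OF e0(3) one0[OF e0(1,2)]] by metis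
   have p1: "p > 1" using p(1) prime_gt_1_nat by blast
   have dvd: "p dvd e y" if "e : E" for e y
    using p(3) one0[OF that, of y] E(3) that unfolding expo_def by (cases "y : X") auto
   obtain b where b: "b e : k" "b e [^] p = c e" if "e : E" for e
    using perfect[OF p(1,2) ck(1)] by metis
   have b0: "b e ~= \<zero>" if "e : E" for e
    using b(2)[OF that] ck(2)[OF that] p1 by (auto simp: nat_pow_zero)
   \<comment> \<open>The p-th root of the relation: exponents are divided by p and coefficients are
     replaced by p-th roots in k. By additivity of Frobenius its p-th power is the given relation,
     and a domain has no nilpotent elements besides zero.\<close>
   define h where "h = (%e (y::'a). e y div p)"
   have hp: "(%y. h e y * p) = e" if "e : E" for e using dvd[OF that] unfolding h_def by simp
   have inj: "inj_on h E" by (rule inj_onI) (metis hp)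
   define c' where "c' = (%e. b (%y. e y * p))"
   have c'h: "c' (h e) = b e" if "e : E" for e unfolding c'_def using hp[OF that] by simp
   have c'k: "c' : h ` E \<rightarrow> k - {\<zero>}" using c'h b(1) b0 by auto
   have t: "(%e. c' e \<otimes> mnm e) : h ` E \<rightarrow> carrier R" using term_closed[OF c'k, of "%e. e"] by simp
   have t2: "(%e. c' (h e) \<otimes> mnm (h e)) : E \<rightarrow> carrier R" using t by auto
   have "(\<Oplus>e\<in>h ` E. c' e \<otimes> mnm e) [^] p = (\<Oplus>e\<in>E. c' (h e) \<otimes> mnm (h e)) [^] p"
    using finsum_reindex[OF t inj] by simp
   also have "\<dots> = (\<Oplus>e\<in>E. (c' (h e) \<otimes> mnm (h e)) [^] p)"
    by (rule frobenius_finsum[OF p(1,2) t2 E(1)])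
   also have "\<dots> = (\<Oplus>e\<in>E. c e \<otimes> mnm e)"
   proof (rule finsum_cong'[OF refl])
    show "(%e. c e \<otimes> mnm e) : E \<rightarrow> carrier R" using ck(3) by auto
    fix e assume e: "e : E"
    have "(b e \<otimes> mnm (h e)) [^] p = b e [^] p \<otimes> mnm (h e) [^] p"
     using k_carrier[OF b(1)[OF e]] by (simp add: nat_pow_distrib)
    then show "(c' (h e) \<otimes> mnm (h e)) [^] p = c e \<otimes> mnm e"
     using c'h[OF e] b(2)[OF e] hp[OF e] by (simp add: mnm_pow)
   qed
   also have "\<dots> = \<zero>" by (rule E(5))
   finally have "(\<Oplus>e\<in>h ` E. c' e \<otimes> mnm e) = \<zero>"
    using primeideal_pow[OF zeroprimeideal, of "\<Oplus>e\<in>h ` E. c' e \<otimes> mnm e" p] finsum_closed[OF t] by auto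
   then have "relation (h ` E) c'"
    unfolding relation_def using c'k E by (auto simp: h_def expo_def)
   moreover have "(\<Sum>e\<in>h ` E. \<Sum>y\<in>X. e y) < (\<Sum>e\<in>E. \<Sum>y\<in>X. e y)"
   proof -
    have "(\<Sum>e\<in>h ` E. \<Sum>y\<in>X. e y) = (\<Sum>e\<in>E. \<Sum>y\<in>X. h e y)" by (simp add: sum.reindex[OF inj])
    also have "\<dots> < (\<Sum>e\<in>E. \<Sum>y\<in>X. e y)"
    proof (rule sum_strict_mono_ex1[OF E(1)])
     show "\<forall>e\<in>E. (\<Sum>y\<in>X. h e y) \<le> (\<Sum>y\<in>X. e y)" by (intro ballI sum_mono) (simp add: h_def)
     have "h e0 x0 < e0 x0" using e0(3) p1 by (simp add: h_def)
     then have "(\<Sum>y\<in>X. h e0 y) < (\<Sum>y\<in>X. e0 y)"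
      by (intro sum_strict_mono_ex1[OF X(1)]) (use e0 in \<open>auto simp: h_def\<close>)
     then show "\<exists>e\<in>E. (\<Sum>y\<in>X. h e y) < (\<Sum>y\<in>X. e y)" using e0(1) by blast
    qed
    finally show ?thesis .
   qed
   ultimately show False using less.hyps by blast
  qed
 qed
qed

end

text \<open>Expanding the coefficients into monomials in the other generators turns a nonzero
  polynomial in x into a formally nonzero combination of monomials, so that an algebraic dependence
  of x becomes a \<open>relation\<close>.\<close>

lemma (in perfect_subfield) polynomial_expansion:
 assumes x: "x : X" and B: "B = generate_ring R (k \<union> (X - {x}))" and S: "S = R\<lparr>carrier := B\<rparr>"
  and C: "subring C R" and T: "T = R\<lparr>carrier := C\<rparr>" and pe: "poly_ext S T ev dv"
  and em: "!!c n. c : B ==> ev (monom (UP S) c n) = c \<otimes> x [^] n"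
  and H: "H : carrier (UP S)" "H ~= \<zero>[UP S]"
 shows "\<exists>E c. finite E \<and> E ~= {} \<and> E \<subseteq> expo X \<and> c : E \<rightarrow> k - {\<zero>} \<and> ev H = (\<Oplus>e\<in>E. c e \<otimes> mnm e)"
proof -
 interpret pe: poly_ext S "UP S" T ev dv by (rule pe) simp
 have xR: "x : carrier R" using x X by blast
 have CR: "C \<subseteq> carrier R" using subringE(1)[OF C] .
 have Bs: "B \<subseteq> mspan (X - {x})" unfolding B by (rule generate_mspan) blast
 have ev_add: "ev (G \<oplus>[UP S] G') = ev G \<oplus> ev G'" "ev G : carrier R"
  if "G : carrier (UP S)" "G' : carrier (UP S)" for G G'
  using that pe.ev.hom_add[of G G'] pe.ev.hom_closed[of G] CR by (auto simp: T)
 \<comment> \<open>The bound on the exponent of x keeps the monomials that come from degree n in x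
   apart from those found before, so no cancellation can empty E.\<close>
 have main: "\<exists>E c. finite E \<and> E \<subseteq> expo X \<and> c : E \<rightarrow> k - {\<zero>} \<and> (\<forall>e\<in>E. e x < n) \<and>
   (H ~= \<zero>[UP S] --> E ~= {}) \<and> ev H = (\<Oplus>e\<in>E. c e \<otimes> mnm e)"
  if "H : carrier (UP S)" "\<forall>k\<ge>n. coeff (UP S) H k = \<zero>[S]" for n H
  using that
 proof (induction n arbitrary: H)
  case 0
  then have H0: "H = \<zero>[UP S]" by (intro pe.poly_eqI) auto
  then have "ev H = \<zero>" by (simp add: pe.ev.hom_zero) (simp add: T)
  with H0 show ?case by (intro exI[of _ "{}"]) simp
 next
  case (Suc n)
  define b where "b = coeff (UP S) H n"
  define H' where "H' = H \<ominus>\<^bsub>UP S\<^esub> monom (UP S) b n"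
  have bB: "b : B" using pe.coeff_closed[OF Suc.prems(1), of n] unfolding b_def by (simp add: S)
  have bS: "b : carrier S" using bB by (simp add: S)
  note r = pe.remove_top[OF Suc.prems(1) Suc.prems(2), folded b_def, folded H'_def]
  obtain E c where E0: "finite E \<and> E \<subseteq> expo X \<and> c : E \<rightarrow> k - {\<zero>} \<and> (\<forall>e\<in>E. e x < n) \<and>
   (H' ~= \<zero>[UP S] --> E ~= {}) \<and> ev H' = (\<Oplus>e\<in>E. c e \<otimes> mnm e)"
   using Suc.IH[OF r(1,2)] by (elim exE) (erule that)
  then have E: "finite E" "E \<subseteq> expo X" "c : E \<rightarrow> k - {\<zero>}" "\<forall>e\<in>E. e x < n"
   "ev H' = (\<Oplus>e\<in>E. c e \<otimes> mnm e)" by blast+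
  show ?case
  proof (cases "b = \<zero>")
   case True
   then have "monom (UP S) b n = \<zero>[UP S]" using pe.monom_zero[of n] by (simp add: S)
   then have "H = H'" using r(4) r(1) by simp
   then show ?thesis using E0 by (intro exI[of _ E] exI[of _ c]) auto
  next
   case False
   obtain F a where F: "finite F" "F \<subseteq> expo (X - {x})" "a : F \<rightarrow> k - {\<zero>}" and b: "b = (\<Oplus>e\<in>F. a e \<otimes> mnm e)"
    using mspan_representation[of b "X - {x}"] Bs bB by blast
   have Fne: "F ~= {}" using False b by auto
   have F0: "e x = 0" if "e : F" for e using F(2) that unfolding expo_def by blast
   define h where "h = (%e::'a \<Rightarrow> nat. e(x := n))"
   have inj: "inj_on h F"
   proof (rule inj_onI)
    fix e f assume ef: "e : F" "f : F" "h e = h f"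
    show "e = f"
    proof
     fix y show "e y = f y" using fun_cong[OF ef(3), of y] F0[OF ef(1)] F0[OF ef(2)] by (cases "y = x") (auto simp: h_def)
    qed
   qed
   have h0: "(h e)(x := 0) = e" if "e : F" for e using F0[OF that] unfolding h_def by auto
   define c' where "c' = (%e. if e x = n then a (e(x := 0)) else c e)"
   have c'h: "c' (h e) = a e" if "e : F" for e unfolding c'_def h0[OF that] by (simp add: h_def)
   have c'E: "c' e = c e" if "e : E" for e using E(4) that unfolding c'_def by auto
   have disj: "E \<inter> h ` F = {}" using E(4) by (auto simp: h_def)
   have c'k: "c' : E \<union> h ` F \<rightarrow> k - {\<zero>}" using c'h c'E E(3) F(3) by auto
   have t1: "(%e. c' e \<otimes> mnm e) : E \<rightarrow> carrier R" "(%e. c' e \<otimes> mnm e) : h ` F \<rightarrow> carrier R"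
    using term_closed[OF c'k, of "%e. e"] by auto
   have t2: "(%e. a e \<otimes> mnm e) : F \<rightarrow> carrier R" using term_closed[OF F(3), of "%e. e"] by simp
   have xn: "x [^] n : carrier R" using xR by simp
   have "ev (monom (UP S) b n) = (\<Oplus>e\<in>F. a e \<otimes> mnm e) \<otimes> x [^] n" using em[OF bB] b by simp
   also have "\<dots> = (\<Oplus>e\<in>F. a e \<otimes> mnm e \<otimes> x [^] n)" by (rule finsum_ldistr[OF F(1) xn t2])
   also have "\<dots> = (\<Oplus>e\<in>F. c' (h e) \<otimes> mnm (h e))"
   proof (rule finsum_cong'[OF refl])
    show "(%e. c' (h e) \<otimes> mnm (h e)) : F \<rightarrow> carrier R" using t1(2) by auto
    fix e assume e: "e : F"
    have "e(x := 0) = e" using F0[OF e] by auto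
    moreover have "a e : carrier R" using F(3) e k_carrier by auto
    ultimately show "a e \<otimes> mnm e \<otimes> x [^] n = c' (h e) \<otimes> mnm (h e)"
     using mnm_split[OF x, of e n] c'h[OF e] xn by (simp add: h_def m_assoc)
   qed
   also have "\<dots> = (\<Oplus>e\<in>h ` F. c' e \<otimes> mnm e)" by (rule finsum_reindex[OF t1(2) inj, symmetric])
   finally have evm: "ev (monom (UP S) b n) = (\<Oplus>e\<in>h ` F. c' e \<otimes> mnm e)" .
   have "ev H' = (\<Oplus>e\<in>E. c' e \<otimes> mnm e)" unfolding E(5) by (rule finsum_cong'[OF refl t1(1)]) (simp add: c'E)
   moreover have "ev H = ev H' \<oplus> ev (monom (UP S) b n)"
    using ev_add(1)[OF r(1), of "monom (UP S) b n"] r(4) bS by simp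
   ultimately have "ev H = (\<Oplus>e\<in>E \<union> h ` F. c' e \<otimes> mnm e)"
    using finsum_Un_disjoint[OF E(1) finite_imageI[OF F(1)] disj t1] evm by simp
   moreover have "E \<union> h ` F \<subseteq> expo X"
    using E(2) F(2) x expo_mono[of "X - {x}" X] by (auto simp: h_def intro!: expo_upd)
   moreover have "\<forall>e\<in>E \<union> h ` F. e x < Suc n" using E(4) by (auto simp: h_def)
   ultimately show ?thesis using E(1) F(1) Fne c'k
    by (intro exI[of _ "E \<union> h ` F"] exI[of _ c']) auto
  qed
 qed
 obtain n where "\<forall>k\<ge>n. coeff (UP S) H k = \<zero>[S]" using pe.bounded_coeff[OF H(1)] by blast
 from main[OF H(1) this] H(2) show ?thesis by (metis (no_types, lifting))
qed

text \<open>Each monomial splits into its power of x and a cofactor in B. A combination of monomials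
  is thereby lifted to a polynomial in one variable whose derivative is the partial derivative in
  x.\<close>

lemma (in perfect_subfield) relation_derivative:
 assumes x: "x : X" and B: "B = generate_ring R (k \<union> (X - {x}))" and S: "S = R\<lparr>carrier := B\<rparr>"
  and C: "subring C R" and T: "T = R\<lparr>carrier := C\<rparr>" and pe: "poly_ext S T ev dv"
  and em: "!!c n. c : B ==> ev (monom (UP S) c n) = c \<otimes> x [^] n"
  and dm: "!!c n. c : B ==> dv (monom (UP S) c n) = c \<otimes> ([n] \<cdot> (x [^] (n - 1 :: nat)))"
  and E: "finite E" "E \<subseteq> expo X" "c : E \<rightarrow> k"
 shows "\<exists>G \<in> carrier (UP S). ev G = (\<Oplus>e\<in>E. c e \<otimes> mnm e) \<and>
  dv G = (\<Oplus>e\<in>E. ([(e x)] \<cdot> c e) \<otimes> mnm (e(x := e x - 1)))"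
proof -
 interpret pe: poly_ext S "UP S" T ev dv by (rule pe) simp
 have xR: "x : carrier R" using x X by blast
 have gB: "k \<union> (X - {x}) \<subseteq> carrier R" using kE(1) X(2) by auto
 have Bsub: "subring B R" unfolding B by (rule generate_ring_is_subring[OF gB])
 have inB: "k \<subseteq> B" "X - {x} \<subseteq> B" using generate_ringE(2)[OF gB B] by auto
 show ?thesis using E
 proof (induction E)
  case empty
  have "dv \<zero>[UP S] = \<zero>" using pe.dv_const[of "\<zero>[S]"] pe.monom_zero[of 0] by (simp add: T)
  moreover have "ev \<zero>[UP S] = \<zero>" using pe.ev.hom_zero by (simp add: T)
  ultimately show ?case by (intro bexI[of _ "\<zero>[UP S]"]) auto
 next
  case (insert e E)
  have EE: "E \<subseteq> expo X" "c : E \<rightarrow> k" using insert.prems by auto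
  from insert.IH[OF EE] obtain G where G: "G : carrier (UP S)" "ev G = (\<Oplus>e\<in>E. c e \<otimes> mnm e)"
   "dv G = (\<Oplus>e\<in>E. ([(e x)] \<cdot> c e) \<otimes> mnm (e(x := e x - 1)))" by blast
  define a where "a = c e \<otimes> mnm (e(x := 0))"
  have ce: "c e : k" "c e : carrier R" using insert.prems k_carrier by auto
  have ck: "c f : carrier R" if "f : E" for f using insert.prems(2) that k_carrier by auto
  have "e(x := 0) : expo (X - {x})" using insert.prems(1) unfolding expo_def by auto
  then have "mnm (e(x := 0)) : B" by (rule mnm_in_subring[OF Bsub inB(2)])
  then have aB: "a : B" unfolding a_def using subringE(6)[OF Bsub] inB(1) ce(1) by blast
  have M: "monom (UP S) a (e x) : carrier (UP S)" using aB by (intro pe.monom_closed) (simp add: S)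
  have 1: "ev (monom (UP S) a (e x)) = c e \<otimes> mnm e"
   using em[OF aB, of "e x"] mnm_split'[OF x, of e] ce xR by (simp add: a_def m_assoc)
  have "dv (monom (UP S) a (e x)) = c e \<otimes> mnm (e(x := 0)) \<otimes> ([(e x)] \<cdot> (x [^] (e x - 1)))"
   using dm[OF aB, of "e x"] by (simp add: a_def)
  also have "\<dots> = ([(e x)] \<cdot> c e) \<otimes> (mnm (e(x := 0)) \<otimes> x [^] (e x - 1))"
   using ce xR by (simp add: add_pow_rdistr add_pow_ldistr m_assoc)
  also have "\<dots> = ([(e x)] \<cdot> c e) \<otimes> mnm (e(x := e x - 1))" using mnm_split[OF x, of e "e x - 1"] by simp
  finally have 2: "dv (monom (UP S) a (e x)) = ([(e x)] \<cdot> c e) \<otimes> mnm (e(x := e x - 1))" .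
  let ?G = "monom (UP S) a (e x) \<oplus>[UP S] G"
  have "ev ?G = (\<Oplus>e\<in>insert e E. c e \<otimes> mnm e)"
   using pe.ev.hom_add[OF M G(1)] 1 G(2) insert.hyps ce ck by (subst finsum_insert) (auto simp: T)
  moreover have "dv ?G = (\<Oplus>e\<in>insert e E. ([(e x)] \<cdot> c e) \<otimes> mnm (e(x := e x - 1)))"
   using pe.dv_add[OF M G(1)] 2 G(3) insert.hyps ce ck by (subst finsum_insert) (auto simp: T)
  ultimately show ?case using pe.UP_a_closed[OF M G(1)] by metis
 qed
qed

section \<open>Finitely generated domains over a perfect field\<close>

lemma (in domain) gen_reg_subfield:
 assumes k: "subring k R" and inv: "!!a. a : k ==> a ~= \<zero> ==> \<exists>b \<in> k. a \<otimes> b = \<one>"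
 shows "gen_reg (R\<lparr>carrier := k\<rparr>)"
proof -
 let ?S = "R\<lparr>carrier := k\<rparr>"
 have "reg_at ?S q" if q: "primeideal q ?S" for q
 proof -
  note f = primeideal_facts[OF q] and i = ideal_facts[OF primeideal_facts(1)[OF q]]
  have "q \<subseteq> {\<zero>}"
  proof
   fix a assume a: "a : q"
   show "a : {\<zero>}"
   proof (rule ccontr)
    assume "a ~: {\<zero>}"
    then obtain b where "b : k" "a \<otimes> b = \<one>" using inv i(1) a by auto
    then show False using i(5)[OF a, of b] f(4) by simp
   qed
  qed
  then have "q \<subseteq> saturation ?S q {\<zero>}"
   using f(4) subringE(1,2,3)[OF k] unfolding saturation_def by (auto intro!: bexI[of _ \<one>])
  then show ?thesis unfolding reg_at_def by (intro exI[of _ "[]"]) simp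
 qed
 moreover have "\<one>[?S] : carrier ?S - {\<zero>[?S]}" using subringE(3)[OF k] by simp
 ultimately show ?thesis unfolding gen_reg_def by blast
qed

text \<open>Induction on the number of generators.  If no generator is transcendental over the ring
 generated by the others, then some generator is separable over it, because the field is perfect.\<close>

theorem (in domain) gen_reg_generate:
 assumes k: "subring k R" and inv: "!!a. a : k ==> a ~= \<zero> ==> \<exists>b \<in> k. a \<otimes> b = \<one>"
  and perfect: "!!p a. Factorial_Ring.prime (p::nat) ==> [p] \<cdot> \<one> = \<zero> ==> a : k ==> \<exists>b \<in> k. b [^] p = a"
  and X: "finite X" "X \<subseteq> carrier R"
 shows "gen_reg (R\<lparr>carrier := generate_ring R (k \<union> X)\<rparr>)"
 using X
proof (induction "card X" arbitrary: X rule: less_induct)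
 case less
 interpret ps: perfect_subfield R k X
  by (intro perfect_subfield.intro perfect_subfield_axioms.intro domain_axioms k inv perfect less.prems)
 have kR: "k \<subseteq> carrier R" using subringE(1)[OF k] .
 define C where "C = generate_ring R (k \<union> X)"
 have C: "subring C R" unfolding C_def using generate_ring_is_subring kR less.prems by simp
 show ?case
 proof (cases "X = {}")
  case True
  have "generate_ring R (k \<union> X) = k"
   using True generate_ring_min_subring1[OF kR k] generate_ringE(2)[OF kR refl] by auto
  then show ?thesis using gen_reg_subfield[OF k inv] by simp
 next
  case False
  show ?thesis
  proof (rule ccontr)
   assume ng: "\<not> ?thesis"
   \<comment> \<open>If the claim fails for X, both steps fail for every x: x satisfies a nonzero
     polynomial over the ring generated by the others, and every polynomial that vanishes at x has
     derivative zero there.\<close>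
   have ext: "\<exists>B S T ev dv. B = generate_ring R (k \<union> (X - {x})) \<and> S = R\<lparr>carrier := B\<rparr> \<and> T = R\<lparr>carrier := C\<rparr> \<and>
    poly_ext S T ev dv \<and> (\<forall>c n. c : B --> ev (monom (UP S) c n) = c \<otimes> x [^] n) \<and>
    (\<forall>c n. c : B --> dv (monom (UP S) c n) = c \<otimes> ([n] \<cdot> (x [^] (n - 1 :: nat)))) \<and>
    (\<exists>H\<in>carrier (UP S). H ~= \<zero>[UP S] \<and> ev H = \<zero>) \<and> (\<forall>G\<in>carrier (UP S). ev G = \<zero> --> dv G = \<zero>)"
    if x: "x : X" for x
   proof -
    have xR: "x : carrier R" using x less.prems by auto
    define B where "B = generate_ring R (k \<union> (X - {x}))"
    have gB: "k \<union> (X - {x}) \<subseteq> carrier R" using kR less.prems by auto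
    have Bs: "subring B R" unfolding B_def by (rule generate_ring_is_subring[OF gB])
    define S where "S = R\<lparr>carrier := B\<rparr>"
    define T where "T = R\<lparr>carrier := C\<rparr>"
    have CB: "generate_ring R (insert x B) = C"
    proof
     have iB: "insert x B \<subseteq> carrier R" using xR subringE(1)[OF Bs] by blast
     have gX: "k \<union> X \<subseteq> carrier R" using kR less.prems by simp
     note c = generate_ringE(2)[OF gX C_def]
     have "B \<subseteq> C" unfolding B_def by (rule generate_ring_min_subring1[OF gB C]) (use c in auto)
     then show "generate_ring R (insert x B) \<subseteq> C"
      by (intro generate_ring_min_subring1[OF iB C]) (use c x in auto)
     have "k \<union> X \<subseteq> generate_ring R (insert x B)"
      using generate_ringE(2)[OF iB refl] generate_ringE(2)[OF gB B_def] by auto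
     then show "C \<subseteq> generate_ring R (insert x B)" unfolding C_def
      by (rule generate_ring_min_subring1[OF gX generate_ring_is_subring[OF iB]])
    qed
    obtain ev dv where pe: "poly_ext S T ev dv" and e0: "!!c. c : B ==> ev (monom (UP S) c 0) = c"
     and em: "!!c n. c : B ==> ev (monom (UP S) c n) = c \<otimes> x [^] n"
     and dm: "!!c n. c : B ==> dv (monom (UP S) c n) = c \<otimes> ([n] \<cdot> (x [^] (n - 1 :: nat)))"
     using adjoin_generator[OF Bs xR] unfolding CB S_def[symmetric] T_def[symmetric] by metis
    interpret pe: poly_ext S "UP S" T ev dv by (rule pe) simp
    have IH: "gen_reg S" unfolding S_def B_def
    proof (rule less.hyps)
     show "card (X - {x}) < card X" using less.prems(1) x by (rule card_Diff1_less)
    qed (use less.prems in auto)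
    have ngT: "\<not> gen_reg T" using ng unfolding T_def C_def .
    have z: "\<zero>[T] = \<zero>" by (simp add: T_def)
    have incl0: "c = \<zero>[S]" if "c : carrier S" "pe.incl c = \<zero>[T]" for c
     using that(2)[unfolded pe.incl_def] that(1) e0[of c] by (simp add: S_def T_def)
    have "\<exists>H\<in>carrier (UP S). H ~= \<zero>[UP S] \<and> ev H = \<zero>" using pe.transcendental_step[OF _ IH] ngT z by metis
    moreover have "\<forall>G\<in>carrier (UP S). ev G = \<zero> --> dv G = \<zero>" using pe.separable_step[OF incl0 _ _ _ IH] ngT z by metis
    ultimately show ?thesis using pe em dm B_def S_def T_def by metis
   qed
   have deriv: "(\<Oplus>e\<in>E. ([(e x)] \<cdot> c e) \<otimes> ps.mnm (e(x := e x - 1))) = \<zero>"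
    if *: "x : X" "finite E" "E \<subseteq> expo X" "c : E \<rightarrow> k" "(\<Oplus>e\<in>E. c e \<otimes> ps.mnm e) = \<zero>" for x E c
   proof -
    obtain B S T ev dv where e: "B = generate_ring R (k \<union> (X - {x}))" "S = R\<lparr>carrier := B\<rparr>" "T = R\<lparr>carrier := C\<rparr>"
     "poly_ext S T ev dv" and em: "!!c n. c : B ==> ev (monom (UP S) c n) = c \<otimes> x [^] n"
     and dm: "!!c n. c : B ==> dv (monom (UP S) c n) = c \<otimes> ([n] \<cdot> (x [^] (n - 1 :: nat)))"
     and d: "\<forall>G\<in>carrier (UP S). ev G = \<zero> --> dv G = \<zero>" using ext[OF *(1)] by metis
    show ?thesis using ps.relation_derivative[OF *(1) e(1,2) C e(3,4) em dm *(2,3,4)] d *(5) by metis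
   qed
   \<comment> \<open>One algebraic generator already yields a relation, and
     \<open>no_relation\<close> excludes it because the derivatives of all relations vanish.\<close>
   obtain x where x: "x : X" using False by blast
   obtain B S T ev dv where e: "B = generate_ring R (k \<union> (X - {x}))" "S = R\<lparr>carrier := B\<rparr>" "T = R\<lparr>carrier := C\<rparr>"
    "poly_ext S T ev dv" and em: "!!c n. c : B ==> ev (monom (UP S) c n) = c \<otimes> x [^] n"
    and d: "\<exists>H\<in>carrier (UP S). H ~= \<zero>[UP S] \<and> ev H = \<zero>" using ext[OF x] by metis
   obtain H where H: "H : carrier (UP S)" "H ~= \<zero>[UP S]" "ev H = \<zero>" using d by blast
   obtain E c where "finite E" "E ~= {}" "E \<subseteq> expo X" "c : E \<rightarrow> k - {\<zero>}" "ev H = (\<Oplus>e\<in>E. c e \<otimes> ps.mnm e)"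
    using ps.polynomial_expansion[OF x e(1,2) C e(3,4) em H(1,2)] by metis
   then have "ps.relation E c" unfolding ps.relation_def using H(3) by simp
   then show False using ps.no_relation[OF deriv] by blast
  qed
 qed
qed

section \<open>Localization\<close>

text \<open>\<open>R'\<close> is a localization of \<open>R\<close> at \<open>S\<close> via \<open>f\<close>, without reference to a construction.\<close>

locale ring_localization =
 R: cring R + L: cring R' for R (structure) and R' :: "('b, 'n) ring_scheme" +
 fixes f :: "'a \<Rightarrow> 'b" and S :: "'a set"
 assumes f_hom: "f : ring_hom R R'"
  and S_sub: "S \<subseteq> carrier R" and S_one: "\<one> : S"
  and S_mult: "!!s t. s : S ==> t : S ==> s \<otimes> t : S"
  and f_unit: "!!s. s : S ==> f s : Units R'"
  and f_surj: "!!c. c : carrier R' ==> \<exists>s\<in>S. \<exists>a\<in>carrier R. f s \<otimes>[R'] c = f a"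
  and f_inj: "!!a. a : carrier R ==> f a = \<zero>[R'] ==> \<exists>s\<in>S. s \<otimes> a = \<zero>"
begin

sublocale f: ring_hom_cring R R' f by unfold_locales (rule f_hom)

lemma S_carrier: "s : S ==> s : carrier R" using S_sub by blast

lemma fS_closed: "s : S ==> f s : carrier R'" using S_carrier by simp

lemma cancel_unit:
 assumes "s : S" "c : carrier R'" "d : carrier R'" "f s \<otimes>[R'] c = f s \<otimes>[R'] d"
 shows "c = d"
 using assms f_unit L.Units_l_cancel by simp

lemma f_eq:
 assumes "a : carrier R" "b : carrier R" "f a = f b"
 obtains s where "s : S" "s \<otimes> a = s \<otimes> b"
proof -
 have "f (a \<ominus> b) = \<zero>[R']" using assms by (simp add: R.minus_eq L.r_neg)
 then obtain s where s: "s : S" "s \<otimes> (a \<ominus> b) = \<zero>" using f_inj[of "a \<ominus> b"] assms by auto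
 then have "s \<otimes> a \<ominus> s \<otimes> b = \<zero>" using assms S_carrier by (simp add: R.minus_eq R.r_distr R.r_minus)
 then show ?thesis using that s(1) assms S_carrier R.r_right_minus_eq by (metis R.m_closed)
qed

text \<open>The ideal generated by the image of I, when I is an ideal: the fractions a / s with a in
  I. The equation is written without inverses because the elements of \<open>R'\<close> are not
  given as fractions.\<close>

definition extend :: "'a set \<Rightarrow> 'b set" where
 "extend I = {c : carrier R'. \<exists>s\<in>S. \<exists>a\<in>I. f s \<otimes>[R'] c = f a}"

lemma extendI: "c : carrier R' ==> s : S ==> a : I ==> f s \<otimes>[R'] c = f a ==> c : extend I"
 unfolding extend_def by blast

lemma extendE:
 assumes "c : extend I"
 obtains s a where "s : S" "a : I" "f s \<otimes>[R'] c = f a" "c : carrier R'"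
 using assms unfolding extend_def by blast

lemma f_in_extend: "I \<subseteq> carrier R ==> a : I ==> f a : extend I"
 by (rule extendI[OF _ S_one]) auto

lemma extend_ideal:
 assumes "ideal I R" shows "ideal (extend I) R'"
proof (rule L.ideal_if)
 note i = ideal_facts[OF assms]
 show "extend I \<subseteq> carrier R'" unfolding extend_def by auto
 show "\<zero>[R'] : extend I" using f_in_extend[OF i(1,2)] by simp
 show "c \<oplus>[R'] d : extend I" if c: "c : extend I" and d: "d : extend I" for c d
 proof -
  obtain s a where 1: "s : S" "a : I" "f s \<otimes>[R'] c = f a" "c : carrier R'" by (rule extendE[OF c])
  obtain t b where 2: "t : S" "b : I" "f t \<otimes>[R'] d = f b" "d : carrier R'" by (rule extendE[OF d])
  have cl: "a : carrier R" "b : carrier R" "s : carrier R" "t : carrier R" using 1 2 i(1) S_carrier by auto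
  have "f (s \<otimes> t) \<otimes>[R'] (c \<oplus>[R'] d) = f t \<otimes>[R'] (f s \<otimes>[R'] c) \<oplus>[R'] f s \<otimes>[R'] (f t \<otimes>[R'] d)"
   using cl 1(4) 2(4) by (simp add: L.r_distr L.m_ac)
  also have "\<dots> = f (t \<otimes> a \<oplus> s \<otimes> b)" unfolding 1(3) 2(3) using cl by simp
  finally show ?thesis using i(3)[OF i(4)[OF 1(2) cl(4)] i(4)[OF 2(2) cl(3)]]
   by (intro extendI[OF _ S_mult[OF 1(1) 2(1)]]) (use 1 2 in auto)
 qed
 show "r \<otimes>[R'] c : extend I" if c: "c : extend I" and r: "r : carrier R'" for c r
 proof -
  obtain s a where 1: "s : S" "a : I" "f s \<otimes>[R'] c = f a" "c : carrier R'" by (rule extendE[OF c])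
  obtain t b where 2: "t : S" "b : carrier R" "f t \<otimes>[R'] r = f b" using f_surj[OF r] by blast
  have cl: "a : carrier R" "s : carrier R" "t : carrier R" using 1 2 i(1) S_carrier by auto
  have "f (t \<otimes> s) \<otimes>[R'] (r \<otimes>[R'] c) = (f t \<otimes>[R'] r) \<otimes>[R'] (f s \<otimes>[R'] c)"
   using cl 1(4) r by (simp add: L.m_ac)
  also have "\<dots> = f (b \<otimes> a)" unfolding 1(3) 2(3) using cl 2(2) by simp
  finally show ?thesis using i(4)[OF 1(2) 2(2)]
   by (intro extendI[OF _ S_mult[OF 2(1) 1(1)]]) (use 1 r in auto)
 qed
qed

lemma extend_zero: "extend {\<zero>} = {\<zero>[R']}"
proof
 show "extend {\<zero>} \<subseteq> {\<zero>[R']}"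
 proof
  fix c assume c: "c : extend {\<zero>}"
  obtain s a where 1: "s : S" "a : {\<zero>}" "f s \<otimes>[R'] c = f a" "c : carrier R'" by (rule extendE[OF c])
  then have "f s \<otimes>[R'] c = f s \<otimes>[R'] \<zero>[R']" using fS_closed by simp
  then show "c : {\<zero>[R']}" using cancel_unit[OF 1(1,4)] by simp
 qed
 show "{\<zero>[R']} \<subseteq> extend {\<zero>}" using ideal_facts(2)[OF extend_ideal[OF R.zeroideal]] by simp
qed

lemma extend_least:
 assumes J: "ideal J R'" and I: "!!a. a : I ==> f a : J"
 shows "extend I \<subseteq> J"
proof
 fix c assume c: "c : extend I"
 obtain s a where 1: "s : S" "a : I" "f s \<otimes>[R'] c = f a" "c : carrier R'" by (rule extendE[OF c])
 have u: "f s : Units R'" using f_unit 1(1) .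
 have "inv\<^bsub>R'\<^esub> (f s) \<otimes>[R'] (f s \<otimes>[R'] c) : J"
  unfolding 1(3) using ideal_facts(4)[OF J I[OF 1(2)]] L.Units_inv_closed[OF u] by blast
 moreover have "inv\<^bsub>R'\<^esub> (f s) \<otimes>[R'] (f s \<otimes>[R'] c) = c"
  using u 1(4) by (metis L.Units_closed L.Units_inv_closed L.Units_l_inv L.l_one L.m_assoc)
 ultimately show "c : J" by simp
qed

lemma extend_adj:
 assumes I: "ideal I R" and y: "y : carrier R"
 shows "extend (adj R I y) = adj R' (extend I) (f y)"
proof
 note ai = R.adj_ideal[OF I y] and ti = L.adj_ideal[OF extend_ideal[OF I] f.hom_closed[OF y]]
 show "adj R' (extend I) (f y) \<subseteq> extend (adj R I y)"
 proof (rule L.adj_least[OF extend_ideal[OF ai(1)]])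
  show "extend I \<subseteq> extend (adj R I y)" unfolding extend_def using ai(2) by blast
  show "f y : extend (adj R I y)" using f_in_extend[OF ideal_facts(1)[OF ai(1)] ai(3)] .
 qed
 show "extend (adj R I y) \<subseteq> adj R' (extend I) (f y)"
 proof (rule extend_least[OF ti(1)])
  note t = ideal_facts[OF ti(1)]
  fix c assume c: "c : adj R I y"
  obtain i a where *: "i : I" "a : carrier R" "c = i \<oplus> y \<otimes> a" by (rule adjE[OF c])
  have "i : carrier R" using * ideal_facts(1)[OF I] by auto
  then have "f c = f i \<oplus>[R'] f y \<otimes>[R'] f a" using * y by simp
  moreover have "f i : adj R' (extend I) (f y)" using f_in_extend[OF ideal_facts(1)[OF I] *(1)] ti(2) by auto
  moreover have "f y \<otimes>[R'] f a : adj R' (extend I) (f y)" using t(5)[OF ti(3) f.hom_closed[OF *(2)]] .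
  ultimately show "f c : adj R' (extend I) (f y)" using t(3) by simp
 qed
qed

text \<open>Every ideal of the localization is the extension of its contraction, so the images of
  generators of the contraction generate it.\<close>

lemma noetherian_transfer:
 assumes "noetherian_ring R" shows "noetherian_ring R'"
proof (rule L.noetherian_ringI)
 fix J assume J: "ideal J R'"
 note j = ideal_facts[OF J]
 define I where "I = {a : carrier R. f a : J}"
 have "ideal I R" unfolding I_def using j by (intro R.ideal_if) auto
 then obtain A where A: "A \<subseteq> carrier R" "finite A" "I = Idl A"
  using noetherian_ring.finetely_gen[OF assms] by blast
 have fA: "f ` A \<subseteq> carrier R'" using A(1) by auto
 have AI: "A \<subseteq> I" unfolding A(3) by (rule R.genideal_self[OF A(1)])
 have g: "ideal (Idl\<^bsub>R'\<^esub> (f ` A)) R'" by (rule L.genideal_ideal[OF fA])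
 have "J = Idl\<^bsub>R'\<^esub> (f ` A)"
 proof
  show "Idl\<^bsub>R'\<^esub> (f ` A) \<subseteq> J" by (rule L.genideal_minimal[OF J]) (use AI in \<open>auto simp: I_def\<close>)
  have "ideal {a : carrier R. f a : Idl\<^bsub>R'\<^esub> (f ` A)} R" using ideal_facts[OF g] by (intro R.ideal_if) auto
  then have "I \<subseteq> {a : carrier R. f a : Idl\<^bsub>R'\<^esub> (f ` A)}" unfolding A(3)
   by (rule R.genideal_minimal) (use A(1) L.genideal_self[OF fA] in auto)
  then have "extend I \<subseteq> Idl\<^bsub>R'\<^esub> (f ` A)" by (intro extend_least[OF g]) auto
  moreover have "J \<subseteq> extend I"
  proof
   fix c assume c: "c : J"
   then have cR: "c : carrier R'" using j(1) by blast
   obtain s a where 1: "s : S" "a : carrier R" "f s \<otimes>[R'] c = f a" using f_surj[OF cR] by blast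
   have "f s \<otimes>[R'] c : J" using j(4)[OF c fS_closed[OF 1(1)]] .
   then have "a : I" unfolding I_def using 1 by simp
   then show "c : extend I" by (rule extendI[OF cR 1(1) _ 1(3)])
  qed
  ultimately show "J \<subseteq> Idl\<^bsub>R'\<^esub> (f ` A)" by blast
 qed
 then show "\<exists>A\<subseteq>carrier R'. finite A \<and> J = Idl\<^bsub>R'\<^esub> A" using fA A(2) by blast
qed

lemma domain_transfer:
 assumes "domain R" "\<zero> ~: S" shows "domain R'"
proof (rule domain.intro[OF L.is_cring], unfold_locales)
 interpret D: domain R by fact
 show "\<one>[R'] ~= \<zero>[R']"
 proof
  assume "\<one>[R'] = \<zero>[R']"
  then have "f \<one> = \<zero>[R']" by simp
  then obtain s where "s : S" "s \<otimes> \<one> = \<zero>" using f_inj by blast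
  then show False using assms(2) S_carrier by simp
 qed
 have nz: "s ~= \<zero>" if "s : S" for s using that assms(2) by blast
 fix c d assume cd: "c \<otimes>[R'] d = \<zero>[R']" "c : carrier R'" "d : carrier R'"
 obtain s a where 1: "s : S" "a : carrier R" "f s \<otimes>[R'] c = f a" using f_surj[OF cd(2)] by blast
 obtain t b where 2: "t : S" "b : carrier R" "f t \<otimes>[R'] d = f b" using f_surj[OF cd(3)] by blast
 have "f (a \<otimes> b) = (f s \<otimes>[R'] c) \<otimes>[R'] (f t \<otimes>[R'] d)" unfolding 1(3) 2(3) using 1 2 by simp
 also have "\<dots> = (f s \<otimes>[R'] f t) \<otimes>[R'] (c \<otimes>[R'] d)" using fS_closed[OF 1(1)] fS_closed[OF 2(1)] cd(2,3) by (simp add: L.m_ac)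
 also have "\<dots> = \<zero>[R']" using cd(1) fS_closed 1 2 by simp
 finally obtain u where u: "u : S" "u \<otimes> (a \<otimes> b) = \<zero>" using f_inj[of "a \<otimes> b"] 1 2 by auto
 then have "a = \<zero> \<or> b = \<zero>" using D.integral_iff nz[OF u(1)] S_carrier 1 2 by simp
 moreover have "c = \<zero>[R']" if "a = \<zero>" using cancel_unit[OF 1(1) cd(2) L.zero_closed] 1(1,3) that fS_closed by simp
 moreover have "d = \<zero>[R']" if "b = \<zero>" using cancel_unit[OF 2(1) cd(3) L.zero_closed] 2(1,3) that fS_closed by simp
 ultimately show "c = \<zero>[R'] \<or> d = \<zero>[R']" by blast
qed

end

section \<open>Localization at a prime ideal\<close>

locale prime_localization = ring_localization R R' f "carrier R - p"
 for R (structure) and R' :: "('b, 'n) ring_scheme" and f :: "'a \<Rightarrow> 'b" and p +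
 assumes p: "primeideal p R"
begin

lemmas p_ideal = primeideal_facts(1)[OF p]

lemma extend_p_contract: "a : carrier R ==> f a : extend p ==> a : p"
proof (elim extendE)
 fix s b assume *: "a : carrier R" "s : carrier R - p" "b : p" "f s \<otimes>[R'] f a = f b"
 have b: "b : carrier R" using *(3) ideal_facts(1)[OF p_ideal] by blast
 have "f (s \<otimes> a) = f b" using * by simp
 then obtain t where t: "t : carrier R - p" "t \<otimes> (s \<otimes> a) = t \<otimes> b" using f_eq[of "s \<otimes> a" b] * b by auto
 have "t \<otimes> (s \<otimes> a) : p" unfolding t(2) using ideal_facts(4)[OF p_ideal *(3)] t(1) by blast
 then show "a : p" using primeideal_facts(5)[OF p] t(1) *(1,2) by (metis DiffD1 DiffD2 R.m_closed)
qed

text \<open>A fraction a / s outside the extended prime has its numerator outside p, which f makes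
  invertible. The nonunits thus form a single ideal, which makes \<open>R'\<close> local.\<close>

lemma unit_iff: "c : carrier R' ==> c : Units R' \<longleftrightarrow> c ~: extend p"
proof
 assume c: "c : carrier R'" "c ~: extend p"
 obtain s a where 1: "s : carrier R - p" "a : carrier R" "f s \<otimes>[R'] c = f a" using f_surj[OF c(1)] by blast
 have "a ~: p" using extendI[OF c(1) 1(1) _ 1(3)] c(2) by blast
 then have "f a : Units R'" using f_unit 1(2) by blast
 then have u: "f s \<otimes>[R'] c : Units R'" unfolding 1(3) .
 show "c : Units R'" by (rule L.prod_unit_l[OF u f_unit[OF 1(1)] fS_closed[OF 1(1)] c(1)])
next
 assume c: "c : carrier R'" "c : Units R'"
 show "c ~: extend p"
 proof
  assume "c : extend p"
  then have "inv\<^bsub>R'\<^esub> c \<otimes>[R'] c : extend p"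
   using ideal_facts(4)[OF extend_ideal[OF p_ideal]] L.Units_inv_closed[OF c(2)] by blast
  then have "f \<one> : extend p" using L.Units_l_inv[OF c(2)] by simp
  then show False using extend_p_contract[of \<one>] primeideal_facts(4)[OF p] by blast
 qed
qed

lemma extend_p_maximal: "maximalideal (extend p) R'"
proof (rule maximalidealI)
 show "ideal (extend p) R'" by (rule extend_ideal[OF p_ideal])
 have "\<one>[R'] ~: extend p" using unit_iff[of "\<one>[R']"] by simp
 then show "carrier R' ~= extend p" using L.one_closed by blast
 fix J assume J: "ideal J R'" "extend p \<subseteq> J" "J \<subseteq> carrier R'"
 show "J = extend p \<or> J = carrier R'"
 proof (cases "J \<subseteq> extend p")
  case False
  then obtain c where c: "c : J" "c : Units R'" using unit_iff J(3) by blast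
  then have "inv\<^bsub>R'\<^esub> c \<otimes>[R'] c : J" using ideal_facts(4)[OF J(1)] L.Units_inv_closed by blast
  then have "\<one>[R'] : J" using L.Units_l_inv[OF c(2)] by simp
  then show ?thesis using ideal.one_imp_carrier[OF J(1)] by blast
 qed (use J in blast)
qed

lemma local: "local_ring R'"
 unfolding local_ring_def
proof (intro conjI ex1I)
 show "maximalideal (extend p) R'" by (rule extend_p_maximal)
 fix J assume J: "maximalideal J R'"
 interpret J: maximalideal J R' by fact
 have "J \<subseteq> extend p"
 proof
  fix c assume c: "c : J"
  then have cR: "c : carrier R'" using J.a_subset by blast
  show "c : extend p"
  proof (rule ccontr)
   assume "c ~: extend p"
   then have u: "c : Units R'" using unit_iff[OF cR] by simp
   then have "inv\<^bsub>R'\<^esub> c \<otimes>[R'] c : J" using J.I_l_closed[OF c] L.Units_inv_closed by blast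
   then have "\<one>[R'] : J" using L.Units_l_inv[OF u] by simp
   then show False using J.one_imp_carrier J.I_notcarr by blast
  qed
 qed
 moreover have "extend p \<subseteq> carrier R'" unfolding extend_def by blast
 moreover have "extend p ~= carrier R'"
  using maximalideal.I_notcarr[OF extend_p_maximal] by blast
 ultimately show "J = extend p" using J.I_maximal[OF extend_ideal[OF p_ideal]] by blast
qed (rule L.is_cring)

end

text \<open>The recursion of \<open>regseq_at\<close> with membership in place of saturation, for a
  ring in which the localization has already taken place.\<close>

fun strict_regseq :: "('a, 'z) ring_scheme \<Rightarrow> 'a set \<Rightarrow> 'a list \<Rightarrow> bool" where
 "strict_regseq R I [] = True"
| "strict_regseq R I (x # xs) = ((\<forall>a \<in> carrier R. x \<otimes>[R] a : I --> a : I) \<and> strict_regseq R (adj R I x) xs)"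

context prime_localization
begin

lemma extend_saturation:
 assumes I: "ideal I R" and a: "a : saturation R p I"
 shows "f a : extend I"
proof -
 obtain t where t: "t : carrier R - p" "t \<otimes> a : I" "a : carrier R" using a unfolding saturation_def by blast
 then have "f t \<otimes>[R'] f a = f (t \<otimes> a)" by simp
 then show ?thesis using extendI[OF _ t(1,2)] t(3) by simp
qed

text \<open>The denominators of c and of the product are cleared, and a further multiplier u turns
  the equality of images into an equality in R; there the regularity of x applies.\<close>

lemma regular_extend:
 assumes I: "ideal I R" and x: "x : carrier R" "regular_at R p I x"
  and c: "c : carrier R'" "f x \<otimes>[R'] c : extend I"
 shows "c : extend I"
proof -
 obtain s a where s: "s : carrier R - p" "a : I" "f s \<otimes>[R'] (f x \<otimes>[R'] c) = f a" by (rule extendE[OF c(2)])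
 obtain t b where t: "t : carrier R - p" "b : carrier R" "f t \<otimes>[R'] c = f b" using f_surj[OF c(1)] by blast
 have cl: "s : carrier R" "t : carrier R" "a : carrier R" using s t ideal_facts(1)[OF I] by auto
 have "f (s \<otimes> (x \<otimes> b)) = f s \<otimes>[R'] (f x \<otimes>[R'] (f t \<otimes>[R'] c))" unfolding t(3) using cl x t(2) by simp
 also have "\<dots> = f t \<otimes>[R'] (f s \<otimes>[R'] (f x \<otimes>[R'] c))" using cl x c(1) by (simp add: L.m_ac)
 also have "\<dots> = f (t \<otimes> a)" unfolding s(3) using cl by simp
 finally obtain u where u: "u : carrier R - p" "u \<otimes> (s \<otimes> (x \<otimes> b)) = u \<otimes> (t \<otimes> a)"
  using f_eq[of "s \<otimes> (x \<otimes> b)" "t \<otimes> a"] cl x(1) t(2) by auto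
 have us: "u \<otimes> s : carrier R - p" using primeideal_facts(6)[OF p u(1) s(1)] .
 have "x \<otimes> ((u \<otimes> s) \<otimes> b) = u \<otimes> (s \<otimes> (x \<otimes> b))" using u(1) cl x(1) t(2) by (simp add: R.m_ac)
 also have "\<dots> : I" unfolding u(2) using ideal_facts(4)[OF I] s(2) u(1) cl by simp
 finally have "(u \<otimes> s) \<otimes> b : saturation R p I"
  using x(2) us t(2) unfolding regular_at_def by simp
 then have e: "f ((u \<otimes> s) \<otimes> b) : extend I" by (rule extend_saturation[OF I])
 have "f ((u \<otimes> s) \<otimes> b) = f (u \<otimes> s \<otimes> t) \<otimes>[R'] c"
  using t(3) us t(1,2) c(1) by (simp add: L.m_assoc)
 with e obtain v d where v: "v : carrier R - p" "d : I" "f v \<otimes>[R'] (f (u \<otimes> s \<otimes> t) \<otimes>[R'] c) = f d"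
  by (metis extendE)
 have ust: "u \<otimes> s \<otimes> t : carrier R - p" using primeideal_facts(6)[OF p us t(1)] .
 have "f (v \<otimes> (u \<otimes> s \<otimes> t)) \<otimes>[R'] c = f d" using v ust c(1) by (simp add: L.m_assoc)
 then show ?thesis using extendI[OF c(1) S_mult[OF v(1) ust] v(2)] by blast
qed

lemma regseq_extend:
 assumes "ideal I R" "set xs \<subseteq> carrier R" "regseq_at R p I xs"
 shows "strict_regseq R' (extend I) (map f xs) \<and> adjoin R' (extend I) (map f xs) = extend (adjoin R I xs)"
 using assms
proof (induction xs arbitrary: I)
 case (Cons x xs)
 then have x: "x : carrier R" and r: "regular_at R p I x" by auto
 have "\<forall>c \<in> carrier R'. f x \<otimes>[R'] c : extend I --> c : extend I"
  using regular_extend[OF Cons.prems(1) x r] by blast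
 then show ?case using Cons.IH[OF R.adj_ideal(1)[OF Cons.prems(1) x]] Cons.prems
  by (simp add: extend_adj[OF Cons.prems(1) x])
qed auto

text \<open>Saturations at p become plain ideals in any localization at p: the sequence maps to an
  honest regular sequence, and the inclusion of p in a saturation becomes generation of the maximal
  ideal.\<close>

lemma regular_local:
 assumes "reg_at R p"
 obtains ys where "set ys \<subseteq> extend p" "Idl\<^bsub>R'\<^esub> (set ys) = extend p" "strict_regseq R' {\<zero>[R']} ys"
proof -
 obtain xs where xs: "set xs \<subseteq> p" "regseq_at R p {\<zero>} xs" "p \<subseteq> saturation R p (adjoin R {\<zero>} xs)"
  using assms unfolding reg_at_def by blast
 have xR: "set xs \<subseteq> carrier R" using xs(1) ideal_facts(1)[OF p_ideal] by blast
 define J where "J = adjoin R {\<zero>} xs"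
 have J: "ideal J R" using R.adjoin_ideal[OF R.zeroideal xR] unfolding J_def by simp
 note * = regseq_extend[OF R.zeroideal xR xs(2), unfolded extend_zero, folded J_def]
 let ?ys = "map f xs"
 have ysp: "set ?ys \<subseteq> extend p" using xs(1) f_in_extend[OF ideal_facts(1)[OF p_ideal]] by auto
 have ysc: "set ?ys \<subseteq> carrier R'" using xR by auto
 have g: "ideal (Idl\<^bsub>R'\<^esub> (set ?ys)) R'" by (rule L.genideal_ideal[OF ysc])
 have "extend J \<subseteq> Idl\<^bsub>R'\<^esub> (set ?ys)"
  using L.adjoin_least[OF g _ L.genideal_self[OF ysc], of "{\<zero>[R']}"] ideal_facts(2)[OF g] * by auto
 moreover have "extend p \<subseteq> extend J"
  by (rule extend_least[OF extend_ideal[OF J]]) (use xs(3) extend_saturation[OF J] in \<open>auto simp: J_def\<close>)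
 ultimately have "Idl\<^bsub>R'\<^esub> (set ?ys) = extend p"
  using L.genideal_minimal[OF extend_ideal[OF p_ideal] ysp] by blast
 then show ?thesis using that ysp * by blast
qed

end

section \<open>Free modules and generic freeness\<close>

definition madj :: "('r, 'm, 'z) module_scheme \<Rightarrow> 'm set \<Rightarrow> 'r \<Rightarrow> 'm set" where
 "madj M N x = {n \<oplus>[M] x \<odot>[M] m | n m. n : N \<and> m : carrier M}"

text \<open>Each x has to act injectively on M/N. The submodule N is carried along so that no
  quotient module is formed, and the quotients may be zero, as they are for cohomology modules that
  vanish.\<close>

fun module_regular :: "('r, 'm, 'z) module_scheme \<Rightarrow> 'm set \<Rightarrow> 'r list \<Rightarrow> bool" where
 "module_regular M N [] = True"
| "module_regular M N (x # xs) =
   ((\<forall>m \<in> carrier M. x \<odot>[M] m : N --> m : N) \<and> module_regular M (madj M N x) xs)"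

definition lincomb :: "('r, 'm, 'z) module_scheme \<Rightarrow> nat \<Rightarrow> (nat \<Rightarrow> 'm) \<Rightarrow> (nat \<Rightarrow> 'r) \<Rightarrow> 'm" where
 "lincomb M n b r = (\<Oplus>\<^bsub>M\<^esub>i\<in>{..<n}. r i \<odot>[M] b i)"

text \<open>The basis is a family indexed by numbers below n, not a set: rank 0 is included, and a
  family can be mapped to a localization without concern for coincidences among its members.\<close>

definition free_basis :: "('r, 'y) ring_scheme \<Rightarrow> ('r, 'm, 'z) module_scheme \<Rightarrow> nat \<Rightarrow> (nat \<Rightarrow> 'm) \<Rightarrow> bool" where
 "free_basis R M n b \<longleftrightarrow> b : {..<n} \<rightarrow> carrier M \<and>
   (\<forall>m\<in>carrier M. \<exists>r. r : {..<n} \<rightarrow> carrier R \<and> m = lincomb M n b r) \<and>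
   (\<forall>r. r : {..<n} \<rightarrow> carrier R --> lincomb M n b r = \<zero>[M] --> (\<forall>i<n. r i = \<zero>[R]))"

context module
begin

lemma lincomb_terms: "b : {..<n} \<rightarrow> carrier M ==> r : {..<n} \<rightarrow> carrier R ==>
  (%i. r i \<odot>[M] b i) : {..<n::nat} \<rightarrow> carrier M"
 by (auto simp: Pi_iff)

lemma lincomb_closed: "b : {..<n} \<rightarrow> carrier M ==> r : {..<n} \<rightarrow> carrier R ==> lincomb M n b r : carrier M"
 unfolding lincomb_def by (rule M.finsum_closed[OF lincomb_terms])

lemma lincomb_cong:
 assumes "b : {..<n} \<rightarrow> carrier M" "s : {..<n} \<rightarrow> carrier R" "!!i. i < n ==> r i = s i"
 shows "lincomb M n b r = lincomb M n b s"
 unfolding lincomb_def by (rule M.finsum_cong'[OF refl lincomb_terms[OF assms(1,2)]]) (simp add: assms(3))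

lemma lincomb_add:
 assumes b: "b : {..<n} \<rightarrow> carrier M" and r: "r : {..<n} \<rightarrow> carrier R" and s: "s : {..<n} \<rightarrow> carrier R"
 shows "lincomb M n b (%i. r i \<oplus> s i) = lincomb M n b r \<oplus>[M] lincomb M n b s"
proof -
 have "lincomb M n b (%i. r i \<oplus> s i) = (\<Oplus>\<^bsub>M\<^esub>i\<in>{..<n}. r i \<odot>[M] b i \<oplus>[M] s i \<odot>[M] b i)"
  unfolding lincomb_def
  by (rule M.finsum_cong'[OF refl]) (use b r s in \<open>auto simp: Pi_iff smult_l_distr\<close>)
 also have "\<dots> = lincomb M n b r \<oplus>[M] lincomb M n b s"
  unfolding lincomb_def by (rule M.finsum_addf[OF lincomb_terms[OF b r] lincomb_terms[OF b s]])
 finally show ?thesis .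
qed

lemma lincomb_smult:
 assumes b: "b : {..<n} \<rightarrow> carrier M" and r: "r : {..<n} \<rightarrow> carrier R" and a: "a : carrier R"
 shows "lincomb M n b (%i. a \<otimes> r i) = a \<odot>[M] lincomb M n b r"
proof -
 have "lincomb M n b (%i. a \<otimes> r i) = (\<Oplus>\<^bsub>M\<^esub>i\<in>{..<n}. a \<odot>[M] (r i \<odot>[M] b i))"
  unfolding lincomb_def
  by (rule M.finsum_cong'[OF refl]) (use b r a in \<open>auto simp: Pi_iff smult_assoc1\<close>)
 also have "\<dots> = a \<odot>[M] lincomb M n b r"
  unfolding lincomb_def by (rule finsum_smult_ldistr[OF _ a lincomb_terms[OF b r], symmetric]) simp
 finally show ?thesis .
qed

lemma lincomb_minus:
 assumes b: "b : {..<n} \<rightarrow> carrier M" and r: "r : {..<n} \<rightarrow> carrier R"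
 shows "lincomb M n b (%i. \<ominus> r i) = \<ominus>\<^bsub>M\<^esub> lincomb M n b r"
proof -
 have "lincomb M n b (%i. \<ominus> r i) = lincomb M n b (%i. \<ominus> \<one> \<otimes> r i)"
  by (rule lincomb_cong[OF b]) (use r R.l_minus in \<open>auto simp: Pi_iff\<close>)
 also have "\<dots> = \<ominus> \<one> \<odot>[M] lincomb M n b r" by (rule lincomb_smult[OF b r]) simp
 also have "\<dots> = \<ominus>\<^bsub>M\<^esub> lincomb M n b r" using lincomb_closed[OF b r] by (simp add: smult_l_minus smult_one)
 finally show ?thesis .
qed

lemma lincomb_zero: "b : {..<n} \<rightarrow> carrier M ==> lincomb M n b (%_. \<zero>) = \<zero>[M]"
proof -
 assume b: "b : {..<n} \<rightarrow> carrier M"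
 then have "lincomb M n b (%_. \<zero>) = (\<Oplus>\<^bsub>M\<^esub>i\<in>{..<n}. \<zero>[M])"
  unfolding lincomb_def by (intro M.finsum_cong') (auto simp: Pi_iff)
 then show ?thesis by simp
qed

lemma lincomb_Suc:
 assumes b: "b : {..<Suc n} \<rightarrow> carrier M" and r: "r : {..<Suc n} \<rightarrow> carrier R"
 shows "lincomb M (Suc n) b r = r n \<odot>[M] b n \<oplus>[M] lincomb M n b r"
 unfolding lincomb_def lessThan_Suc
 by (rule M.finsum_insert) (use b r in \<open>auto simp: Pi_iff\<close>)

text \<open>In coordinates the submodule is I^n. Membership is tested in every coordinate, and
  adding x M to it replaces I by I + xR.\<close>

lemma free_regular:
 assumes fb: "free_basis R M n b" and "ideal I R" "set xs \<subseteq> carrier R" "strict_regseq R I xs"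
 shows "module_regular M {lincomb M n b r | r. r : {..<n} \<rightarrow> I} xs"
 using assms(2-)
proof (induction xs arbitrary: I)
 case (Cons x xs)
 have b: "b : {..<n} \<rightarrow> carrier M" and span: "!!m. m : carrier M ==> \<exists>r. r : {..<n} \<rightarrow> carrier R \<and> m = lincomb M n b r"
  and ind: "!!r i. r : {..<n} \<rightarrow> carrier R ==> lincomb M n b r = \<zero>[M] ==> i < n ==> r i = \<zero>"
  using fb unfolding free_basis_def by auto
 define N where "N = (%I. {lincomb M n b r | r. r : {..<n} \<rightarrow> I})"
 have x: "x : carrier R" using Cons.prems by simp
 note i = ideal_facts[OF Cons.prems(1)]
 have IR: "r : {..<n} \<rightarrow> carrier R" if "r : {..<n} \<rightarrow> I" for r using that i(1) by auto
 have reg: "m : N I" if m: "m : carrier M" "x \<odot>[M] m : N I" for m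
 proof -
  obtain r where r: "r : {..<n} \<rightarrow> carrier R" "m = lincomb M n b r" using span[OF m(1)] by blast
  obtain s where s: "s : {..<n} \<rightarrow> I" "x \<odot>[M] m = lincomb M n b s" using m(2) unfolding N_def by blast
  have xr: "(%i. x \<otimes> r i) : {..<n} \<rightarrow> carrier R" using r(1) x by auto
  have ms: "(%i. \<ominus> s i) : {..<n} \<rightarrow> carrier R" using IR[OF s(1)] by auto
  have "lincomb M n b (%i. x \<otimes> r i \<oplus> \<ominus> s i) = x \<odot>[M] m \<oplus>[M] \<ominus>\<^bsub>M\<^esub> lincomb M n b s"
   using lincomb_add[OF b xr ms] lincomb_smult[OF b r(1) x] lincomb_minus[OF b IR[OF s(1)]] r(2) by simp
  also have "\<dots> = \<zero>[M]" unfolding s(2) using lincomb_closed[OF b IR[OF s(1)]] by (simp add: M.r_neg)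
  finally have z: "x \<otimes> r i \<oplus> \<ominus> s i = \<zero>" if "i < n" for i
   using ind[of "%i. x \<otimes> r i \<oplus> \<ominus> s i" i] xr ms that by (auto simp: Pi_iff)
  have "r i : I" if "i < n" for i
  proof -
   have ri: "r i : carrier R" "s i : carrier R" "s i : I" using r(1) IR[OF s(1)] s(1) that by auto
   have "x \<otimes> r i = s i" using z[OF that] ri x R.r_right_minus_eq[of "x \<otimes> r i" "s i"] by (simp add: R.minus_eq)
   then show ?thesis using Cons.prems(3) ri by auto
  qed
  then show ?thesis unfolding N_def using r(2) by auto
 qed
 have "madj M (N I) x = N (adj R I x)"
 proof
  show "madj M (N I) x \<subseteq> N (adj R I x)"
  proof
   fix y assume "y : madj M (N I) x"
   then obtain s m where s: "s : {..<n} \<rightarrow> I" and m: "m : carrier M" and y: "y = lincomb M n b s \<oplus>[M] x \<odot>[M] m"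
    unfolding madj_def N_def by blast
   obtain r where r: "r : {..<n} \<rightarrow> carrier R" "m = lincomb M n b r" using span[OF m] by blast
   have xr: "(%i. x \<otimes> r i) : {..<n} \<rightarrow> carrier R" using r(1) x by auto
   have "y = lincomb M n b (%i. s i \<oplus> x \<otimes> r i)"
    unfolding y r(2) using lincomb_add[OF b IR[OF s] xr] lincomb_smult[OF b r(1) x] by simp
   moreover have "(%i. s i \<oplus> x \<otimes> r i) : {..<n} \<rightarrow> adj R I x"
    by (rule Pi_I, rule adjI) (use s r(1) in auto)
   ultimately show "y : N (adj R I x)" unfolding N_def by blast
  qed
  show "N (adj R I x) \<subseteq> madj M (N I) x"
  proof
   fix y assume "y : N (adj R I x)"
   then obtain r where r: "r : {..<n} \<rightarrow> adj R I x" "y = lincomb M n b r" unfolding N_def by blast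
   have "\<forall>i\<in>{..<n}. \<exists>s a. s : I \<and> a : carrier R \<and> r i = s \<oplus> x \<otimes> a"
    using r(1) unfolding adj_def by (auto simp: Pi_iff)
   then obtain s a where sa: "!!i. i < n ==> s i : I \<and> a i : carrier R \<and> r i = s i \<oplus> x \<otimes> a i"
    by (metis lessThan_iff)
   have s: "s : {..<n} \<rightarrow> I" and a: "a : {..<n} \<rightarrow> carrier R" using sa by auto
   have xa: "(%i. x \<otimes> a i) : {..<n} \<rightarrow> carrier R" using a x by auto
   have "y = lincomb M n b (%i. s i \<oplus> x \<otimes> a i)"
    unfolding r(2) by (rule lincomb_cong[OF b]) (use sa IR[OF s] xa in auto)
   also have "\<dots> = lincomb M n b s \<oplus>[M] x \<odot>[M] lincomb M n b a"
    using lincomb_add[OF b IR[OF s] xa] lincomb_smult[OF b a x] by simp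
   finally show "y : madj M (N I) x" unfolding madj_def N_def using s lincomb_closed[OF b a] by blast
  qed
 qed
 then have "module_regular M (madj M (N I) x) xs"
  using Cons.IH[OF R.adj_ideal(1)[OF Cons.prems(1) x]] Cons.prems unfolding N_def by simp
 then show ?case using reg unfolding N_def by simp
qed simp

lemma free_regular_zero:
 assumes fb: "free_basis R M n b" and "set xs \<subseteq> carrier R" "strict_regseq R {\<zero>} xs"
 shows "module_regular M {\<zero>[M]} xs"
proof -
 have b: "b : {..<n} \<rightarrow> carrier M" using fb unfolding free_basis_def by simp
 have z: "lincomb M n b r = \<zero>[M]" if "r : {..<n} \<rightarrow> {\<zero>}" for r
  using lincomb_cong[OF b, of "%_. \<zero>" r] lincomb_zero[OF b] that by auto
 have "{lincomb M n b r | r. r : {..<n} \<rightarrow> {\<zero>}} = {\<zero>[M]}"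
 proof (intro equalityI subsetI)
  fix m assume "m : {\<zero>[M]}"
  then have "m = lincomb M n b (%_. \<zero>) \<and> (%_. \<zero>) : {..<n} \<rightarrow> {\<zero>}" using z by simp
  then show "m : {lincomb M n b r | r. r : {..<n} \<rightarrow> {\<zero>}}" by (intro CollectI exI)
 qed (use z in auto)
 then show ?thesis using free_regular[OF fb R.zeroideal assms(2,3)] by simp
qed

text \<open>Away from \<open>f\<close>, the module is free over \<open>R / p\<close>, and \<open>s\<close> makes \<open>R / p\<close> and \<open>R\<close> agree.
 The basis is a maximal independent family taken from a finite set of generators.\<close>

lemma generic_freeness:
 assumes p: "primeideal p R" and s: "s : carrier R - p" "!!a. a : p ==> s \<otimes> a = \<zero>"
  and G: "finite G" "G \<subseteq> carrier M" "!!N. submodule N R M ==> G \<subseteq> N ==> N = carrier M"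
 shows "\<exists>f n b. f : carrier R - p \<and> b : {..<n} \<rightarrow> carrier M \<and>
   (\<forall>m\<in>carrier M. \<exists>r. r : {..<n} \<rightarrow> carrier R \<and> f \<odot>[M] m = lincomb M n b r) \<and>
   (\<forall>r. r : {..<n} \<rightarrow> carrier R --> lincomb M n b r = \<zero>[M] --> (\<forall>i<n. r i : p))"
proof -
 note pf = ideal_facts[OF primeideal_facts(1)[OF p]]
 \<comment> \<open>Linear independence over R/p of a family drawn from G: a vanishing combination
   has all its coefficients in p.\<close>
 define Ind where "Ind = (%n b. b : {..<n} \<rightarrow> G \<and>
   (\<forall>r. r : {..<n} \<rightarrow> carrier R --> lincomb M n b r = \<zero>[M] --> (\<forall>i<n. r i : p)))"
 \<comment> \<open>Two equal members would give a relation with coefficients 1 and -1, but 1 is not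
   in p. So the members are distinct, the length is at most the size of G, and a longest family
   exists.\<close>
 have bd: "n \<le> card G" if I: "Ind n b" for n b
 proof -
  have bG: "b : {..<n} \<rightarrow> G" and bM: "b : {..<n} \<rightarrow> carrier M" using I G(2) unfolding Ind_def by auto
  have "inj_on b {..<n}"
  proof (rule inj_onI, rule ccontr)
   fix i j assume ij: "i : {..<n}" "j : {..<n}" "b i = b j" "i ~= j"
   define r where "r = (%l. if l = i then \<one> else if l = j then \<ominus> \<one> else \<zero>)"
   have r: "r : {..<n} \<rightarrow> carrier R" unfolding r_def by auto
   note t = lincomb_terms[OF bM r]
   have bi: "b i : carrier M" using ij(1) bM by auto
   have "lincomb M n b r = (\<Oplus>\<^bsub>M\<^esub>l\<in>{i, j}. r l \<odot>[M] b l)"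
    unfolding lincomb_def
    by (rule M.add.finprod_mono_neutral_cong_right) (use ij t bM in \<open>auto simp: r_def Pi_iff\<close>)
   also have "\<dots> = r i \<odot>[M] b i \<oplus>[M] r j \<odot>[M] b j"
    using ij bi by (simp add: r_def)
   also have "\<dots> = \<zero>[M]" using ij(3,4) bi by (simp add: r_def smult_l_minus M.r_neg smult_one)
   finally have "r i : p" using I r ij(1) unfolding Ind_def by blast
   then show False using primeideal_facts(4)[OF p] by (simp add: r_def)
  qed
  then show ?thesis using card_inj_on_le[of b "{..<n}" G] bG G(1) by auto
 qed
 have "Ind 0 undefined" unfolding Ind_def by simp
 then have ex: "\<exists>n. (\<exists>b. Ind n b)" by blast
 define n where "n = (GREATEST n. \<exists>b. Ind n b)"
 have "\<exists>b. Ind n b" unfolding n_def by (rule GreatestI_ex_nat[OF ex, of "card G"]) (use bd in blast)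
 then obtain b where I: "Ind n b" by blast
 have max: "\<not> Ind (Suc n) b'" for b'
 proof
  assume "Ind (Suc n) b'"
  then have "Suc n \<le> n" unfolding n_def
   by (intro Greatest_le_nat[of _ _ "card G"]) (use bd in blast)+
  then show False by simp
 qed
 have bG: "b : {..<n} \<rightarrow> G" and b: "b : {..<n} \<rightarrow> carrier M" using I G(2) unfolding Ind_def by auto
 have ind: "!!r i. r : {..<n} \<rightarrow> carrier R ==> lincomb M n b r = \<zero>[M] ==> i < n ==> r i : p"
  using I unfolding Ind_def by blast
 define sp where "sp = {lincomb M n b r | r. r : {..<n} \<rightarrow> carrier R}"
 have sp_smult: "a \<odot>[M] m : sp" if a: "a : carrier R" and m: "m : sp" for a m
 proof -
  obtain r where r: "r : {..<n} \<rightarrow> carrier R" "m = lincomb M n b r" using m unfolding sp_def by blast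
  have "(%i. a \<otimes> r i) : {..<n} \<rightarrow> carrier R" using r(1) a by auto
  then show ?thesis unfolding sp_def r(2) using lincomb_smult[OF b r(1) a] by (metis (mono_tags, lifting) mem_Collect_eq)
 qed
 have sp_add: "m \<oplus>[M] m' : sp" if m: "m : sp" "m' : sp" for m m'
 proof -
  obtain r where r: "r : {..<n} \<rightarrow> carrier R" "m = lincomb M n b r" using m(1) unfolding sp_def by blast
  obtain r' where r': "r' : {..<n} \<rightarrow> carrier R" "m' = lincomb M n b r'" using m(2) unfolding sp_def by blast
  have "(%i. r i \<oplus> r' i) : {..<n} \<rightarrow> carrier R" using r(1) r'(1) by auto
  then show ?thesis unfolding sp_def r(2) r'(2) using lincomb_add[OF b r(1) r'(1)] by (metis (mono_tags, lifting) mem_Collect_eq)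
 qed
 have sp_zero: "\<zero>[M] : sp"
 proof -
  have "(%_. \<zero>) : {..<n} \<rightarrow> carrier R" by simp
  then show ?thesis unfolding sp_def using lincomb_zero[OF b] by (metis (mono_tags, lifting) mem_Collect_eq)
 qed
 have sp_carrier: "sp \<subseteq> carrier M" unfolding sp_def using lincomb_closed[OF b] by blast
 \<comment> \<open>Appending g destroys independence. In the resulting relation the coefficient of g
   is outside p, so this multiple of g lies in the span.\<close>
 have gen: "\<exists>a\<in>carrier R - p. a \<odot>[M] g : sp" if g: "g : G" for g
 proof -
  have gM: "g : carrier M" using g G(2) by blast
  define b' where "b' = b(n := g)"
  have b'G: "b' : {..<Suc n} \<rightarrow> G" using bG g unfolding b'_def by (auto simp: Pi_iff less_Suc_eq)
  then have b'M: "b' : {..<Suc n} \<rightarrow> carrier M" using G(2) by auto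
  obtain r j where r: "r : {..<Suc n} \<rightarrow> carrier R" "lincomb M (Suc n) b' r = \<zero>[M]" "j < Suc n" "r j ~: p"
   using max[of b'] b'G unfolding Ind_def by blast
  have rn: "r n : carrier R" "r : {..<n} \<rightarrow> carrier R" using r(1) by auto
  have l: "lincomb M n b' r = lincomb M n b r"
   unfolding lincomb_def by (rule M.finsum_cong'[OF refl lincomb_terms[OF b rn(2)]]) (simp add: b'_def)
  have lc: "lincomb M n b r : carrier M" by (rule lincomb_closed[OF b rn(2)])
  have eq: "r n \<odot>[M] g \<oplus>[M] lincomb M n b r = \<zero>[M]"
   using lincomb_Suc[OF b'M r(1)] r(2) l by (simp add: b'_def)
  \<comment> \<open>If the coefficient of g were in p, then s would kill it, and s times the
    relation would involve the members of b alone. All products of s with the remaining coefficients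
    would lie in p, hence so would these coefficients, against the choice of r.\<close>
  have "r n ~: p"
  proof
   assume rp: "r n : p"
   have sR: "s : carrier R" using s(1) by simp
   have "s \<odot>[M] (r n \<odot>[M] g) = \<zero>[M]" using s(2)[OF rp] rn(1) gM sR by (metis smult_assoc1 smult_l_null)
   then have "s \<odot>[M] lincomb M n b r = \<zero>[M]"
    using arg_cong[OF eq, of "%m. s \<odot>[M] m"] rn(1) gM sR lc by (simp add: smult_r_distr)
   then have z: "lincomb M n b (%i. s \<otimes> r i) = \<zero>[M]" using lincomb_smult[OF b rn(2) sR] by simp
   have "(%i. s \<otimes> r i) : {..<n} \<rightarrow> carrier R" using rn(2) sR by auto
   from ind[OF this z] have srp: "s \<otimes> r i : p" if "i < n" for i using that by simp
   have "r i : p" if "i < n" for i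
   proof -
    have ri: "r i : carrier R" using rn(2) that by auto
    show ?thesis using primeideal_facts(5)[OF p sR ri srp[OF that]] s(1) by blast
   qed
   then show False using r(3,4) rp less_Suc_eq by metis
  qed
  moreover have "r n \<odot>[M] g : sp"
  proof -
   have "r n \<odot>[M] g = \<ominus>\<^bsub>M\<^esub> lincomb M n b r" using eq rn(1) gM lc by (metis M.minus_equality smult_closed)
   also have "\<dots> = \<ominus> \<one> \<odot>[M] lincomb M n b r" using lc by (simp add: smult_l_minus smult_one)
   also have "\<dots> : sp" by (rule sp_smult) (use rn(2) sp_def in auto)
   finally show ?thesis .
  qed
  ultimately show ?thesis using rn(1) by blast
 qed
 have "\<exists>f\<in>carrier R - p. \<forall>g\<in>F. f \<odot>[M] g : sp" if "finite F" "F \<subseteq> G" for F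
  using that
 proof (induction F)
  case empty
  have "\<one> : carrier R - p" using primeideal_facts(4)[OF p] by simp
  then show ?case by blast
 next
  case (insert g F)
  then obtain f where f: "f : carrier R - p" "\<forall>g\<in>F. f \<odot>[M] g : sp" by auto
  obtain a where a: "a : carrier R - p" "a \<odot>[M] g : sp" using gen[of g] insert.prems by blast
  have M: "h : carrier M" if "h : insert g F" for h using that insert.prems G(2) by blast
  have "(f \<otimes> a) \<odot>[M] h : sp" if h: "h : insert g F" for h
  proof (cases "h = g")
   case True
   have "(f \<otimes> a) \<odot>[M] g = f \<odot>[M] (a \<odot>[M] g)" using f(1) a(1) M by (simp add: smult_assoc1)
   then show ?thesis using True sp_smult a(2) f(1) by simp
  next
   case False
   have "(f \<otimes> a) \<odot>[M] h = (a \<otimes> f) \<odot>[M] h" using f(1) a(1) by (simp add: R.m_comm)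
   also have "\<dots> = a \<odot>[M] (f \<odot>[M] h)" using f(1) a(1) M[OF h] by (simp add: smult_assoc1)
   finally show ?thesis using False h sp_smult f(2) a(1) by simp
  qed
  then show ?case using primeideal_facts(6)[OF p f(1) a(1)] by blast
 qed
 from this[OF G(1)] obtain f where f: "f : carrier R - p" "\<forall>g\<in>G. f \<odot>[M] g : sp" by blast
 have fR: "f : carrier R" using f(1) by simp
 define N where "N = {m : carrier M. f \<odot>[M] m : sp}"
 have Na: "a \<odot>[M] m : N" if a: "a : carrier R" and m: "m : N" for a m
 proof -
  have mM: "m : carrier M" "f \<odot>[M] m : sp" using m unfolding N_def by auto
  have "f \<odot>[M] (a \<odot>[M] m) = a \<odot>[M] (f \<odot>[M] m)"
   using a mM(1) fR smult_assoc1[of f a m] smult_assoc1[of a f m] by (simp add: R.m_comm)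
  then show ?thesis unfolding N_def using sp_smult[OF a mM(2)] a mM(1) by simp
 qed
 have "submodule N R M"
 proof (rule submoduleI)
  show "N \<subseteq> carrier M" unfolding N_def by blast
  show "\<zero>[M] : N" unfolding N_def using sp_zero fR by simp
  show "\<ominus>\<^bsub>M\<^esub> a : N" if "a : N" for a
  proof -
   have "a : carrier M" using that unfolding N_def by blast
   then have "\<ominus> \<one> \<odot>[M] a = \<ominus>\<^bsub>M\<^esub> a" by (simp add: smult_l_minus smult_one)
   then show ?thesis using Na[OF _ that, of "\<ominus> \<one>"] by simp
  qed
  show "a \<oplus>[M] c : N" if "a : N" "c : N" for a c
   using that sp_add fR unfolding N_def by (simp add: smult_r_distr)
  show "a \<odot>[M] m : N" if "a : carrier R" "m : N" for a m using Na that by blast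
 qed
 moreover have "G \<subseteq> N" unfolding N_def using f(2) G(2) by blast
 ultimately have NM: "N = carrier M" by (rule G(3))
 have "\<forall>m\<in>carrier M. \<exists>r. r : {..<n} \<rightarrow> carrier R \<and> f \<odot>[M] m = lincomb M n b r"
 proof
  fix m assume "m : carrier M"
  then have "f \<odot>[M] m : sp" using NM unfolding N_def by blast
  then show "\<exists>r. r : {..<n} \<rightarrow> carrier R \<and> f \<odot>[M] m = lincomb M n b r" unfolding sp_def by blast
 qed
 then show ?thesis using f(1) b ind by (intro exI[of _ f] exI[of _ n] exI[of _ b]) simp
qed

end

section \<open>Localization of modules\<close>

locale module_localization = ring_localization R R' f S + M: module R M + M': module R' M'
 for R (structure) and R' :: "('r, 'n) ring_scheme" and f :: "'a \<Rightarrow> 'r" and S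
  and M :: "('a, 'm, 'x) module_scheme" and M' :: "('r, 'l, 'y) module_scheme" +
 fixes g :: "'m \<Rightarrow> 'l"
 assumes g_closed: "!!m. m : carrier M ==> g m : carrier M'"
  and g_add: "!!m n. m : carrier M ==> n : carrier M ==> g (m \<oplus>[M] n) = g m \<oplus>[M'] g n"
  and g_smult: "!!a m. a : carrier R ==> m : carrier M ==> g (a \<odot>[M] m) = f a \<odot>[M'] g m"
  and g_surj: "!!c. c : carrier M' ==> \<exists>s\<in>S. \<exists>m\<in>carrier M. f s \<odot>[M'] c = g m"
  and g_inj: "!!m. m : carrier M ==> g m = \<zero>[M'] ==> \<exists>s\<in>S. s \<odot>[M] m = \<zero>[M]"
begin

lemma g_zero: "g \<zero>[M] = \<zero>[M']"
 using g_smult[of \<zero> "\<zero>[M]"] g_closed[of "\<zero>[M]"] by simp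

lemma cancel_module:
 assumes "s : S" "c : carrier M'"
 shows "inv\<^bsub>R'\<^esub> (f s) : carrier R'" "inv\<^bsub>R'\<^esub> (f s) \<odot>[M'] (f s \<odot>[M'] c) = c"
proof -
 show i: "inv\<^bsub>R'\<^esub> (f s) : carrier R'" using f_unit[OF assms(1)] by simp
 show "inv\<^bsub>R'\<^esub> (f s) \<odot>[M'] (f s \<odot>[M'] c) = c"
  using f_unit[OF assms(1)] i fS_closed[OF assms(1)] assms(2) M'.smult_assoc1[symmetric]
  by (simp add: M'.smult_one)
qed

lemma trivial_transfer:
 assumes "carrier M = {\<zero>[M]}" shows "carrier M' = {\<zero>[M']}"
proof -
 have "c = \<zero>[M']" if c: "c : carrier M'" for c
 proof -
  obtain s m where s: "s : S" "m : carrier M" "f s \<odot>[M'] c = g m" using g_surj[OF c] by blast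
  then have "f s \<odot>[M'] c = \<zero>[M']" using assms g_zero by simp
  then show ?thesis using cancel_module[OF s(1) c] by simp
 qed
 then show ?thesis by auto
qed

text \<open>The preimage of N is a submodule containing G, hence all of M; since every element of
  \<open>M'\<close> is a fraction of an image, N is everything.\<close>

lemma generators_transfer:
 assumes G: "finite G" "G \<subseteq> carrier M" "!!N. submodule N R M ==> G \<subseteq> N ==> N = carrier M"
  and N: "submodule N R' M'" "g ` G \<subseteq> N"
 shows "N = carrier M'"
proof
 note n = M'.submoduleE[OF N(1)]
 show "N \<subseteq> carrier M'" by (rule n(1))
 define N0 where "N0 = {m : carrier M. g m : N}"
 have N0: "a \<odot>[M] m : N0" if "a : carrier R" "m : N0" for a m
  using that n(4)[of "f a" "g m"] unfolding N0_def by (simp add: g_smult)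
 have z: "\<zero>[M'] : N"
 proof -
  obtain y where y: "y : N" using n(2) by blast
  then have "\<zero>[R'] \<odot>[M'] y : N" using n(4) by simp
  then show ?thesis using y n(1) by auto
 qed
 have "submodule N0 R M"
 proof (rule M.submoduleI)
  show "N0 \<subseteq> carrier M" unfolding N0_def by blast
  show "\<zero>[M] : N0" unfolding N0_def using g_zero z by simp
  show "\<ominus>\<^bsub>M\<^esub> a : N0" if "a : N0" for a
  proof -
   have "a : carrier M" using that unfolding N0_def by blast
   then have "\<ominus> \<one> \<odot>[M] a = \<ominus>\<^bsub>M\<^esub> a" by (simp add: M.smult_l_minus M.smult_one)
   then show ?thesis using N0[OF _ that, of "\<ominus> \<one>"] by simp
  qed
  show "a \<oplus>[M] c : N0" if "a : N0" "c : N0" for a c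
   using that n(5) unfolding N0_def by (simp add: g_add)
  show "a \<odot>[M] m : N0" if "a : carrier R" "m : N0" for a m using N0 that by blast
 qed
 moreover have "G \<subseteq> N0" unfolding N0_def using N(2) G(2) by blast
 ultimately have N0M: "N0 = carrier M" by (rule G(3))
 show "carrier M' \<subseteq> N"
 proof
  fix c assume c: "c : carrier M'"
  obtain s m where s: "s : S" "m : carrier M" "f s \<odot>[M'] c = g m" using g_surj[OF c] by blast
  have "g m : N" using s(2) N0M unfolding N0_def by blast
  then have "inv\<^bsub>R'\<^esub> (f s) \<odot>[M'] (f s \<odot>[M'] c) : N" using n(4) cancel_module(1)[OF s(1) c] s(3) by simp
  then show "c : N" using cancel_module(2)[OF s(1) c] by simp
 qed
qed

lemma g_lincomb:
 assumes b: "b : {..<n} \<rightarrow> carrier M" and r: "r : {..<n} \<rightarrow> carrier R"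
 shows "g (lincomb M n b r) = lincomb M' n (%i. g (b i)) (%i. f (r i))"
 using assms
proof (induction n)
 case 0
 show ?case by (simp add: lincomb_def g_zero)
next
 case (Suc n)
 have b': "b : {..<n} \<rightarrow> carrier M" and r': "r : {..<n} \<rightarrow> carrier R" using Suc.prems by auto
 have gb: "(%i. g (b i)) : {..<Suc n} \<rightarrow> carrier M'" and fr: "(%i. f (r i)) : {..<Suc n} \<rightarrow> carrier R'"
  using Suc.prems g_closed by (auto simp: Pi_iff)
 have "b n : carrier M" "r n : carrier R" using Suc.prems by auto
 then have "g (lincomb M (Suc n) b r) = f (r n) \<odot>[M'] g (b n) \<oplus>[M'] g (lincomb M n b r)"
  unfolding M.lincomb_Suc[OF Suc.prems] using M.lincomb_closed[OF b' r'] by (simp add: g_add g_smult)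
 then show ?case unfolding M'.lincomb_Suc[OF gb fr] Suc.IH[OF b' r'] .
qed

lemma common_denominator:
 assumes "r : {..<n::nat} \<rightarrow> carrier R'"
 shows "\<exists>t\<in>S. \<forall>i<n. \<exists>a\<in>carrier R. f t \<otimes>[R'] r i = f a"
 using assms
proof (induction n)
 case 0
 show ?case using S_one by auto
next
 case (Suc n)
 have "r : {..<n} \<rightarrow> carrier R'" using Suc.prems by auto
 from Suc.IH[OF this] obtain t where t: "t : S" "\<forall>i<n. \<exists>a\<in>carrier R. f t \<otimes>[R'] r i = f a" by blast
 have rn: "r n : carrier R'" using Suc.prems by auto
 obtain u a where u: "u : S" "a : carrier R" "f u \<otimes>[R'] r n = f a" using f_surj[OF rn] by blast
 have tu: "f (t \<otimes> u) = f t \<otimes>[R'] f u" using t u S_carrier by simp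
 have c: "f t : carrier R'" "f u : carrier R'" using fS_closed t u by auto
 have "\<exists>a\<in>carrier R. f (t \<otimes> u) \<otimes>[R'] r i = f a" if i: "i < Suc n" for i
 proof (cases "i = n")
  case True
  have "f (t \<otimes> u) \<otimes>[R'] r n = f (t \<otimes> a)"
   using tu c rn u S_carrier[OF t(1)] by (simp add: L.m_assoc)
  then show ?thesis using True S_carrier[OF t(1)] u(2) R.m_closed by blast
 next
  case False
  then have "i < n" using i by simp
  then obtain d where d: "d : carrier R" "f t \<otimes>[R'] r i = f d" using t(2) by blast
  have ri: "r i : carrier R'" using Suc.prems i by auto
  have "f (t \<otimes> u) \<otimes>[R'] r i = f u \<otimes>[R'] (f t \<otimes>[R'] r i)" using tu c ri by (simp add: L.m_ac)
  also have "\<dots> = f (u \<otimes> d)" using d S_carrier[OF u(1)] by simp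
  finally show ?thesis using S_carrier[OF u(1)] d(1) R.m_closed by blast
 qed
 then show ?case using S_mult[OF t(1) u(1)] by blast
qed

text \<open>The element h becomes invertible, so the span becomes the whole module. Independence is
  demanded only for the images of the coefficients in \<open>R'\<close>: in this way independence
  modulo a prime that dies in \<open>R'\<close> turns into independence over
  \<open>R'\<close>.\<close>

lemma localized_basis:
 assumes h: "h : S" and b: "b : {..<n} \<rightarrow> carrier M"
  and span: "!!m. m : carrier M ==> \<exists>r. r : {..<n} \<rightarrow> carrier R \<and> h \<odot>[M] m = lincomb M n b r"
  and ind: "!!r i. r : {..<n} \<rightarrow> carrier R ==> lincomb M n b r = \<zero>[M] ==> i < n ==> f (r i) = \<zero>[R']"
 shows "free_basis R' M' n (%i. g (b i))"
 unfolding free_basis_def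
proof (intro conjI ballI allI impI)
 let ?b = "%i. g (b i)"
 show gb: "?b : {..<n} \<rightarrow> carrier M'" using b g_closed by auto
 fix c assume c: "c : carrier M'"
 obtain s m where s: "s : S" "m : carrier M" "f s \<odot>[M'] c = g m" using g_surj[OF c] by blast
 obtain r where r: "r : {..<n} \<rightarrow> carrier R" "h \<odot>[M] m = lincomb M n b r" using span[OF s(2)] by blast
 have fr: "(%i. f (r i)) : {..<n} \<rightarrow> carrier R'" using r(1) by auto
 have hs: "h \<otimes> s : S" using S_mult h s(1) by blast
 have "f (h \<otimes> s) \<odot>[M'] c = f h \<odot>[M'] (f s \<odot>[M'] c)"
  using h s(1) c S_carrier fS_closed by (simp add: M'.smult_assoc1)
 also have "\<dots> = g (h \<odot>[M] m)" using s g_smult S_carrier[OF h] by simp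
 finally have e: "f (h \<otimes> s) \<odot>[M'] c = lincomb M' n ?b (%i. f (r i))" unfolding r(2) g_lincomb[OF b r(1)] .
 note k = cancel_module[OF hs c]
 have "c = lincomb M' n ?b (%i. inv\<^bsub>R'\<^esub> (f (h \<otimes> s)) \<otimes>[R'] f (r i))"
  using k(2) unfolding e M'.lincomb_smult[OF gb fr k(1)] by simp
 moreover have "(%i. inv\<^bsub>R'\<^esub> (f (h \<otimes> s)) \<otimes>[R'] f (r i)) : {..<n} \<rightarrow> carrier R'" using fr k(1) by (auto simp: Pi_iff)
 ultimately show "\<exists>r. r : {..<n} \<rightarrow> carrier R' \<and> c = lincomb M' n ?b r" by blast
next
 let ?b = "%i. g (b i)"
 have gb: "?b : {..<n} \<rightarrow> carrier M'" using b g_closed by auto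
 fix r i assume r: "r : {..<n} \<rightarrow> carrier R'" "lincomb M' n ?b r = \<zero>[M']" and i: "i < n"
 obtain t where t: "t : S" "\<forall>i<n. \<exists>a\<in>carrier R. f t \<otimes>[R'] r i = f a" using common_denominator[OF r(1)] by blast
 then obtain a where a: "!!i. i < n ==> a i : carrier R \<and> f t \<otimes>[R'] r i = f (a i)" by metis
 have aR: "a : {..<n} \<rightarrow> carrier R" using a by auto
 have fa: "(%i. f (a i)) : {..<n} \<rightarrow> carrier R'" using aR by auto
 have ft: "f t : carrier R'" using fS_closed t(1) .
 have "g (lincomb M n b a) = lincomb M' n ?b (%i. f (a i))" by (rule g_lincomb[OF b aR])
 also have "\<dots> = lincomb M' n ?b (%i. f t \<otimes>[R'] r i)"
  by (rule M'.lincomb_cong[OF gb, symmetric]) (use a fa in auto)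
 also have "\<dots> = \<zero>[M']" unfolding M'.lincomb_smult[OF gb r(1) ft] r(2) using ft by simp
 finally obtain u where u: "u : S" "u \<odot>[M] lincomb M n b a = \<zero>[M]" using g_inj M.lincomb_closed[OF b aR] by blast
 have uR: "u : carrier R" using S_carrier u(1) .
 have ua: "(%i. u \<otimes> a i) : {..<n} \<rightarrow> carrier R" using aR uR by auto
 have "f (u \<otimes> a i) = \<zero>[R']"
  using ind[OF ua _ i] u(2) M.lincomb_smult[OF b aR uR] by simp
 moreover have ri: "r i : carrier R'" using r(1) i by auto
 ultimately have "f u \<otimes>[R'] (f t \<otimes>[R'] r i) = f u \<otimes>[R'] \<zero>[R']" using a[OF i] uR fS_closed[OF u(1)] by simp
 then have "f t \<otimes>[R'] r i = \<zero>[R']" using cancel_unit[OF u(1)] ri ft by simp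
 then have "f t \<otimes>[R'] r i = f t \<otimes>[R'] \<zero>[R']" using ft by simp
 then show "r i = \<zero>[R']" using cancel_unit[OF t(1)] ri by simp
qed

end

section \<open>Cohomology of complexes\<close>

lemma comm_group_cong:
 fixes G :: "('a, 'y) monoid_scheme" and H :: "('a, 'z) monoid_scheme"
 assumes "comm_group G" "carrier H = carrier G" "monoid.mult H = monoid.mult G" "\<one>[H] = \<one>[G]"
 shows "comm_group H"
proof -
 interpret G: comm_group G by fact
 show ?thesis
 proof (rule comm_groupI)
  fix x assume "x : carrier H"
  then show "\<exists>y\<in>carrier H. y \<otimes>[H] x = \<one>[H]" using G.l_inv_ex assms by auto
 qed (use assms G.m_assoc G.m_comm in auto)
qed

locale complex =
 fixes C :: "('a, 'z) cochain_scheme"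
 assumes complex: "cochain_complex C"
begin

lemma cpt_comm_group: "comm_group (cpt C n)"
 using complex unfolding cochain_complex_def by blast

lemma cpt_group: "group (cpt C n)" using cpt_comm_group comm_group_def by blast

sublocale G: comm_group "cpt C n" for n by (rule cpt_comm_group)

lemma dif_hom: "dif C n : hom (cpt C n) (cpt C (n + 1))"
 using complex unfolding cochain_complex_def by blast

lemma dif_closed [simp]: "x : elts C n ==> dif C n x : elts C (n + 1)"
 using dif_hom unfolding hom_def by blast

lemma dif_mult: "x : elts C n ==> y : elts C n ==>
  dif C n (x \<otimes>[cpt C n] y) = dif C n x \<otimes>[cpt C (n + 1)] dif C n y"
 using dif_hom unfolding hom_def by blast

lemma dif_one: "dif C n \<one>[cpt C n] = \<one>[cpt C (n + 1)]"
 using hom_one[OF dif_hom cpt_group cpt_group] .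

lemma dif_inv: "x : elts C n ==> dif C n (inv\<^bsub>cpt C n\<^esub> x) = inv\<^bsub>cpt C (n + 1)\<^esub> dif C n x"
 using group_hom.hom_inv[of "cpt C n" "cpt C (n + 1)" "dif C n" x] cpt_group dif_hom
 by (simp add: group_hom_def group_hom_axioms_def)

lemma dif_dif: "x : elts C n ==> dif C (n + 1) (dif C n x) = \<one>[cpt C (n + 1 + 1)]"
 using complex unfolding cochain_complex_def by blast

lemma cocycles_iff: "z : cocycles C n \<longleftrightarrow> z : elts C n \<and> dif C n z = \<one>[cpt C (n + 1)]"
 unfolding cocycles_def kernel_def by simp

lemma cocycles_carrier: "z : cocycles C n ==> z : elts C n" by (simp add: cocycles_iff)

lemma cocycles_mult: "z : cocycles C n ==> w : cocycles C n ==> z \<otimes>[cpt C n] w : cocycles C n"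
 by (simp add: cocycles_iff dif_mult)

lemma cocycles_one: "\<one>[cpt C n] : cocycles C n" by (simp add: cocycles_iff dif_one)

lemma cocycles_inv: "z : cocycles C n ==> inv\<^bsub>cpt C n\<^esub> z : cocycles C n"
 by (simp add: cocycles_iff dif_inv)

lemma coboundariesI: "x : elts C (n - 1) ==> dif C (n - 1) x : coboundaries C n"
 unfolding coboundaries_def by blast

lemma coboundariesI': "x : elts C m ==> m + 1 = n ==> dif C m x : coboundaries C n"
 using coboundariesI[of x n] by auto

lemma coboundariesE:
 assumes "b : coboundaries C n"
 obtains x where "x : elts C (n - 1)" "b = dif C (n - 1) x"
 using assms unfolding coboundaries_def by blast

lemma coboundaries_cocycles: "b : coboundaries C n ==> b : cocycles C n"
 by (elim coboundariesE) (use dif_dif[of _ "n - 1"] dif_closed[of _ "n - 1"] in \<open>auto simp: cocycles_iff\<close>)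

lemma coboundaries_mult: "b : coboundaries C n ==> c : coboundaries C n ==> b \<otimes>[cpt C n] c : coboundaries C n"
proof (elim coboundariesE)
 fix x y assume "x : elts C (n - 1)" "y : elts C (n - 1)" "b = dif C (n - 1) x" "c = dif C (n - 1) y"
 then show ?thesis using dif_mult[of x "n - 1" y] coboundariesI[of "x \<otimes>[cpt C (n - 1)] y" n] by simp
qed

lemma coboundaries_one: "\<one>[cpt C n] : coboundaries C n"
 using coboundariesI[of "\<one>[cpt C (n - 1)]" n] dif_one[of "n - 1"] by simp

lemma coboundaries_inv: "b : coboundaries C n ==> inv\<^bsub>cpt C n\<^esub> b : coboundaries C n"
proof (elim coboundariesE)
 fix x assume "x : elts C (n - 1)" "b = dif C (n - 1) x"
 then show ?thesis using dif_inv[of x "n - 1"] coboundariesI[of "inv\<^bsub>cpt C (n - 1)\<^esub> x" n] by simp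
qed

lemma coboundaries_carrier: "b : coboundaries C n ==> b : elts C n"
 using coboundaries_cocycles cocycles_carrier by blast

lemma coboundaries_subgroup: "subgroup (coboundaries C n) (cpt C n)"
 using coboundaries_carrier coboundaries_mult coboundaries_one coboundaries_inv
 by unfold_locales auto

abbreviation Z where "Z n \<equiv> (cpt C n)\<lparr>carrier := cocycles C n\<rparr>"

lemma Z_comm_group: "comm_group (Z n)"
proof -
 have "subgroup (cocycles C n) (cpt C n)"
  using cocycles_carrier cocycles_mult cocycles_one cocycles_inv by unfold_locales auto
 then have "group (Z n)" using G.subgroup_imp_group by blast
 then show ?thesis
  by (rule group.group_comm_groupI) (use cocycles_carrier G.m_comm in auto)
qed

lemma B_subgroup_Z: "subgroup (coboundaries C n) (Z n)"
proof -
 interpret Zg: comm_group "Z n" by (rule Z_comm_group)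
 have "subgroup (cocycles C n) (cpt C n)"
  using cocycles_carrier cocycles_mult cocycles_one cocycles_inv by unfold_locales auto
 then show ?thesis
  using G.subgroup_incl[OF coboundaries_subgroup] coboundaries_cocycles by blast
qed

lemma B_normal_Z: "normal (coboundaries C n) (Z n)"
 by (rule comm_group.subgroup_imp_normal[OF Z_comm_group B_subgroup_Z])

lemma cohomology_comm_group: "comm_group (cohomology C n)"
 unfolding cohomology_def by (rule comm_group.abelian_FactGroup[OF Z_comm_group B_subgroup_Z])

lemma coh_class_Z: "coh_class C n z = coboundaries C n #>\<^bsub>Z n\<^esub> z"
 unfolding coh_class_def r_coset_def by simp

lemma cohomology_carrier: "carrier (cohomology C n) = coh_class C n ` cocycles C n"
 unfolding cohomology_def FactGroup_def RCOSETS_def coh_class_Z by auto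

lemma coh_class_mult:
 "z : cocycles C n ==> w : cocycles C n ==>
  coh_class C n z \<otimes>[cohomology C n] coh_class C n w = coh_class C n (z \<otimes>[cpt C n] w)"
 unfolding cohomology_def coh_class_Z FactGroup_def
 using normal.rcos_sum[OF B_normal_Z[of n], of z w] by simp

lemma coh_class_mem: "w : coh_class C n z \<longleftrightarrow> (\<exists>b\<in>coboundaries C n. w = b \<otimes>[cpt C n] z)"
 unfolding coh_class_def r_coset_def by auto

lemma coh_class_self: "z : elts C n ==> z : coh_class C n z"
 unfolding coh_class_mem using coboundaries_one by force

lemma coh_class_shift:
 assumes b: "b : coboundaries C n" and z: "z : elts C n"
 shows "coh_class C n (b \<otimes>[cpt C n] z) = coh_class C n z"
proof
 have bc: "b : elts C n" using coboundaries_carrier[OF b] .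
 show "coh_class C n (b \<otimes>[cpt C n] z) \<subseteq> coh_class C n z"
 proof
  fix w assume "w : coh_class C n (b \<otimes>[cpt C n] z)"
  then obtain d where d: "d : coboundaries C n" "w = d \<otimes>[cpt C n] (b \<otimes>[cpt C n] z)" unfolding coh_class_mem by blast
  then have "w = (d \<otimes>[cpt C n] b) \<otimes>[cpt C n] z" using bc z coboundaries_carrier by (simp add: G.m_assoc)
  then show "w : coh_class C n z" unfolding coh_class_mem using coboundaries_mult[OF d(1) b] by blast
 qed
 show "coh_class C n z \<subseteq> coh_class C n (b \<otimes>[cpt C n] z)"
 proof
  fix w assume "w : coh_class C n z"
  then obtain d where d: "d : coboundaries C n" "w = d \<otimes>[cpt C n] z" unfolding coh_class_mem by blast
  have dc: "d : elts C n" using coboundaries_carrier[OF d(1)] .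
  have "w = (d \<otimes>[cpt C n] inv\<^bsub>cpt C n\<^esub> b) \<otimes>[cpt C n] (b \<otimes>[cpt C n] z)"
   using bc z dc d(2) by (metis G.inv_closed G.inv_solve_left G.m_assoc G.m_closed)
  then show "w : coh_class C n (b \<otimes>[cpt C n] z)"
   unfolding coh_class_mem using coboundaries_mult[OF d(1) coboundaries_inv[OF b]] by blast
 qed
qed

lemma coh_class_memD:
 assumes "w : coh_class C n z" "z : cocycles C n"
 shows "w : cocycles C n" "coh_class C n w = coh_class C n z"
proof -
 obtain b where b: "b : coboundaries C n" "w = b \<otimes>[cpt C n] z" using assms(1) unfolding coh_class_mem by blast
 show "w : cocycles C n" unfolding b(2) using cocycles_mult coboundaries_cocycles[OF b(1)] assms(2) by blast
 show "coh_class C n w = coh_class C n z"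
  unfolding b(2) by (rule coh_class_shift[OF b(1) cocycles_carrier[OF assms(2)]])
qed

lemma coh_class_eq_iff:
 assumes "z : elts C n" "w : elts C n"
 shows "coh_class C n z = coh_class C n w \<longleftrightarrow> (\<exists>b\<in>coboundaries C n. z = b \<otimes>[cpt C n] w)"
 using coh_class_self[OF assms(1)] coh_class_shift[OF _ assms(2)] coh_class_mem by metis

lemma coh_one: "\<one>[cohomology C n] = coh_class C n \<one>[cpt C n]"
proof -
 have "coboundaries C n = coh_class C n \<one>[cpt C n]"
  using coboundaries_carrier by (auto simp: coh_class_mem)
 then show ?thesis unfolding cohomology_def FactGroup_def by simp
qed

lemma coh_class_zero_iff:
 assumes "z : elts C n"
 shows "coh_class C n z = \<one>[cohomology C n] \<longleftrightarrow> z : coboundaries C n"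
 unfolding coh_one coh_class_eq_iff[OF assms G.one_closed] using coboundaries_carrier by auto

end

lemma (in dg_ring) complex: "complex A" by unfold_locales (rule cochain)

sublocale dg_ring \<subseteq> A: complex A by (rule complex)

sublocale dg_module \<subseteq> M: complex M by unfold_locales (rule module_cochain)

section \<open>The ring \<open>H0\<close> and its action on cohomology\<close>

context dg_ring
begin

lemma dmul_closed: "a : elts A i ==> b : elts A j ==> dmul A i j a b : elts A (i + j)"
 using dmul_left_hom[of b j i] unfolding hom_def by blast

lemma dmul_add_left: "a : elts A i ==> a' : elts A i ==> b : elts A j ==>
  dmul A i j (a \<otimes>[cpt A i] a') b = dmul A i j a b \<otimes>[cpt A (i + j)] dmul A i j a' b"
 using dmul_left_hom[of b j i] unfolding hom_def by blast

lemma dmul_add_right: "a : elts A i ==> b : elts A j ==> b' : elts A j ==>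
  dmul A i j a (b \<otimes>[cpt A j] b') = dmul A i j a b \<otimes>[cpt A (i + j)] dmul A i j a b'"
 using dmul_right_hom[of a i j] unfolding hom_def by blast

lemma degree_one: "a : elts A 1 ==> a = \<one>[cpt A 1]"
 using nonpositive[of 1] by simp

lemma dif_degree_zero: "a : elts A 0 ==> dif A 0 a = \<one>[cpt A 1]"
 using degree_one A.dif_closed[of a 0] by simp

lemma cocycles_zero: "cocycles A 0 = elts A 0"
 using dif_degree_zero by (auto simp: A.cocycles_iff)

lemma dmul_comm0: "a : elts A 0 ==> b : elts A 0 ==> dmul A 0 0 a b = dmul A 0 0 b a"
 using graded_comm[of b 0 a 0] by (simp add: signed_def)

lemma ring0_simps: "carrier (ring0 A) = elts A 0" "monoid.mult (ring0 A) = dmul A 0 0"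
 "\<one>[ring0 A] = dunit A" "\<zero>[ring0 A] = \<one>[cpt A 0]" "ring.add (ring0 A) = monoid.mult (cpt A 0)"
 by (simp_all add: ring0_def)

lemma ring0_add_monoid: "add_monoid (ring0 A) = cpt A 0"
 by (simp add: ring0_def)

lemma ring0_cring: "cring (ring0 A)"
proof (rule cringI)
 have "comm_group (add_monoid (ring0 A))" unfolding ring0_add_monoid by (rule A.cpt_comm_group)
 then show "abelian_group (ring0 A)"
  using abelian_group.intro abelian_group_axioms.intro comm_group.axioms(1) abelian_monoid.intro by blast
 show "comm_monoid (ring0 A)"
  by (rule comm_monoidI)
   (use dunit_closed dmul_closed[of _ 0 _ 0] dmul_assoc[of _ 0 _ 0 _ 0] dmul_dunit_left[of _ 0] dmul_comm0
    in \<open>auto simp: ring0_simps\<close>)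
qed (use dmul_add_left[of _ 0 _ _ 0] in \<open>auto simp: ring0_simps\<close>)

text \<open>There is nothing in degree 1, so d a = 0 and a d x = d (a x).\<close>

lemma coboundaries_dmul:
 assumes a: "a : elts A 0" and b: "b : coboundaries A 0"
 shows "dmul A 0 0 a b : coboundaries A 0"
proof -
 obtain x where x: "x : elts A (-1)" "b = dif A (-1) x" using A.coboundariesE[OF b] by auto
 have "dif A (-1) (dmul A 0 (-1) a x) = dmul A 1 (-1) (dif A 0 a) x \<otimes>[cpt A 0] dmul A 0 0 a (dif A (-1) x)"
  using leibniz[OF a x(1)] by (simp add: signed_def)
 moreover have "dmul A 1 (-1) (dif A 0 a) x = \<one>[cpt A 0]"
  using hom_one[OF dmul_left_hom[OF x(1), of 1] A.cpt_group A.cpt_group] dif_degree_zero[OF a] by simp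
 moreover have "dmul A 0 0 a (dif A (-1) x) : elts A 0"
  using dmul_closed[OF a, of "dif A (-1) x" 0] A.dif_closed[OF x(1)] by simp
 ultimately have "dmul A 0 0 a b = dif A (-1) (dmul A 0 (-1) a x)" using x(2) by simp
 moreover have "dmul A 0 (-1) a x : elts A (0 - 1)" using dmul_closed[OF a x(1)] by simp
 ultimately show ?thesis using A.coboundariesI[of "dmul A 0 (-1) a x" 0] by simp
qed

lemma coboundaries_ideal: "ideal (coboundaries A 0) (ring0 A)"
proof (rule cring.ideal_if[OF ring0_cring])
 show "coboundaries A 0 \<subseteq> carrier (ring0 A)" using A.coboundaries_carrier by (auto simp: ring0_simps)
 show "\<zero>[ring0 A] : coboundaries A 0" using A.coboundaries_one by (simp add: ring0_simps)
 show "a \<oplus>[ring0 A] b : coboundaries A 0" if "a : coboundaries A 0" "b : coboundaries A 0" for a b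
  using A.coboundaries_mult that by (simp add: ring0_simps)
 show "r \<otimes>[ring0 A] a : coboundaries A 0" if "a : coboundaries A 0" "r : carrier (ring0 A)" for a r
  using coboundaries_dmul that by (simp add: ring0_simps)
qed

lemma H0_cring: "cring (H0 A)"
 unfolding H0_def by (rule ideal.quotient_is_cring[OF coboundaries_ideal ring0_cring])

lemma H0_proj_class: "H0_proj A a = coh_class A 0 a"
 unfolding H0_proj_def coh_class_def a_r_coset_def' r_coset_def by (simp add: ring0_simps)

lemma H0_proj_coset: "coh_class A 0 a = coboundaries A 0 +>\<^bsub>ring0 A\<^esub> a"
 using H0_proj_class unfolding H0_proj_def by simp

lemma H0_carrier: "carrier (H0 A) = coh_class A 0 ` elts A 0"
 unfolding H0_def FactRing_def A_RCOSETS_def' H0_proj_coset by (auto simp: ring0_simps)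

lemma H0_classes:
 assumes "a : elts A 0" "b : elts A 0"
 shows "coh_class A 0 a \<otimes>[H0 A] coh_class A 0 b = coh_class A 0 (dmul A 0 0 a b)"
  "coh_class A 0 a \<oplus>[H0 A] coh_class A 0 b = coh_class A 0 (a \<otimes>[cpt A 0] b)"
proof -
 show "coh_class A 0 a \<otimes>[H0 A] coh_class A 0 b = coh_class A 0 (dmul A 0 0 a b)"
  unfolding H0_def FactRing_def H0_proj_coset
  using ideal.rcoset_mult_add[OF coboundaries_ideal, of a b] assms by (simp add: ring0_simps)
 show "coh_class A 0 a \<oplus>[H0 A] coh_class A 0 b = coh_class A 0 (a \<otimes>[cpt A 0] b)"
  unfolding H0_def FactRing_def H0_proj_coset
  using abelian_subgroup.a_rcos_sum[OF abelian_subgroupI3[OF ideal.axioms(1)[OF coboundaries_ideal]], of a b]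
   assms cring.axioms(1)[OF ring0_cring] ring.is_abelian_group by (auto simp: ring0_simps)
qed

lemma H0_one: "\<one>[H0 A] = coh_class A 0 (dunit A)"
 unfolding H0_def FactRing_def H0_proj_coset by (simp add: ring0_simps)

lemma H0_zero: "\<zero>[H0 A] = coh_class A 0 \<one>[cpt A 0]"
 using A.coh_one[of 0] unfolding H0_def FactRing_def cohomology_def FactGroup_def by simp

end

context dg_module
begin

lemma dact_closed: "a : elts A i ==> m : elts M j ==> dact M i j a m : elts M (i + j)"
 using dact_left_hom[of m j i] unfolding hom_def by blast

lemma dact_add_left: "a : elts A i ==> a' : elts A i ==> m : elts M j ==>
  dact M i j (a \<otimes>[cpt A i] a') m = dact M i j a m \<otimes>[cpt M (i + j)] dact M i j a' m"
 using dact_left_hom[of m j i] unfolding hom_def by blast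

lemma dact_add_right: "a : elts A i ==> m : elts M j ==> m' : elts M j ==>
  dact M i j a (m \<otimes>[cpt M j] m') = dact M i j a m \<otimes>[cpt M (i + j)] dact M i j a m'"
 using dact_right_hom[of a i j] unfolding hom_def by blast

lemma dact_zero: "m : elts M j ==> dact M i j \<one>[cpt A i] m = \<one>[cpt M (i + j)]"
 "a : elts A i ==> dact M i j a \<one>[cpt M j] = \<one>[cpt M (i + j)]"
 using hom_one[OF dact_left_hom A.cpt_group M.cpt_group] hom_one[OF dact_right_hom M.cpt_group M.cpt_group] by auto

lemma act0_closed: "a : elts A 0 ==> m : elts M n ==> dact M 0 n a m : elts M n"
 using dact_closed[of a 0 m n] by simp

lemma dif_act0:
 assumes a: "a : elts A 0" and m: "m : elts M n"
 shows "dif M n (dact M 0 n a m) = dact M 0 (n + 1) a (dif M n m)"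
 using module_leibniz[OF a m] dact_zero(1)[OF m, of 1] dif_degree_zero[OF a]
  act0_closed[OF a M.dif_closed[OF m]] by (simp add: signed_def add.commute)

lemma act0_cocycles: "a : elts A 0 ==> z : cocycles M n ==> dact M 0 n a z : cocycles M n"
 using dif_act0[of a z n] dact_zero(2)[of a 0 "n + 1"] act0_closed by (simp add: M.cocycles_iff)

lemma act0_coboundaries:
 assumes "a : elts A 0" "b : coboundaries M n"
 shows "dact M 0 n a b : coboundaries M n"
proof -
 obtain x where x: "x : elts M (n - 1)" "b = dif M (n - 1) x" using M.coboundariesE[OF assms(2)] by blast
 then have "dact M 0 n a b = dif M (n - 1) (dact M 0 (n - 1) a x)" using dif_act0[OF assms(1) x(1)] by simp
 then show ?thesis using M.coboundariesI[OF act0_closed[OF assms(1) x(1)]] by simp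
qed

text \<open>If b = d x and z is a cocycle, then b z = d (x z). Hence the action of degree 0 on
  cohomology factors through \<open>H0 A\<close>.\<close>

lemma boundary_act:
 assumes b: "b : coboundaries A 0" and z: "z : cocycles M n"
 shows "dact M 0 n b z : coboundaries M n"
proof -
 obtain x where x: "x : elts A (-1)" "b = dif A (-1) x" using A.coboundariesE[OF b] by auto
 have zc: "z : elts M n" "dif M n z = \<one>[cpt M (n + 1)]" using z by (auto simp: M.cocycles_iff)
 have xc: "dact M (-1) (n + 1) x (dif M n z) = \<one>[cpt M n]" unfolding zc(2) using dact_zero(2)[OF x(1), of "n + 1"] by simp
 have bc: "dact M 0 n b z : elts M n" using act0_closed[OF A.coboundaries_carrier[OF b] zc(1)] .
 have "dif M (n - 1) (dact M (-1) n x z) = dact M 0 n b z"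
  using module_leibniz[OF x(1) zc(1)] x(2) xc bc by (simp add: signed_def)
 moreover have "dact M (-1) n x z : elts M (n - 1)" using dact_closed[OF x(1) zc(1)] by simp
 ultimately show ?thesis using M.coboundariesI by metis
qed

lemma act_class:
 assumes a: "a : elts A 0" and z: "z : cocycles M n"
  and a': "a' : coh_class A 0 a" and z': "z' : coh_class M n z"
 shows "coh_class M n (dact M 0 n a' z') = coh_class M n (dact M 0 n a z)"
proof -
 obtain b where b: "b : coboundaries A 0" "a' = b \<otimes>[cpt A 0] a" using a' unfolding A.coh_class_mem by blast
 obtain c where c: "c : coboundaries M n" "z' = c \<otimes>[cpt M n] z" using z' unfolding M.coh_class_mem by blast
 have zc: "z : elts M n" using z by (rule M.cocycles_carrier)
 have bc: "b : elts A 0" "c : elts M n"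
  using A.coboundaries_carrier[OF b(1)] M.coboundaries_carrier[OF c(1)] by auto
 have a'c: "a' : elts A 0" unfolding b(2) using bc a by simp
 have "dact M 0 n a' z' = dact M 0 n a' c \<otimes>[cpt M n] dact M 0 n a' z"
  unfolding c(2) using dact_add_right[OF a'c bc(2) zc] by simp
 also have "dact M 0 n a' z = dact M 0 n b z \<otimes>[cpt M n] dact M 0 n a z"
  unfolding b(2) using dact_add_left[OF bc(1) a zc] by simp
 finally have "dact M 0 n a' z' = dact M 0 n a' c \<otimes>[cpt M n] (dact M 0 n b z \<otimes>[cpt M n] dact M 0 n a z)" .
 then show ?thesis
  using M.coh_class_shift[OF act0_coboundaries[OF a'c c(1)]] M.coh_class_shift[OF boundary_act[OF b(1) z]]
   act0_closed[OF bc(1) zc] act0_closed[OF a zc] by simp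
qed

text \<open>The scalar multiplication of \<open>coh_module\<close> is a union over all
  representatives; by \<open>act_class\<close> all members of the union are the same coset.\<close>

lemma smult_class:
 assumes a: "a : elts A 0" and z: "z : cocycles M n"
 shows "coh_class A 0 a \<odot>[coh_module M n] coh_class M n z = coh_class M n (dact M 0 n a z)"
proof -
 have "coh_class A 0 a \<odot>[coh_module M n] coh_class M n z
   = (\<Union>a'\<in>coh_class A 0 a. \<Union>z'\<in>coh_class M n z. coh_class M n (dact M 0 n a' z'))"
  by (simp add: coh_module_def)
 also have "\<dots> = (\<Union>a'\<in>coh_class A 0 a. \<Union>z'\<in>coh_class M n z. coh_class M n (dact M 0 n a z))"
  using act_class[OF a z] by simp
 also have "\<dots> = coh_class M n (dact M 0 n a z)"
  using A.coh_class_self[OF a] M.coh_class_self[OF M.cocycles_carrier[OF z]] by auto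
 finally show ?thesis .
qed

lemma coh_module_simps: "carrier (coh_module M n) = coh_class M n ` cocycles M n"
 "\<zero>[coh_module M n] = coh_class M n \<one>[cpt M n]"
 "z : cocycles M n ==> w : cocycles M n ==>
   coh_class M n z \<oplus>[coh_module M n] coh_class M n w = coh_class M n (z \<otimes>[cpt M n] w)"
 using M.cohomology_carrier[of n] M.coh_one[of n] M.coh_class_mult[of z n w]
 by (simp_all add: coh_module_def)

lemma coh_module_module: "module (H0 A) (coh_module M n)"
proof (rule moduleI)
 show "cring (H0 A)" by (rule H0_cring)
 have "comm_group (add_monoid (coh_module M n))"
  by (rule comm_group_cong[OF M.cohomology_comm_group[of n]]) (simp_all add: coh_module_def)
 then show "abelian_group (coh_module M n)"
  using abelian_group.intro abelian_group_axioms.intro comm_group.axioms(1) abelian_monoid.intro by blast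
 fix x c assume "x : carrier (H0 A)" "c : carrier (coh_module M n)"
 then obtain a z where a: "a : elts A 0" "x = coh_class A 0 a" and z: "z : cocycles M n" "c = coh_class M n z"
  unfolding H0_carrier coh_module_simps by blast
 have zc: "z : elts M n" using z(1) by (rule M.cocycles_carrier)
 show "x \<odot>[coh_module M n] c : carrier (coh_module M n)"
  unfolding a z smult_class[OF a(1) z(1)] coh_module_simps using act0_cocycles[OF a(1) z(1)] by blast
 {
  fix y assume "y : carrier (H0 A)"
  then obtain b where b: "b : elts A 0" "y = coh_class A 0 b" unfolding H0_carrier by blast
  show "(x \<oplus>[H0 A] y) \<odot>[coh_module M n] c = x \<odot>[coh_module M n] c \<oplus>[coh_module M n] y \<odot>[coh_module M n] c"
   unfolding a(2) b(2) z(2) H0_classes[OF a(1) b(1)] smult_class[OF a(1) z(1)] smult_class[OF b(1) z(1)]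
    smult_class[OF A.G.m_closed[OF a(1) b(1)] z(1)]
    coh_module_simps(3)[OF act0_cocycles[OF a(1) z(1)] act0_cocycles[OF b(1) z(1)]]
   using dact_add_left[OF a(1) b(1) zc] by simp
  have ab: "dmul A 0 0 a b : elts A 0" using dmul_closed[OF a(1) b(1)] by simp
  show "(x \<otimes>[H0 A] y) \<odot>[coh_module M n] c = x \<odot>[coh_module M n] (y \<odot>[coh_module M n] c)"
   unfolding a(2) b(2) z(2) H0_classes[OF a(1) b(1)] smult_class[OF b(1) z(1)] smult_class[OF ab z(1)]
    smult_class[OF a(1) act0_cocycles[OF b(1) z(1)]]
   using dact_assoc[OF a(1) b(1) zc] by simp
 next
  fix d assume "d : carrier (coh_module M n)"
  then obtain w where w: "w : cocycles M n" "d = coh_class M n w" unfolding coh_module_simps by blast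
  show "x \<odot>[coh_module M n] (c \<oplus>[coh_module M n] d) = x \<odot>[coh_module M n] c \<oplus>[coh_module M n] x \<odot>[coh_module M n] d"
   unfolding a(2) z(2) w(2) coh_module_simps(3)[OF z(1) w(1)] smult_class[OF a(1) z(1)] smult_class[OF a(1) w(1)]
    smult_class[OF a(1) M.cocycles_mult[OF z(1) w(1)]]
    coh_module_simps(3)[OF act0_cocycles[OF a(1) z(1)] act0_cocycles[OF a(1) w(1)]]
   using dact_add_right[OF a(1) zc M.cocycles_carrier[OF w(1)]] by simp
 }
next
 fix c assume "c : carrier (coh_module M n)"
 then obtain z where z: "z : cocycles M n" "c = coh_class M n z" unfolding coh_module_simps by blast
 have zc: "z : elts M n" using z(1) by (rule M.cocycles_carrier)
 show "\<one>[H0 A] \<odot>[coh_module M n] c = c"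
  unfolding z(2) H0_one smult_class[OF dunit_closed z(1)] dact_dunit[OF zc] ..
qed

end

lemma (in dg_ring) dg_self_module: "dg_module A (dg_self A)"
proof (unfold_locales, goal_cases)
 case 1
 show ?case using cochain unfolding dg_self_def cochain_complex_def by simp
qed (use dmul_left_hom dmul_right_hom dmul_assoc dmul_dunit_left leibniz in \<open>simp_all add: dg_self_def\<close>)

lemma dg_self_simps: "cpt (dg_self A) = cpt A" "dif (dg_self A) = dif A" "dact (dg_self A) = dmul A"
 by (simp_all add: dg_self_def)

lemma dg_self_cohomology: "cocycles (dg_self A) n = cocycles A n" "coboundaries (dg_self A) n = coboundaries A n"
 "coh_class (dg_self A) n = coh_class A n" "cohomology (dg_self A) n = cohomology A n"
 by (simp_all add: cocycles_def coboundaries_def coh_class_def cohomology_def dg_self_simps fun_eq_iff)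

locale chain_map = C: complex C + D: complex D
 for C :: "('a, 'y) cochain_scheme" and D :: "('b, 'z) cochain_scheme" +
 fixes g :: "int \<Rightarrow> 'a \<Rightarrow> 'b"
 assumes g_hom: "!!n. g n : hom (cpt C n) (cpt D n)"
  and g_dif: "!!n x. x : elts C n ==> g (n + 1) (dif C n x) = dif D n (g n x)"
begin

lemma g_closed: "x : elts C n ==> g n x : elts D n"
 using g_hom[of n] unfolding hom_def by blast

lemma g_mult: "x : elts C n ==> y : elts C n ==>
  g n (x \<otimes>[cpt C n] y) = g n x \<otimes>[cpt D n] g n y"
 using g_hom[of n] unfolding hom_def by blast

lemma g_one: "g n \<one>[cpt C n] = \<one>[cpt D n]"
 using hom_one[OF g_hom C.cpt_group D.cpt_group] .

lemma g_cocycles: "z : cocycles C n ==> g n z : cocycles D n"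
 using g_dif[of z n] g_one[of "n + 1"] g_closed by (simp add: C.cocycles_iff D.cocycles_iff)

lemma g_coboundaries: "b : coboundaries C n ==> g n b : coboundaries D n"
proof (elim C.coboundariesE)
 fix x assume "x : elts C (n - 1)" "b = dif C (n - 1) x"
 then show ?thesis using g_dif[of x "n - 1"] D.coboundariesI[OF g_closed[of x "n - 1"]] by simp
qed

lemma coh_map_class:
 assumes z: "z : cocycles C n"
 shows "coh_map D g n (coh_class C n z) = coh_class D n (g n z)"
proof -
 have zc: "z : elts C n" using C.cocycles_carrier[OF z] .
 have "coh_class D n (g n w) = coh_class D n (g n z)" if w: "w : coh_class C n z" for w
 proof -
  obtain b where b: "b : coboundaries C n" "w = b \<otimes>[cpt C n] z" using w unfolding C.coh_class_mem by blast
  then have "g n w = g n b \<otimes>[cpt D n] g n z" using g_mult C.coboundaries_carrier zc by blast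
  then show ?thesis using D.coh_class_shift[OF g_coboundaries[OF b(1)] g_closed[OF zc]] by simp
 qed
 then have "coh_map D g n (coh_class C n z) = (\<Union>w\<in>coh_class C n z. coh_class D n (g n z))"
  unfolding coh_map_def by (intro SUP_cong) auto
 then show ?thesis using C.coh_class_self[OF zc] by auto
qed

end

section \<open>Koszul complexes\<close>

text \<open>Degrees index the components of a complex, so an expression such as
  \<open>n + 1 + 1\<close> has to keep this form and must not be merged into
  \<open>n + 2\<close>.\<close>

declare [[simproc del: int_combine_numerals]]

lemma signed_closed: "comm_group G ==> x : carrier G ==> signed G k x : carrier G"
 unfolding signed_def using group.inv_closed[of G x] by (simp add: comm_group_def)

lemma signed_mult:
 assumes "comm_group G" "x : carrier G" "y : carrier G"
 shows "signed G k (x \<otimes>[G] y) = signed G k x \<otimes>[G] signed G k y"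
 using comm_group.inv_mult[OF assms] unfolding signed_def by simp

locale koszul_module = dg_module A "M :: ('a, 'm koszul_elt) dg_module" for A :: "('a, 'z) dg_ring_scheme" and M +
 fixes a :: 'a
 assumes a: "a : elts A 0"
begin

abbreviation K where "K \<equiv> koszul M a"

lemma K_mem: "u : elts K n \<longleftrightarrow>
  (\<exists>m m'. u = KPair m m' \<and> m : elts M n \<and> m' : elts M (n + 1))"
 unfolding koszul_def by auto

lemma K_pair: "KPair m m' : elts K n \<longleftrightarrow> m : elts M n \<and> m' : elts M (n + 1)"
 unfolding koszul_def by auto

lemma K_mult: "KPair m m' \<otimes>[cpt K n] KPair w w' = KPair (m \<otimes>[cpt M n] w) (m' \<otimes>[cpt M (n + 1)] w')"
 unfolding koszul_def by simp

lemma K_one: "\<one>[cpt K n] = KPair \<one>[cpt M n] \<one>[cpt M (n + 1)]"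
 unfolding koszul_def by simp

lemma K_dif: "dif K n (KPair m m') = KPair (dif M n m \<otimes>[cpt M (n + 1)] dact M 0 (n + 1) a m')
  (inv\<^bsub>cpt M (n + 1 + 1)\<^esub> (dif M (n + 1) m'))"
 unfolding koszul_def by simp

lemma K_act: "dact K i n b (KPair m m') = KPair (dact M i n b m) (signed (cpt M (i + n + 1)) i (dact M i (n + 1) b m'))"
 unfolding koszul_def by simp

lemma K_group: "comm_group (cpt K n)"
proof (rule comm_groupI)
 fix x assume "x : elts K n"
 then obtain m m' where x: "x = KPair m m'" "m : elts M n" "m' : elts M (n + 1)" unfolding K_mem by blast
 then have "KPair (inv\<^bsub>cpt M n\<^esub> m) (inv\<^bsub>cpt M (n + 1)\<^esub> m') \<otimes>[cpt K n] x = \<one>[cpt K n]"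
  by (simp add: K_mult K_one)
 moreover have "KPair (inv\<^bsub>cpt M n\<^esub> m) (inv\<^bsub>cpt M (n + 1)\<^esub> m') : elts K n" using x by (simp add: K_pair)
 ultimately show "\<exists>y\<in>elts K n. y \<otimes>[cpt K n] x = \<one>[cpt K n]" by blast
qed (auto simp: K_mem K_mult K_one M.G.m_ac)

lemma K_inv: "m : elts M n ==> m' : elts M (n + 1) ==>
  inv\<^bsub>cpt K n\<^esub> (KPair m m') = KPair (inv\<^bsub>cpt M n\<^esub> m) (inv\<^bsub>cpt M (n + 1)\<^esub> m')"
 using comm_group.axioms(2)[OF K_group]
 by (intro group.inv_equality) (auto simp: K_pair K_mult K_one)

lemma K_complex: "cochain_complex K"
 unfolding cochain_complex_def
proof (intro allI conjI ballI)
 fix n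
 show "comm_group (cpt K n)" by (rule K_group)
 show "dif K n : hom (cpt K n) (cpt K (n + 1))"
 proof (rule homI)
  fix x assume "x : elts K n"
  then obtain m m' where x: "x = KPair m m'" "m : elts M n" "m' : elts M (n + 1)" unfolding K_mem by blast
  then show "dif K n x : elts K (n + 1)" by (simp add: K_dif K_pair act0_closed[OF a])
  fix y assume "y : elts K n"
  then obtain w w' where y: "y = KPair w w'" "w : elts M n" "w' : elts M (n + 1)" unfolding K_mem by blast
  have "dact M 0 (n + 1) a (m' \<otimes>[cpt M (n + 1)] w') = dact M 0 (n + 1) a m' \<otimes>[cpt M (n + 1)] dact M 0 (n + 1) a w'"
   using dact_add_right[OF a x(3) y(3)] by simp
  then show "dif K n (x \<otimes>[cpt K n] y) = dif K n x \<otimes>[cpt K (n + 1)] dif K n y"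
   using x y act0_closed[OF a x(3)] act0_closed[OF a y(3)]
   by (simp add: K_mult K_dif M.dif_mult M.G.m_ac M.G.inv_mult)
 qed
 fix x assume "x : elts K n"
 then obtain m m' where x: "x = KPair m m'" "m : elts M n" "m' : elts M (n + 1)" unfolding K_mem by blast
 let ?d = "dif M (n + 1) m'"
 have dc: "?d : elts M (n + 1 + 1)" using x(3) by simp
 have ac: "dact M 0 (n + 1 + 1) a ?d : elts M (n + 1 + 1)" by (rule act0_closed[OF a dc])
 have "dact M 0 (n + 1 + 1) a (inv\<^bsub>cpt M (n + 1 + 1)\<^esub> ?d) = inv\<^bsub>cpt M (n + 1 + 1)\<^esub> dact M 0 (n + 1 + 1) a ?d"
  using dact_add_right[OF a dc M.G.inv_closed[OF dc]] dact_zero(2)[OF a] dc ac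
   act0_closed[OF a M.G.inv_closed[OF dc]] by (intro M.G.inv_equality[symmetric]) (simp_all add: M.G.m_comm)
 then show "dif K (n + 1) (dif K n x) = \<one>[cpt K (n + 1 + 1)]"
  using x dc ac act0_closed[OF a x(3)] M.dif_dif[OF x(2)] M.dif_dif[OF x(3)] dif_act0[OF a x(3)]
  by (simp add: K_dif K_one M.dif_mult M.dif_inv)
qed

lemma dact_inv: "b : elts A i ==> m : elts M j ==>
  dact M i j b (inv\<^bsub>cpt M j\<^esub> m) = inv\<^bsub>cpt M (i + j)\<^esub> dact M i j b m"
 using group_hom.hom_inv[of "cpt M j" "cpt M (i + j)" "dact M i j b" m] M.cpt_group dact_right_hom[of b i j]
 by (simp add: group_hom_def group_hom_axioms_def)

lemma dact_signed: "b : elts A i ==> m : elts M j ==>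
  dact M i j b (signed (cpt M j) k m) = signed (cpt M (i + j)) k (dact M i j b m)"
 unfolding signed_def by (simp add: dact_inv)

lemma a_central: "b : elts A i ==> m : elts M j ==>
  dact M 0 (i + j) a (dact M i j b m) = dact M i j b (dact M 0 j a m)"
 using dact_assoc[OF a, of b i m j] dact_assoc[of b i a 0 m j] a graded_comm[of b i a 0] by (simp add: signed_def)

text \<open>The generator of degree -1 passes b at the cost of the sign (-1)^i, and its differential
  a is central of degree 0. The two cases are the parities of i.\<close>

lemma K_leibniz:
 assumes b: "b : elts A i" and m: "m : elts M j" "m' : elts M (j + 1)"
 shows "dif K (i + j) (dact K i j b (KPair m m')) =
   dact K (i + 1) j (dif A i b) (KPair m m') \<otimes>[cpt K (i + j + 1)]
   signed (cpt K (i + j + 1)) i (dact K i (j + 1) b (dif K j (KPair m m')))"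
proof -
 have e: "i + (j + 1) = i + j + 1" "i + 1 + j = i + j + 1" "i + 1 + (j + 1) = i + j + 1 + 1"
  "i + (j + 1 + 1) = i + j + 1 + 1" by linarith+
 have db: "dif A i b : elts A (i + 1)" using b by simp
 have c1: "dact M i j b m : elts M (i + j)" "dact M i (j + 1) b m' : elts M (i + j + 1)"
  using dact_closed[OF b m(1)] dact_closed[OF b m(2)] by (simp_all only: e)
 have c2: "dact M (i + 1) j (dif A i b) m : elts M (i + j + 1)"
  "dact M (i + 1) (j + 1) (dif A i b) m' : elts M (i + j + 1 + 1)"
  using dact_closed[OF db m(1)] dact_closed[OF db m(2)] by (simp_all only: e)
 have c3: "dact M i (j + 1) b (dif M j m) : elts M (i + j + 1)"
  "dact M i (j + 1 + 1) b (dif M (j + 1) m') : elts M (i + j + 1 + 1)"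
  using dact_closed[OF b M.dif_closed[OF m(1)]] dact_closed[OF b M.dif_closed[OF m(2)]] by (simp_all only: e)
 have am: "dact M 0 (j + 1) a m' : elts M (j + 1)" by (rule act0_closed[OF a m(2)])
 have c4: "dact M i (j + 1) b (dact M 0 (j + 1) a m') : elts M (i + j + 1)"
  using dact_closed[OF b am] by (simp only: e)
 have l1: "dif M (i + j) (dact M i j b m) = dact M (i + 1) j (dif A i b) m \<otimes>[cpt M (i + j + 1)]
   signed (cpt M (i + j + 1)) i (dact M i (j + 1) b (dif M j m))" by (rule module_leibniz[OF b m(1)])
 have l2: "dif M (i + j + 1) (dact M i (j + 1) b m') = dact M (i + 1) (j + 1) (dif A i b) m' \<otimes>[cpt M (i + j + 1 + 1)]
   signed (cpt M (i + j + 1 + 1)) i (dact M i (j + 1 + 1) b (dif M (j + 1) m'))"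
  using module_leibniz[OF b m(2)] by (simp only: e)
 have ce: "dact M 0 (i + j + 1) a (dact M i (j + 1) b m') = dact M i (j + 1) b (dact M 0 (j + 1) a m')"
  using a_central[OF b m(2)] by (simp only: e)
 have r: "dact M i (j + 1) b (dif M j m \<otimes>[cpt M (j + 1)] dact M 0 (j + 1) a m') =
   dact M i (j + 1) b (dif M j m) \<otimes>[cpt M (i + j + 1)] dact M i (j + 1) b (dact M 0 (j + 1) a m')"
  using dact_add_right[OF b M.dif_closed[OF m(1)] am] by (simp only: e)
 have ri: "dact M i (j + 1 + 1) b (inv\<^bsub>cpt M (j + 1 + 1)\<^esub> dif M (j + 1) m') = inv\<^bsub>cpt M (i + j + 1 + 1)\<^esub> dact M i (j + 1 + 1) b (dif M (j + 1) m')"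
  using dact_inv[OF b M.dif_closed[OF m(2)]] by (simp only: e)
 have ai: "dact M 0 (i + j + 1) a (inv\<^bsub>cpt M (i + j + 1)\<^esub> dact M i (j + 1) b m') = inv\<^bsub>cpt M (i + j + 1)\<^esub> dact M i (j + 1) b (dact M 0 (j + 1) a m')"
 proof -
  have "dact M 0 (i + j + 1) a (signed (cpt M (i + j + 1)) 1 (dact M i (j + 1) b m'))
    = signed (cpt M (i + j + 1)) 1 (dact M 0 (i + j + 1) a (dact M i (j + 1) b m'))"
   using dact_signed[OF a c1(2), of 1] by simp
  then show ?thesis using ce by (simp add: signed_def)
 qed
 show ?thesis
 proof (cases "even i")
  case True
  then show ?thesis
   unfolding K_act K_dif e
   using c1 c2 c3 c4 l1 l2 ce r ri m by (simp add: signed_def M.G.m_assoc M.G.inv_mult K_mult)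
 next
  case False
  then show ?thesis
   unfolding K_act K_dif e
   using c1 c2 c3 c4 l1 l2 ce r ri ai m
   by (simp add: signed_def M.G.m_assoc M.G.inv_mult K_mult K_inv M.dif_inv)
 qed
qed

lemma K_module: "dg_module A K"
proof (unfold_locales, goal_cases)
 case 1
 show ?case by (rule K_complex)
next
 case (2 u j i)
 then obtain m m' where u: "u = KPair m m'" "m : elts M j" "m' : elts M (j + 1)" unfolding K_mem by blast
 have e: "i + (j + 1) = i + j + 1" by simp
 show ?case unfolding u(1) K_act
 proof (rule homI)
  fix x assume x: "x : elts A i"
  have c: "dact M i j x m : elts M (i + j)" "dact M i (j + 1) x m' : elts M (i + j + 1)"
   using dact_closed[OF x u(2)] dact_closed[OF x u(3)] by (simp_all only: e)
  then show "KPair (dact M i j x m) (signed (cpt M (i + j + 1)) i (dact M i (j + 1) x m')) : elts K (i + j)"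
   using signed_closed[OF M.cpt_comm_group] by (simp add: K_pair)
  fix y assume y: "y : elts A i"
  have d: "dact M i j y m : elts M (i + j)" "dact M i (j + 1) y m' : elts M (i + j + 1)"
   using dact_closed[OF y u(2)] dact_closed[OF y u(3)] by (simp_all only: e)
  show "KPair (dact M i j (x \<otimes>[cpt A i] y) m) (signed (cpt M (i + j + 1)) i (dact M i (j + 1) (x \<otimes>[cpt A i] y) m')) =
    KPair (dact M i j x m) (signed (cpt M (i + j + 1)) i (dact M i (j + 1) x m')) \<otimes>[cpt K (i + j)]
    KPair (dact M i j y m) (signed (cpt M (i + j + 1)) i (dact M i (j + 1) y m'))"
   using dact_add_left[OF x y u(2)] dact_add_left[OF x y u(3), unfolded e] signed_mult[OF M.cpt_comm_group c(2) d(2)]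
   by (simp add: K_mult)
 qed
next
 case (3 b i j)
 have e: "i + (j + 1) = i + j + 1" by simp
 show ?case
 proof (rule homI)
  fix x assume "x : elts K j"
  then obtain m m' where u: "x = KPair m m'" "m : elts M j" "m' : elts M (j + 1)" unfolding K_mem by blast
  have c: "dact M i j b m : elts M (i + j)" "dact M i (j + 1) b m' : elts M (i + j + 1)"
   using dact_closed[OF 3 u(2)] dact_closed[OF 3 u(3)] by (simp_all only: e)
  then show "dact K i j b x : elts K (i + j)"
   unfolding u(1) K_act using signed_closed[OF M.cpt_comm_group] by (simp add: K_pair)
  fix y assume "y : elts K j"
  then obtain w w' where v: "y = KPair w w'" "w : elts M j" "w' : elts M (j + 1)" unfolding K_mem by blast
  have d: "dact M i (j + 1) b w' : elts M (i + j + 1)" using dact_closed[OF 3 v(3)] by (simp only: e)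
  show "dact K i j b (x \<otimes>[cpt K j] y) = dact K i j b x \<otimes>[cpt K (i + j)] dact K i j b y"
   unfolding u(1) v(1) K_act K_mult
   using dact_add_right[OF 3 u(2) v(2)] dact_add_right[OF 3 u(3) v(3), unfolded e] signed_mult[OF M.cpt_comm_group c(2) d]
   by simp
 qed
next
 case (4 b i c j u k)
 then obtain m m' where u: "u = KPair m m'" "m : elts M k" "m' : elts M (k + 1)" unfolding K_mem by blast
 have e: "i + j + (k + 1) = i + j + k + 1" "j + (k + 1) = j + k + 1" "i + (j + k + 1) = i + j + k + 1"
  "i + (j + k) = i + j + k" by linarith+
 have c: "dact M j (k + 1) c m' : elts M (j + k + 1)" using dact_closed[OF 4(2) u(3)] by (simp only: e)
 have d: "dact M i (j + k + 1) b (dact M j (k + 1) c m') : elts M (i + j + k + 1)"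
  using dact_closed[OF 4(1) c] by (simp only: e)
 have s: "signed (cpt M (i + j + k + 1)) i (signed (cpt M (i + j + k + 1)) j x) = signed (cpt M (i + j + k + 1)) (i + j) x"
  if "x : elts M (i + j + k + 1)" for x using that unfolding signed_def by auto
 have "dact M (i + j) (k + 1) (dmul A i j b c) m' = dact M i (j + k + 1) b (dact M j (k + 1) c m')"
  using dact_assoc[OF 4(1,2) u(3)] by (simp only: e)
 moreover have "dact M i (j + k + 1) b (signed (cpt M (j + k + 1)) j (dact M j (k + 1) c m'))
   = signed (cpt M (i + j + k + 1)) j (dact M i (j + k + 1) b (dact M j (k + 1) c m'))"
  using dact_signed[OF 4(1) c, of j] by (simp only: e)
 ultimately show ?case unfolding u(1) K_act
  using dact_assoc[OF 4(1,2) u(2)] s[OF d] by (simp only: e)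
next
 case (5 u j)
 then obtain m m' where u: "u = KPair m m'" "m : elts M j" "m' : elts M (j + 1)" unfolding K_mem by blast
 show ?case unfolding u(1) K_act using dact_dunit[OF u(2)] dact_dunit[OF u(3)] by (simp add: signed_def)
next
 case (6 b i u j)
 then obtain m m' where u: "u = KPair m m'" "m : elts M j" "m' : elts M (j + 1)" unfolding K_mem by blast
 show ?case unfolding u(1) by (rule K_leibniz[OF 6(1) u(2,3)])
qed

sublocale K: dg_module A K by (rule K_module)

text \<open>The map sending m to 1 tensor m. Up to signs the Koszul complex is the cone of
  multiplication by a, and \<open>emb_surj\<close> and \<open>emb_kernel\<close> are the parts of
  its long exact sequence around H^n(K).\<close>

definition emb :: "int \<Rightarrow> 'm koszul_elt \<Rightarrow> 'm koszul_elt" where "emb n m = KPair m \<one>[cpt M (n + 1)]"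

lemma emb_chain: "chain_map M K emb"
proof unfold_locales
 show "emb n : hom (cpt M n) (cpt K n)" for n
  by (rule homI) (auto simp: emb_def K_pair K_mult)
 show "emb (n + 1) (dif M n x) = dif K n (emb n x)" if "x : elts M n" for n x
  using that by (simp add: emb_def K_dif M.dif_one dact_zero(2)[OF a, of "n + 1", simplified])
qed

sublocale emb: chain_map M K emb by (rule emb_chain)

lemma emb_act: "b : elts A 0 ==> emb n (dact M 0 n b m) = dact K 0 n b (emb n m)"
 using dact_zero(2)[of b 0 "n + 1"] by (simp add: emb_def K_act signed_def)

text \<open>For a cocycle with components m and m', the class of m' is killed by a; injectivity of a
  in degree n + 1 makes m' a boundary d w.\<close>

lemma emb_surj:
 assumes inj: "!!c. c : carrier (coh_module M (n + 1)) ==>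
   coh_class A 0 a \<odot>[coh_module M (n + 1)] c = \<zero>[coh_module M (n + 1)] ==> c = \<zero>[coh_module M (n + 1)]"
  and u: "u : cocycles K n"
 shows "\<exists>z\<in>cocycles M n. coh_class K n (emb n z) = coh_class K n u"
proof -
 obtain m m' where m: "u = KPair m m'" "m : elts M n" "m' : elts M (n + 1)"
  using K.M.cocycles_carrier[OF u] unfolding K_mem by blast
 let ?am = "dact M 0 (n + 1) a m'"
 have amc: "?am : elts M (n + 1)" by (rule act0_closed[OF a m(3)])
 have dm: "dif M n m : elts M (n + 1)" using m(2) by simp
 have "dif K n u = \<one>[cpt K (n + 1)]" using u by (simp add: K.M.cocycles_iff)
 then have 1: "dif M n m \<otimes>[cpt M (n + 1)] ?am = \<one>[cpt M (n + 1)]"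
  and 2: "inv\<^bsub>cpt M (n + 1 + 1)\<^esub> dif M (n + 1) m' = \<one>[cpt M (n + 1 + 1)]"
  unfolding m(1) K_dif K_one by auto
 have z': "m' : cocycles M (n + 1)"
  using 2 m(3) M.G.inv_inv[OF M.dif_closed[OF m(3)]] M.G.inv_one by (simp add: M.cocycles_iff)
 have "?am = inv\<^bsub>cpt M (n + 1)\<^esub> dif M n m" using M.G.inv_equality[OF 1 amc dm]
  by (metis "1" M.G.inv_equality M.G.m_comm amc dm)
 then have "?am : coboundaries M (n + 1)" using M.coboundaries_inv[OF M.coboundariesI'[OF m(2) refl]] by simp
 then have "coh_class M (n + 1) ?am = \<one>[cohomology M (n + 1)]" using M.coh_class_zero_iff[OF amc] by simp
 then have "coh_class A 0 a \<odot>[coh_module M (n + 1)] coh_class M (n + 1) m' = \<zero>[coh_module M (n + 1)]"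
  unfolding smult_class[OF a z'] by (simp add: coh_module_def)
 then have "coh_class M (n + 1) m' = \<zero>[coh_module M (n + 1)]"
  using inj[of "coh_class M (n + 1) m'"] z' by (auto simp: coh_module_simps(1))
 then have "m' : coboundaries M (n + 1)" using M.coh_class_zero_iff[OF m(3)] by (simp add: coh_module_def)
 then obtain w where w: "w : elts M n" "m' = dif M n w" using M.coboundariesE[of m' "n + 1"] by auto
 let ?aw = "dact M 0 n a w"
 have aw: "?aw : elts M n" by (rule act0_closed[OF a w(1)])
 let ?z = "?aw \<otimes>[cpt M n] m"
 have zc: "?z : elts M n" using aw m(2) by simp
 have "dif M n ?z = ?am \<otimes>[cpt M (n + 1)] dif M n m"
  using M.dif_mult[OF aw m(2)] dif_act0[OF a w(1)] w(2) by simp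
 then have "dif M n ?z = \<one>[cpt M (n + 1)]" using 1 M.G.m_comm[OF amc dm] by simp
 then have z: "?z : cocycles M n" using zc by (simp add: M.cocycles_iff)
 \<comment> \<open>The element w in the second slot has boundary (a w, -m'); adding this boundary to
   u removes the second component.\<close>
 have p: "KPair \<one>[cpt M (n - 1)] w : elts K (n - 1)" using w(1) by (simp add: K_pair)
 have "dif K (n - 1) (KPair \<one>[cpt M (n - 1)] w) = KPair ?aw (inv\<^bsub>cpt M (n + 1)\<^esub> m')"
  unfolding K_dif using M.dif_one[of "n - 1"] aw w(2) by simp
 then have b: "KPair ?aw (inv\<^bsub>cpt M (n + 1)\<^esub> m') : coboundaries K n" using K.M.coboundariesI[OF p] by simp
 have "KPair ?aw (inv\<^bsub>cpt M (n + 1)\<^esub> m') \<otimes>[cpt K n] u = emb n ?z"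
  unfolding m(1) K_mult emb_def using m(3) by simp
 then have "coh_class K n (emb n ?z) = coh_class K n u"
  using K.M.coh_class_shift[OF b K.M.cocycles_carrier[OF u]] by simp
 then show ?thesis using z by blast
qed

text \<open>If 1 tensor z is the boundary of the pair of m and m', then z = d m + a m' and d m' = 0,
  so the class of z is a times that of m'.\<close>

lemma emb_kernel:
 assumes z: "z : cocycles M n" and k: "coh_class K n (emb n z) = \<zero>[coh_module K n]"
 shows "\<exists>c\<in>carrier (coh_module M n). coh_class M n z = coh_class A 0 a \<odot>[coh_module M n] c"
proof -
 have zc: "z : elts M n" using M.cocycles_carrier[OF z] .
 have "emb n z : coboundaries K n"
  using k K.M.coh_class_zero_iff[OF emb.g_closed[OF zc]] by (simp add: coh_module_def)
 then obtain u where u: "u : elts K (n - 1)" "emb n z = dif K (n - 1) u" by (rule K.M.coboundariesE)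
 obtain m m' where m: "u = KPair m m'" "m : elts M (n - 1)" "m' : elts M n"
  using u(1) unfolding K_mem by auto
 have e: "z = dif M (n - 1) m \<otimes>[cpt M n] dact M 0 n a m'" "inv\<^bsub>cpt M (n + 1)\<^esub> dif M n m' = \<one>[cpt M (n + 1)]"
  using u(2) unfolding m(1) K_dif emb_def by simp_all
 have m': "m' : cocycles M n"
  using e(2) m(3) M.G.inv_inv[OF M.dif_closed[OF m(3)]] M.G.inv_one by (simp add: M.cocycles_iff)
 have "coh_class M n z = coh_class M n (dact M 0 n a m')"
  unfolding e(1) by (rule M.coh_class_shift[OF M.coboundariesI[OF m(2)] act0_closed[OF a m(3)]])
 then show ?thesis using smult_class[OF a m'] m' by (auto simp: coh_module_simps(1))
qed

end

text \<open>The preimage of N + x M' under a surjection is the preimage of N plus x M, so the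
  recursion on M and the one on M' run in parallel. This takes the place of an identification of M'
  with a quotient of M.\<close>

lemma module_regular_surjective:
 assumes M: "module R M" and M': "module R M'"
  and closed: "!!m. m : carrier M ==> g m : carrier M'"
  and add: "!!m n. m : carrier M ==> n : carrier M ==> g (m \<oplus>[M] n) = g m \<oplus>[M'] g n"
  and smult: "!!a m. a : carrier R ==> m : carrier M ==> g (a \<odot>[M] m) = a \<odot>[M'] g m"
  and surj: "!!c. c : carrier M' ==> \<exists>m\<in>carrier M. g m = c"
  and "N \<subseteq> carrier M'" "set xs \<subseteq> carrier R" "module_regular M {m : carrier M. g m : N} xs"
 shows "module_regular M' N xs"
 using assms(7-)
proof (induction xs arbitrary: N)
 case (Cons x xs)
 interpret M: module R M by (rule M)
 interpret M': module R M' by (rule M')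
 have x: "x : carrier R" using Cons.prems by simp
 have reg: "c : N" if c: "c : carrier M'" "x \<odot>[M'] c : N" for c
 proof -
  obtain m where m: "m : carrier M" "g m = c" using surj[OF c(1)] by blast
  then show ?thesis using Cons.prems(3) c(2) smult[OF x m(1)] x by auto
 qed
 have "{m : carrier M. g m : madj M' N x} = madj M {m : carrier M. g m : N} x"
 proof
  show "{m : carrier M. g m : madj M' N x} \<subseteq> madj M {m : carrier M. g m : N} x"
  proof
   fix m assume "m : {m : carrier M. g m : madj M' N x}"
   then obtain n c where m: "m : carrier M" and n: "n : N" and c: "c : carrier M'" and e: "g m = n \<oplus>[M'] x \<odot>[M'] c"
    unfolding madj_def by blast
   obtain d where d: "d : carrier M" "g d = c" using surj[OF c] by blast
   have xd: "x \<odot>[M] d : carrier M" using x d by simp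
   let ?m = "m \<oplus>[M] \<ominus>\<^bsub>M\<^esub> (x \<odot>[M] d)"
   have m': "?m : carrier M" using m xd by simp
   have eq: "?m \<oplus>[M] x \<odot>[M] d = m" using m xd by (simp add: M.M.add.m_assoc M.M.l_neg)
   have nc: "n : carrier M'" using n Cons.prems(1) by blast
   have "g ?m \<oplus>[M'] x \<odot>[M'] c = n \<oplus>[M'] x \<odot>[M'] c"
    using add[OF m' xd] eq e smult[OF x d(1)] d(2) by simp
   then have "g ?m = n" using closed[OF m'] nc x c by simp
   then show "m : madj M {m : carrier M. g m : N} x" unfolding madj_def
    using m' n d(1) eq by (intro CollectI exI[of _ ?m] exI[of _ d]) auto
  qed
  show "madj M {m : carrier M. g m : N} x \<subseteq> {m : carrier M. g m : madj M' N x}"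
  proof
   fix m assume "m : madj M {m : carrier M. g m : N} x"
   then obtain n d where nd: "n : carrier M" "g n : N" "d : carrier M" and m: "m = n \<oplus>[M] x \<odot>[M] d"
    unfolding madj_def by blast
   have "g m = g n \<oplus>[M'] x \<odot>[M'] g d" unfolding m using add smult nd x by simp
   then show "m : {m : carrier M. g m : madj M' N x}" unfolding madj_def using nd m x closed by auto
  qed
 qed
 then have "module_regular M {m : carrier M. g m : madj M' N x} xs" using Cons.prems(3) by simp
 moreover have "madj M' N x \<subseteq> carrier M'" unfolding madj_def using Cons.prems(1) x by auto
 ultimately have "module_regular M' (madj M' N x) xs" using Cons.IH Cons.prems(2) by simp
 then show ?case using reg by simp
qed simp

lemma coh_map_linear:
 assumes M: "dg_module A M" and N: "dg_module A N" and g: "chain_map M N g"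
  and act: "!!b m n. b : elts A 0 ==> m : elts M n ==> g n (dact M 0 n b m) = dact N 0 n b (g n m)"
 shows "!!c. c : carrier (coh_module M n) ==> coh_map N g n c : carrier (coh_module N n)"
  "!!c d. c : carrier (coh_module M n) ==> d : carrier (coh_module M n) ==>
    coh_map N g n (c \<oplus>[coh_module M n] d) = coh_map N g n c \<oplus>[coh_module N n] coh_map N g n d"
  "!!x c. x : carrier (H0 A) ==> c : carrier (coh_module M n) ==>
    coh_map N g n (x \<odot>[coh_module M n] c) = x \<odot>[coh_module N n] coh_map N g n c"
proof -
 interpret M: dg_module A M by (rule M)
 interpret N: dg_module A N by (rule N)
 interpret g: chain_map M N g by (rule g)
 show "coh_map N g n c : carrier (coh_module N n)" if c: "c : carrier (coh_module M n)" for c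
 proof -
  obtain z where "z : cocycles M n" "c = coh_class M n z" using c unfolding M.coh_module_simps by blast
  then show ?thesis using g.coh_map_class g.g_cocycles unfolding N.coh_module_simps by auto
 qed
 show "coh_map N g n (c \<oplus>[coh_module M n] d) = coh_map N g n c \<oplus>[coh_module N n] coh_map N g n d"
  if cd: "c : carrier (coh_module M n)" "d : carrier (coh_module M n)" for c d
 proof -
  obtain z where z: "z : cocycles M n" "c = coh_class M n z" using cd(1) unfolding M.coh_module_simps by blast
  obtain w where w: "w : cocycles M n" "d = coh_class M n w" using cd(2) unfolding M.coh_module_simps by blast
  show ?thesis unfolding z(2) w(2) M.coh_module_simps(3)[OF z(1) w(1)]
   g.coh_map_class[OF z(1)] g.coh_map_class[OF w(1)] g.coh_map_class[OF M.M.cocycles_mult[OF z(1) w(1)]]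
   N.coh_module_simps(3)[OF g.g_cocycles[OF z(1)] g.g_cocycles[OF w(1)]]
   using g.g_mult z(1) w(1) M.M.cocycles_carrier by simp
 qed
 show "coh_map N g n (x \<odot>[coh_module M n] c) = x \<odot>[coh_module N n] coh_map N g n c"
  if xc: "x : carrier (H0 A)" "c : carrier (coh_module M n)" for x c
 proof -
  obtain b where b: "b : elts A 0" "x = coh_class A 0 b" using xc(1) unfolding M.H0_carrier by blast
  obtain z where z: "z : cocycles M n" "c = coh_class M n z" using xc(2) unfolding M.coh_module_simps by blast
  show ?thesis unfolding z(2) b(2) M.smult_class[OF b(1) z(1)] g.coh_map_class[OF z(1)]
   g.coh_map_class[OF M.act0_cocycles[OF b(1) z(1)]] N.smult_class[OF b(1) g.g_cocycles[OF z(1)]]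
   using act[OF b(1) M.M.cocycles_carrier[OF z(1)]] by simp
 qed
qed

lemma (in dg_module) trivial_cohomology_iff:
 "trivial_group (cohomology M n) \<longleftrightarrow> carrier (coh_module M n) = {\<zero>[coh_module M n]}"
 using comm_group.axioms(2)[OF M.cohomology_comm_group[of n]]
 unfolding trivial_group_def by (simp add: coh_module_def)

text \<open>Injectivity of a in all degrees breaks the long exact sequence into short ones: H^n(K)
  is H^n(M) modulo a, and the remaining sequence is regular on it. Boundedness below passes along
  the surjection.\<close>

lemma (in koszul_module) koszul_regular:
 assumes bb: "bounded_below M" and xs: "set xs \<subseteq> carrier (H0 A)"
  and reg: "!!n. module_regular (coh_module M n) {\<zero>[coh_module M n]} (coh_class A 0 a # xs)"
 shows "bounded_below K" "module_regular (coh_module K n) {\<zero>[coh_module K n]} xs"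
proof -
 let ?x = "coh_class A 0 a"
 have inj: "c = \<zero>[coh_module M n]"
  if "c : carrier (coh_module M n)" "?x \<odot>[coh_module M n] c = \<zero>[coh_module M n]" for c n
  using reg[of n] that by simp
 note lin = coh_map_linear[OF dg_module_axioms K_module emb_chain emb_act]
 have surj: "\<exists>m\<in>carrier (coh_module M n). coh_map K emb n m = c" if c: "c : carrier (coh_module K n)" for c n
 proof -
  obtain u where u: "u : cocycles K n" "c = coh_class K n u" using c unfolding K.coh_module_simps by blast
  obtain z where z: "z : cocycles M n" "coh_class K n (emb n z) = coh_class K n u" using emb_surj[OF inj u(1)] by blast
  then show ?thesis using emb.coh_map_class[OF z(1)] u(2) by (auto simp: coh_module_simps(1))
 qed
 have zero: "coh_map K emb n \<zero>[coh_module M n] = \<zero>[coh_module K n]" for n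
  unfolding coh_module_simps(2) K.coh_module_simps(2) emb.coh_map_class[OF M.cocycles_one] emb.g_one ..
 obtain N where N: "!!n. n < N ==> trivial_group (cohomology M n)" using bb unfolding bounded_below_def by blast
 show "bounded_below K" unfolding bounded_below_def
 proof (intro exI allI impI)
  fix n assume "n < N"
  then have t: "carrier (coh_module M n) = {\<zero>[coh_module M n]}" using N trivial_cohomology_iff by blast
  have "c = \<zero>[coh_module K n]" if "c : carrier (coh_module K n)" for c
   using surj[OF that] t zero by auto
  moreover have "\<zero>[coh_module K n] : carrier (coh_module K n)"
   unfolding K.coh_module_simps using K.M.cocycles_one by blast
  ultimately have "carrier (coh_module K n) = {\<zero>[coh_module K n]}" by blast
  then show "trivial_group (cohomology K n)" using K.trivial_cohomology_iff by blast
 qed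
 interpret HM: module "H0 A" "coh_module M n" by (rule coh_module_module)
 interpret HK: module "H0 A" "coh_module K n" by (rule K.coh_module_module)
 have x: "?x : carrier (H0 A)" unfolding H0_carrier using a by blast
 have "{m : carrier (coh_module M n). coh_map K emb n m : {\<zero>[coh_module K n]}}
   = madj (coh_module M n) {\<zero>[coh_module M n]} ?x"
 proof
  show "{m : carrier (coh_module M n). coh_map K emb n m : {\<zero>[coh_module K n]}}
    \<subseteq> madj (coh_module M n) {\<zero>[coh_module M n]} ?x"
  proof
   fix m assume "m : {m : carrier (coh_module M n). coh_map K emb n m : {\<zero>[coh_module K n]}}"
   then have m: "m : carrier (coh_module M n)" "coh_map K emb n m = \<zero>[coh_module K n]" by auto
   obtain z where z: "z : cocycles M n" "m = coh_class M n z" using m(1) unfolding coh_module_simps by blast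
   obtain c where c: "c : carrier (coh_module M n)" "m = ?x \<odot>[coh_module M n] c"
    using emb_kernel[OF z(1)] m(2) emb.coh_map_class[OF z(1)] z(2) by auto
   have "m = \<zero>[coh_module M n] \<oplus>[coh_module M n] ?x \<odot>[coh_module M n] c"
    using c x by simp
   then show "m : madj (coh_module M n) {\<zero>[coh_module M n]} ?x" unfolding madj_def using c(1) by blast
  qed
  show "madj (coh_module M n) {\<zero>[coh_module M n]} ?x
    \<subseteq> {m : carrier (coh_module M n). coh_map K emb n m : {\<zero>[coh_module K n]}}"
  proof
   fix m assume "m : madj (coh_module M n) {\<zero>[coh_module M n]} ?x"
   then obtain c where c: "c : carrier (coh_module M n)" "m = \<zero>[coh_module M n] \<oplus>[coh_module M n] ?x \<odot>[coh_module M n] c"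
    unfolding madj_def by blast
   then have m: "m = ?x \<odot>[coh_module M n] c" using x by simp
   obtain z where z: "z : cocycles M n" "c = coh_class M n z" using c(1) unfolding coh_module_simps by blast
   let ?az = "dact M 0 n a z"
   have zc: "z : elts M n" "dif M n z = \<one>[cpt M (n + 1)]" using z(1) by (auto simp: M.cocycles_iff)
   have p: "KPair \<one>[cpt M (n - 1)] z : elts K (n - 1)" using zc(1) by (simp add: K_pair)
   have "dif K (n - 1) (KPair \<one>[cpt M (n - 1)] z) = emb n ?az"
    unfolding K_dif emb_def using M.dif_one[of "n - 1"] act0_closed[OF a zc(1)] zc(2) by simp
   then have "emb n ?az : coboundaries K n" using K.M.coboundariesI[OF p] by simp
   then have "coh_class K n (emb n ?az) = \<zero>[coh_module K n]"
    using K.M.coh_class_zero_iff[of "emb n ?az" n] K.M.coboundaries_carrier by (simp add: coh_module_def)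
   then have "coh_map K emb n m = \<zero>[coh_module K n]"
    unfolding m z(2) smult_class[OF a z(1)] emb.coh_map_class[OF act0_cocycles[OF a z(1)]] .
   moreover have "m : carrier (coh_module M n)" unfolding m using x c(1) by simp
   ultimately show "m : {m : carrier (coh_module M n). coh_map K emb n m : {\<zero>[coh_module K n]}}" by blast
  qed
 qed
 then have "module_regular (coh_module M n) {m : carrier (coh_module M n). coh_map K emb n m : {\<zero>[coh_module K n]}} xs"
  using reg[of n] by simp
 then show "module_regular (coh_module K n) {\<zero>[coh_module K n]} xs"
  by (intro module_regular_surjective[OF coh_module_module K.coh_module_module lin(1) lin(2) lin(3) surj _ xs]) auto
qed

text \<open>The definition concerns the lowest cohomology module only, but the cohomology of a
  Koszul complex in degree n involves degrees n and n + 1. Regularity in every degree is the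
  hypothesis that reproduces itself, and it requires no knowledge of where the infimum
  moves.\<close>

lemma regular_sequence_criterion:
 assumes "dg_module A M" "bounded_below M" "set xs \<subseteq> carrier (H0 A)"
  "!!n. module_regular (coh_module M n) {\<zero>[coh_module M n]} xs"
 shows "regular_sequence M xs"
 using assms
proof (induction xs arbitrary: M)
 case (Cons x xs)
 interpret M: dg_module A M by (rule Cons.prems(1))
 have x: "x : carrier (H0 A)" and xs: "set xs \<subseteq> carrier (H0 A)" using Cons.prems(3) by auto
 obtain b where b: "b : elts A 0" "x = coh_class A 0 b" using x unfolding M.H0_carrier by blast
 \<comment> \<open>The very lift chosen by \<open>koszul_H0\<close>: any member of the class x lies
   in degree 0 and represents x.\<close>
 define a where "a = (SOME a. a : x)"
 have "a : x" unfolding a_def using M.A.coh_class_self[OF b(1)] b(2) by (metis someI)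
 then have a0: "a : elts A 0" and ax: "coh_class A 0 a = x"
  using M.A.coh_class_memD[of a 0 b] b M.cocycles_zero by auto
 interpret koszul_module A M a by unfold_locales (rule a0)
 have reg: "!!n. module_regular (coh_module M n) {\<zero>[coh_module M n]} (coh_class A 0 a # xs)"
  using Cons.prems(4) ax by simp
 have "regular_sequence (koszul M a) xs"
  by (rule Cons.IH[OF K_module koszul_regular(1)[OF Cons.prems(2) xs reg] xs koszul_regular(2)[OF Cons.prems(2) xs reg]])
 moreover have "regular_element M x" unfolding regular_element_def
 proof (intro conjI impI inj_onI)
  show "bounded_below M" by (rule Cons.prems(2))
  fix c d assume cd: "c : carrier (coh_module M (coh_inf M))" "d : carrier (coh_module M (coh_inf M))"
   "x \<odot>[coh_module M (coh_inf M)] c = x \<odot>[coh_module M (coh_inf M)] d"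
  let ?H = "coh_module M (coh_inf M)"
  interpret H: module "H0 A" ?H by (rule M.coh_module_module)
  have "x \<odot>[?H] (c \<ominus>\<^bsub>?H\<^esub> d) = \<zero>[?H]"
   using cd x H.smult_r_distr[of x c "\<ominus>\<^bsub>?H\<^esub> d"] H.smult_r_minus[of x d] H.M.r_neg by (simp add: H.M.minus_eq)
  then have "c \<ominus>\<^bsub>?H\<^esub> d = \<zero>[?H]" using Cons.prems(4)[of "coh_inf M"] cd by simp
  then show "c = d" using cd(1,2) H.M.r_neg H.M.minus_equality H.M.minus_minus H.M.a_inv_closed unfolding H.M.minus_eq by metis
 qed
 ultimately show ?case by (simp add: koszul_H0_def a_def)
qed simp

lemma koszul_base_module:
 assumes "dg_module A M" shows "dg_module A (koszul_base M)"
proof -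
 interpret dg_module A M by fact
 let ?B = "koszul_base M"
 have grp: "comm_group (cpt ?B n)" for n
 proof (rule comm_groupI)
  fix x assume "x : elts ?B n"
  then show "\<exists>y\<in>elts ?B n. y \<otimes>[cpt ?B n] x = \<one>[cpt ?B n]"
   by (intro bexI[of _ "KBase (inv\<^bsub>cpt M n\<^esub> (kbase x))"]) (auto simp: koszul_base_def)
 qed (auto simp: koszul_base_def M.G.m_ac)
 have inv: "inv\<^bsub>cpt ?B n\<^esub> (KBase m) = KBase (inv\<^bsub>cpt M n\<^esub> m)" if "m : elts M n" for m n
  using comm_group.axioms(2)[OF grp] that by (intro group.inv_equality) (auto simp: koszul_base_def)
 have sg: "signed (cpt ?B n) k (KBase m) = KBase (signed (cpt M n) k m)" if "m : elts M n" for m n k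
  using inv[OF that] by (simp add: signed_def)
 show ?thesis
 proof (unfold_locales, goal_cases)
  case 1
  show ?case unfolding cochain_complex_def
   using grp by (auto simp: koszul_base_def hom_def M.dif_mult M.dif_dif)
 next
  case (6 b i u j)
  obtain m where m: "m : elts M j" "u = KBase m" using 6(2) by (auto simp: koszul_base_def)
  have e: "i + (j + 1) = i + j + 1" by simp
  have "dact M i (j + 1) b (dif M j m) : elts M (i + j + 1)"
   using dact_closed[OF 6(1) M.dif_closed[OF m(1)]] by (simp only: e)
  from sg[OF this, of i] show ?case using module_leibniz[OF 6(1) m(1)] m(2) by (simp add: koszul_base_def)
 qed (auto simp: koszul_base_def hom_def dact_closed dact_add_left dact_add_right dact_assoc dact_dunit)
qed

text \<open>The wrapping by \<open>KBase\<close> is an isomorphism of DG-modules; it carries the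
  hypothesis on the cohomology of B to the type in which Koszul complexes can be iterated.\<close>

theorem sequence_regular_criterion:
 assumes loc: "noetherian_local_dg_ring B \<mm>" and bd: "bounded_cohomology B"
  and xs: "set xs \<subseteq> \<mm>" "Idl\<^bsub>H0 B\<^esub> (set xs) = \<mm>"
  and reg: "!!n. module_regular (coh_module (dg_self B) n) {\<zero>[coh_module (dg_self B) n]} xs"
 shows "sequence_regular B"
proof -
 interpret B: dg_ring B using loc unfolding noetherian_local_dg_ring_def noetherian_dg_ring_def by blast
 interpret S: dg_module B "dg_self B" by (rule B.dg_self_module)
 interpret K: dg_module B "koszul_base (dg_self B)" by (rule koszul_base_module[OF B.dg_self_module])
 let ?S = "dg_self B" and ?K = "koszul_base (dg_self B)"
 have ch: "chain_map ?S ?K (%n. KBase)"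
  by unfold_locales (auto simp: koszul_base_def hom_def)
 interpret g: chain_map ?S ?K "%n. KBase" by (rule ch)
 note lin = coh_map_linear[OF B.dg_self_module koszul_base_module[OF B.dg_self_module] ch]
 have act: "KBase (dact ?S 0 n b m) = dact ?K 0 n b (KBase m)" for n b m by (simp add: koszul_base_def)
 have cocycle: "\<exists>z. z : cocycles ?S n \<and> u = KBase z" if "u : cocycles ?K n" for u n
  using that by (auto simp: cocycles_def kernel_def koszul_base_def)
 have surj: "\<exists>m\<in>carrier (coh_module ?S n). coh_map ?K (%n. KBase) n m = c" if c: "c : carrier (coh_module ?K n)" for c n
 proof -
  obtain u where u: "u : cocycles ?K n" "c = coh_class ?K n u" using c unfolding K.coh_module_simps by blast
  obtain z where z: "z : cocycles ?S n" "u = KBase z" using cocycle[OF u(1)] by blast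
  then show ?thesis using g.coh_map_class[OF z(1)] u(2) by (auto simp: S.coh_module_simps(1))
 qed
 have zero: "coh_map ?K (%n. KBase) n \<zero>[coh_module ?S n] = \<zero>[coh_module ?K n]" for n
  unfolding S.coh_module_simps(2) K.coh_module_simps(2) g.coh_map_class[OF S.M.cocycles_one] g.g_one ..
 have ker: "c = \<zero>[coh_module ?S n]"
  if c: "c : carrier (coh_module ?S n)" "coh_map ?K (%n. KBase) n c = \<zero>[coh_module ?K n]" for c n
 proof -
  obtain z where z: "z : cocycles ?S n" "c = coh_class ?S n z" using c(1) unfolding S.coh_module_simps by blast
  have zc: "z : elts ?S n" using S.M.cocycles_carrier[OF z(1)] .
  have "KBase z : coboundaries ?K n"
   using c(2) unfolding z(2) g.coh_map_class[OF z(1)]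
   using K.M.coh_class_zero_iff[OF g.g_closed[OF zc]] by (simp add: coh_module_def)
  then have "z : coboundaries ?S n" by (auto simp: coboundaries_def koszul_base_def)
  then show ?thesis unfolding z(2) using S.M.coh_class_zero_iff[OF zc] by (simp add: coh_module_def)
 qed
 have z0: "\<zero>[coh_module ?S n] : carrier (coh_module ?S n)" for n
  unfolding S.coh_module_simps using S.M.cocycles_one by blast
 have "{m : carrier (coh_module ?S n). coh_map ?K (%n. KBase) n m : {\<zero>[coh_module ?K n]}} = {\<zero>[coh_module ?S n]}" for n
  using zero ker z0 by auto
 then have pre: "module_regular (coh_module ?S n) {m : carrier (coh_module ?S n). coh_map ?K (%n. KBase) n m : {\<zero>[coh_module ?K n]}} xs" for n
  using reg by simp
 have max: "maximalideal \<mm> (H0 B)" using loc unfolding noetherian_local_dg_ring_def by blast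
 have xsc: "set xs \<subseteq> carrier (H0 B)" using xs(1) ideal_facts(1)[OF maximalideal.axioms(1)[OF max]] by blast
 have k0: "{\<zero>[coh_module ?K n]} \<subseteq> carrier (coh_module ?K n)" for n
  unfolding K.coh_module_simps using K.M.cocycles_one by blast
 have "regular_sequence ?K xs"
 proof (rule regular_sequence_criterion[OF K.dg_module_axioms _ xsc])
  show "module_regular (coh_module ?K n) {\<zero>[coh_module ?K n]} xs" for n
   by (rule module_regular_surjective[OF S.coh_module_module K.coh_module_module lin(1)[OF act] lin(2)[OF act]
      lin(3)[OF act] surj k0 xsc pre])
  obtain N where N: "!!n. n < N ==> trivial_group (cohomology B n)" using bd unfolding bounded_cohomology_def by blast
  show "bounded_below ?K" unfolding bounded_below_def
  proof (intro exI allI impI)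
   fix n assume "n < N"
   then have "trivial_group (cohomology ?S n)" using N by (simp add: dg_self_cohomology)
   then have t: "carrier (coh_module ?S n) = {\<zero>[coh_module ?S n]}" using S.trivial_cohomology_iff by blast
   have "c = \<zero>[coh_module ?K n]" if "c : carrier (coh_module ?K n)" for c
    using surj[OF that] t zero by auto
   then have "carrier (coh_module ?K n) = {\<zero>[coh_module ?K n]}" using k0 by blast
   then show "trivial_group (cohomology ?K n)" using K.trivial_cohomology_iff by blast
  qed
 qed
 then show ?thesis unfolding sequence_regular_def using loc bd xs by blast
qed

section \<open>Stalks\<close>

text \<open>Germs depend on restriction maps alone. The locale serves both the graded pieces of a
  sheaf of DG-rings and the presheaf formed by \<open>H0\<close> of its sections, which is a sheaf
  only after sheafification.\<close>

locale presheaf_at =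
 fixes T :: "'p topology" and S :: "'p set \<Rightarrow> 'a set" and r :: "'p set \<Rightarrow> 'p set \<Rightarrow> 'a \<Rightarrow> 'a" and x :: 'p
 assumes x: "x : topspace T"
  and r_closed: "openin T U ==> openin T V ==> V \<subseteq> U ==> s : S U ==> r U V s : S V"
  and r_id: "openin T U ==> s : S U ==> r U U s = s"
  and r_comp: "openin T U ==> openin T V ==> openin T W ==> W \<subseteq> V ==> V \<subseteq> U ==> s : S U ==>
    r V W (r U V s) = r U W s"
begin

definition nb :: "'p set \<Rightarrow> bool" where "nb U \<longleftrightarrow> openin T U \<and> x : U"

lemma nb_top: "nb (topspace T)" unfolding nb_def using x by simp
lemma nb_Int: "nb U ==> nb V ==> nb (U \<inter> V)" unfolding nb_def by auto
abbreviation gm where "gm \<equiv> germ T S r x"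
abbreviation gms where "gms \<equiv> germs T S r x"

lemma gm_mem: "(V, t) : gm U s \<longleftrightarrow> nb V \<and> t : S V \<and> (\<exists>W. nb W \<and> W \<subseteq> U \<inter> V \<and> r U W s = r V W t)"
 unfolding germ_def nb_def by auto

lemma agree_smaller:
 assumes "nb U" "nb V" "s : S U" "t : S V" "nb W" "W \<subseteq> U \<inter> V" "r U W s = r V W t" "nb W'" "W' \<subseteq> W"
 shows "r U W' s = r V W' t"
 using r_comp[of U W W' s] r_comp[of V W W' t] assms by (auto simp: nb_def)

lemma gm_sub:
 assumes "nb U" "nb V" "s : S U" "t : S V" "nb W" "W \<subseteq> U \<inter> V" "r U W s = r V W t"
 shows "gm U s \<subseteq> gm V t"
proof clarify
 fix Y y assume "(Y, y) : gm U s"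
 then obtain W' where y: "nb Y" "y : S Y" "nb W'" "W' \<subseteq> U \<inter> Y" "r U W' s = r Y W' y" unfolding gm_mem by blast
 let ?W = "W \<inter> W'"
 have n: "nb ?W" using nb_Int assms(5) y(3) by blast
 have "r U ?W s = r V ?W t" using agree_smaller[OF assms(1-7) n] by simp
 moreover have "r U ?W s = r Y ?W y" using agree_smaller[OF assms(1) y(1) assms(3) y(2-5) n] by simp
 ultimately show "(Y, y) : gm V t" unfolding gm_mem using y n assms(6) by (intro conjI exI[of _ ?W]) auto
qed

lemma gm_eqI:
 assumes "nb U" "nb V" "s : S U" "t : S V" "nb W" "W \<subseteq> U \<inter> V" "r U W s = r V W t"
 shows "gm U s = gm V t"
 using gm_sub[OF assms] gm_sub[OF assms(2,1,4,3,5) _ assms(7)[symmetric]] assms(6) by blast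

lemma gm_self: "nb U ==> s : S U ==> (U, s) : gm U s"
 unfolding gm_mem by (intro conjI exI[of _ U]) auto

lemma gm_memD:
 assumes "nb U" "s : S U" "(V, t) : gm U s"
 shows "nb V" "t : S V" "gm V t = gm U s"
proof -
 obtain W where w: "nb V" "t : S V" "nb W" "W \<subseteq> U \<inter> V" "r U W s = r V W t" using assms(3) unfolding gm_mem by blast
 then show "nb V" "t : S V" by auto
 show "gm V t = gm U s" using gm_eqI[OF assms(1) w(1) assms(2) w(2-5)] by simp
qed

lemma gm_eqD:
 assumes "nb U" "nb V" "s : S U" "t : S V" "gm U s = gm V t"
 obtains W where "nb W" "W \<subseteq> U \<inter> V" "r U W s = r V W t"
proof -
 have "(V, t) : gm U s" using gm_self[OF assms(2,4)] assms(5) by simp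
 then show ?thesis using that unfolding gm_mem by blast
qed

lemma gm_restrict: "nb U ==> nb V ==> V \<subseteq> U ==> s : S U ==> gm V (r U V s) = gm U s"
 using r_id[of V "r U V s"] r_closed[of U V s] by (intro gm_eqI[of V U _ _ V]) (auto simp: nb_def)

lemma gm_closed: "nb U ==> s : S U ==> gm U s : gms"
 unfolding germs_def nb_def by blast

lemma gmsE:
 assumes "g : gms" obtains U s where "nb U" "s : S U" "g = gm U s"
 using assms unfolding germs_def nb_def by blast

lemma gmsE_in:
 assumes "g : gms" "nb V" obtains U s where "nb U" "U \<subseteq> V" "s : S U" "g = gm U s"
proof -
 obtain U s where u: "nb U" "s : S U" "g = gm U s" by (rule gmsE[OF assms(1)])
 have n: "nb (U \<inter> V)" using nb_Int u(1) assms(2) by blast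
 show ?thesis
  using that[OF n _ r_closed[of U "U \<inter> V" s]] gm_restrict[OF u(1) n _ u(2)] u n by (simp add: nb_def)
qed

text \<open>Operations on stalks are unions over all representatives; such a union is a value as
  soon as all representatives give the same one.\<close>

lemma Union_germ:
 assumes "nb U" "s : S U" "!!V t. nb V ==> t : S V ==> gm V t = gm U s ==> F V t = c"
 shows "(\<Union>(V, t)\<in>gm U s. F V t) = c"
proof -
 have "(\<Union>(V, t)\<in>gm U s. F V t) = (\<Union>p\<in>gm U s. c)"
  using gm_memD[OF assms(1,2)] assms(3) by (intro SUP_cong) (auto simp: split_def)
 then show ?thesis using gm_self[OF assms(1,2)] by auto
qed

end

locale dg_space_at =
 fixes K :: "'k ring" and X :: "('p, 'a, 'k) dg_space" and x :: 'p
 assumes X: "dg_ringed_space K X" and xX: "x : topspace (dsp X)"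
begin

sublocale pre: presheaf_at "dsp X" "%U. elts (dsec X U) n" "%U V. dres X U V n" x for n
proof unfold_locales
 have "sheaf_on (dsp X) (%U. elts (dsec X U) n) (%U V. dres X U V n)"
  using X unfolding dg_ringed_space_def by blast
 note s = this[unfolded sheaf_on_def]
 note s1 = s[THEN conjunct1] and s2 = s[THEN conjunct2, THEN conjunct1]
  and s3 = s[THEN conjunct2, THEN conjunct2, THEN conjunct1]
 show "x : topspace (dsp X)" by (rule xX)
 show "dres X U V n s : elts (dsec X V) n"
  if "openin (dsp X) U" "openin (dsp X) V" "V \<subseteq> U" "s : elts (dsec X U) n" for U V s
 proof -
  have "dres X U V n : elts (dsec X U) n \<rightarrow> elts (dsec X V) n"
   using s1[rule_format, of U V] that(1-3) by simp
  then show ?thesis using that(4) by (rule funcset_mem)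
 qed
 show "dres X U U n s = s" if "openin (dsp X) U" "s : elts (dsec X U) n" for U s
  using s2[rule_format, of U s] that by simp
 show "dres X V W n (dres X U V n s) = dres X U W n s"
  if "openin (dsp X) U" "openin (dsp X) V" "openin (dsp X) W" "W \<subseteq> V" "V \<subseteq> U" "s : elts (dsec X U) n" for U V W s
  using s3[rule_format, of U V W s] that by simp
qed

abbreviation nb where "nb U \<equiv> openin (dsp X) U \<and> x : U"

lemma nb_iff: "presheaf_at.nb (dsp X) x U \<longleftrightarrow> nb U" by (rule pre.nb_def)

abbreviation gm where "gm n U s \<equiv> dg_germ X x n U s"

lemmas gm_def = dg_germ_def

lemma sec_dg: "openin (dsp X) U ==> dg_ring (dsec X U)"
 using X unfolding dg_ringed_space_def dg_algebra_def by blast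

lemma res_hom: "openin (dsp X) U ==> openin (dsp X) V ==> V \<subseteq> U ==> dg_hom (dsec X U) (dsec X V) (dres X U V)"
 using X unfolding dg_ringed_space_def dg_alg_hom_def by blast

lemma res_facts:
 assumes "openin (dsp X) U" "openin (dsp X) V" "V \<subseteq> U"
 shows "s : elts (dsec X U) n ==> dres X U V n s : elts (dsec X V) n"
  "s : elts (dsec X U) n ==> t : elts (dsec X U) n ==>
   dres X U V n (s \<otimes>[cpt (dsec X U) n] t) = dres X U V n s \<otimes>[cpt (dsec X V) n] dres X U V n t"
  "s : elts (dsec X U) n ==> dres X U V (n + 1) (dif (dsec X U) n s) = dif (dsec X V) n (dres X U V n s)"
  "s : elts (dsec X U) i ==> t : elts (dsec X U) j ==>
   dres X U V (i + j) (dmul (dsec X U) i j s t) = dmul (dsec X V) i j (dres X U V i s) (dres X U V j t)"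
  "dres X U V 0 (dunit (dsec X U)) = dunit (dsec X V)"
  "dres X U V n \<one>[cpt (dsec X U) n] = \<one>[cpt (dsec X V) n]"
proof -
 note h = res_hom[OF assms, unfolded dg_hom_def]
 show "s : elts (dsec X U) n ==> dres X U V n s : elts (dsec X V) n"
  "s : elts (dsec X U) n ==> t : elts (dsec X U) n ==>
   dres X U V n (s \<otimes>[cpt (dsec X U) n] t) = dres X U V n s \<otimes>[cpt (dsec X V) n] dres X U V n t"
  using h[THEN conjunct1, rule_format, of n] by (simp_all add: hom_mult hom_in_carrier)
 show "s : elts (dsec X U) n ==> dres X U V (n + 1) (dif (dsec X U) n s) = dif (dsec X V) n (dres X U V n s)"
  "s : elts (dsec X U) i ==> t : elts (dsec X U) j ==>
   dres X U V (i + j) (dmul (dsec X U) i j s t) = dmul (dsec X V) i j (dres X U V i s) (dres X U V j t)"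
  "dres X U V 0 (dunit (dsec X U)) = dunit (dsec X V)"
  using h[THEN conjunct2, THEN conjunct1, rule_format, of s n] h[THEN conjunct2, THEN conjunct2, THEN conjunct1, rule_format, of s i t j]
   h[THEN conjunct2, THEN conjunct2, THEN conjunct2] by simp_all
 have "dres X U V n : hom (cpt (dsec X U) n) (cpt (dsec X V) n)" by (rule h[THEN conjunct1, rule_format])
 then show "dres X U V n \<one>[cpt (dsec X U) n] = \<one>[cpt (dsec X V) n]"
  using hom_one complex.cpt_group dg_ring.complex sec_dg assms by metis
qed

lemma gm_eqI:
 assumes "nb U" "nb V" "s : elts (dsec X U) n" "t : elts (dsec X V) n" "nb W" "W \<subseteq> U \<inter> V"
  "dres X U W n s = dres X V W n t"
 shows "gm n U s = gm n V t"
 unfolding gm_def using pre.gm_eqI[of U V s n t W] assms by (simp add: pre.nb_def)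

lemma gm_eqD:
 assumes "nb U" "nb V" "s : elts (dsec X U) n" "t : elts (dsec X V) n" "gm n U s = gm n V t"
 obtains W where "nb W" "W \<subseteq> U \<inter> V" "dres X U W n s = dres X V W n t"
 using pre.gm_eqD[of U V s n t] assms unfolding gm_def pre.nb_def by metis

lemma gm_restrict:
 "nb U ==> nb V ==> V \<subseteq> U ==> s : elts (dsec X U) n ==> gm n V (dres X U V n s) = gm n U s"
 unfolding gm_def using pre.gm_restrict[of U V s n] by (simp add: pre.nb_def)

lemma stalk_carrier: "elts (dg_stalk X x) n = germs (dsp X) (%U. elts (dsec X U) n) (%U V. dres X U V n) x"
 by (simp add: dg_stalk_def)

lemma gm_closed: "nb U ==> s : elts (dsec X U) n ==> gm n U s : elts (dg_stalk X x) n"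
 unfolding gm_def stalk_carrier using pre.gm_closed[of U s n] by (simp add: pre.nb_def)

lemma stalkE:
 assumes "g : elts (dg_stalk X x) n" "nb V"
 obtains U s where "nb U" "U \<subseteq> V" "s : elts (dsec X U) n" "g = gm n U s"
 using pre.gmsE_in[of g n V] assms unfolding gm_def stalk_carrier pre.nb_def by metis

lemma nb_top: "nb (topspace (dsp X))" using xX by simp

lemma nb_Int: "nb U ==> nb V ==> nb (U \<inter> V)" by auto

lemma stalkE2:
 assumes "g : elts (dg_stalk X x) i" "h : elts (dg_stalk X x) j"
 obtains U s t where "nb U" "s : elts (dsec X U) i" "t : elts (dsec X U) j" "g = gm i U s" "h = gm j U t"
proof -
 obtain U s where u: "nb U" "s : elts (dsec X U) i" "g = gm i U s" by (rule stalkE[OF assms(1) nb_top])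
 obtain V t where v: "nb V" "V \<subseteq> U" "t : elts (dsec X V) j" "h = gm j V t" by (rule stalkE[OF assms(2) u(1)])
 show ?thesis using that[OF v(1) _ v(3) _ v(4)] res_facts(1)[of U V s i] gm_restrict[of U V s i] u v by simp
qed

lemma stalkE3:
 assumes "g : elts (dg_stalk X x) i" "h : elts (dg_stalk X x) j" "k : elts (dg_stalk X x) l"
 obtains U s t w where "nb U" "s : elts (dsec X U) i" "t : elts (dsec X U) j"
  "w : elts (dsec X U) l" "g = gm i U s" "h = gm j U t" "k = gm l U w"
proof -
 obtain U s t where u: "nb U" "s : elts (dsec X U) i" "t : elts (dsec X U) j" "g = gm i U s" "h = gm j U t"
  by (rule stalkE2[OF assms(1,2)])
 obtain V w where v: "nb V" "V \<subseteq> U" "w : elts (dsec X V) l" "k = gm l V w" by (rule stalkE[OF assms(3) u(1)])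
 show ?thesis using that[OF v(1) _ _ v(3) _ _ v(4)] res_facts(1)[of U V s i] gm_restrict[of U V s i]
   res_facts(1)[of U V t j] gm_restrict[of U V t j] u v by simp
qed

lemma Union_gm:
 assumes "nb U" "s : elts (dsec X U) n"
  "!!V t. nb V ==> t : elts (dsec X V) n ==> gm n V t = gm n U s ==> F V t = c"
 shows "(\<Union>(V, t)\<in>gm n U s. F V t) = c"
 unfolding gm_def by (rule pre.Union_germ) (use assms in \<open>auto simp: pre.nb_def gm_def\<close>)

text \<open>One argument for sums and products: an operation that commutes with restriction may be
  computed on any common neighbourhood, because two choices of representatives agree on a smaller
  one.\<close>

lemma binary_germ:
 fixes F :: "'p set \<Rightarrow> 'a \<Rightarrow> 'a \<Rightarrow> 'a"
 assumes U: "nb U" "s : elts (dsec X U) i" "t : elts (dsec X U) j"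
  and closed: "!!U s t. nb U ==> s : elts (dsec X U) i ==> t : elts (dsec X U) j ==> F U s t : elts (dsec X U) k"
  and res: "!!U V s t. nb U ==> nb V ==> V \<subseteq> U ==> s : elts (dsec X U) i ==> t : elts (dsec X U) j ==>
    dres X U V k (F U s t) = F V (dres X U V i s) (dres X U V j t)"
 shows "(\<Union>(V, s')\<in>gm i U s. \<Union>(V', t')\<in>gm j U t. gm k (V \<inter> V') (F (V \<inter> V') (dres X V (V \<inter> V') i s') (dres X V' (V \<inter> V') j t')))
   = gm k U (F U s t)"
proof (rule Union_gm[OF U(1,2)])
 fix V s' assume V: "nb V" "s' : elts (dsec X V) i" "gm i V s' = gm i U s"
 show "(\<Union>(V', t')\<in>gm j U t. gm k (V \<inter> V') (F (V \<inter> V') (dres X V (V \<inter> V') i s') (dres X V' (V \<inter> V') j t'))) = gm k U (F U s t)"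
 proof (rule Union_gm[OF U(1,3)])
  fix V' t' assume V': "nb V'" "t' : elts (dsec X V') j" "gm j V' t' = gm j U t"
  obtain W where W: "nb W" "W \<subseteq> V \<inter> U" "dres X V W i s' = dres X U W i s" using gm_eqD[OF V(1) U(1) V(2) U(2) V(3)] by metis
  obtain W' where W': "nb W'" "W' \<subseteq> V' \<inter> U" "dres X V' W' j t' = dres X U W' j t" using gm_eqD[OF V'(1) U(1) V'(2) U(3) V'(3)] by metis
  let ?W = "W \<inter> W'" and ?V = "V \<inter> V'"
  have n: "nb ?W" "nb ?V" using V(1) V'(1) W(1) W'(1) by auto
  have sub: "?W \<subseteq> ?V" "?W \<subseteq> U" "?V \<subseteq> V" "?V \<subseteq> V'" "?W \<subseteq> W" "?W \<subseteq> W'" using W(2) W'(2) by auto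
  have o: "openin (dsp X) U" "openin (dsp X) V" "openin (dsp X) V'" "openin (dsp X) W" "openin (dsp X) W'"
   "openin (dsp X) ?W" "openin (dsp X) ?V" using U V V' W W' by auto
  have c: "dres X V ?V i s' : elts (dsec X ?V) i" "dres X V' ?V j t' : elts (dsec X ?V) j"
   using res_facts(1)[OF o(2,7) sub(3) V(2)] res_facts(1)[OF o(3,7) sub(4) V'(2)] by auto
  have es: "dres X ?V ?W i (dres X V ?V i s') = dres X U ?W i s"
   using pre.r_comp[OF o(2,7,6) sub(1,3) V(2)] pre.r_comp[OF o(2,4,6) sub(5) _ V(2)] W(2,3)
    pre.r_comp[OF o(1,4,6) sub(5) _ U(2)] by auto
  have et: "dres X ?V ?W j (dres X V' ?V j t') = dres X U ?W j t"
   using pre.r_comp[OF o(3,7,6) sub(1,4) V'(2)] pre.r_comp[OF o(3,5,6) sub(6) _ V'(2)] W'(2,3)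
    pre.r_comp[OF o(1,5,6) sub(6) _ U(3)] by auto
  show "gm k ?V (F ?V (dres X V ?V i s') (dres X V' ?V j t')) = gm k U (F U s t)"
  proof (rule gm_eqI[OF n(2) U(1) closed[OF n(2) c] closed[OF U] n(1)])
   show "?W \<subseteq> ?V \<inter> U" using sub by auto
   show "dres X ?V ?W k (F ?V (dres X V ?V i s') (dres X V' ?V j t')) = dres X U ?W k (F U s t)"
    unfolding res[OF n(2,1) sub(1) c] res[OF U(1) n(1) sub(2) U(2,3)] es et ..
  qed
 qed
qed

lemma stalk_mult:
 assumes "nb U" "s : elts (dsec X U) n" "t : elts (dsec X U) n"
 shows "gm n U s \<otimes>[cpt (dg_stalk X x) n] gm n U t = gm n U (s \<otimes>[cpt (dsec X U) n] t)"
proof -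
 have "(\<Union>(V, s')\<in>gm n U s. \<Union>(V', t')\<in>gm n U t.
   gm n (V \<inter> V') (dres X V (V \<inter> V') n s' \<otimes>[cpt (dsec X (V \<inter> V')) n] dres X V' (V \<inter> V') n t'))
   = gm n U (s \<otimes>[cpt (dsec X U) n] t)"
  by (rule binary_germ[OF assms, of "%U s t. s \<otimes>[cpt (dsec X U) n] t" n])
   (simp_all add: monoid.m_closed group.is_monoid complex.cpt_group dg_ring.complex sec_dg res_facts(2))
 then show ?thesis by (simp add: dg_stalk_def)
qed

lemma stalk_dmul:
 assumes "nb U" "s : elts (dsec X U) i" "t : elts (dsec X U) j"
 shows "dmul (dg_stalk X x) i j (gm i U s) (gm j U t) = gm (i + j) U (dmul (dsec X U) i j s t)"
proof -
 have "(\<Union>(V, s')\<in>gm i U s. \<Union>(V', t')\<in>gm j U t.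
   gm (i + j) (V \<inter> V') (dmul (dsec X (V \<inter> V')) i j (dres X V (V \<inter> V') i s') (dres X V' (V \<inter> V') j t')))
   = gm (i + j) U (dmul (dsec X U) i j s t)"
  by (rule binary_germ[OF assms, of "%U s t. dmul (dsec X U) i j s t" "i + j"])
   (simp_all add: dg_ring.dmul_closed sec_dg res_facts(4))
 then show ?thesis by (simp add: dg_stalk_def)
qed

lemma unary_germ:
 assumes U: "nb U" "s : elts (dsec X U) i"
  and eq: "!!V W s'. nb V ==> nb W ==> W \<subseteq> V ==> s' : elts (dsec X V) i ==> F W (dres X V W i s') = F V s'"
 shows "(\<Union>(V, s')\<in>gm i U s. F V s') = F U s"
proof (rule Union_gm[OF U])
 fix V s' assume V: "nb V" "s' : elts (dsec X V) i" "gm i V s' = gm i U s"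
 obtain W where W: "nb W" "W \<subseteq> V \<inter> U" "dres X V W i s' = dres X U W i s" using gm_eqD[OF V(1) U(1) V(2) U(2) V(3)] by metis
 show "F V s' = F U s" using eq[OF V(1) W(1) _ V(2)] eq[OF U(1) W(1) _ U(2)] W(2,3) by simp
qed

lemma stalk_dif:
 assumes "nb U" "s : elts (dsec X U) n"
 shows "dif (dg_stalk X x) n (gm n U s) = gm (n + 1) U (dif (dsec X U) n s)"
proof -
 have "(\<Union>(V, s')\<in>gm n U s. gm (n + 1) V (dif (dsec X V) n s')) = gm (n + 1) U (dif (dsec X U) n s)"
 proof (rule unary_germ[OF assms, of "%V s'. gm (n + 1) V (dif (dsec X V) n s')"])
  fix V W s' assume a: "nb V" "nb W" "W \<subseteq> V" "s' : elts (dsec X V) n"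
  have "dif (dsec X V) n s' : elts (dsec X V) (n + 1)"
   using complex.dif_closed[OF dg_ring.complex[OF sec_dg]] a by blast
  then show "gm (n + 1) W (dif (dsec X W) n (dres X V W n s')) = gm (n + 1) V (dif (dsec X V) n s')"
   using gm_restrict[OF a(1-3), of "dif (dsec X V) n s'" "n + 1"] res_facts(3)[of V W s' n] a by simp
 qed
 then show ?thesis by (simp add: dg_stalk_def)
qed

lemma sec_one: "openin (dsp X) U ==> \<one>[cpt (dsec X U) n] : elts (dsec X U) n"
 by (simp add: monoid.one_closed group.is_monoid complex.cpt_group dg_ring.complex sec_dg)

lemma stalk_one: "nb U ==> \<one>[cpt (dg_stalk X x) n] = gm n U \<one>[cpt (dsec X U) n]"
 using gm_restrict[of "topspace (dsp X)" U "\<one>[cpt (dsec X (topspace (dsp X))) n]" n] nb_top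
  res_facts(6)[of "topspace (dsp X)" U n] sec_one[of "topspace (dsp X)" n] openin_subset[of "dsp X" U]
 by (simp add: dg_stalk_def)

lemma stalk_dunit: "nb U ==> dunit (dg_stalk X x) = gm 0 U (dunit (dsec X U))"
 using gm_restrict[of "topspace (dsp X)" U "dunit (dsec X (topspace (dsp X)))" 0] nb_top
  res_facts(5)[of "topspace (dsp X)" U] dg_ring.dunit_closed[OF sec_dg[of "topspace (dsp X)"]] openin_subset[of "dsp X" U]
 by (simp add: dg_stalk_def)

lemma stalk_group: "comm_group (cpt (dg_stalk X x) n)"
proof (rule comm_groupI)
 let ?G = "cpt (dg_stalk X x) n"
 have cg: "comm_group (cpt (dsec X U) n)" if "nb U" for U
  using complex.cpt_comm_group dg_ring.complex sec_dg that by blast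
 show "\<one>[?G] : carrier ?G" using stalk_one[OF nb_top] gm_closed[OF nb_top sec_one] by simp
 fix g assume g: "g : carrier ?G"
 {
  obtain U s where u: "nb U" "s : elts (dsec X U) n" "g = gm n U s" by (rule stalkE[OF g nb_top])
  interpret comm_group "cpt (dsec X U) n" by (rule cg[OF u(1)])
  show "\<one>[?G] \<otimes>[?G] g = g" using u stalk_one[OF u(1)] stalk_mult[OF u(1) one_closed u(2)] by simp
  have "gm n U (inv\<^bsub>cpt (dsec X U) n\<^esub> s) \<otimes>[?G] g = \<one>[?G]"
   using u stalk_one[OF u(1)] stalk_mult[OF u(1) inv_closed[OF u(2)] u(2)] by simp
  then show "\<exists>y\<in>carrier ?G. y \<otimes>[?G] g = \<one>[?G]" using gm_closed[OF u(1) inv_closed[OF u(2)]] by blast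
 }
 fix h assume h: "h : carrier ?G"
 {
  obtain U s t where u: "nb U" "s : elts (dsec X U) n" "t : elts (dsec X U) n" "g = gm n U s" "h = gm n U t"
   by (rule stalkE2[OF g h])
  interpret comm_group "cpt (dsec X U) n" by (rule cg[OF u(1)])
  show "g \<otimes>[?G] h : carrier ?G" using u gm_closed[OF u(1) m_closed[OF u(2,3)]] stalk_mult[OF u(1-3)] by simp
  show "g \<otimes>[?G] h = h \<otimes>[?G] g" using u stalk_mult[OF u(1-3)] stalk_mult[OF u(1,3,2)] m_comm by simp
 }
 fix k assume k: "k : carrier ?G"
 obtain U s t w where u: "nb U" "s : elts (dsec X U) n" "t : elts (dsec X U) n"
  "w : elts (dsec X U) n" "g = gm n U s" "h = gm n U t" "k = gm n U w" by (rule stalkE3[OF g h k])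
 interpret comm_group "cpt (dsec X U) n" by (rule cg[OF u(1)])
 show "g \<otimes>[?G] h \<otimes>[?G] k = g \<otimes>[?G] (h \<otimes>[?G] k)"
  using u stalk_mult[OF u(1-3)] stalk_mult[OF u(1,3,4)] stalk_mult[OF u(1) m_closed[OF u(2,3)] u(4)]
   stalk_mult[OF u(1,2) m_closed[OF u(3,4)]] m_assoc by simp
qed

lemma stalk_inv:
 assumes "nb U" "s : elts (dsec X U) n"
 shows "inv\<^bsub>cpt (dg_stalk X x) n\<^esub> (gm n U s) = gm n U (inv\<^bsub>cpt (dsec X U) n\<^esub> s)"
proof -
 interpret comm_group "cpt (dsec X U) n" using complex.cpt_comm_group dg_ring.complex sec_dg assms by blast
 show ?thesis
  using comm_group.axioms(2)[OF stalk_group] stalk_mult[OF assms(1) inv_closed[OF assms(2)] assms(2)] stalk_one[OF assms(1)]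
   gm_closed[OF assms] gm_closed[OF assms(1) inv_closed[OF assms(2)]] assms(2)
  by (intro group.inv_equality) simp_all
qed

lemma stalk_signed:
 assumes "nb U" "s : elts (dsec X U) n"
 shows "signed (cpt (dg_stalk X x) n) k (gm n U s) = gm n U (signed (cpt (dsec X U) n) k s)"
 unfolding signed_def using stalk_inv[OF assms] by simp

text \<open>Up to three germs have representatives on one common neighbourhood, where each axiom is
  an axiom for the DG-ring of sections.\<close>

lemma stalk_dg_ring: "dg_ring (dg_stalk X x)"
proof
 let ?A = "dg_stalk X x"
 have dc: "dif (dsec X U) n s : elts (dsec X U) (n + 1)" if "nb U" "s : elts (dsec X U) n" for U n s
  using complex.dif_closed[OF dg_ring.complex[OF sec_dg]] that by blast
 show "cochain_complex ?A" unfolding cochain_complex_def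
 proof (intro allI conjI ballI)
  fix n
  show "comm_group (cpt ?A n)" by (rule stalk_group)
  show "dif ?A n : hom (cpt ?A n) (cpt ?A (n + 1))"
  proof (rule homI)
   fix g assume g: "g : elts ?A n"
   obtain U s where u: "nb U" "s : elts (dsec X U) n" "g = gm n U s" by (rule stalkE[OF g nb_top])
   show "dif ?A n g : elts ?A (n + 1)" using u stalk_dif[OF u(1,2)] gm_closed[OF u(1) dc[OF u(1,2)]] by simp
   fix h assume h: "h : elts ?A n"
   obtain U s t where u: "nb U" "s : elts (dsec X U) n" "t : elts (dsec X U) n" "g = gm n U s" "h = gm n U t"
    by (rule stalkE2[OF g h])
   interpret dg_ring "dsec X U" using sec_dg u(1) by blast
   show "dif ?A n (g \<otimes>[cpt ?A n] h) = dif ?A n g \<otimes>[cpt ?A (n + 1)] dif ?A n h"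
    unfolding u(4,5) stalk_mult[OF u(1-3)] stalk_dif[OF u(1,2)] stalk_dif[OF u(1,3)]
     stalk_dif[OF u(1) A.G.m_closed[OF u(2,3)]] stalk_mult[OF u(1) dc[OF u(1,2)] dc[OF u(1,3)]] A.dif_mult[OF u(2,3)] ..
  qed
  fix g assume g: "g : elts ?A n"
  obtain U s where u: "nb U" "s : elts (dsec X U) n" "g = gm n U s" by (rule stalkE[OF g nb_top])
  interpret dg_ring "dsec X U" using sec_dg u(1) by blast
  show "dif ?A (n + 1) (dif ?A n g) = \<one>[cpt ?A (n + 1 + 1)]"
   unfolding u(3) stalk_dif[OF u(1,2)] stalk_dif[OF u(1) dc[OF u(1,2)]] stalk_one[OF u(1)] A.dif_dif[OF u(2)] ..
 qed
 show "elts ?A n = {\<one>[cpt ?A n]}" if n: "0 < n" for n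
 proof -
  have "g = \<one>[cpt ?A n]" if g: "g : elts ?A n" for g
  proof -
   obtain U s where u: "nb U" "s : elts (dsec X U) n" "g = gm n U s" by (rule stalkE[OF g nb_top])
   then show ?thesis using dg_ring.nonpositive[OF sec_dg n] stalk_one[OF u(1)] by simp
  qed
  then show ?thesis using stalk_one[OF nb_top] gm_closed[OF nb_top sec_one] by auto
 qed
 show "dunit ?A : elts ?A 0"
  using stalk_dunit[OF nb_top] gm_closed[OF nb_top] dg_ring.dunit_closed[OF sec_dg] nb_top by simp
 fix i j g h assume g: "g : elts ?A i"
 {
  obtain U s where u: "nb U" "s : elts (dsec X U) i" "g = gm i U s" by (rule stalkE[OF g nb_top])
  interpret dg_ring "dsec X U" using sec_dg u(1) by blast
  show "dmul ?A 0 i (dunit ?A) g = g" "dmul ?A i 0 g (dunit ?A) = g"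
   unfolding u(3) stalk_dunit[OF u(1)] stalk_dmul[OF u(1) dunit_closed u(2)] stalk_dmul[OF u(1,2) dunit_closed]
   using dmul_dunit_left[OF u(2)] dmul_dunit_right[OF u(2)] by simp_all
  show "odd i ==> dmul ?A i i g g = \<one>[cpt ?A (i + i)]"
   unfolding u(3) stalk_dmul[OF u(1,2,2)] stalk_one[OF u(1)] using odd_square[OF _ u(2)] by simp
 }
 {
  show "(%a. dmul ?A j i a g) : hom (cpt ?A j) (cpt ?A (j + i))" for j
  proof (rule homI)
   fix a assume a: "a : elts ?A j"
   obtain U s t where u: "nb U" "s : elts (dsec X U) j" "t : elts (dsec X U) i" "a = gm j U s" "g = gm i U t"
    by (rule stalkE2[OF a g])
   show "dmul ?A j i a g : elts ?A (j + i)"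
    unfolding u(4,5) stalk_dmul[OF u(1-3)] by (rule gm_closed[OF u(1) dg_ring.dmul_closed[OF sec_dg[OF conjunct1[OF u(1)]] u(2,3)]])
   fix b assume b: "b : elts ?A j"
   obtain U s t w where u: "nb U" "s : elts (dsec X U) j" "t : elts (dsec X U) j"
    "w : elts (dsec X U) i" "a = gm j U s" "b = gm j U t" "g = gm i U w" by (rule stalkE3[OF a b g])
   interpret dg_ring "dsec X U" using sec_dg u(1) by blast
   show "dmul ?A j i (a \<otimes>[cpt ?A j] b) g = dmul ?A j i a g \<otimes>[cpt ?A (j + i)] dmul ?A j i b g"
    unfolding u(5-7) stalk_mult[OF u(1-3)] stalk_dmul[OF u(1,2,4)] stalk_dmul[OF u(1,3,4)]
     stalk_dmul[OF u(1) A.G.m_closed[OF u(2,3)] u(4)] dmul_add_left[OF u(2-4)]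
     stalk_mult[OF u(1) dmul_closed[OF u(2,4)] dmul_closed[OF u(3,4)]] ..
  qed
  show "(%b. dmul ?A i j g b) : hom (cpt ?A j) (cpt ?A (i + j))" for j
  proof (rule homI)
   fix a assume a: "a : elts ?A j"
   obtain U s t where u: "nb U" "s : elts (dsec X U) i" "t : elts (dsec X U) j" "g = gm i U s" "a = gm j U t"
    by (rule stalkE2[OF g a])
   show "dmul ?A i j g a : elts ?A (i + j)"
    unfolding u(4,5) stalk_dmul[OF u(1-3)] by (rule gm_closed[OF u(1) dg_ring.dmul_closed[OF sec_dg[OF conjunct1[OF u(1)]] u(2,3)]])
   fix b assume b: "b : elts ?A j"
   obtain U w s t where u: "nb U" "w : elts (dsec X U) i" "s : elts (dsec X U) j" "t : elts (dsec X U) j"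
    "g = gm i U w" "a = gm j U s" "b = gm j U t" by (rule stalkE3[OF g a b])
   interpret dg_ring "dsec X U" using sec_dg u(1) by blast
   show "dmul ?A i j g (a \<otimes>[cpt ?A j] b) = dmul ?A i j g a \<otimes>[cpt ?A (i + j)] dmul ?A i j g b"
    unfolding u(5-7) stalk_mult[OF u(1,3,4)] stalk_dmul[OF u(1,2,3)] stalk_dmul[OF u(1,2,4)]
     stalk_dmul[OF u(1,2) A.G.m_closed[OF u(3,4)]] dmul_add_right[OF u(2-4)]
     stalk_mult[OF u(1) dmul_closed[OF u(2,3)] dmul_closed[OF u(2,4)]] ..
  qed
 }
 assume h: "h : elts ?A j"
 {
  obtain U s t where u: "nb U" "s : elts (dsec X U) i" "t : elts (dsec X U) j" "g = gm i U s" "h = gm j U t"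
   by (rule stalkE2[OF g h])
  interpret dg_ring "dsec X U" using sec_dg u(1) by blast
  have dd: "dmul (dsec X U) (i + 1) j (dif (dsec X U) i s) t : elts (dsec X U) (i + j + 1)"
   "dmul (dsec X U) i (j + 1) s (dif (dsec X U) j t) : elts (dsec X U) (i + j + 1)"
   using dmul_closed[OF A.dif_closed[OF u(2)] u(3)] dmul_closed[OF u(2) A.dif_closed[OF u(3)]]
   by (simp_all add: add.assoc add.commute add.left_commute)
  have e: "i + 1 + j = i + j + 1" "i + (j + 1) = i + j + 1" by simp_all
  show "dmul ?A j i h g = signed (cpt ?A (i + j)) (i * j) (dmul ?A i j g h)"
   unfolding u(4,5) stalk_dmul[OF u(1-3)] stalk_dmul[OF u(1,3,2)] stalk_signed[OF u(1) dmul_closed[OF u(2,3)]]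
    graded_comm[OF u(2,3)] by (simp add: add.commute)
  show "dif ?A (i + j) (dmul ?A i j g h) = dmul ?A (i + 1) j (dif ?A i g) h \<otimes>[cpt ?A (i + j + 1)]
      signed (cpt ?A (i + j + 1)) i (dmul ?A i (j + 1) g (dif ?A j h))"
   unfolding u(4,5) stalk_dmul[OF u(1-3)] stalk_dif[OF u(1,2)] stalk_dif[OF u(1,3)]
    stalk_dif[OF u(1) dmul_closed[OF u(2,3)]] stalk_dmul[OF u(1) dc[OF u(1,2)] u(3)] stalk_dmul[OF u(1,2) dc[OF u(1,3)]] e
    stalk_signed[OF u(1) dd(2)] stalk_mult[OF u(1) dd(1) signed_closed[OF A.cpt_comm_group dd(2)]] leibniz[OF u(2,3)] ..
 }
 fix k l assume k: "k : elts ?A l"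
 obtain U s t w where u: "nb U" "s : elts (dsec X U) i" "t : elts (dsec X U) j"
  "w : elts (dsec X U) l" "g = gm i U s" "h = gm j U t" "k = gm l U w" by (rule stalkE3[OF g h k])
 interpret dg_ring "dsec X U" using sec_dg u(1) by blast
 show "dmul ?A (i + j) l (dmul ?A i j g h) k = dmul ?A i (j + l) g (dmul ?A j l h k)"
  unfolding u(5-7) stalk_dmul[OF u(1-3)] stalk_dmul[OF u(1,3,4)] stalk_dmul[OF u(1) dmul_closed[OF u(2,3)] u(4)]
   stalk_dmul[OF u(1,2) dmul_closed[OF u(3,4)]] dmul_assoc[OF u(2-4)] by (simp add: add.assoc)
qed

end

section \<open>Maps in cohomology\<close>

abbreviation coh :: "('a, 'z) dg_ring_scheme \<Rightarrow> int \<Rightarrow> ('a set, 'a set) module" where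
 "coh A n \<equiv> coh_module (dg_self A) n"

context dg_ring
begin

interpretation S: dg_module A "dg_self A" by (rule dg_self_module)

lemma coh_simps: "carrier (coh A n) = coh_class A n ` cocycles A n"
 "\<zero>[coh A n] = coh_class A n \<one>[cpt A n]"
 "z : cocycles A n ==> w : cocycles A n ==>
   coh_class A n z \<oplus>[coh A n] coh_class A n w = coh_class A n (z \<otimes>[cpt A n] w)"
 "a : elts A 0 ==> z : cocycles A n ==>
   coh_class A 0 a \<odot>[coh A n] coh_class A n z = coh_class A n (dmul A 0 n a z)"
 using S.coh_module_simps[where n = n] S.smult_class[of a z n] by (simp_all add: dg_self_simps dg_self_cohomology)

lemma coh_mod: "module (H0 A) (coh A n)" by (rule S.coh_module_module)

lemma H0_coh: "carrier (H0 A) = carrier (coh A 0)" unfolding coh_simps H0_carrier cocycles_zero ..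

lemma H0_coh_zero: "\<zero>[H0 A] = \<zero>[coh A 0]" unfolding coh_simps H0_zero ..

lemma H0_coh_smult: "x : carrier (H0 A) ==> y : carrier (H0 A) ==> x \<odot>[coh A 0] y = x \<otimes>[H0 A] y"
 unfolding H0_carrier using coh_simps(4)[of _ _ 0] H0_classes(1) cocycles_zero by auto

lemma coh_class_zero: "z : elts A n ==> coh_class A n z = \<zero>[coh A n] \<longleftrightarrow> z : coboundaries A n"
 using A.coh_class_zero_iff[of z n] unfolding coh_simps A.coh_one .

lemma mul0_closed: "a : elts A 0 ==> m : elts A n ==> dmul A 0 n a m : elts A n"
 using dmul_closed[of a 0 m n] by simp

lemma dif_mul0: "a : elts A 0 ==> m : elts A n ==> dif A n (dmul A 0 n a m) = dmul A 0 (n + 1) a (dif A n m)"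
 using S.dif_act0[of a m n] by (simp add: dg_self_simps)

lemma mul0_assoc: "a : elts A 0 ==> b : elts A 0 ==> m : elts A n ==>
  dmul A 0 n (dmul A 0 0 a b) m = dmul A 0 n a (dmul A 0 n b m)"
 using dmul_assoc[of a 0 b 0 m n] by simp

lemma mul0_comm: "a : elts A 0 ==> b : elts A 0 ==> m : elts A n ==>
  dmul A 0 n a (dmul A 0 n b m) = dmul A 0 n b (dmul A 0 n a m)"
 using mul0_assoc[of a b m n] mul0_assoc[of b a m n] dmul_comm0[of a b] by simp

lemma mul0_one: "a : elts A 0 ==> dmul A 0 n a \<one>[cpt A n] = \<one>[cpt A n]"
 using S.dact_zero(2)[of a 0 n] by (simp add: dg_self_simps)

lemma mul0_inv: "a : elts A 0 ==> m : elts A n ==>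
  dmul A 0 n a (inv\<^bsub>cpt A n\<^esub> m) = inv\<^bsub>cpt A n\<^esub> (dmul A 0 n a m)"
 using group_hom.hom_inv[of "cpt A n" "cpt A n" "%b. dmul A 0 n a b" m] dmul_right_hom[of a 0 n] A.cpt_group
 by (simp add: group_hom_def group_hom_axioms_def)

lemma mul0_add: "a : elts A 0 ==> m : elts A n ==> w : elts A n ==>
  dmul A 0 n a (m \<otimes>[cpt A n] w) = dmul A 0 n a m \<otimes>[cpt A n] dmul A 0 n a w"
 using dmul_add_right[of a 0 m n w] by simp

lemma mul0_cocycles: "a : elts A 0 ==> z : cocycles A n ==> dmul A 0 n a z : cocycles A n"
 using S.act0_cocycles[of a z n] by (simp add: dg_self_simps dg_self_cohomology)

end

definition coh_iso :: "('a, 'y) dg_ring_scheme \<Rightarrow> ('b, 'z) dg_ring_scheme \<Rightarrow> (int \<Rightarrow> 'a set \<Rightarrow> 'b set) \<Rightarrow> bool" where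
 "coh_iso B C f \<longleftrightarrow> dg_ring B \<and> dg_ring C \<and> f 0 : ring_hom (H0 B) (H0 C) \<and>
   (\<forall>n. bij_betw (f n) (carrier (coh B n)) (carrier (coh C n))) \<and>
   (\<forall>n. \<forall>c\<in>carrier (coh B n). \<forall>d\<in>carrier (coh B n). f n (c \<oplus>[coh B n] d) = f n c \<oplus>[coh C n] f n d) \<and>
   (\<forall>n. \<forall>x\<in>carrier (H0 B). \<forall>c\<in>carrier (coh B n). f n (x \<odot>[coh B n] c) = f 0 x \<odot>[coh C n] f n c)"

locale dg_homomorphism = B: dg_ring B + C: dg_ring C
 for B :: "('a, 'y) dg_ring_scheme" and C :: "('b, 'z) dg_ring_scheme" +
 fixes g :: "int \<Rightarrow> 'a \<Rightarrow> 'b"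
 assumes dg_hom: "dg_hom B C g"
begin

sublocale g: chain_map B C g
 using dg_hom unfolding dg_hom_def by unfold_locales blast+

lemma g_mul: "a : elts B i ==> b : elts B j ==> g (i + j) (dmul B i j a b) = dmul C i j (g i a) (g j b)"
 using dg_hom[unfolded dg_hom_def, THEN conjunct2, THEN conjunct2, THEN conjunct1, rule_format, of a i b j] .

lemma g_mul0: "a : elts B 0 ==> b : elts B j ==> g j (dmul B 0 j a b) = dmul C 0 j (g 0 a) (g j b)"
 using g_mul[of a 0 b j] by simp

lemma g_dunit: "g 0 (dunit B) = dunit C"
 using dg_hom unfolding dg_hom_def by blast

abbreviation H where "H \<equiv> coh_map C g"

lemma H_class: "z : cocycles B n ==> H n (coh_class B n z) = coh_class C n (g n z)" by (rule g.coh_map_class)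

lemma H_class0: "a : elts B 0 ==> H 0 (coh_class B 0 a) = coh_class C 0 (g 0 a)"
 using H_class[of a 0] unfolding B.cocycles_zero .

lemma H_closed: "c : carrier (coh B n) ==> H n c : carrier (coh C n)"
 unfolding B.coh_simps C.coh_simps using H_class g.g_cocycles by auto

lemma H_add: "c : carrier (coh B n) ==> d : carrier (coh B n) ==> H n (c \<oplus>[coh B n] d) = H n c \<oplus>[coh C n] H n d"
 unfolding B.coh_simps(1)
 by (auto simp: H_class B.coh_simps(3) C.coh_simps(3) g.g_cocycles B.A.cocycles_mult g.g_mult B.A.cocycles_carrier)

lemma H_smult: "x : carrier (H0 B) ==> c : carrier (coh B n) ==> H n (x \<odot>[coh B n] c) = H 0 x \<odot>[coh C n] H n c"
 unfolding B.coh_simps(1) B.H0_carrier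
 by (auto simp: H_class H_class0 B.coh_simps(4) C.coh_simps(4) g.g_cocycles g.g_closed B.mul0_cocycles g_mul0 B.A.cocycles_carrier)

lemma H_ring_hom: "H 0 : ring_hom (H0 B) (H0 C)"
proof (rule ring_hom_memI)
 show "H 0 x : carrier (H0 C)" if "x : carrier (H0 B)" for x
  using that H_closed[of x 0] by (simp add: B.H0_coh C.H0_coh)
 show "H 0 \<one>[H0 B] = \<one>[H0 C]" unfolding B.H0_one C.H0_one using H_class0[OF B.dunit_closed] g_dunit by simp
 fix x y assume "x : carrier (H0 B)" "y : carrier (H0 B)"
 then obtain a b where "a : elts B 0" "b : elts B 0" "x = coh_class B 0 a" "y = coh_class B 0 b"
  unfolding B.H0_carrier by blast
 then show "H 0 (x \<otimes>[H0 B] y) = H 0 x \<otimes>[H0 C] H 0 y" "H 0 (x \<oplus>[H0 B] y) = H 0 x \<oplus>[H0 C] H 0 y"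
  using B.mul0_closed[of a b 0] by (simp_all add: B.H0_classes C.H0_classes H_class0 g.g_closed g_mul0 g.g_mult)
qed

lemma quasi_iso_coh_iso: "quasi_iso B C g ==> coh_iso B C H"
 unfolding coh_iso_def quasi_iso_def
 using B.dg_ring_axioms C.dg_ring_axioms H_ring_hom H_add H_smult
 by (simp add: B.coh_simps(1) C.coh_simps(1) B.A.cohomology_carrier C.A.cohomology_carrier)

lemma bijective_coh_iso:
 assumes bij: "!!n. bij_betw (g n) (elts B n) (elts C n)"
 shows "coh_iso B C H"
proof (rule quasi_iso_coh_iso, unfold quasi_iso_def, intro allI bij_betwI')
 have inj: "z = w" if "z : elts B n" "w : elts B n" "g n z = g n w" for n z w
  using bij[of n] that unfolding bij_betw_def inj_on_def by simp
 have surj: "\<exists>z\<in>elts B n. w = g n z" if "w : elts C n" for n w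
  using bij[of n] that unfolding bij_betw_def by (metis imageE)
 fix n
 {
  fix c d assume "c : carrier (cohomology B n)" "d : carrier (cohomology B n)"
  then obtain z w where zw: "z : cocycles B n" "w : cocycles B n" "c = coh_class B n z" "d = coh_class B n w"
   unfolding B.A.cohomology_carrier by blast
  note k = B.A.cocycles_carrier[OF zw(1)] B.A.cocycles_carrier[OF zw(2)]
  have "coh_class B n z = coh_class B n w" if eq: "coh_class C n (g n z) = coh_class C n (g n w)"
  proof -
   obtain b where b: "b : coboundaries C n" "g n z = b \<otimes>[cpt C n] g n w"
    using eq C.A.coh_class_eq_iff[of "g n z" n "g n w"] g.g_closed k by blast
   obtain y where y: "y : elts C (n - 1)" "b = dif C (n - 1) y" using C.A.coboundariesE[OF b(1)] by blast
   obtain u where u: "u : elts B (n - 1)" "y = g (n - 1) u" using surj[OF y(1)] by blast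
   have bu: "dif B (n - 1) u : coboundaries B n" using B.A.coboundariesI[OF u(1)] .
   have "g n (dif B (n - 1) u) = b" using g.g_dif[OF u(1)] u y by simp
   then have "g n z = g n (dif B (n - 1) u \<otimes>[cpt B n] w)"
    using b g.g_mult[OF B.A.coboundaries_carrier[OF bu] k(2)] by simp
   then have "z = dif B (n - 1) u \<otimes>[cpt B n] w" using inj[OF k(1)] B.A.coboundaries_carrier[OF bu] k(2) by simp
   then show ?thesis using B.A.coh_class_eq_iff[OF k] bu by blast
  qed
  then show "(H n c = H n d) = (c = d)" unfolding zw(3,4) H_class[OF zw(1)] H_class[OF zw(2)]
   using H_class[OF zw(1)] H_class[OF zw(2)] by metis
 next
  fix c assume "c : carrier (cohomology B n)"
  then show "H n c : carrier (cohomology C n)" using H_closed[of c n]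
   by (simp add: B.coh_simps(1) C.coh_simps(1) B.A.cohomology_carrier C.A.cohomology_carrier)
 next
  fix e assume "e : carrier (cohomology C n)"
  then obtain w where w: "w : cocycles C n" "e = coh_class C n w" unfolding C.A.cohomology_carrier by blast
  obtain z where z: "z : elts B n" "w = g n z" using surj[OF C.A.cocycles_carrier[OF w(1)]] by blast
  have "g (n + 1) (dif B n z) = g (n + 1) \<one>[cpt B (n + 1)]"
   using w(1) g.g_dif[OF z(1)] g.g_one unfolding C.A.cocycles_iff z(2) by simp
  then have "z : cocycles B n" using z(1) inj[of "dif B n z" "n + 1"] by (simp add: B.A.cocycles_iff)
  then show "\<exists>c\<in>carrier (cohomology B n). e = H n c"
   unfolding w(2) z(2) B.A.cohomology_carrier using H_class by blast
 }
qed

end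

lemma coh_isoD:
 assumes "coh_iso B C f"
 shows "dg_ring B" "dg_ring C" "f 0 : ring_hom (H0 B) (H0 C)"
  "!!n. bij_betw (f n) (carrier (coh B n)) (carrier (coh C n))"
  "!!n c. c : carrier (coh B n) ==> f n c : carrier (coh C n)"
  "!!n c d. c : carrier (coh B n) ==> d : carrier (coh B n) ==> f n c = f n d ==> c = d"
  "!!n e. e : carrier (coh C n) ==> \<exists>c\<in>carrier (coh B n). e = f n c"
  "!!n c d. c : carrier (coh B n) ==> d : carrier (coh B n) ==> f n (c \<oplus>[coh B n] d) = f n c \<oplus>[coh C n] f n d"
  "!!n x c. x : carrier (H0 B) ==> c : carrier (coh B n) ==> f n (x \<odot>[coh B n] c) = f 0 x \<odot>[coh C n] f n c"
proof -
 note a = assms[unfolded coh_iso_def]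
 show "dg_ring B" "dg_ring C" "f 0 : ring_hom (H0 B) (H0 C)" using a by simp_all
 show b: "bij_betw (f n) (carrier (coh B n)) (carrier (coh C n))" for n using a by simp
 show "c : carrier (coh B n) ==> f n c : carrier (coh C n)" for n c using b[of n] bij_betwE by metis
 show "c : carrier (coh B n) ==> d : carrier (coh B n) ==> f n c = f n d ==> c = d" for n c d
  using b[of n] unfolding bij_betw_def inj_on_def by simp
 show "\<exists>c\<in>carrier (coh B n). e = f n c" if "e : carrier (coh C n)" for n e
  using b[of n] that unfolding bij_betw_def by (metis imageE)
 show "c : carrier (coh B n) ==> d : carrier (coh B n) ==> f n (c \<oplus>[coh B n] d) = f n c \<oplus>[coh C n] f n d" for n c d
  using a by simp
 show "x : carrier (H0 B) ==> c : carrier (coh B n) ==> f n (x \<odot>[coh B n] c) = f 0 x \<odot>[coh C n] f n c" for n x c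
  using a by simp
qed

lemma coh_iso_trans:
 assumes f: "coh_iso B C f" and g: "coh_iso C D g"
 shows "coh_iso B D (%n. g n \<circ> f n)"
proof -
 note F = coh_isoD[OF f] and G = coh_isoD[OF g]
 have h: "f 0 x : carrier (H0 C)" if "x : carrier (H0 B)" for x using F(3) that by (rule ring_hom_closed)
 show ?thesis unfolding coh_iso_def
  using F(1) G(2) ring_hom_trans[OF F(3) G(3)] bij_betw_trans[OF F(4) G(4)]
  by (simp add: F(5,8,9) G(5,8,9) h)
qed

lemma coh_iso_sym:
 assumes f: "coh_iso B C f"
 shows "coh_iso C B (%n. inv_into (carrier (coh B n)) (f n))"
proof -
 note F = coh_isoD[OF f]
 let ?g = "%n. inv_into (carrier (coh B n)) (f n)"
 interpret B: dg_ring B by (rule F(1))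
 interpret C: dg_ring C by (rule F(2))
 have gb: "bij_betw (?g n) (carrier (coh C n)) (carrier (coh B n))" for n by (rule bij_betw_inv_into[OF F(4)])
 have g: "?g n c : carrier (coh B n)" "f n (?g n c) = c" if "c : carrier (coh C n)" for n c
  using bij_betwE[OF gb, of n] bij_betw_inv_into_right[OF F(4)] that by auto
 have gI: "?g n c = d" if "d : carrier (coh B n)" "f n d = c" for n c d
  using bij_betw_inv_into_left[OF F(4)] that by auto
 interpret MB: module "H0 B" "coh B n" for n by (rule B.coh_mod)
 have "f 0 : ring_iso (H0 B) (H0 C)" unfolding ring_iso_def using F(3) F(4)[of 0] B.H0_coh C.H0_coh by simp
 then have r: "?g 0 : ring_hom (H0 C) (H0 B)"
  using ring_iso_set_sym[OF cring.axioms(1)[OF B.H0_cring]] unfolding ring_iso_def B.H0_coh by blast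
 have "?g n (c \<oplus>[coh C n] d) = ?g n c \<oplus>[coh B n] ?g n d" if "c : carrier (coh C n)" "d : carrier (coh C n)" for n c d
  using that by (intro gI) (simp_all add: F(8) g)
 moreover have "?g n (x \<odot>[coh C n] c) = ?g 0 x \<odot>[coh B n] ?g n c" if "x : carrier (H0 C)" "c : carrier (coh C n)" for n x c
  using that ring_hom_closed[OF r that(1)] by (intro gI) (simp_all add: F(9) g C.H0_coh)
 ultimately show ?thesis unfolding coh_iso_def using F(1,2) r gb by simp
qed

text \<open>Localization is demanded on cohomology only: of \<open>H0\<close> as a ring and of each
  cohomology module over it.\<close>

locale coh_localization = A: dg_ring A + B: dg_ring B
 for A :: "('a, 'y) dg_ring_scheme" and B :: "('b, 'z) dg_ring_scheme" +
 fixes f :: "int \<Rightarrow> 'a set \<Rightarrow> 'b set" and S :: "'a set set"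
 assumes loc0: "ring_localization (H0 A) (H0 B) (f 0) S"
  and loc: "!!n. module_localization (H0 A) (H0 B) (f 0) S (coh A n) (coh B n) (f n)"

text \<open>This is what the cohomological formulation is for: the target may be replaced by any
  DG-ring with isomorphic cohomology, in particular along a zigzag of quasi-isomorphisms.\<close>

lemma coh_localization_iso:
 assumes f: "coh_localization A B f S" and g: "coh_iso B C g"
 shows "coh_localization A C (%n. g n \<circ> f n) S"
proof -
 interpret f: coh_localization A B f S by (rule f)
 note G = coh_isoD[OF g]
 interpret C: dg_ring C by (rule G(2))
 interpret L: ring_localization "H0 A" "H0 B" "f 0" S by (rule f.loc0)
 interpret CH: cring "H0 C" by (rule C.H0_cring)
 interpret g: ring_hom_cring "H0 B" "H0 C" "g 0" by unfold_locales (rule G(3))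
 have gz: "g n c = \<zero>[coh C n] \<longleftrightarrow> c = \<zero>[coh B n]" if c: "c : carrier (coh B n)" for c n
 proof -
  interpret MB: module "H0 B" "coh B n" by (rule f.B.coh_mod)
  interpret MC: module "H0 C" "coh C n" by (rule C.coh_mod)
  have "g n \<zero>[coh B n] \<oplus>[coh C n] g n \<zero>[coh B n] = g n \<zero>[coh B n]" using G(8)[of "\<zero>[coh B n]" n "\<zero>[coh B n]"] by simp
  then have "g n \<zero>[coh B n] = \<zero>[coh C n]" using G(5)[of "\<zero>[coh B n]" n] by (simp add: MC.add.r_cancel_one)
  then show ?thesis using G(6)[OF c, of "\<zero>[coh B n]"] by auto
 qed
 have rl: "ring_localization (H0 A) (H0 C) ((%n. g n \<circ> f n) 0) S"
 proof
  show "(%n. g n \<circ> f n) 0 : ring_hom (H0 A) (H0 C)" using ring_hom_trans[OF L.f_hom G(3)] by simp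
  show "S \<subseteq> carrier (H0 A)" "\<one>[H0 A] : S" "!!s t. s : S ==> t : S ==> s \<otimes>[H0 A] t : S"
   by (rule L.S_sub L.S_one L.S_mult; assumption)+
  show "(%n. g n \<circ> f n) 0 s : Units (H0 C)" if "s : S" for s
  proof -
   have u: "f 0 s : carrier (H0 B)" "inv\<^bsub>H0 B\<^esub> (f 0 s) : carrier (H0 B)" "f 0 s \<otimes>[H0 B] inv\<^bsub>H0 B\<^esub> (f 0 s) = \<one>[H0 B]"
    using L.f_unit[OF that] by (simp_all add: L.L.Units_closed)
   have "g 0 (f 0 s) \<otimes>[H0 C] g 0 (inv\<^bsub>H0 B\<^esub> (f 0 s)) = \<one>[H0 C]" using g.hom_mult[OF u(1,2)] u(3) by simp
   moreover have k: "g 0 (f 0 s) : carrier (H0 C)" "g 0 (inv\<^bsub>H0 B\<^esub> (f 0 s)) : carrier (H0 C)" using u(1,2) by simp_all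
   ultimately have "g 0 (f 0 s) : Units (H0 C)" using CH.m_comm[OF k] unfolding Units_def by (metis (mono_tags, lifting) mem_Collect_eq)
   then show ?thesis by simp
  qed
  show "\<exists>s\<in>S. \<exists>a\<in>carrier (H0 A). (%n. g n \<circ> f n) 0 s \<otimes>[H0 C] c = (%n. g n \<circ> f n) 0 a" if c: "c : carrier (H0 C)" for c
  proof -
   obtain d where d: "d : carrier (H0 B)" "c = g 0 d" using G(7)[of c 0] c f.B.H0_coh C.H0_coh by auto
   obtain s a where "s : S" "a : carrier (H0 A)" "f 0 s \<otimes>[H0 B] d = f 0 a" using L.f_surj[OF d(1)] by metis
   then show ?thesis using g.hom_mult[of "f 0 s" d] d L.fS_closed by (intro bexI[of _ s] bexI[of _ a]) simp_all
  qed
  show "\<exists>s\<in>S. s \<otimes>[H0 A] a = \<zero>[H0 A]" if "a : carrier (H0 A)" "(%n. g n \<circ> f n) 0 a = \<zero>[H0 C]" for a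
   using L.f_inj[OF that(1)] that gz[of "f 0 a" 0] by (simp add: f.B.H0_coh_zero C.H0_coh_zero f.B.H0_coh[symmetric])
 qed
 have ml: "module_localization (H0 A) (H0 C) ((%n. g n \<circ> f n) 0) S (coh A n) (coh C n) (g n \<circ> f n)" for n
 proof -
  interpret L': ring_localization "H0 A" "H0 C" "(%n. g n \<circ> f n) 0" S by (rule rl)
  interpret M: module_localization "H0 A" "H0 B" "f 0" S "coh A n" "coh B n" "f n" by (rule f.loc)
  interpret MC: module "H0 C" "coh C n" by (rule C.coh_mod)
  show ?thesis
  proof
   show "(g n \<circ> f n) m : carrier (coh C n)" if "m : carrier (coh A n)" for m
    using G(5) M.g_closed that by simp
   show "(g n \<circ> f n) (m \<oplus>[coh A n] m') = (g n \<circ> f n) m \<oplus>[coh C n] (g n \<circ> f n) m'"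
    if "m : carrier (coh A n)" "m' : carrier (coh A n)" for m m'
    using that by (simp add: M.g_add G(8) M.g_closed)
   show "(g n \<circ> f n) (a \<odot>[coh A n] m) = (%n. g n \<circ> f n) 0 a \<odot>[coh C n] (g n \<circ> f n) m"
    if "a : carrier (H0 A)" "m : carrier (coh A n)" for a m
    using that by (simp add: M.g_smult G(9) M.g_closed)
   show "\<exists>s\<in>S. \<exists>m\<in>carrier (coh A n). (%n. g n \<circ> f n) 0 s \<odot>[coh C n] c = (g n \<circ> f n) m" if c: "c : carrier (coh C n)" for c
   proof -
    obtain d where d: "d : carrier (coh B n)" "c = g n d" using G(7)[OF c] by blast
    obtain s a where "s : S" "a : carrier (coh A n)" "f 0 s \<odot>[coh B n] d = f n a" using M.g_surj[OF d(1)] by metis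
    then show ?thesis using G(9)[of "f 0 s" d n] d L.fS_closed by (intro bexI[of _ s] bexI[of _ a]) simp_all
   qed
   show "\<exists>s\<in>S. s \<odot>[coh A n] m = \<zero>[coh A n]" if "m : carrier (coh A n)" "(g n \<circ> f n) m = \<zero>[coh C n]" for m
    using M.g_inj[OF that(1)] that gz[of "f n m" n] M.g_closed by simp
  qed
 qed
 show ?thesis
  by (intro coh_localization.intro coh_localization_axioms.intro f.A.dg_ring_axioms C.dg_ring_axioms) (rule rl ml)+
qed

text \<open>The characterization of a localization by elements, on the level of complexes. Its
  passage to cohomology is the exactness of localization, carried out below by clearing
  denominators.\<close>

locale dg_localization_map = dg_homomorphism B C g
 for B :: "('a, 'y) dg_ring_scheme" and C :: "('b, 'z) dg_ring_scheme" and g +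
 fixes S :: "'a set"
 assumes S_sub: "S \<subseteq> elts B 0" and S_one: "dunit B : S"
  and S_mult: "!!s t. s : S ==> t : S ==> dmul B 0 0 s t : S"
  and g_unit: "!!s. s : S ==> \<exists>u\<in>elts C 0. dmul C 0 0 (g 0 s) u = dunit C"
  and g_surj: "!!c n. c : elts C n ==> \<exists>s\<in>S. \<exists>a\<in>elts B n. dmul C 0 n (g 0 s) c = g n a"
  and g_inj: "!!a n. a : elts B n ==> g n a = \<one>[cpt C n] ==> \<exists>s\<in>S. dmul B 0 n s a = \<one>[cpt B n]"
begin

lemma S_carrier: "s : S ==> s : elts B 0" using S_sub by blast

text \<open>A cocycle becomes g a after multiplication by some s. The differential of a maps to
  zero, so some t kills it, and t a is a cocycle.\<close>

lemma coh_surj: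
 assumes "c : carrier (coh C n)"
 shows "\<exists>s\<in>S. \<exists>m\<in>carrier (coh B n). H 0 (coh_class B 0 s) \<odot>[coh C n] c = H n m"
proof -
 obtain z where z: "z : cocycles C n" "c = coh_class C n z" using assms unfolding C.coh_simps by blast
 note zc = C.A.cocycles_carrier[OF z(1)]
 obtain s a where s: "s : S" "a : elts B n" "dmul C 0 n (g 0 s) z = g n a" using g_surj[OF zc] by metis
 note sc = S_carrier[OF s(1)]
 have "g (n + 1) (dif B n a) = dif C n (dmul C 0 n (g 0 s) z)" using g.g_dif[OF s(2)] s(3) by simp
 also have "\<dots> = \<one>[cpt C (n + 1)]"
  using C.mul0_cocycles[OF g.g_closed[OF sc] z(1)] by (simp add: C.A.cocycles_iff)
 finally obtain t where t: "t : S" "dmul B 0 (n + 1) t (dif B n a) = \<one>[cpt B (n + 1)]"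
  using g_inj[OF B.A.dif_closed[OF s(2)]] by metis
 note tc = S_carrier[OF t(1)]
 have co: "dmul B 0 n t a : cocycles B n"
  using t(2) B.dif_mul0[OF tc s(2)] B.mul0_closed[OF tc s(2)] by (simp add: B.A.cocycles_iff)
 have ts: "dmul B 0 0 t s : S" using S_mult[OF t(1) s(1)] .
 have "dmul C 0 n (g 0 (dmul B 0 0 t s)) z = g n (dmul B 0 n t a)"
  using g_mul0[OF tc sc] g_mul0[OF tc s(2)] C.mul0_assoc[OF g.g_closed[OF tc] g.g_closed[OF sc] zc] s(3) by simp
 then have "H 0 (coh_class B 0 (dmul B 0 0 t s)) \<odot>[coh C n] c = H n (coh_class B n (dmul B 0 n t a))"
  using H_class0[OF S_carrier[OF ts]] H_class[OF co] C.coh_simps(4)[OF g.g_closed[OF S_carrier[OF ts]] z(1)] z(2) by simp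
 then show ?thesis using ts co unfolding B.coh_simps(1) by blast
qed

text \<open>If the image of z is a boundary d y, the denominator of y is cleared: s z and d a get
  the same image, so some t makes t s z equal to d (t a).\<close>

lemma coh_inj:
 assumes "m : carrier (coh B n)" "H n m = \<zero>[coh C n]"
 shows "\<exists>s\<in>S. coh_class B 0 s \<odot>[coh B n] m = \<zero>[coh B n]"
proof -
 obtain z where z: "z : cocycles B n" "m = coh_class B n z" using assms(1) unfolding B.coh_simps by blast
 note zc = B.A.cocycles_carrier[OF z(1)]
 have "g n z : coboundaries C n"
  using assms(2) H_class[OF z(1)] C.coh_class_zero[OF g.g_closed[OF zc]] z(2) by simp
 then obtain y where y: "y : elts C (n - 1)" "g n z = dif C (n - 1) y" using C.A.coboundariesE by blast
 obtain s a where s: "s : S" "a : elts B (n - 1)" "dmul C 0 (n - 1) (g 0 s) y = g (n - 1) a"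
  using g_surj[OF y(1)] by metis
 note sc = S_carrier[OF s(1)]
 have da: "dif B (n - 1) a : elts B n" using B.A.dif_closed[OF s(2)] by simp
 have sz: "dmul B 0 n s z : elts B n" using B.mul0_closed[OF sc zc] .
 have "g n (dmul B 0 n s z) = dmul C 0 n (g 0 s) (dif C (n - 1) y)" using g_mul0[OF sc zc] y by simp
 also have "\<dots> = g n (dif B (n - 1) a)"
  using C.dif_mul0[OF g.g_closed[OF sc] y(1)] s(3) g.g_dif[OF s(2)] by simp
 finally have eq: "g n (dmul B 0 n s z) = g n (dif B (n - 1) a)" .
 let ?w = "dmul B 0 n s z \<otimes>[cpt B n] inv\<^bsub>cpt B n\<^esub> dif B (n - 1) a"
 have "g n ?w \<otimes>[cpt C n] g n (dif B (n - 1) a) = g n (dif B (n - 1) a)"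
  using g.g_mult[of ?w n "dif B (n - 1) a"] da sz eq by (simp add: B.A.G.m_assoc)
 then have "g n ?w = \<one>[cpt C n]" using g.g_closed[OF da] g.g_closed[of ?w n] da sz by (simp add: C.A.G.r_cancel_one)
 then obtain t where t: "t : S" "dmul B 0 n t ?w = \<one>[cpt B n]" using g_inj[of ?w n] da sz by auto
 note tc = S_carrier[OF t(1)]
 have "dmul B 0 n t (dmul B 0 n s z) \<otimes>[cpt B n] inv\<^bsub>cpt B n\<^esub> dmul B 0 n t (dif B (n - 1) a) = \<one>[cpt B n]"
  using t(2) B.mul0_add[OF tc sz, of "inv\<^bsub>cpt B n\<^esub> dif B (n - 1) a"] B.mul0_inv[OF tc da] da by simp
 then have "dmul B 0 n t (dmul B 0 n s z) = dmul B 0 n t (dif B (n - 1) a)"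
  using B.A.G.inv_solve_right'[of "\<one>[cpt B n]" n] B.mul0_closed[OF tc sz] B.mul0_closed[OF tc da] by simp
 also have "\<dots> = dif B (n - 1) (dmul B 0 (n - 1) t a)" using B.dif_mul0[OF tc s(2)] by simp
 finally have "dmul B 0 n (dmul B 0 0 t s) z : coboundaries B n"
  using B.A.coboundariesI[OF B.mul0_closed[OF tc s(2)]] B.mul0_assoc[OF tc sc zc] by simp
 then have "coh_class B 0 (dmul B 0 0 t s) \<odot>[coh B n] m = \<zero>[coh B n]"
  using B.coh_simps(4)[OF _ z(1), of "dmul B 0 0 t s"] S_carrier[OF S_mult[OF t(1) s(1)]] z(2)
   B.coh_class_zero[OF B.mul0_closed[OF _ zc], of "dmul B 0 0 t s"] by simp
 then show ?thesis using S_mult[OF t(1) s(1)] by blast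
qed

lemma coh_localization: "coh_localization B C H (coh_class B 0 ` S)"
proof -
 interpret BR: cring "H0 B" by (rule B.H0_cring)
 interpret CR: cring "H0 C" by (rule C.H0_cring)
 have rl: "ring_localization (H0 B) (H0 C) (H 0) (coh_class B 0 ` S)"
 proof
  show "H 0 : ring_hom (H0 B) (H0 C)" by (rule H_ring_hom)
  show "coh_class B 0 ` S \<subseteq> carrier (H0 B)" unfolding B.H0_carrier using S_sub by blast
  show "\<one>[H0 B] : coh_class B 0 ` S" unfolding B.H0_one using S_one by blast
  show "s \<otimes>[H0 B] t : coh_class B 0 ` S" if "s : coh_class B 0 ` S" "t : coh_class B 0 ` S" for s t
   using that S_mult S_carrier B.H0_classes(1) by auto
  show "H 0 s : Units (H0 C)" if "s : coh_class B 0 ` S" for s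
  proof -
   obtain r where r: "r : S" "s = coh_class B 0 r" using \<open>s : coh_class B 0 ` S\<close> by blast
   obtain u where u: "u : elts C 0" "dmul C 0 0 (g 0 r) u = dunit C" using g_unit[OF r(1)] by blast
   note gr = g.g_closed[OF S_carrier[OF r(1)]]
   have "coh_class C 0 (g 0 r) \<otimes>[H0 C] coh_class C 0 u = \<one>[H0 C]" using C.H0_classes(1)[OF gr u(1)] u(2) C.H0_one by simp
   moreover have k: "coh_class C 0 (g 0 r) : carrier (H0 C)" "coh_class C 0 u : carrier (H0 C)"
    using gr u(1) unfolding C.H0_carrier by simp_all
   ultimately have "coh_class C 0 (g 0 r) : Units (H0 C)"
    using CR.m_comm[OF k] unfolding Units_def by (metis (mono_tags, lifting) mem_Collect_eq)
   then show ?thesis using H_class0[OF S_carrier[OF r(1)]] r(2) by simp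
  qed
  show "\<exists>s\<in>coh_class B 0 ` S. \<exists>a\<in>carrier (H0 B). H 0 s \<otimes>[H0 C] c = H 0 a" if "c : carrier (H0 C)" for c
  proof -
   obtain s m where "s : S" "m : carrier (H0 B)" "H 0 (coh_class B 0 s) \<odot>[coh C 0] c = H 0 m"
    using coh_surj[of c 0] \<open>c : carrier (H0 C)\<close> unfolding C.H0_coh B.H0_coh by metis
   moreover have "H 0 (coh_class B 0 s) : carrier (H0 C)"
    using ring_hom_closed[OF H_ring_hom] S_carrier[OF \<open>s : S\<close>] unfolding B.H0_carrier by blast
   ultimately show ?thesis using C.H0_coh_smult[OF _ that] by (intro bexI[of _ "coh_class B 0 s"] bexI[of _ m]) auto
  qed
  show "\<exists>s\<in>coh_class B 0 ` S. s \<otimes>[H0 B] a = \<zero>[H0 B]" if a: "a : carrier (H0 B)" "H 0 a = \<zero>[H0 C]" for a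
  proof -
   obtain s where s: "s : S" "coh_class B 0 s \<odot>[coh B 0] a = \<zero>[coh B 0]"
    using coh_inj[of a 0] a unfolding C.H0_coh_zero B.H0_coh by blast
   have "coh_class B 0 s : carrier (H0 B)" using S_carrier[OF s(1)] unfolding B.H0_carrier by blast
   then show ?thesis using B.H0_coh_smult[OF _ a(1)] s B.H0_coh_zero by (intro bexI[of _ "coh_class B 0 s"]) auto
  qed
 qed
 have ml: "module_localization (H0 B) (H0 C) (H 0) (coh_class B 0 ` S) (coh B n) (coh C n) (H n)" for n
 proof -
  interpret L: ring_localization "H0 B" "H0 C" "H 0" "coh_class B 0 ` S" by (rule rl)
  interpret MB: module "H0 B" "coh B n" by (rule B.coh_mod)
  interpret MC: module "H0 C" "coh C n" by (rule C.coh_mod)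
  show ?thesis
   by unfold_locales (use H_closed H_add H_smult coh_surj coh_inj in auto)
 qed
 show ?thesis
  by (intro coh_localization.intro coh_localization_axioms.intro B.dg_ring_axioms C.dg_ring_axioms) (rule rl ml)+
qed

end

section \<open>Maps of stalks\<close>

text \<open>Sections of G are taken over \<open>w V\<close>. One construction thus covers a map of
  sheaves, where w is the identity, and the passage along a chart, where \<open>w V\<close> is a
  preimage.\<close>

locale stalk_morphism = F: dg_space_at K F x + G: dg_space_at K G y
 for K :: "'k ring" and F :: "('p, 'a, 'k) dg_space" and x and G :: "('q, 'b, 'k) dg_space" and y +
 fixes w :: "'p set \<Rightarrow> 'q set" and \<phi> :: "'p set \<Rightarrow> int \<Rightarrow> 'a \<Rightarrow> 'b"
 assumes w_nb: "F.nb V ==> G.nb (w V)" and w_mono: "V \<subseteq> V' ==> w V \<subseteq> w V'"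
  and \<phi>_hom: "F.nb V ==> dg_hom (dsec F V) (dsec G (w V)) (\<phi> V)"
  and \<phi>_res: "F.nb U ==> F.nb V ==> V \<subseteq> U ==> s : elts (dsec F U) n ==>
    \<phi> V n (dres F U V n s) = dres G (w U) (w V) n (\<phi> U n s)"
begin

definition \<tau> :: "int \<Rightarrow> ('p set \<times> 'a) set \<Rightarrow> ('q set \<times> 'b) set" where
 "\<tau> n g = (\<Union>(V, s) \<in> g. dg_germ G y n (w V) (\<phi> V n s))"

lemma hm: "F.nb V ==> dg_homomorphism (dsec F V) (dsec G (w V)) (\<phi> V)"
 using F.sec_dg G.sec_dg \<phi>_hom w_nb by (simp add: dg_homomorphism_def dg_homomorphism_axioms_def)

lemma \<phi>_closed: "F.nb V ==> s : elts (dsec F V) n ==> \<phi> V n s : elts (dsec G (w V)) n"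
 using \<phi>_hom[of V] hom_in_carrier unfolding dg_hom_def by metis

lemma hm_facts:
 assumes "F.nb V"
 shows "\<phi> V 0 (dunit (dsec F V)) = dunit (dsec G (w V))" "dunit (dsec F V) : elts (dsec F V) 0"
  "s : elts (dsec F V) i ==> t : elts (dsec F V) i ==>
   s \<otimes>[cpt (dsec F V) i] t : elts (dsec F V) i \<and>
   \<phi> V i (s \<otimes>[cpt (dsec F V) i] t) = \<phi> V i s \<otimes>[cpt (dsec G (w V)) i] \<phi> V i t"
  "s : elts (dsec F V) i ==> dif (dsec F V) i s : elts (dsec F V) (i + 1) \<and>
   \<phi> V (i + 1) (dif (dsec F V) i s) = dif (dsec G (w V)) i (\<phi> V i s)"
  "s : elts (dsec F V) i ==> u : elts (dsec F V) j ==>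
   dmul (dsec F V) i j s u : elts (dsec F V) (i + j) \<and>
   \<phi> V (i + j) (dmul (dsec F V) i j s u) = dmul (dsec G (w V)) i j (\<phi> V i s) (\<phi> V j u)"
proof -
 interpret h: dg_homomorphism "dsec F V" "dsec G (w V)" "\<phi> V" by (rule hm[OF assms])
 show "\<phi> V 0 (dunit (dsec F V)) = dunit (dsec G (w V))" by (rule h.g_dunit)
 show "dunit (dsec F V) : elts (dsec F V) 0" by (rule h.B.dunit_closed)
 show "s \<otimes>[cpt (dsec F V) i] t : elts (dsec F V) i \<and>
   \<phi> V i (s \<otimes>[cpt (dsec F V) i] t) = \<phi> V i s \<otimes>[cpt (dsec G (w V)) i] \<phi> V i t"
  if "s : elts (dsec F V) i" "t : elts (dsec F V) i"
  by (intro conjI h.B.A.G.m_closed h.g.g_mult that)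
 show "dif (dsec F V) i s : elts (dsec F V) (i + 1) \<and>
   \<phi> V (i + 1) (dif (dsec F V) i s) = dif (dsec G (w V)) i (\<phi> V i s)" if "s : elts (dsec F V) i"
  by (intro conjI h.B.A.dif_closed h.g.g_dif that)
 show "dmul (dsec F V) i j s u : elts (dsec F V) (i + j) \<and>
   \<phi> V (i + j) (dmul (dsec F V) i j s u) = dmul (dsec G (w V)) i j (\<phi> V i s) (\<phi> V j u)"
  if "s : elts (dsec F V) i" "u : elts (dsec F V) j"
  by (intro conjI h.B.dmul_closed h.g_mul that)
qed

lemma \<tau>_germ:
 assumes "F.nb V" "s : elts (dsec F V) n"
 shows "\<tau> n (F.gm n V s) = G.gm n (w V) (\<phi> V n s)"
 unfolding \<tau>_def
proof (rule F.unary_germ[OF assms, of "%V s. G.gm n (w V) (\<phi> V n s)"])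
 fix V W s' assume a: "F.nb V" "F.nb W" "W \<subseteq> V" "s' : elts (dsec F V) n"
 show "G.gm n (w W) (\<phi> W n (dres F V W n s')) = G.gm n (w V) (\<phi> V n s')"
  unfolding \<phi>_res[OF a] by (rule G.gm_restrict[OF w_nb[OF a(1)] w_nb[OF a(2)] w_mono[OF a(3)] \<phi>_closed[OF a(1,4)]])
qed

lemma \<tau>_dg_hom: "dg_hom (dg_stalk F x) (dg_stalk G y) \<tau>"
 unfolding dg_hom_def
proof (intro conjI allI ballI)
 have c: "\<tau> n g : elts (dg_stalk G y) n" if "g : elts (dg_stalk F x) n" for n g
  by (rule F.stalkE[OF that F.nb_top]) (use \<tau>_germ G.gm_closed w_nb \<phi>_closed in simp)
 show "\<tau> 0 (dunit (dg_stalk F x)) = dunit (dg_stalk G y)"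
 proof -
  show ?thesis unfolding F.stalk_dunit[OF F.nb_top] G.stalk_dunit[OF w_nb[OF F.nb_top]] \<tau>_germ[OF F.nb_top hm_facts(2)[OF F.nb_top]] hm_facts(1)[OF F.nb_top] ..
 qed
 fix n
 show "\<tau> n : hom (cpt (dg_stalk F x) n) (cpt (dg_stalk G y) n)"
 proof (rule homI[OF c], assumption)
  fix g g' assume g: "g : elts (dg_stalk F x) n" "g' : elts (dg_stalk F x) n"
  obtain V s t where u: "F.nb V" "s : elts (dsec F V) n" "t : elts (dsec F V) n" "g = F.gm n V s" "g' = F.gm n V t"
   by (rule F.stalkE2[OF g])
  show "\<tau> n (g \<otimes>[cpt (dg_stalk F x) n] g') = \<tau> n g \<otimes>[cpt (dg_stalk G y) n] \<tau> n g'"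
   unfolding u(4,5) F.stalk_mult[OF u(1-3)] \<tau>_germ[OF u(1,2)] \<tau>_germ[OF u(1,3)] \<tau>_germ[OF u(1) conjunct1[OF hm_facts(3)[OF u(1-3)]]]
    conjunct2[OF hm_facts(3)[OF u(1-3)]] G.stalk_mult[OF w_nb[OF u(1)] \<phi>_closed[OF u(1,2)] \<phi>_closed[OF u(1,3)]] ..
 qed
 {
  fix g assume g: "g : elts (dg_stalk F x) n"
  obtain V s where u: "F.nb V" "s : elts (dsec F V) n" "g = F.gm n V s" by (rule F.stalkE[OF g F.nb_top])
  show "\<tau> (n + 1) (dif (dg_stalk F x) n g) = dif (dg_stalk G y) n (\<tau> n g)"
   unfolding u(3) F.stalk_dif[OF u(1,2)] \<tau>_germ[OF u(1,2)] \<tau>_germ[OF u(1) conjunct1[OF hm_facts(4)[OF u(1,2)]]]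
    conjunct2[OF hm_facts(4)[OF u(1,2)]] G.stalk_dif[OF w_nb[OF u(1)] \<phi>_closed[OF u(1,2)]] ..
 }
 fix j g g' assume g: "g : elts (dg_stalk F x) n" "g' : elts (dg_stalk F x) j"
 obtain V s t where u: "F.nb V" "s : elts (dsec F V) n" "t : elts (dsec F V) j" "g = F.gm n V s" "g' = F.gm j V t"
  by (rule F.stalkE2[OF g])
 show "\<tau> (n + j) (dmul (dg_stalk F x) n j g g') = dmul (dg_stalk G y) n j (\<tau> n g) (\<tau> j g')"
  unfolding u(4,5) F.stalk_dmul[OF u(1-3)] \<tau>_germ[OF u(1,2)] \<tau>_germ[OF u(1,3)] \<tau>_germ[OF u(1) conjunct1[OF hm_facts(5)[OF u(1-3)]]]
   conjunct2[OF hm_facts(5)[OF u(1-3)]] G.stalk_dmul[OF w_nb[OF u(1)] \<phi>_closed[OF u(1,2)] \<phi>_closed[OF u(1,3)]] ..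
qed

lemma \<tau>_homomorphism: "dg_homomorphism (dg_stalk F x) (dg_stalk G y) \<tau>"
 using F.stalk_dg_ring G.stalk_dg_ring \<tau>_dg_hom by (simp add: dg_homomorphism_def dg_homomorphism_axioms_def)

text \<open>The sets \<open>w V\<close> form a neighbourhood basis at y, so all germs there and all
  coincidences between them are seen on sections over such sets, where the map is bijective.\<close>

lemma \<tau>_coh_iso:
 assumes cofinal: "!!W. G.nb W ==> \<exists>V. F.nb V \<and> w V \<subseteq> W"
  and bij: "!!V n. F.nb V ==> bij_betw (\<phi> V n) (elts (dsec F V) n) (elts (dsec G (w V)) n)"
 shows "coh_iso (dg_stalk F x) (dg_stalk G y) (coh_map (dg_stalk G y) \<tau>)"
proof (rule dg_homomorphism.bijective_coh_iso[OF \<tau>_homomorphism], rule bij_betwI')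
 interpret dg_homomorphism "dg_stalk F x" "dg_stalk G y" \<tau> by (rule \<tau>_homomorphism)
 fix n
 {
  fix g g' assume g: "g : elts (dg_stalk F x) n" "g' : elts (dg_stalk F x) n"
  obtain V s t where u: "F.nb V" "s : elts (dsec F V) n" "t : elts (dsec F V) n" "g = F.gm n V s" "g' = F.gm n V t"
   by (rule F.stalkE2[OF g])
  have "g = g'" if "\<tau> n g = \<tau> n g'"
  proof -
   have "G.gm n (w V) (\<phi> V n s) = G.gm n (w V) (\<phi> V n t)" using that u \<tau>_germ[OF u(1,2)] \<tau>_germ[OF u(1,3)] by simp
   then obtain W where W: "G.nb W" "W \<subseteq> w V \<inter> w V" "dres G (w V) W n (\<phi> V n s) = dres G (w V) W n (\<phi> V n t)"
    using G.gm_eqD[OF w_nb[OF u(1)] w_nb[OF u(1)] \<phi>_closed[OF u(1,2)] \<phi>_closed[OF u(1,3)]] by metis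
   obtain V' where V': "F.nb V'" "w V' \<subseteq> W" using cofinal[OF W(1)] by blast
   let ?V = "V \<inter> V'"
   have n: "F.nb ?V" using F.nb_Int[OF u(1) V'(1)] .
   have sub: "w ?V \<subseteq> W" "W \<subseteq> w V" using w_mono[of ?V V'] V'(2) W(2) by auto
   have o: "openin (dsp G) (w V)" "openin (dsp G) W" "openin (dsp G) (w ?V)" using w_nb[OF u(1)] w_nb[OF n] W(1) by auto
   have "\<phi> ?V n (dres F V ?V n s) = \<phi> ?V n (dres F V ?V n t)"
    unfolding \<phi>_res[OF u(1) n Int_lower1 u(2)] \<phi>_res[OF u(1) n Int_lower1 u(3)]
    using G.pre.r_comp[OF o sub \<phi>_closed[OF u(1,2)]] G.pre.r_comp[OF o sub \<phi>_closed[OF u(1,3)]] W(3) by simp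
   then have "dres F V ?V n s = dres F V ?V n t"
    using bij[OF n, of n] F.res_facts(1)[of V ?V s n] F.res_facts(1)[of V ?V t n] u n
    unfolding bij_betw_def inj_on_def by simp
   then show ?thesis unfolding u(4,5) using F.gm_eqI[OF u(1,1,2,3) n] by simp
  qed
  then show "(\<tau> n g = \<tau> n g') = (g = g')" by blast
 }
 show "\<tau> n g : elts (dg_stalk G y) n" if "g : elts (dg_stalk F x) n" for g
  using g.g_closed that .
 fix k assume k: "k : elts (dg_stalk G y) n"
 obtain W t where W: "G.nb W" "t : elts (dsec G W) n" "k = G.gm n W t" by (rule G.stalkE[OF k G.nb_top])
 obtain V where V: "F.nb V" "w V \<subseteq> W" using cofinal[OF W(1)] by blast
 have "dres G W (w V) n t : elts (dsec G (w V)) n" using G.res_facts(1)[of W "w V" t n] W w_nb[OF V(1)] V(2) by simp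
 then obtain s where s: "s : elts (dsec F V) n" "dres G W (w V) n t = \<phi> V n s"
  using bij[OF V(1), of n] unfolding bij_betw_def by (metis imageE)
 have "k = \<tau> n (F.gm n V s)"
  unfolding \<tau>_germ[OF V(1) s(1)] W(3) s(2)[symmetric] using G.gm_restrict[OF W(1) w_nb[OF V(1)] V(2) W(2)] by simp
 then show "\<exists>g\<in>elts (dg_stalk F x) n. k = \<tau> n g" using F.gm_closed[OF V(1) s(1)] by blast
qed

end

lemma sheaf_quasi_iso_stalk:
 assumes "sheaf_quasi_iso K F G" "x : topspace (dsp F)"
 shows "\<exists>f. coh_iso (dg_stalk F x) (dg_stalk G x) f"
proof -
 have a: "dg_ringed_space K F" "dg_ringed_space K G" "dsp F = dsp G" using assms(1) unfolding sheaf_quasi_iso_def by simp_all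
 obtain \<phi> where p: "dg_sheaf_hom K F G \<phi>" "quasi_iso (dg_stalk F x) (dg_stalk G x) (dg_stalk_map G \<phi> x)"
  using assms unfolding sheaf_quasi_iso_def by metis
 interpret F: dg_space_at K F x using a assms(2) by unfold_locales
 interpret G: dg_space_at K G x using a assms(2) by unfold_locales simp_all
 note h = p(1)[unfolded dg_sheaf_hom_def]
 interpret stalk_morphism K F x G x "%V. V" \<phi>
 proof
  show "F.nb V ==> dg_hom (dsec F V) (dsec G V) (\<phi> V)" for V
   using h[THEN conjunct1, rule_format, of V] unfolding dg_alg_hom_def by simp
  show "F.nb U ==> F.nb V ==> V \<subseteq> U ==> s : elts (dsec F U) n ==> \<phi> V n (dres F U V n s) = dres G U V n (\<phi> U n s)"
   for U V s n using h[THEN conjunct2, rule_format, of U V s n] by simp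
 qed (use a in simp_all)
 have "\<tau> = dg_stalk_map G \<phi> x" by (simp add: fun_eq_iff \<tau>_def dg_stalk_map_def)
 then show ?thesis using dg_homomorphism.quasi_iso_coh_iso[OF \<tau>_homomorphism] p(2) by auto
qed

text \<open>This relation is symmetric and transitive and contains every link of a zigzag, so it
  contains \<open>qis_equivalent\<close>; the sheaves in between can then be forgotten.\<close>

definition stalks_iso :: "'k ring \<Rightarrow> ('p, 'a, 'k) dg_space \<Rightarrow> ('p, 'b, 'k) dg_space \<Rightarrow> bool" where
 "stalks_iso K F G \<longleftrightarrow> dg_ringed_space K F \<and> dg_ringed_space K G \<and> dsp F = dsp G \<and>
   (\<forall>x\<in>topspace (dsp F). \<exists>f. coh_iso (dg_stalk F x) (dg_stalk G x) f)"

lemma stalks_isoD: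
 assumes "stalks_iso K F G"
 shows "dg_ringed_space K F" "dg_ringed_space K G" "dsp F = dsp G"
  "x : topspace (dsp F) ==> \<exists>f. coh_iso (dg_stalk F x) (dg_stalk G x) f"
 using assms unfolding stalks_iso_def by simp_all

lemma stalks_iso_sym:
 assumes "stalks_iso K F G" shows "stalks_iso K G F"
 unfolding stalks_iso_def
proof (intro conjI ballI)
 note a = stalks_isoD[OF assms]
 show "dg_ringed_space K G" "dg_ringed_space K F" "dsp G = dsp F" using a by simp_all
 fix x assume "x : topspace (dsp G)"
 then obtain f where "coh_iso (dg_stalk F x) (dg_stalk G x) f" using a(3,4) by metis
 then show "\<exists>f. coh_iso (dg_stalk G x) (dg_stalk F x) f" by (intro exI) (rule coh_iso_sym)
qed

lemma stalks_iso_trans: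
 assumes "stalks_iso K F G" "stalks_iso K G H" shows "stalks_iso K F H"
 unfolding stalks_iso_def
proof (intro conjI ballI)
 note a = stalks_isoD[OF assms(1)] and b = stalks_isoD[OF assms(2)]
 show "dg_ringed_space K F" "dg_ringed_space K H" "dsp F = dsp H" using a b by simp_all
 fix x assume x: "x : topspace (dsp F)"
 obtain f where f: "coh_iso (dg_stalk F x) (dg_stalk G x) f" using a(4)[OF x] by (elim exE)
 obtain g where g: "coh_iso (dg_stalk G x) (dg_stalk H x) g" using b(4)[OF x[unfolded a(3)]] by (elim exE)
 show "\<exists>f. coh_iso (dg_stalk F x) (dg_stalk H x) f" by (intro exI) (rule coh_iso_trans[OF f g])
qed

lemma linked_stalks_iso:
 fixes K :: "'k ring" and F :: "('p, 'a, 'k) dg_space" and G :: "('p, 'b, 'k) dg_space"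
 assumes "qis_linked K F G" shows "stalks_iso K F G"
 using assms unfolding qis_linked_def
proof
 show "stalks_iso K F G" if q: "sheaf_quasi_iso K F G"
  using sheaf_quasi_iso_stalk[OF q] q unfolding stalks_iso_def sheaf_quasi_iso_def by simp
 assume q: "sheaf_quasi_iso K G F"
 have "stalks_iso K G F"
  using sheaf_quasi_iso_stalk[OF q] q unfolding stalks_iso_def sheaf_quasi_iso_def by simp
 then show "stalks_iso K F G" by (rule stalks_iso_sym)
qed

lemma equivalent_stalks_iso:
 fixes TU :: "'u itself" and K :: "'k ring" and F :: "('p, 'a, 'k) dg_space" and G :: "('p, 'b, 'k) dg_space"
 assumes "qis_equivalent TU K F G" shows "stalks_iso K F G"
proof -
 obtain F' G' :: "('p, 'u, 'k) dg_space" where l: "qis_linked K F F'" "(qis_linked K)\<^sup>*\<^sup>* F' G'" "qis_linked K G' G"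
  using assms unfolding qis_equivalent_def by metis
 from l(2) have "stalks_iso K F G'"
 proof (induction rule: rtranclp_induct)
  case base
  show ?case by (rule linked_stalks_iso[OF l(1)])
 next
  case (step G1 G2)
  show ?case by (rule stalks_iso_trans[OF step.IH linked_stalks_iso[OF step.hyps(2)]])
 qed
 then show ?thesis by (rule stalks_iso_trans[OF _ linked_stalks_iso[OF l(3)]])
qed

lemma chart_facts:
 assumes U: "openin X U" and h: "homeomorphic_map (subtopology X U) T h"
 shows "h ` U = topspace T" "inj_on h U"
  "openin T V ==> openin X {y : U. h y : V}" "openin X W ==> openin T (h ` (W \<inter> U))"
proof -
 have top: "topspace (subtopology X U) = U" using openin_subset[OF U] by auto
 show "h ` U = topspace T" using homeomorphic_imp_surjective_map[OF h] top by simp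
 show "inj_on h U" using homeomorphic_imp_injective_map[OF h] top by simp
 show "openin X {y : U. h y : V}" if "openin T V"
 proof -
  have "openin (subtopology X U) {y : topspace (subtopology X U). h y : V}"
   using homeomorphic_imp_continuous_map[OF h] that unfolding continuous_map_def by blast
  then show ?thesis using openin_trans_full U unfolding top by blast
 qed
 show "openin T (h ` (W \<inter> U))" if "openin X W"
  using homeomorphic_imp_open_map[OF h] that unfolding open_map_def by (simp add: openin_subtopology_Int)
qed

text \<open>A chart is a homeomorphism on the open set U, so preimages of neighbourhoods of
  \<open>h x\<close> are cofinal among the neighbourhoods of x, and over these the sections are
  literally the same.\<close>

lemma transport_stalk:
 assumes X: "dg_ringed_space K X" and XT: "dg_ringed_space K (dg_transport X U h T)"
  and U: "openin (dsp X) U" and h: "homeomorphic_map (subtopology (dsp X) U) T h" and x: "x : U"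
 shows "\<exists>f. coh_iso (dg_stalk (dg_transport X U h T) (h x)) (dg_stalk X x) f"
proof -
 note c = chart_facts[OF U h]
 have hx: "h x : topspace T" using c(1) x by blast
 let ?F = "dg_transport X U h T"
 have s: "dsp ?F = T" "dsec ?F V = dsec X {y : U. h y : V}" "dres ?F V W = dres X {y : U. h y : V} {y : U. h y : W}" for V W
  by (simp_all add: dg_transport_def)
 interpret F: dg_space_at K ?F "h x" using XT hx s by unfold_locales simp_all
 interpret G: dg_space_at K X x using X x openin_subset[OF U] by unfold_locales auto
 interpret stalk_morphism K ?F "h x" X x "%V. {y : U. h y : V}" "%V n s. s"
 proof
  show "F.nb V ==> G.nb {y : U. h y : V}" for V using c(3)[of V] x by (simp add: s)
  show "dg_hom (dsec ?F V) (dsec X {y : U. h y : V}) (%n s. s)" for V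
   by (simp add: s dg_hom_def hom_def)
 qed (auto simp: s)
 have "\<exists>V. F.nb V \<and> {y : U. h y : V} \<subseteq> W" if "G.nb W" for W
  using that c(4)[of W] x c(2) by (intro exI[of _ "h ` (W \<inter> U)"]) (auto simp: s inj_on_def)
 then have "coh_iso (dg_stalk ?F (h x)) (dg_stalk X x) (coh_map (dg_stalk X x) \<tau>)"
  by (rule \<tau>_coh_iso) (simp_all add: s bij_betw_def inj_on_def)
 then show ?thesis by blast
qed

text \<open>The stalk of X at x is joined to that of the affine model through the transported sheaf:
  on one side by the chart, on the other by the zigzag.\<close>

lemma affine_open_stalks:
 fixes K :: "'k ring" and X :: "('p, 'a, 'k) dg_space" and A :: "('c, 'k) dg_alg"
 assumes X: "dg_ringed_space K X" and aff: "affine_open K X U A"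
 obtains h where "homeomorphic_map (subtopology (dsp X) U) (zariski (H0 A)) h"
  "dg_ringed_space K (affine_dg_scheme A)"
  "!!x. x : U ==> \<exists>f. coh_iso (dg_stalk (affine_dg_scheme A) (h x)) (dg_stalk X x) f"
proof -
 note a = aff[unfolded affine_open_def]
 have U: "openin (dsp X) U" by (rule a[THEN conjunct1])
 from a[THEN conjunct2, THEN conjunct2]
 obtain h where "homeomorphic_map (subtopology (dsp X) U) (zariski (H0 A)) h \<and>
   qis_equivalent TYPE('c) K (dg_transport X U h (zariski (H0 A))) (affine_dg_scheme A)" ..
 then have h: "homeomorphic_map (subtopology (dsp X) U) (zariski (H0 A)) h"
  "stalks_iso K (dg_transport X U h (zariski (H0 A))) (affine_dg_scheme A)"
  using equivalent_stalks_iso by auto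
 note s = h(2)[unfolded stalks_iso_def]
 have "\<exists>f. coh_iso (dg_stalk (affine_dg_scheme A) (h x)) (dg_stalk X x) f" if x: "x : U" for x
 proof -
  have "topspace (subtopology (dsp X) U) = U" using openin_subset[OF U] by auto
  then have "h x : topspace (zariski (H0 A))" using homeomorphic_imp_surjective_map[OF h(1)] x by blast
  then obtain f where f: "coh_iso (dg_stalk (dg_transport X U h (zariski (H0 A))) (h x)) (dg_stalk (affine_dg_scheme A) (h x)) f"
   using s[THEN conjunct2, THEN conjunct2, THEN conjunct2, rule_format, of "h x"] by (auto simp: dg_transport_def)
  obtain f' where f': "coh_iso (dg_stalk (dg_transport X U h (zariski (H0 A))) (h x)) (dg_stalk X x) f'"
   using transport_stalk[OF X conjunct1[OF s] U h(1) x] by (elim exE)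
  show ?thesis by (intro exI) (rule coh_iso_trans[OF coh_iso_sym[OF f] f'])
 qed
 then show ?thesis using that[OF h(1)] s by simp
qed

section \<open>The Zariski topology\<close>

text \<open>By primality, the intersection of the open sets of E and E' is the open set of all
  products of their elements; unions of open sets come from unions of the sets of elements.\<close>

lemma (in cring) istopology_zariski: "istopology (%U. \<exists>E \<subseteq> carrier R. U = {\<pp> : Spec R. \<not> E \<subseteq> \<pp>})"
 unfolding istopology_def
proof (intro conjI allI impI)
 fix U V assume U: "\<exists>E\<subseteq>carrier R. U = {\<pp> : Spec R. \<not> E \<subseteq> \<pp>}" and V: "\<exists>E\<subseteq>carrier R. V = {\<pp> : Spec R. \<not> E \<subseteq> \<pp>}"
 from U obtain E where "E \<subseteq> carrier R \<and> U = {\<pp> : Spec R. \<not> E \<subseteq> \<pp>}" ..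
 moreover from V obtain E' where "E' \<subseteq> carrier R \<and> V = {\<pp> : Spec R. \<not> E' \<subseteq> \<pp>}" ..
 ultimately have E: "E \<subseteq> carrier R" "E' \<subseteq> carrier R" "U = {\<pp> : Spec R. \<not> E \<subseteq> \<pp>}" "V = {\<pp> : Spec R. \<not> E' \<subseteq> \<pp>}" by simp_all
 let ?E = "{a \<otimes> b | a b. a : E \<and> b : E'}"
 have iff: "(\<not> ?E \<subseteq> p) = (\<not> E \<subseteq> p \<and> \<not> E' \<subseteq> p)" if p: "p : Spec R" for p
 proof -
  have p': "primeideal p R" using p unfolding Spec_def by simp
  have I: "a \<otimes> b : p" if "a : p \<or> b : p" "a : E" "b : E'" for a b
   using ideal_facts(4)[OF primeideal_facts(1)[OF p'], of a b] ideal_facts(5)[OF primeideal_facts(1)[OF p'], of a b]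
    ideal_facts(4)[OF primeideal_facts(1)[OF p'], of b a] ideal_facts(5)[OF primeideal_facts(1)[OF p'], of b a] that E(1,2) by auto
  have J: "a : p \<or> b : p" if "a \<otimes> b : p" "a : E" "b : E'" for a b
   using primeideal_facts(5)[OF p', of a b] that E(1,2) by auto
  show ?thesis
  proof
   assume "\<not> ?E \<subseteq> p"
   then obtain a b where "a : E" "b : E'" "a \<otimes> b ~: p" by blast
   then show "\<not> E \<subseteq> p \<and> \<not> E' \<subseteq> p" using I[of a b] by auto
  next
   assume "\<not> E \<subseteq> p \<and> \<not> E' \<subseteq> p"
   then obtain a b where ab: "a : E" "b : E'" "a ~: p" "b ~: p" by auto
   then have "a \<otimes> b ~: p" using J by blast
   then show "\<not> ?E \<subseteq> p" using ab by auto
  qed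
 qed
 have "U \<inter> V = {\<pp> : Spec R. \<not> ?E \<subseteq> \<pp>}"
 proof (rule Set.set_eqI)
  show "p : U \<inter> V \<longleftrightarrow> p : {\<pp> : Spec R. \<not> ?E \<subseteq> \<pp>}" for p
   unfolding E(3,4) Int_iff mem_Collect_eq using iff[of p] by argo
 qed
 moreover have "?E \<subseteq> carrier R" using E(1,2) by auto
 ultimately show "\<exists>E\<subseteq>carrier R. U \<inter> V = {\<pp> : Spec R. \<not> E \<subseteq> \<pp>}" by (intro exI[of _ ?E] conjI)
next
 fix \<U> assume "\<forall>U\<in>\<U>. \<exists>E\<subseteq>carrier R. U = {\<pp> : Spec R. \<not> E \<subseteq> \<pp>}"
 from bchoice[OF this] obtain E where E: "\<forall>U\<in>\<U>. E U \<subseteq> carrier R \<and> U = {\<pp> : Spec R. \<not> E U \<subseteq> \<pp>}" ..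
 have "\<Union>\<U> = {\<pp> : Spec R. \<not> (\<Union>U\<in>\<U>. E U) \<subseteq> \<pp>}"
 proof (intro Set.set_eqI iffI)
  fix p assume "p : \<Union>\<U>"
  then obtain U where "U : \<U>" "p : U" by blast
  then have "p : Spec R" "\<not> E U \<subseteq> p" using E by auto
  then show "p : {\<pp> : Spec R. \<not> (\<Union>U\<in>\<U>. E U) \<subseteq> \<pp>}" using \<open>U : \<U>\<close> by blast
 next
  fix p assume "p : {\<pp> : Spec R. \<not> (\<Union>U\<in>\<U>. E U) \<subseteq> \<pp>}"
  then obtain U where "U : \<U>" "\<not> E U \<subseteq> p" "p : Spec R" by blast
  then have "p : U" using E by auto
  then show "p : \<Union>\<U>" using \<open>U : \<U>\<close> by blast
 qed
 then show "\<exists>E\<subseteq>carrier R. \<Union>\<U> = {\<pp> : Spec R. \<not> E \<subseteq> \<pp>}" using E by (intro exI[of _ "\<Union>U\<in>\<U>. E U"]) auto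
qed

lemma (in cring) openin_zariski: "openin (zariski R) U \<longleftrightarrow> (\<exists>E \<subseteq> carrier R. U = {\<pp> : Spec R. \<not> E \<subseteq> \<pp>})"
 unfolding zariski_def topology_inverse'[OF istopology_zariski] ..

lemma (in cring) openin_basic: "f : carrier R ==> openin (zariski R) {\<pp> : Spec R. f ~: \<pp>}"
 unfolding openin_zariski by (intro exI[of _ "{f}"]) auto

lemma (in cring) topspace_zariski: "topspace (zariski R) = Spec R"
proof -
 have "{\<pp> : Spec R. \<one> ~: \<pp>} = Spec R" using primeideal_facts(4) unfolding Spec_def by auto
 then have "openin (zariski R) (Spec R)" using openin_basic[OF one_closed] by simp
 moreover have "U \<subseteq> Spec R" if "openin (zariski R) U" for U using that unfolding openin_zariski by auto
 ultimately show ?thesis unfolding topspace_def by blast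
qed

section \<open>Localization of DG-rings\<close>

locale dg_mult_set = dg_ring A for A :: "('a, 'k) dg_alg" +
 fixes S :: "'a set"
 assumes S_sub: "S \<subseteq> elts A 0" and S_one: "dunit A : S"
  and S_mult: "!!s t. s : S ==> t : S ==> dmul A 0 0 s t : S"
begin

lemma S_carrier: "s : S ==> s : elts A 0" using S_sub by blast

abbreviation fr where "fr n a f \<equiv> dg_frac A S n a f"

lemma fr_mem: "(b, g) : fr n a f \<longleftrightarrow> b : elts A n \<and> g : S \<and>
  (\<exists>h\<in>S. dmul A 0 n h (dmul A 0 n g a) = dmul A 0 n h (dmul A 0 n f b))"
 unfolding dg_frac_def by simp

lemma fr_self: "a : elts A n ==> f : S ==> (a, f) : fr n a f"
 unfolding fr_mem using S_one by blast

text \<open>Transitivity of equality of fractions: the new multiplier is the product of the two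
  given ones and of the middle denominator f.\<close>

lemma fr_sub:
 assumes a: "a : elts A n" "f : S" and b: "b : elts A n" "g : S"
  and h: "h : S" "dmul A 0 n h (dmul A 0 n g a) = dmul A 0 n h (dmul A 0 n f b)"
 shows "fr n a f \<subseteq> fr n b g"
proof clarify
 fix c k assume "(c, k) : fr n a f"
 then obtain l where c: "c : elts A n" "k : S" "l : S" "dmul A 0 n l (dmul A 0 n k a) = dmul A 0 n l (dmul A 0 n f c)"
  unfolding fr_mem by blast
 note k = S_carrier[OF a(2)] S_carrier[OF b(2)] S_carrier[OF h(1)] S_carrier[OF c(2)] S_carrier[OF c(3)]
 let ?H = "dmul A 0 0 (dmul A 0 0 h l) f"
 have "dmul A 0 n l (dmul A 0 n k (dmul A 0 n h (dmul A 0 n g a))) = dmul A 0 n l (dmul A 0 n k (dmul A 0 n h (dmul A 0 n f b)))"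
  using h(2) by simp
 moreover have "dmul A 0 n h (dmul A 0 n g (dmul A 0 n l (dmul A 0 n k a))) = dmul A 0 n h (dmul A 0 n g (dmul A 0 n l (dmul A 0 n f c)))"
  using c(4) by simp
 ultimately have "dmul A 0 n ?H (dmul A 0 n k b) = dmul A 0 n ?H (dmul A 0 n g c)"
  using a(1) b(1) c(1) k by (simp add: mul0_closed mul0_assoc mul0_comm)
 moreover have "?H : S" using S_mult h(1) c(3) a(2) by simp
 ultimately show "(c, k) : fr n b g" unfolding fr_mem using c by blast
qed

lemma fr_eqI:
 assumes "a : elts A n" "f : S" "b : elts A n" "g : S"
  "h : S" "dmul A 0 n h (dmul A 0 n g a) = dmul A 0 n h (dmul A 0 n f b)"
 shows "fr n a f = fr n b g"
 using fr_sub[OF assms] fr_sub[OF assms(3,4,1,2,5) assms(6)[symmetric]] by blast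

lemma fr_eqD:
 assumes "a : elts A n" "f : S" "b : elts A n" "g : S" "fr n a f = fr n b g"
 shows "\<exists>h\<in>S. dmul A 0 n h (dmul A 0 n g a) = dmul A 0 n h (dmul A 0 n f b)"
 using fr_self[OF assms(3,4)] unfolding assms(5)[symmetric] fr_mem by simp

lemma fr_eqI1:
 assumes "a : elts A n" "f : S" "b : elts A n" "g : S" "dmul A 0 n g a = dmul A 0 n f b"
 shows "fr n a f = fr n b g"
 using fr_eqI[OF assms(1-4) S_one] assms(5) by simp

lemma Union_fr:
 assumes a: "a : elts A n" "f : S"
  and F: "!!b g h. b : elts A n ==> g : S ==> h : S ==>
   dmul A 0 n h (dmul A 0 n g a) = dmul A 0 n h (dmul A 0 n f b) ==> F b g = c"
 shows "(\<Union>(b, g)\<in>fr n a f. F b g) = c"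
proof -
 have "F b g = c" if m: "(b, g) : fr n a f" for b g
 proof -
  from m obtain h where "h : S" "dmul A 0 n h (dmul A 0 n g a) = dmul A 0 n h (dmul A 0 n f b)" unfolding fr_mem by auto
  then show ?thesis using F[of b g h] m unfolding fr_mem by simp
 qed
 then have "(\<Union>(b, g)\<in>fr n a f. F b g) = (\<Union>p\<in>fr n a f. c)" by (intro SUP_cong) auto
 then show ?thesis using fr_self[OF a] by auto
qed

abbreviation L where "L \<equiv> dg_localization A S"

lemma fr_add:
 assumes a: "a : elts A n" "f : S" and b: "b : elts A n" "g : S"
 shows "fr n a f \<otimes>[cpt L n] fr n b g = fr n (dmul A 0 n g a \<otimes>[cpt A n] dmul A 0 n f b) (dmul A 0 0 f g)"
proof -
 have "(\<Union>(a', f')\<in>fr n a f. \<Union>(b', g')\<in>fr n b g.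
   fr n (dmul A 0 n g' a' \<otimes>[cpt A n] dmul A 0 n f' b') (dmul A 0 0 f' g'))
  = fr n (dmul A 0 n g a \<otimes>[cpt A n] dmul A 0 n f b) (dmul A 0 0 f g)"
 proof (rule Union_fr[OF a], rule Union_fr[OF b])
  fix a' f' h b' g' k
  assume a': "a' : elts A n" "f' : S" "h : S" "dmul A 0 n h (dmul A 0 n f' a) = dmul A 0 n h (dmul A 0 n f a')"
   and b': "b' : elts A n" "g' : S" "k : S" "dmul A 0 n k (dmul A 0 n g' b) = dmul A 0 n k (dmul A 0 n g b')"
  note c = S_carrier[OF a(2)] S_carrier[OF b(2)] S_carrier[OF a'(2)] S_carrier[OF a'(3)] S_carrier[OF b'(2)] S_carrier[OF b'(3)]
  have "dmul A 0 n k (dmul A 0 n g (dmul A 0 n g' (dmul A 0 n h (dmul A 0 n f' a))))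
    = dmul A 0 n k (dmul A 0 n g (dmul A 0 n g' (dmul A 0 n h (dmul A 0 n f a'))))" using a'(4) by simp
  moreover have "dmul A 0 n h (dmul A 0 n f (dmul A 0 n f' (dmul A 0 n k (dmul A 0 n g' b))))
    = dmul A 0 n h (dmul A 0 n f (dmul A 0 n f' (dmul A 0 n k (dmul A 0 n g b'))))" using b'(4) by simp
  ultimately have "dmul A 0 n (dmul A 0 0 h k) (dmul A 0 n (dmul A 0 0 f g) (dmul A 0 n g' a' \<otimes>[cpt A n] dmul A 0 n f' b'))
   = dmul A 0 n (dmul A 0 0 h k) (dmul A 0 n (dmul A 0 0 f' g') (dmul A 0 n g a \<otimes>[cpt A n] dmul A 0 n f b))"
   using a(1) b(1) a'(1) b'(1) c by (simp add: mul0_closed mul0_assoc mul0_comm mul0_add)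
  then show "fr n (dmul A 0 n g' a' \<otimes>[cpt A n] dmul A 0 n f' b') (dmul A 0 0 f' g')
   = fr n (dmul A 0 n g a \<otimes>[cpt A n] dmul A 0 n f b) (dmul A 0 0 f g)"
   using a b a' b' c by (intro fr_eqI[of _ _ _ _ _ "dmul A 0 0 h k"]) (simp_all add: S_mult mul0_closed)
 qed
 then show ?thesis by (simp add: dg_localization_def)
qed

lemma fr_dif:
 assumes a: "a : elts A n" "f : S"
 shows "dif L n (fr n a f) = fr (n + 1) (dif A n a) f"
proof -
 have "(\<Union>(a', f')\<in>fr n a f. fr (n + 1) (dif A n a') f') = fr (n + 1) (dif A n a) f"
 proof (rule Union_fr[OF a])
  fix a' f' h
  assume a': "a' : elts A n" "f' : S" "h : S" "dmul A 0 n h (dmul A 0 n f' a) = dmul A 0 n h (dmul A 0 n f a')"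
  have "dmul A 0 (n + 1) h (dmul A 0 (n + 1) f' (dif A n a)) = dmul A 0 (n + 1) h (dmul A 0 (n + 1) f (dif A n a'))"
   using arg_cong[OF a'(4), of "dif A n"] a(1) a'(1) S_carrier[OF a(2)] S_carrier[OF a'(2)] S_carrier[OF a'(3)]
   by (simp add: dif_mul0 mul0_closed)
  then show "fr (n + 1) (dif A n a') f' = fr (n + 1) (dif A n a) f"
   using a a' by (intro fr_eqI[of _ _ _ _ _ h]) simp_all
 qed
 then show ?thesis by (simp add: dg_localization_def)
qed

lemma dmul_scalar_left:
 "f : elts A 0 ==> a : elts A i ==> b : elts A j ==>
  dmul A i j (dmul A 0 i f a) b = dmul A 0 (i + j) f (dmul A i j a b)"
 using dmul_assoc[of f 0 a i b j] by simp

lemma scalar_comm: "f : elts A 0 ==> a : elts A i ==> dmul A i 0 a f = dmul A 0 i f a"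
 using graded_comm[of f 0 a i] by (simp add: signed_def)

lemma dmul_scalar_right:
 assumes "f : elts A 0" "a : elts A i" "b : elts A j"
 shows "dmul A i j a (dmul A 0 j f b) = dmul A 0 (i + j) f (dmul A i j a b)"
 using dmul_assoc[OF assms(2,1,3)] scalar_comm[OF assms(1,2)] dmul_scalar_left[OF assms] by simp

lemma dmul_scalars:
 assumes "h : elts A 0" "f : elts A 0" "k : elts A 0" "g : elts A 0"
  "a : elts A i" "b : elts A j"
 shows "dmul A i j (dmul A 0 i h (dmul A 0 i f a)) (dmul A 0 j k (dmul A 0 j g b))
  = dmul A 0 (i + j) h (dmul A 0 (i + j) f (dmul A 0 (i + j) k (dmul A 0 (i + j) g (dmul A i j a b))))"
 using assms dmul_scalar_left[of h "dmul A 0 i f a" i "dmul A 0 j k (dmul A 0 j g b)" j]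
  dmul_scalar_left[of f a i "dmul A 0 j k (dmul A 0 j g b)" j]
  dmul_scalar_right[of k a i "dmul A 0 j g b" j] dmul_scalar_right[of g a i b j]
 by (simp add: mul0_closed)

lemma fr_dmul:
 assumes a: "a : elts A i" "f : S" and b: "b : elts A j" "g : S"
 shows "dmul L i j (fr i a f) (fr j b g) = fr (i + j) (dmul A i j a b) (dmul A 0 0 f g)"
proof -
 have "(\<Union>(a', f')\<in>fr i a f. \<Union>(b', g')\<in>fr j b g. fr (i + j) (dmul A i j a' b') (dmul A 0 0 f' g'))
  = fr (i + j) (dmul A i j a b) (dmul A 0 0 f g)"
 proof (rule Union_fr[OF a], rule Union_fr[OF b])
  fix a' f' h b' g' k
  assume a': "a' : elts A i" "f' : S" "h : S" "dmul A 0 i h (dmul A 0 i f' a) = dmul A 0 i h (dmul A 0 i f a')"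
   and b': "b' : elts A j" "g' : S" "k : S" "dmul A 0 j k (dmul A 0 j g' b) = dmul A 0 j k (dmul A 0 j g b')"
  note c = S_carrier[OF a(2)] S_carrier[OF b(2)] S_carrier[OF a'(2)] S_carrier[OF a'(3)] S_carrier[OF b'(2)] S_carrier[OF b'(3)]
  have "dmul A i j (dmul A 0 i h (dmul A 0 i f' a)) (dmul A 0 j k (dmul A 0 j g' b))
    = dmul A i j (dmul A 0 i h (dmul A 0 i f a')) (dmul A 0 j k (dmul A 0 j g b'))" using a'(4) b'(4) by simp
  note e = this[unfolded dmul_scalars[OF c(4,3,6,5) a(1) b(1)] dmul_scalars[OF c(4,1,6,2) a'(1) b'(1)]]
  then have "dmul A 0 (i + j) (dmul A 0 0 h k) (dmul A 0 (i + j) (dmul A 0 0 f g) (dmul A i j a' b'))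
   = dmul A 0 (i + j) (dmul A 0 0 h k) (dmul A 0 (i + j) (dmul A 0 0 f' g') (dmul A i j a b))"
   using a(1) b(1) a'(1) b'(1) c
   by (simp add: mul0_closed dmul_closed mul0_assoc mul0_comm)
  then show "fr (i + j) (dmul A i j a' b') (dmul A 0 0 f' g') = fr (i + j) (dmul A i j a b) (dmul A 0 0 f g)"
   using a b a' b' c by (intro fr_eqI[of _ _ _ _ _ "dmul A 0 0 h k"]) (simp_all add: S_mult dmul_closed)
 qed
 then show ?thesis by (simp add: dg_localization_def)
qed

end

section \<open>Stalks of affine DG-schemes\<close>

text \<open>The stalk is a DG-ring for general reasons and is compared with A directly, by checking
  the elementwise properties of a localization at the complement of p. That the affine model is a
  sheaf of DG-algebras is part of what an affine chart provides.\<close>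

locale affine_point = dg_ring A for K :: "'k ring" and A :: "('a, 'k) dg_alg" +
 fixes p :: "'a set set"
 assumes space: "dg_ringed_space K (affine_dg_scheme A)" and p: "p : Spec (H0 A)"
begin

abbreviation X where "X \<equiv> affine_dg_scheme A"
abbreviation T where "T \<equiv> zariski (H0 A)"
abbreviation C where "C q \<equiv> prime_compl A q"

interpretation HR: cring "H0 A" by (rule H0_cring)

lemma dsp_X: "dsp X = T" by (simp add: affine_dg_scheme_def)

lemma top_T: "topspace T = Spec (H0 A)" by (rule HR.topspace_zariski)

sublocale P: dg_space_at K X p
 using space p by unfold_locales (simp_all add: dsp_X top_T)

lemma C_mult_set:
 assumes "q : Spec (H0 A)" shows "dg_mult_set A (C q)"
proof
 have q: "primeideal q (H0 A)" using assms unfolding Spec_def by simp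
 show "C q \<subseteq> elts A 0" unfolding prime_compl_def by blast
 show "dunit A : C q" unfolding prime_compl_def H0_proj_class using primeideal_facts(4)[OF q] H0_one dunit_closed by simp
 fix s t assume "s : C q" "t : C q"
 then have st: "s : elts A 0" "t : elts A 0" "coh_class A 0 s ~: q" "coh_class A 0 t ~: q"
  unfolding prime_compl_def H0_proj_class by auto
 have "coh_class A 0 (dmul A 0 0 s t) ~: q"
  using primeideal_facts(5)[OF q, of "coh_class A 0 s" "coh_class A 0 t"] H0_classes(1)[OF st(1,2)] st unfolding H0_carrier by auto
 then show "dmul A 0 0 s t : C q" using mul0_closed[OF st(1,2)] unfolding prime_compl_def H0_proj_class by simp
qed

lemma C_dunit: "q : Spec (H0 A) ==> dunit A : C q"
 using dg_mult_set.S_one[OF C_mult_set] .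

definition sec where "sec n V a f = (\<lambda>q\<in>V. dg_frac A (C q) n a f)"

lemma sec_mem:
 assumes "openin T V" "a : elts A n" "!!q. q : V ==> f : C q"
 shows "sec n V a f : elts (dsec X V) n"
proof -
 have "\<exists>W a' f'. openin T W \<and> q : W \<and> W \<subseteq> V \<and> a' : elts A n \<and>
   (\<forall>q'\<in>W. f' : C q' \<and> sec n V a f q' = dg_frac A (C q') n a' f')" if "q : V" for q
  using assms that by (intro exI[of _ V] exI[of _ a] exI[of _ f]) (auto simp: sec_def)
 then show ?thesis by (auto simp: affine_dg_scheme_def affine_sections_def sec_def)
qed

lemma V_spec: "openin T V ==> q : V ==> q : Spec (H0 A)"
 using openin_subset[of T V] unfolding top_T by blast

definition \<iota> where "\<iota> n a = P.gm n (Spec (H0 A)) (sec n (Spec (H0 A)) a (dunit A))"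

lemma nb_Spec: "P.nb (Spec (H0 A))"
 using p openin_topspace[of T] unfolding dsp_X top_T by simp

lemma glob: "a : elts A n ==> sec n (Spec (H0 A)) a (dunit A) : elts (dsec X (Spec (H0 A))) n"
 using sec_mem[of "Spec (H0 A)" a n "dunit A"] nb_Spec C_dunit unfolding dsp_X by simp

lemma \<iota>_nb: "P.nb V ==> a : elts A n ==> \<iota> n a = P.gm n V (sec n V a (dunit A))"
proof -
 assume V: "P.nb V" and a: "a : elts A n"
 have sub: "V \<subseteq> Spec (H0 A)" using V V_spec unfolding dsp_X by blast
 have "dres X (Spec (H0 A)) V n (sec n (Spec (H0 A)) a (dunit A)) = sec n V a (dunit A)"
  using sub by (auto simp: affine_dg_scheme_def sec_def restrict_def fun_eq_iff)
 then show ?thesis unfolding \<iota>_def using P.gm_restrict[OF nb_Spec V sub glob[OF a]] by simp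
qed

lemma sec_dmul:
 assumes V: "openin T V" and a: "a : elts A i" "b : elts A j"
  and f: "!!q. q : V ==> f : C q" "!!q. q : V ==> g : C q"
 shows "dmul (dsec X V) i j (sec i V a f) (sec j V b g) = sec (i + j) V (dmul A i j a b) (dmul A 0 0 f g)"
proof
 fix q
 show "dmul (dsec X V) i j (sec i V a f) (sec j V b g) q = sec (i + j) V (dmul A i j a b) (dmul A 0 0 f g) q"
  using dg_mult_set.fr_dmul[OF C_mult_set[OF V_spec[OF V]] a(1) f(1) a(2) f(2), of q]
  by (cases "q : V") (simp_all add: affine_dg_scheme_def sec_def dg_local_def)
qed

lemma sec_eqI:
 assumes V: "openin T V" and a: "a : elts A n" "b : elts A n"
  and f: "!!q. q : V ==> f : C q" "!!q. q : V ==> g : C q" and eq: "dmul A 0 n g a = dmul A 0 n f b"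
 shows "sec n V a f = sec n V b g"
proof
 fix q show "sec n V a f q = sec n V b g q"
  using dg_mult_set.fr_eqI1[OF C_mult_set[OF V_spec[OF V]] a(1) f(1) a(2) f(2) eq, of q]
  by (cases "q : V") (simp_all add: sec_def)
qed

lemma \<iota>_dg_hom: "dg_hom A (dg_stalk X p) \<iota>"
 unfolding dg_hom_def
proof (intro conjI allI ballI)
 let ?S = "Spec (H0 A)" and ?u = "dunit A"
 have o: "openin T ?S" using nb_Spec unfolding dsp_X by simp
 note ms = dg_mult_set.fr_add[OF C_mult_set] dg_mult_set.fr_dif[OF C_mult_set]
 have uu: "dmul A 0 0 ?u ?u = ?u" using dmul_dunit_left[OF dunit_closed] .
 show "\<iota> 0 ?u = dunit (dg_stalk X p)"
  unfolding P.stalk_dunit[OF nb_Spec] \<iota>_def by (simp add: sec_def affine_dg_scheme_def dg_local_def dg_localization_def)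
 fix n
 show "\<iota> n : hom (cpt A n) (cpt (dg_stalk X p) n)"
 proof (rule homI)
  fix a assume a: "a : elts A n"
  show "\<iota> n a : elts (dg_stalk X p) n" unfolding \<iota>_def by (rule P.gm_closed[OF nb_Spec glob[OF a]])
  fix b assume b: "b : elts A n"
  have "sec n ?S a ?u \<otimes>[cpt (dsec X ?S) n] sec n ?S b ?u = sec n ?S (a \<otimes>[cpt A n] b) ?u"
  proof
   fix q show "(sec n ?S a ?u \<otimes>[cpt (dsec X ?S) n] sec n ?S b ?u) q = sec n ?S (a \<otimes>[cpt A n] b) ?u q"
    using ms(1)[OF _ a C_dunit b C_dunit, of q] uu dmul_dunit_left[OF a] dmul_dunit_left[OF b]
    by (cases "q : ?S") (simp_all add: affine_dg_scheme_def sec_def dg_local_def)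
  qed
  then show "\<iota> n (a \<otimes>[cpt A n] b) = \<iota> n a \<otimes>[cpt (dg_stalk X p) n] \<iota> n b"
   unfolding \<iota>_def P.stalk_mult[OF nb_Spec glob[OF a] glob[OF b]] by simp
 qed
 {
  fix a assume a: "a : elts A n"
  have "dif (dsec X ?S) n (sec n ?S a ?u) = sec (n + 1) ?S (dif A n a) ?u"
  proof
   fix q show "dif (dsec X ?S) n (sec n ?S a ?u) q = sec (n + 1) ?S (dif A n a) ?u q"
    using ms(2)[OF _ a C_dunit, of q] by (cases "q : ?S") (simp_all add: affine_dg_scheme_def sec_def dg_local_def)
  qed
  then show "\<iota> (n + 1) (dif A n a) = dif (dg_stalk X p) n (\<iota> n a)"
   unfolding \<iota>_def P.stalk_dif[OF nb_Spec glob[OF a]] by simp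
 }
 fix j a b assume a: "a : elts A n" and b: "b : elts A j"
 have "dmul (dsec X ?S) n j (sec n ?S a ?u) (sec j ?S b ?u) = sec (n + j) ?S (dmul A n j a b) ?u"
  using sec_dmul[OF o a b, of ?u ?u] C_dunit uu by simp
 then show "\<iota> (n + j) (dmul A n j a b) = dmul (dg_stalk X p) n j (\<iota> n a) (\<iota> j b)"
  unfolding \<iota>_def P.stalk_dmul[OF nb_Spec glob[OF a] glob[OF b]] by simp
qed

lemma basic_nb:
 assumes "s : C p" obtains V where "P.nb V" "\<forall>q\<in>V. s : C q"
proof -
 have s: "s : elts A 0" "coh_class A 0 s ~: p" using assms unfolding prime_compl_def H0_proj_class by auto
 then have "openin T {q : Spec (H0 A). coh_class A 0 s ~: q}" by (intro HR.openin_basic) (simp add: H0_carrier)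
 then show ?thesis
  using that[of "{q : Spec (H0 A). coh_class A 0 s ~: q}"] s p unfolding dsp_X prime_compl_def H0_proj_class by simp
qed

text \<open>An element s outside p is inverted by 1 / s on its basic open set. Near p a section is a
  single fraction a / f, which becomes a when multiplied by f. A vanishing germ of a / 1 has value
  zero at p itself, and this is an equation between fractions.\<close>

lemma \<iota>_localization: "dg_localization_map A (dg_stalk X p) \<iota> (C p)"
proof -
 interpret M: dg_mult_set A "C p" by (rule C_mult_set[OF p])
 have "dg_homomorphism A (dg_stalk X p) \<iota>"
  using dg_ring_axioms P.stalk_dg_ring \<iota>_dg_hom by (simp add: dg_homomorphism_def dg_homomorphism_axioms_def)
 moreover have "\<exists>u\<in>elts (dg_stalk X p) 0. dmul (dg_stalk X p) 0 0 (\<iota> 0 s) u = dunit (dg_stalk X p)" if s: "s : C p" for s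
 proof -
  obtain V where V': "P.nb V" "\<forall>q\<in>V. s : C q" by (rule basic_nb[OF s])
  then have V: "P.nb V" "!!q. q : V ==> s : C q" by auto
  have o: "openin T V" using V(1) unfolding dsp_X by simp
  note sc = M.S_carrier[OF s]
  have u: "!!q. q : V ==> dunit A : C q" using C_dunit V_spec[OF o] by blast
  have su: "sec 0 V (dunit A) s : elts (dsec X V) 0" by (rule sec_mem[OF o dunit_closed V(2)])
  have ss: "sec 0 V s (dunit A) : elts (dsec X V) 0" by (rule sec_mem[OF o sc u])
  have "dmul (dsec X V) 0 0 (sec 0 V s (dunit A)) (sec 0 V (dunit A) s) = sec 0 V (dmul A 0 0 s (dunit A)) (dmul A 0 0 (dunit A) s)"
   using sec_dmul[OF o sc dunit_closed u V(2)] by simp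
  also have "\<dots> = sec 0 V (dunit A) (dunit A)"
   unfolding dmul_dunit_left[OF sc] dmul_dunit_right[OF sc]
   by (rule sec_eqI[OF o sc dunit_closed V(2) u]) (use dmul_dunit_left[OF sc] dmul_dunit_right[OF sc] in simp_all)
  finally have "dmul (dg_stalk X p) 0 0 (\<iota> 0 s) (P.gm 0 V (sec 0 V (dunit A) s)) = \<iota> 0 (dunit A)"
   unfolding \<iota>_nb[OF V(1) sc] \<iota>_nb[OF V(1) dunit_closed] P.stalk_dmul[OF V(1) ss su] by simp
  then show ?thesis using P.gm_closed[OF V(1) su] \<iota>_dg_hom unfolding dg_hom_def by auto
 qed
 moreover have "\<exists>s\<in>C p. \<exists>a\<in>elts A n. dmul (dg_stalk X p) 0 n (\<iota> 0 s) c = \<iota> n a"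
  if c: "c : elts (dg_stalk X p) n" for c n
 proof -
  obtain U t where U: "P.nb U" "t : elts (dsec X U) n" "c = P.gm n U t" by (rule P.stalkE[OF c P.nb_top])
  have "t : affine_sections A n U" using U(2) by (simp add: affine_dg_scheme_def)
  then have "\<exists>W a f. openin T W \<and> p : W \<and> W \<subseteq> U \<and> a : elts A n \<and>
    (\<forall>q\<in>W. f : C q \<and> t q = dg_frac A (C q) n a f)" using U(1) unfolding affine_sections_def by blast
  then obtain W a f where W: "openin T W" "p : W" "W \<subseteq> U" "a : elts A n"
    "!!q. q : W ==> f : C q" "!!q. q : W ==> t q = dg_frac A (C q) n a f" by (elim exE conjE) blast
  have nbW: "P.nb W" using W(1,2) unfolding dsp_X by simp
  have "dres X U W n t = sec n W a f"
   using W(6) by (auto simp: affine_dg_scheme_def sec_def restrict_def fun_eq_iff)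
  then have cW: "c = P.gm n W (sec n W a f)" using P.gm_restrict[OF U(1) nbW W(3) U(2)] U(3) by simp
  have f: "f : C p" "f : elts A 0" using W(2,5) M.S_carrier by auto
  have u: "!!q. q : W ==> dunit A : C q" using C_dunit V_spec[OF W(1)] by blast
  have sa: "sec n W a f : elts (dsec X W) n" by (rule sec_mem[OF W(1,4,5)])
  have sf: "sec 0 W f (dunit A) : elts (dsec X W) 0" by (rule sec_mem[OF W(1) f(2) u])
  have "dmul (dsec X W) 0 n (sec 0 W f (dunit A)) (sec n W a f) = sec n W (dmul A 0 n f a) (dmul A 0 0 (dunit A) f)"
   using sec_dmul[OF W(1) f(2) W(4) u W(5)] by simp
  also have "\<dots> = sec n W a (dunit A)"
   unfolding dmul_dunit_left[OF f(2)]
   by (rule sec_eqI[OF W(1) mul0_closed[OF f(2) W(4)] W(4) W(5) u]) (use dmul_dunit_left[OF mul0_closed[OF f(2) W(4)]] in simp_all)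
  finally have "dmul (dg_stalk X p) 0 n (\<iota> 0 f) c = \<iota> n a"
   unfolding cW \<iota>_nb[OF nbW f(2)] \<iota>_nb[OF nbW W(4)] using P.stalk_dmul[OF nbW sf sa] by simp
  then show ?thesis using f(1) W(4) by blast
 qed
 moreover have "\<exists>s\<in>C p. dmul A 0 n s a = \<one>[cpt A n]" if a: "a : elts A n" "\<iota> n a = \<one>[cpt (dg_stalk X p) n]" for a n
 proof -
  have "P.gm n (Spec (H0 A)) (sec n (Spec (H0 A)) a (dunit A)) = P.gm n (Spec (H0 A)) \<one>[cpt (dsec X (Spec (H0 A))) n]"
   using a(2) unfolding \<iota>_def P.stalk_one[OF nb_Spec] .
  then obtain W where W: "P.nb W" "W \<subseteq> Spec (H0 A) \<inter> Spec (H0 A)"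
   "dres X (Spec (H0 A)) W n (sec n (Spec (H0 A)) a (dunit A)) = dres X (Spec (H0 A)) W n \<one>[cpt (dsec X (Spec (H0 A))) n]"
   using P.gm_eqD[OF nb_Spec nb_Spec glob[OF a(1)] P.sec_one[OF conjunct1[OF nb_Spec]]] by metis
  have "sec n (Spec (H0 A)) a (dunit A) p = \<one>[cpt (dsec X (Spec (H0 A))) n] p"
   using fun_cong[OF W(3), of p] W(1) by (simp add: affine_dg_scheme_def)
  then have "dg_frac A (C p) n a (dunit A) = dg_frac A (C p) n \<one>[cpt A n] (dunit A)"
   using p by (simp add: sec_def affine_dg_scheme_def dg_local_def dg_localization_def)
  then obtain h where h: "h : C p" "dmul A 0 n h (dmul A 0 n (dunit A) a) = dmul A 0 n h (dmul A 0 n (dunit A) \<one>[cpt A n])"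
   using M.fr_eqD[OF a(1) M.S_one A.G.one_closed M.S_one] by blast
  then show ?thesis using dmul_dunit_left[OF a(1)] mul0_one[OF dunit_closed, of n] mul0_one[OF M.S_carrier[OF h(1)], of n]
   by (intro bexI[of _ h]) simp_all
 qed
 ultimately show ?thesis
  using M.S_sub M.S_one M.S_mult by (simp add: dg_localization_map_def dg_localization_map_axioms_def)
qed

lemma coh_C: "coh_class A 0 ` C p = carrier (H0 A) - p"
 unfolding H0_carrier prime_compl_def H0_proj_class by auto

lemma affine_stalk_localization: "\<exists>f. coh_localization A (dg_stalk X p) f (carrier (H0 A) - p)"
 using dg_localization_map.coh_localization[OF \<iota>_localization] unfolding coh_C by blast

end

lemma UN_const: "p : B ==> (!!q. q : B ==> F q = k) ==> (\<Union>q\<in>B. F q) = k"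
 by auto

section \<open>The underlying scheme\<close>

context dg_space_at
begin

abbreviation P where "P \<equiv> H0_presheaf X"
abbreviation Z where "Z \<equiv> underlying_scheme X"
abbreviation L where "L \<equiv> H0 (dg_stalk X x)"
abbreviation HS where "HS U \<equiv> H0 (dsec X U)"
abbreviation hres where "hres U V \<equiv> coh_map (dsec X V) (dres X U V) 0"

text \<open>Cohomology commutes with the direct limit over neighbourhoods, so \<open>H0\<close> of
  the stalk is the stalk of \<open>H0\<close> of the sections. The maps \<theta>, \<Theta> and
  \<epsilon> express this on classes of sections, on germs of such classes and on sections of the
  sheafification.\<close>

definition \<theta> where "\<theta> U = coh_map (dg_stalk X x) (%n. gm n U) 0"

lemma P_simps: "rsp P = dsp X" "rres P U V = hres U V" "carrier (rsec P U) = carrier (HS U)"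
 "monoid.mult (rsec P U) = monoid.mult (HS U)" "one (rsec P U) = one (HS U)"
 "ring.zero (rsec P U) = ring.zero (HS U)" "ring.add (rsec P U) = ring.add (HS U)"
 by (simp_all add: H0_presheaf_def ring.defs)

lemma Z_simps: "rsp Z = dsp X" "rres Z U V s = restrict s V"
 "monoid.mult (rsec Z V) s t = (\<lambda>y\<in>V. s y \<otimes>[rstalk P y] t y)" "ring.add (rsec Z V) s t = (\<lambda>y\<in>V. s y \<oplus>[rstalk P y] t y)"
 "one (rsec Z V) = (\<lambda>y\<in>V. \<one>[rstalk P y])" "ring.zero (rsec Z V) = (\<lambda>y\<in>V. \<zero>[rstalk P y])"
 by (simp_all add: underlying_scheme_def sheafify_def P_simps)

lemma gm_homomorphism: "nb U ==> dg_homomorphism (dsec X U) (dg_stalk X x) (%n. gm n U)"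
 using sec_dg stalk_dg_ring stalk_mult stalk_dif stalk_dmul stalk_dunit gm_closed
 by (simp add: dg_homomorphism_def dg_homomorphism_axioms_def dg_hom_def hom_def)

lemma res_homomorphism: "openin (dsp X) U ==> openin (dsp X) V ==> V \<subseteq> U ==>
  dg_homomorphism (dsec X U) (dsec X V) (dres X U V)"
 using sec_dg res_hom by (simp add: dg_homomorphism_def dg_homomorphism_axioms_def)

lemma \<theta>_hom: "nb U ==> \<theta> U : ring_hom (HS U) L"
 unfolding \<theta>_def by (rule dg_homomorphism.H_ring_hom[OF gm_homomorphism])

lemma HS_elt: "openin (dsp X) U ==> c : carrier (HS U) ==> \<exists>z\<in>elts (dsec X U) 0. c = coh_class (dsec X U) 0 z"
 using dg_ring.H0_carrier[OF sec_dg, of U] by blast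

lemma \<theta>_class: "nb U ==> z : elts (dsec X U) 0 ==> \<theta> U (coh_class (dsec X U) 0 z) = coh_class (dg_stalk X x) 0 (gm 0 U z)"
 unfolding \<theta>_def by (rule dg_homomorphism.H_class0[OF gm_homomorphism])

lemmas hres_class = dg_homomorphism.H_class0[OF res_homomorphism]
lemmas hres_hom = dg_homomorphism.H_ring_hom[OF res_homomorphism]

lemma \<theta>_res:
 assumes "nb U" "nb V" "V \<subseteq> U" "c : carrier (HS U)"
 shows "\<theta> V (hres U V c) = \<theta> U c"
proof -
 obtain z where z: "z : elts (dsec X U) 0" "c = coh_class (dsec X U) 0 z" using HS_elt assms by blast
 then show ?thesis using hres_class[of U V z] \<theta>_class[OF assms(1) z(1)] \<theta>_class[OF assms(2) res_facts(1)[of U V z 0]]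
   gm_restrict[OF assms(1-3) z(1)] res_facts(1)[of U V z 0] assms by simp
qed

sublocale Q: presheaf_at "dsp X" "%U. carrier (HS U)" hres x
proof
 show "x : topspace (dsp X)" by (rule xX)
 show "hres U V s : carrier (HS V)" if "openin (dsp X) U" "openin (dsp X) V" "V \<subseteq> U" "s : carrier (HS U)" for U V s
  using ring_hom_closed[OF hres_hom[OF that(1-3)] that(4)] .
 show "hres U U s = s" if "openin (dsp X) U" "s : carrier (HS U)" for U s
  using HS_elt[OF that] hres_class[OF that(1,1)] pre.r_id[OF that(1)] by auto
 show "hres V W (hres U V s) = hres U W s"
  if "openin (dsp X) U" "openin (dsp X) V" "openin (dsp X) W" "W \<subseteq> V" "V \<subseteq> U" "s : carrier (HS U)" for U V W s
  using HS_elt[OF that(1,6)] hres_class[OF that(1,2,5)] hres_class[OF that(2,3,4)] hres_class[OF that(1,3)] that(4,5)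
   res_facts(1)[OF that(1,2,5)] pre.r_comp[OF that(1-5)] by auto
qed

lemma rres_P: "rres P = hres" by (simp add: H0_presheaf_def)

lemma rgerm_P: "rgerm P x = Q.gm" by (simp add: rgerm_def P_simps(1,3) rres_P)

lemma rstalk_simps: "carrier (rstalk P x) = Q.gms"
 "G \<otimes>[rstalk P x] G' = (\<Union>(U, s)\<in>G. \<Union>(V, t)\<in>G'. Q.gm (U \<inter> V) (hres U (U \<inter> V) s \<otimes>[HS (U \<inter> V)] hres V (U \<inter> V) t))"
 "G \<oplus>[rstalk P x] G' = (\<Union>(U, s)\<in>G. \<Union>(V, t)\<in>G'. Q.gm (U \<inter> V) (hres U (U \<inter> V) s \<oplus>[HS (U \<inter> V)] hres V (U \<inter> V) t))"
 "\<one>[rstalk P x] = Q.gm (topspace (dsp X)) \<one>[HS (topspace (dsp X))]"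
 "\<zero>[rstalk P x] = Q.gm (topspace (dsp X)) \<zero>[HS (topspace (dsp X))]"
 by (simp_all add: rstalk_def P_simps(1,3-) rres_P rgerm_P)

definition \<Theta> where "\<Theta> G = (\<Union>(U, c)\<in>G. \<theta> U c)"

lemma \<theta>_germ:
 assumes "nb U" "s : carrier (HS U)" "(V, t) : Q.gm U s"
 shows "nb V" "t : carrier (HS V)" "\<theta> V t = \<theta> U s"
proof -
 obtain W where W: "nb V" "t : carrier (HS V)" "nb W" "W \<subseteq> U \<inter> V" "hres U W s = hres V W t"
  using assms(3) unfolding Q.gm_mem nb_iff by auto
 show "nb V" "t : carrier (HS V)" using W by auto
 show "\<theta> V t = \<theta> U s" using \<theta>_res[OF assms(1) W(3) _ assms(2)] \<theta>_res[OF W(1,3) _ W(2)] W(4,5) by simp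
qed

lemma \<Theta>_gm:
 assumes U: "nb U" "s : carrier (HS U)" shows "\<Theta> (Q.gm U s) = \<theta> U s"
 unfolding \<Theta>_def
proof (rule UN_const[of "(U, s)"])
 show "(U, s) : Q.gm U s" using Q.gm_self U by (simp add: nb_iff)
 fix q assume "q : Q.gm U s"
 then show "(case q of (V, c) \<Rightarrow> \<theta> V c) = \<theta> U s" using \<theta>_germ(3)[OF U, of "fst q" "snd q"] by (simp add: split_def)
qed

lemma gms_elt:
 assumes "G : Q.gms" obtains U s where "nb U" "s : carrier (HS U)" "G = Q.gm U s"
proof -
 obtain U s where "Q.nb U" "s : carrier (HS U)" "G = Q.gm U s" by (rule Q.gmsE[OF assms])
 then show ?thesis using that[of U s] by (simp add: nb_iff)
qed

text \<open>\<open>rstalk\<close> takes unions over all representatives, on each of which \<open>\<theta>\<close> has the same value.\<close>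

lemma \<Theta>_op:
 assumes G: "G : Q.gms" "G' : Q.gms"
  and f: "!!U a b. nb U ==> a : carrier (HS U) ==> b : carrier (HS U) ==>
    f U a b : carrier (HS U) \<and> \<theta> U (f U a b) = g (\<theta> U a) (\<theta> U b)"
 shows "\<Theta> (\<Union>(U, s)\<in>G. \<Union>(V, t)\<in>G'. Q.gm (U \<inter> V) (f (U \<inter> V) (hres U (U \<inter> V) s) (hres V (U \<inter> V) t))) = g (\<Theta> G) (\<Theta> G')"
proof -
 obtain U0 s0 where u: "nb U0" "s0 : carrier (HS U0)" "G = Q.gm U0 s0" by (rule gms_elt[OF G(1)])
 obtain V0 t0 where v: "nb V0" "t0 : carrier (HS V0)" "G' = Q.gm V0 t0" by (rule gms_elt[OF G(2)])
 let ?f = "%U s V t. f (U \<inter> V) (hres U (U \<inter> V) s) (hres V (U \<inter> V) t)"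
 let ?B = "\<Union>p\<in>G. \<Union>q\<in>G'. Q.gm (fst p \<inter> fst q) (?f (fst p) (snd p) (fst q) (snd q))"
 have e: "nb (U \<inter> V) \<and> ?f U s V t : carrier (HS (U \<inter> V)) \<and> \<theta> (U \<inter> V) (?f U s V t) = g (\<Theta> G) (\<Theta> G')"
  if "(U, s) : G" "(V, t) : G'" for U s V t
 proof -
  note a = \<theta>_germ[OF u(1,2) that(1)[unfolded u(3)]] and b = \<theta>_germ[OF v(1,2) that(2)[unfolded v(3)]]
  have n: "nb (U \<inter> V)" using nb_Int[OF a(1) b(1)] .
  show ?thesis
   using f[OF n Q.r_closed[of U "U \<inter> V" s] Q.r_closed[of V "U \<inter> V" t]] a b n \<theta>_res[OF a(1) n _ a(2)] \<theta>_res[OF b(1) n _ b(2)]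
    \<Theta>_gm[OF u(1,2)] \<Theta>_gm[OF v(1,2)] u(3) v(3) by simp
 qed
 have c: "\<theta> (fst w) (snd w) = g (\<Theta> G) (\<Theta> G')" if w: "w : ?B" for w
 proof -
  from w obtain p where p: "p : G" "w : (\<Union>q\<in>G'. Q.gm (fst p \<inter> fst q) (?f (fst p) (snd p) (fst q) (snd q)))" by (rule UN_E)
  from p(2) obtain q where q: "q : G'" "w : Q.gm (fst p \<inter> fst q) (?f (fst p) (snd p) (fst q) (snd q))" by (rule UN_E)
  have w': "(fst w, snd w) : Q.gm (fst p \<inter> fst q) (?f (fst p) (snd p) (fst q) (snd q))" using q(2) by simp
  show ?thesis using \<theta>_germ(3)[OF _ _ w'] e[of "fst p" "snd p" "fst q" "snd q"] p(1) q(1) by simp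
 qed
 have m: "(U0, s0) : G" "(V0, t0) : G'" using Q.gm_self u v by (simp_all add: nb_iff)
 have "(U0 \<inter> V0, ?f U0 s0 V0 t0) : Q.gm (U0 \<inter> V0) (?f U0 s0 V0 t0)" using Q.gm_self e[OF m] by (simp add: nb_iff)
 then have "(U0 \<inter> V0, ?f U0 s0 V0 t0) : ?B" using m by (intro UN_I[of "(U0, s0)"] UN_I[of "(V0, t0)"]) simp_all
 then show ?thesis unfolding \<Theta>_def[of "\<Union>(U, s)\<in>G. _ U s"] unfolding split_def by (rule UN_const) (rule c)
qed

lemma Z_sec: "carrier (rsec Z V) = {s : extensional V. \<forall>y\<in>V. \<exists>W t. openin (dsp X) W \<and> y : W \<and> W \<subseteq> V \<and>
  t : carrier (HS W) \<and> (\<forall>y'\<in>W. s y' = rgerm P y' W t)}"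
 by (simp add: underlying_scheme_def sheafify_def P_simps)

lemma Z_secE:
 assumes "s : carrier (rsec Z V)" "x : V"
 obtains W t where "nb W" "W \<subseteq> V" "t : carrier (HS W)" "\<forall>y\<in>W. s y = rgerm P y W t"
proof -
 from assms have "\<exists>W t. openin (dsp X) W \<and> x : W \<and> W \<subseteq> V \<and> t : carrier (HS W) \<and> (\<forall>y'\<in>W. s y' = rgerm P y' W t)"
  unfolding Z_sec by blast
 then show ?thesis using that by auto
qed

definition \<epsilon> where "\<epsilon> s = \<Theta> (s x)"

lemma Z_val: "s : carrier (rsec Z V) ==> x : V ==> s x : Q.gms"
 by (erule Z_secE, assumption) (simp add: rgerm_P Q.gm_closed nb_iff)

lemma L_cring: "cring L" by (rule dg_ring.H0_cring[OF stalk_dg_ring])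
lemma HS_cring: "openin (dsp X) U ==> cring (HS U)" by (rule dg_ring.H0_cring[OF sec_dg])

lemma HS_ring: "nb U ==> a : carrier (HS U) ==> b : carrier (HS U) ==> a \<otimes>[HS U] b : carrier (HS U) \<and> a \<oplus>[HS U] b : carrier (HS U)"
 using HS_cring[of U] by (simp add: cring.cring_simprules)

text \<open>The operations of the sheafification are pointwise, and \<epsilon> looks at the value at
  x only; there \<open>\<Theta>_op\<close> applies.\<close>

lemma \<epsilon>_hom:
 assumes "x : V" shows "\<epsilon> : ring_hom (rsec Z V) L"
proof (rule ring_hom_memI)
 fix s assume s: "s : carrier (rsec Z V)"
 obtain U c where "nb U" "c : carrier (HS U)" "s x = Q.gm U c" by (rule gms_elt[OF Z_val[OF s assms]])
 then show "\<epsilon> s : carrier L" unfolding \<epsilon>_def using \<Theta>_gm ring_hom_closed[OF \<theta>_hom] by simp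
 fix t assume t: "t : carrier (rsec Z V)"
 note st = Z_val[OF s assms] Z_val[OF t assms]
 have m: "\<Theta> (s x \<otimes>[rstalk P x] t x) = \<Theta> (s x) \<otimes>[L] \<Theta> (t x)"
  unfolding rstalk_simps by (rule \<Theta>_op[OF st]) (simp add: HS_ring ring_hom_mult[OF \<theta>_hom])
 have a: "\<Theta> (s x \<oplus>[rstalk P x] t x) = \<Theta> (s x) \<oplus>[L] \<Theta> (t x)"
  unfolding rstalk_simps by (rule \<Theta>_op[OF st]) (simp add: HS_ring ring_hom_add[OF \<theta>_hom])
 show "\<epsilon> (s \<otimes>[rsec Z V] t) = \<epsilon> s \<otimes>[L] \<epsilon> t" "\<epsilon> (s \<oplus>[rsec Z V] t) = \<epsilon> s \<oplus>[L] \<epsilon> t"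
  using m a assms unfolding \<epsilon>_def Z_simps by simp_all
next
 have "\<one>[HS (topspace (dsp X))] : carrier (HS (topspace (dsp X)))" using HS_cring[of "topspace (dsp X)"] by (simp add: cring.cring_simprules)
 then show "\<epsilon> \<one>[rsec Z V] = \<one>[L]"
  unfolding \<epsilon>_def Z_simps using assms \<Theta>_gm[OF nb_top] ring_hom_one[OF \<theta>_hom[OF nb_top]] by (simp add: rstalk_simps)
qed

text \<open>A class in degree 0 of the stalk is represented by a section z over some neighbourhood;
  the germs of the class of z at all points there form a section of the sheafification.\<close>

lemma \<epsilon>_surj:
 assumes "c : carrier L" "nb U"
 obtains V s where "nb V" "V \<subseteq> U" "s : carrier (rsec Z V)" "\<epsilon> s = c"
proof -
 obtain g where g: "g : elts (dg_stalk X x) 0" "c = coh_class (dg_stalk X x) 0 g"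
  using assms(1) dg_ring.H0_carrier[OF stalk_dg_ring] by blast
 obtain V z where V: "nb V" "V \<subseteq> U" "z : elts (dsec X V) 0" "g = gm 0 V z" by (rule stalkE[OF g(1) assms(2)])
 let ?t = "coh_class (dsec X V) 0 z" and ?s = "\<lambda>y\<in>V. rgerm P y V (coh_class (dsec X V) 0 z)"
 have t: "?t : carrier (HS V)" using dg_ring.H0_carrier[OF sec_dg] V by blast
 have "\<exists>W t. openin (dsp X) W \<and> y : W \<and> W \<subseteq> V \<and> t : carrier (HS W) \<and> (\<forall>y'\<in>W. ?s y' = rgerm P y' W t)" if "y : V" for y
  using t that V by (intro exI[of _ V] exI[of _ ?t]) simp
 then have "?s : carrier (rsec Z V)" unfolding Z_sec by simp
 moreover have "\<epsilon> ?s = c" unfolding \<epsilon>_def using V t g \<Theta>_gm[OF V(1) t] \<theta>_class[OF V(1,3)] by (simp add: rgerm_P)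
 ultimately show ?thesis using that V by blast
qed

text \<open>If the class of a germ vanishes in the stalk, its representative is a boundary on a
  smaller neighbourhood. The class in \<open>H0\<close> of the sections there is then zero, and with
  it the germs at all nearby points.\<close>

lemma \<epsilon>_inj:
 assumes s: "s : carrier (rsec Z V)" "x : V" "\<epsilon> s = \<zero>[L]"
 obtains W where "nb W" "W \<subseteq> V" "restrict s W = \<zero>[rsec Z W]"
proof -
 obtain W t where W: "nb W" "W \<subseteq> V" "t : carrier (HS W)" "\<forall>y\<in>W. s y = rgerm P y W t" by (rule Z_secE[OF s(1,2)])
 obtain z where z: "z : elts (dsec X W) 0" "t = coh_class (dsec X W) 0 z" using HS_elt W by blast
 interpret S: dg_ring "dg_stalk X x" by (rule stalk_dg_ring)
 have "coh_class (dg_stalk X x) 0 (gm 0 W z) = \<zero>[L]"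
  using s(3) W \<Theta>_gm[OF W(1,3)] \<theta>_class[OF W(1) z(1)] z(2) unfolding \<epsilon>_def by (simp add: rgerm_P)
 then have "gm 0 W z : coboundaries (dg_stalk X x) 0"
  using S.coh_class_zero[OF gm_closed[OF W(1) z(1)]] S.H0_coh_zero by simp
 then obtain u where u: "u : elts (dg_stalk X x) (0 - 1)" "gm 0 W z = dif (dg_stalk X x) (0 - 1) u"
  using S.A.coboundariesE by blast
 obtain V' w where w: "nb V'" "V' \<subseteq> W" "w : elts (dsec X V') (0 - 1)" "u = gm (0 - 1) V' w" by (rule stalkE[OF u(1) W(1)])
 interpret D: dg_ring "dsec X V'" using sec_dg w(1) by blast
 have dw: "dif (dsec X V') (0 - 1) w : elts (dsec X V') 0" using D.A.dif_closed[OF w(3)] by simp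
 have "gm 0 W z = gm 0 V' (dif (dsec X V') (0 - 1) w)" using u(2) w(4) stalk_dif[OF w(1,3)] by simp
 then obtain W' where W': "nb W'" "W' \<subseteq> W \<inter> V'" "dres X W W' 0 z = dres X V' W' 0 (dif (dsec X V') (0 - 1) w)"
  using gm_eqD[OF W(1) w(1) z(1) dw] by metis
 have o: "openin (dsp X) W" "openin (dsp X) V'" "openin (dsp X) W'" "W' \<subseteq> W" "W' \<subseteq> V'" using W w W' by auto
 interpret D': dg_ring "dsec X W'" using sec_dg o by blast
 have "dres X W W' 0 z = dif (dsec X W') (0 - 1) (dres X V' W' (0 - 1) w)"
  using W'(3) res_facts(3)[OF o(2,3,5) w(3)] by simp
 then have "dres X W W' 0 z : coboundaries (dsec X W') 0" using D'.A.coboundariesI[OF res_facts(1)[OF o(2,3,5) w(3)]] by simp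
 then have t0: "hres W W' t = \<zero>[HS W']"
  using D'.coh_class_zero[OF res_facts(1)[OF o(1,3,4) z(1)]] hres_class[OF o(1,3,4) z(1)] z(2) D'.H0_coh_zero by simp
 \<comment> \<open>Vanishing is claimed for a section over W', that is at every point y of W' and
   not only at x; hence the change of the base point.\<close>
 have "restrict s W' y = \<zero>[rsec Z W'] y" for y
 proof (cases "y : W'")
  case True
  interpret Y: dg_space_at K X y using X o(3) True openin_subset by unfold_locales auto
  let ?T = "topspace (dsp X)"
  have n: "Y.nb W" "Y.nb W'" "Y.nb ?T" using o True Y.nb_top by auto
  have sub: "W' \<subseteq> ?T" using openin_subset[OF o(3)] .
  have z0: "\<zero>[HS ?T] : carrier (HS ?T)" using HS_cring[of ?T] by (simp add: cring.cring_simprules)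
  have "hres ?T W' \<zero>[HS ?T] = \<zero>[HS W']"
   using ring_hom_zero[OF hres_hom[OF _ o(3) sub]] cring.axioms(1)[OF HS_cring] o(3) by simp
  then have "rgerm P y W t = \<zero>[rstalk P y]"
   using Y.Q.gm_restrict[of W W' t] Y.Q.gm_restrict[of ?T W' "\<zero>[HS ?T]"] n o(4) W(3) t0 z0 sub
   by (simp add: Y.rgerm_P Y.rstalk_simps Y.nb_iff)
  then show ?thesis using True W(4) o(4) by (auto simp: Z_simps)
 qed (simp add: Z_simps)
 then have "restrict s W' = \<zero>[rsec Z W']" by (rule ext)
 then show ?thesis using that[OF W'(1)] W(2) o(4) by blast
qed

end

section \<open>Fractions\<close>

locale ring_mult_set = cring R for R :: "('a, 'k) kalg" (structure) +
 fixes S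
 assumes S_sub: "S \<subseteq> carrier R" and S_one: "\<one> : S" and S_mult: "!!s t. s : S ==> t : S ==> s \<otimes> t : S"
begin

abbreviation fr where "fr a f \<equiv> ring_frac R S a f"

lemma fr_mem: "(b, g) : fr a f \<longleftrightarrow> b : carrier R \<and> g : S \<and> (\<exists>h\<in>S. h \<otimes> (g \<otimes> a) = h \<otimes> (f \<otimes> b))"
 unfolding ring_frac_def by simp

lemma fr_self: "a : carrier R ==> f : S ==> (a, f) : fr a f"
 unfolding fr_mem using S_one by blast

lemma fr_sub:
 assumes a: "a : carrier R" "f : S" and b: "b : carrier R" "g : S" and h: "h : S" "h \<otimes> (g \<otimes> a) = h \<otimes> (f \<otimes> b)"
 shows "fr a f \<subseteq> fr b g"
proof clarify
 fix c k assume "(c, k) : fr a f"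
 then obtain l where c: "c : carrier R" "k : S" "l : S" "l \<otimes> (k \<otimes> a) = l \<otimes> (f \<otimes> c)" unfolding fr_mem by blast
 have s: "f : carrier R" "g : carrier R" "h : carrier R" "k : carrier R" "l : carrier R" using a b h c S_sub by auto
 have "(h \<otimes> l \<otimes> f) \<otimes> (k \<otimes> b) = (l \<otimes> k) \<otimes> (h \<otimes> (f \<otimes> b))" using s a b by (simp add: m_ac)
 also have "\<dots> = (h \<otimes> g) \<otimes> (l \<otimes> (k \<otimes> a))" unfolding h(2)[symmetric] using s a b by (simp add: m_ac)
 also have "\<dots> = (h \<otimes> l \<otimes> f) \<otimes> (g \<otimes> c)" unfolding c(4) using s a c by (simp add: m_ac)
 finally show "(c, k) : fr b g" unfolding fr_mem using S_mult h(1) c a(2) by blast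
qed

lemma fr_eqI:
 assumes "a : carrier R" "f : S" "b : carrier R" "g : S" "h : S" "h \<otimes> (g \<otimes> a) = h \<otimes> (f \<otimes> b)"
 shows "fr a f = fr b g"
 using fr_sub[OF assms] fr_sub[OF assms(3,4,1,2,5) assms(6)[symmetric]] by blast

lemma fr_op:
 assumes a: "a : carrier R" "f : S" and b: "b : carrier R" "g : S"
  and F: "!!a' f' b' g' h k. \<lbrakk>a' : carrier R; f' : S; b' : carrier R; g' : S; h : S; k : S;
   h \<otimes> (f' \<otimes> a) = h \<otimes> (f \<otimes> a'); k \<otimes> (g' \<otimes> b) = k \<otimes> (g \<otimes> b')\<rbrakk> \<Longrightarrow> F a' f' b' g' = c"
 shows "(\<Union>(a', f')\<in>fr a f. \<Union>(b', g')\<in>fr b g. F a' f' b' g') = c"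
proof -
 have F': "F a' f' b' g' = c" if m: "(a', f') : fr a f" "(b', g') : fr b g" for a' f' b' g'
 proof -
  from m obtain h k where "h : S" "k : S" "h \<otimes> (f' \<otimes> a) = h \<otimes> (f \<otimes> a')" "k \<otimes> (g' \<otimes> b) = k \<otimes> (g \<otimes> b')" unfolding fr_mem by auto
  then show ?thesis using F m unfolding fr_mem by simp
 qed
 have "(\<Union>(a', f')\<in>fr a f. \<Union>(b', g')\<in>fr b g. F a' f' b' g') = (\<Union>p\<in>fr a f. \<Union>q\<in>fr b g. c)"
  by (intro SUP_cong refl) (use F' in auto)
 then show ?thesis using fr_self[OF a] fr_self[OF b] by auto
qed

lemma fr_mult:
 assumes a: "a : carrier R" "f : S" and b: "b : carrier R" "g : S"
 shows "fr a f \<otimes>[localization R S] fr b g = fr (a \<otimes> b) (f \<otimes> g)"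
proof -
 have "(\<Union>(a', f')\<in>fr a f. \<Union>(b', g')\<in>fr b g. fr (a' \<otimes> b') (f' \<otimes> g')) = fr (a \<otimes> b) (f \<otimes> g)"
 proof (rule fr_op[OF a b])
  fix a' f' b' g' h k
  assume c: "a' : carrier R" "f' : S" "b' : carrier R" "g' : S" "h : S" "k : S"
   and e: "h \<otimes> (f' \<otimes> a) = h \<otimes> (f \<otimes> a')" "k \<otimes> (g' \<otimes> b) = k \<otimes> (g \<otimes> b')"
  have s: "f : carrier R" "g : carrier R" "h : carrier R" "k : carrier R" "f' : carrier R" "g' : carrier R"
   using a b c S_sub by auto
  have "(h \<otimes> k) \<otimes> ((f \<otimes> g) \<otimes> (a' \<otimes> b')) = (h \<otimes> (f \<otimes> a')) \<otimes> (k \<otimes> (g \<otimes> b'))" using s c by (simp add: m_ac)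
  also have "\<dots> = (h \<otimes> k) \<otimes> ((f' \<otimes> g') \<otimes> (a \<otimes> b))" unfolding e[symmetric] using s a b by (simp add: m_ac)
  finally show "fr (a' \<otimes> b') (f' \<otimes> g') = fr (a \<otimes> b) (f \<otimes> g)"
   using a b c s by (intro fr_eqI[of _ _ _ _ "h \<otimes> k"]) (simp_all add: S_mult)
 qed
 then show ?thesis by (simp add: localization_def)
qed

lemma fr_add:
 assumes a: "a : carrier R" and b: "b : carrier R"
 shows "fr a \<one> \<oplus>[localization R S] fr b \<one> = fr (a \<oplus> b) \<one>"
proof -
 have "(\<Union>(a', f')\<in>fr a \<one>. \<Union>(b', g')\<in>fr b \<one>. fr ((g' \<otimes> a') \<oplus> (f' \<otimes> b')) (f' \<otimes> g')) = fr (a \<oplus> b) \<one>"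
 proof (rule fr_op[OF a S_one b S_one])
  fix a' f' b' g' h k
  assume c: "a' : carrier R" "f' : S" "b' : carrier R" "g' : S" "h : S" "k : S"
   and e: "h \<otimes> (f' \<otimes> a) = h \<otimes> (\<one> \<otimes> a')" "k \<otimes> (g' \<otimes> b) = k \<otimes> (\<one> \<otimes> b')"
  have s: "h : carrier R" "k : carrier R" "f' : carrier R" "g' : carrier R" using c S_sub by auto
  have "(h \<otimes> k) \<otimes> (\<one> \<otimes> ((g' \<otimes> a') \<oplus> (f' \<otimes> b'))) = (k \<otimes> g') \<otimes> (h \<otimes> (\<one> \<otimes> a')) \<oplus> (h \<otimes> f') \<otimes> (k \<otimes> (\<one> \<otimes> b'))"
   using s c by (simp add: m_ac r_distr)
  also have "\<dots> = (h \<otimes> k) \<otimes> ((f' \<otimes> g') \<otimes> (a \<oplus> b))" unfolding e[symmetric] using s a b by (simp add: m_ac r_distr)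
  finally show "fr ((g' \<otimes> a') \<oplus> (f' \<otimes> b')) (f' \<otimes> g') = fr (a \<oplus> b) \<one>"
   using a b c s S_one by (intro fr_eqI[of _ _ _ _ "h \<otimes> k"]) (simp_all add: S_mult)
 qed
 then show ?thesis by (simp add: localization_def)
qed

end

section \<open>Generic freeness of the cohomology\<close>

lemma (in dg_ring) coh_trivial_iff: "trivial_group (cohomology A n) \<longleftrightarrow> carrier (coh A n) = {\<zero>[coh A n]}"
 using dg_module.trivial_cohomology_iff[OF dg_self_module, of n] by (simp add: dg_self_cohomology)

lemma (in dg_ring) coh_positive:
 assumes "0 < n" shows "carrier (coh A n) = {\<zero>[coh A n]}"
proof -
 have "cocycles A n = {\<one>[cpt A n]}"
  using A.cocycles_carrier[of _ n] A.cocycles_one[of n] nonpositive[OF assms] by blast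
 then show ?thesis by (simp add: coh_simps)
qed

text \<open>\<open>noetherian_dg_ring\<close> asks for finite generation in negative degrees; in
  degree 0 the unit is a generator.\<close>

lemma (in dg_ring) coh_zero_generated:
 assumes "submodule N (H0 A) (coh A 0)" "\<one>[H0 A] : N"
 shows "N = carrier (coh A 0)"
proof
 interpret cring "H0 A" by (rule H0_cring)
 show "N \<subseteq> carrier (coh A 0)" using assms(1) unfolding submodule_def subgroup_def by simp
 show "carrier (coh A 0) \<subseteq> N"
 proof
  fix c assume "c : carrier (coh A 0)"
  then have c: "c : carrier (H0 A)" by (simp add: H0_coh)
  then have "c \<odot>[coh A 0] \<one>[H0 A] : N" using assms unfolding submodule_def submodule_axioms_def by blast
  then show "c : N" using H0_coh_smult[OF c one_closed] c by simp
 qed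
qed

lemma free_basis_trivial:
 assumes "module R M" "carrier M = {\<zero>[M]}" shows "free_basis R M 0 b"
proof -
 interpret module R M by fact
 show ?thesis using assms(2) by (auto simp: free_basis_def lincomb_def)
qed

text \<open>The ideal is finitely generated and each generator is killed by some element of S; the
  product of these elements kills them all.\<close>

lemma (in ring_localization) kernel_annihilator:
 assumes noeth: "noetherian_ring R" and I: "ideal I R" "!!a. a : I ==> f a = \<zero>[R']"
 shows "\<exists>s\<in>S. \<forall>a\<in>I. s \<otimes> a = \<zero>"
proof -
 obtain E where E: "E \<subseteq> carrier R" "finite E" "I = Idl E" using noetherian_ring.finetely_gen[OF noeth I(1)] by metis
 have EI: "E \<subseteq> I" unfolding E(3) by (rule R.genideal_self[OF E(1)])
 have "\<exists>s\<in>S. \<forall>a\<in>E. s \<otimes> a = \<zero>" using E(2) EI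
 proof (induction E)
  case empty then show ?case using S_one by blast
 next
  case (insert e E)
  then obtain s where s: "s : S" "\<forall>a\<in>E. s \<otimes> a = \<zero>" by auto
  have eE: "e : carrier R" "!!a. a : E ==> a : carrier R" using insert.prems ideal_facts(1)[OF I(1)] by auto
  obtain t where t: "t : S" "t \<otimes> e = \<zero>" using f_inj[OF eE(1)] I(2) insert.prems by auto
  have "(s \<otimes> t) \<otimes> a = \<zero>" if "a : insert e E" for a
  proof (cases "a = e")
   case True then show ?thesis using s t S_carrier eE by (simp add: R.m_assoc)
  next
   case False
   then have k: "s : carrier R" "t : carrier R" "a : carrier R" using that s(1) t(1) S_carrier eE(2) by auto
   have "(s \<otimes> t) \<otimes> a = t \<otimes> (s \<otimes> a)" using R.m_lcomm[OF k(2,1,3)] R.m_assoc[OF k] by simp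
   then show ?thesis using False that s t S_carrier by simp
  qed
  then show ?case using S_mult[OF s(1) t(1)] by blast
 qed
 then obtain s where s: "s : S" "\<forall>a\<in>E. s \<otimes> a = \<zero>" by blast
 note sc = S_carrier[OF s(1)]
 have "ideal {a : carrier R. s \<otimes> a = \<zero>} R"
  using sc by (intro R.ideal_if) (auto simp: R.r_distr R.r_minus R.m_lcomm[of s])
 then have "I \<subseteq> {a : carrier R. s \<otimes> a = \<zero>}"
  unfolding E(3) by (rule R.genideal_minimal) (use E(1) s(2) in blast)
 then show ?thesis using s(1) by blast
qed

context coh_localization
begin

sublocale ring_localization "H0 A" "H0 B" "f 0" S by (rule loc0)

lemma coh_trivial: "carrier (coh A n) = {\<zero>[coh A n]} ==> carrier (coh B n) = {\<zero>[coh B n]}"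
 by (rule module_localization.trivial_transfer[OF loc])

lemma bounded_transfer:
 assumes "bounded_cohomology A" shows "bounded_cohomology B"
proof -
 from assms[unfolded bounded_cohomology_def A.coh_trivial_iff] obtain N where
  N: "\<forall>i<N. carrier (coh A i) = {\<zero>[coh A i]}" ..
 show ?thesis unfolding bounded_cohomology_def B.coh_trivial_iff
  by (intro exI[of _ N] allI impI coh_trivial) (use N in simp)
qed

lemma noetherian_dg_transfer:
 assumes "noetherian_dg_ring A" shows "noetherian_dg_ring B"
 unfolding noetherian_dg_ring_def
proof (intro conjI allI impI)
 note a = assms[unfolded noetherian_dg_ring_def]
 show "dg_ring B" by (rule B.dg_ring_axioms)
 show "noetherian_ring (H0 B)" by (rule noetherian_transfer) (rule a[THEN conjunct2, THEN conjunct1])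
 fix n :: int assume "n < 0"
 then have "fin_gen_module (H0 A) (coh A n)" using a[THEN conjunct2, THEN conjunct2] by simp
 then obtain G where G: "finite G" "G \<subseteq> carrier (coh A n)" "!!N. submodule N (H0 A) (coh A n) ==> G \<subseteq> N ==> N = carrier (coh A n)"
  unfolding fin_gen_module_def by auto
 interpret M: module_localization "H0 A" "H0 B" "f 0" S "coh A n" "coh B n" "f n" by (rule loc)
 have "f n ` G \<subseteq> carrier (coh B n)" using G(2) M.g_closed by blast
 then show "fin_gen_module (H0 B) (coh B n)"
  unfolding fin_gen_module_def using G(1) M.generators_transfer[OF G] by (intro exI[of _ "f n ` G"]) simp
qed

end

text \<open>The product of the given elements is outside P by primality, and a prime that avoids the
  product avoids every factor.\<close>

lemma prime_avoid_finite:
 assumes P: "primeideal P R" and F: "finite F" "!!n. n : F ==> g n : carrier R - P"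
 shows "\<exists>f\<in>carrier R - P. \<forall>q. primeideal q R \<and> f ~: q --> (\<forall>n\<in>F. g n ~: q)"
 using F
proof (induction F)
 case empty
 interpret cring R by (rule primeideal_facts(2)[OF P])
 show ?case using primeideal_facts(4)[OF P] by (intro bexI[of _ "\<one>[R]"]) simp_all
next
 case (insert m F)
 then obtain f where f: "f : carrier R - P" "\<forall>q. primeideal q R \<and> f ~: q --> (\<forall>n\<in>F. g n ~: q)" by auto
 have m: "g m : carrier R - P" using insert.prems by simp
 have fm: "f \<otimes>[R] g m : carrier R - P" using primeideal_facts(6)[OF P f(1) m] .
 have "f ~: q \<and> g m ~: q" if q: "primeideal q R" "f \<otimes>[R] g m ~: q" for q
  using ideal_facts(4)[OF primeideal_facts(1)[OF q(1)], of f "g m"] ideal_facts(5)[OF primeideal_facts(1)[OF q(1)], of f "g m"]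
   ideal_facts(4)[OF primeideal_facts(1)[OF q(1)], of "g m" f] ideal_facts(5)[OF primeideal_facts(1)[OF q(1)], of "g m" f] q(2) f(1) m by auto
 then show ?case using f(2) fm by (intro bexI[of _ "f \<otimes>[R] g m"]) auto
qed

text \<open>Boundedness leaves the finitely many degrees from N to 0, and generic freeness modulo P
  is applied in each. As s P = 0 and s becomes invertible in \<open>H0 B\<close>, the ideal P dies
  there, so independence modulo P becomes independence over \<open>H0 B\<close>.\<close>

lemma generic_freeness_coh:
 fixes A :: "('a, 'z) dg_ring_scheme"
 assumes A: "noetherian_dg_ring A" "bounded_cohomology A"
  and P: "primeideal P (H0 A)" and s: "s : carrier (H0 A) - P" "!!a. a : P ==> s \<otimes>[H0 A] a = \<zero>[H0 A]"
 obtains f where "f : carrier (H0 A) - P"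
  "!!(B :: ('b, 'y) dg_ring_scheme) \<eta> p n. primeideal p (H0 A) ==> f ~: p ==> coh_localization A B \<eta> (carrier (H0 A) - p) ==>
    \<exists>k b. free_basis (H0 B) (coh B n) k b"
proof -
 interpret A: dg_ring A using A unfolding noetherian_dg_ring_def by blast
 interpret H: cring "H0 A" by (rule A.H0_cring)
 obtain N where N: "!!n. n < N ==> carrier (coh A n) = {\<zero>[coh A n]}"
  using A(2)[unfolded bounded_cohomology_def A.coh_trivial_iff] by auto
 have fin: "\<exists>G. finite G \<and> G \<subseteq> carrier (coh A n) \<and> (\<forall>M. submodule M (H0 A) (coh A n) \<and> G \<subseteq> M --> M = carrier (coh A n))"
  if "n \<le> 0" for n
 proof (cases "n = 0")
  case True
  then show ?thesis using A.coh_zero_generated H.one_closed by (intro exI[of _ "{\<one>[H0 A]}"]) (simp add: A.H0_coh)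
 next
  case False
  then have "fin_gen_module (H0 A) (coh A n)" using A(1) that unfolding noetherian_dg_ring_def by simp
  then show ?thesis unfolding fin_gen_module_def .
 qed
 let ?Q = "%n f k b. f : carrier (H0 A) - P \<and> b : {..<k} \<rightarrow> carrier (coh A n) \<and>
   (\<forall>m\<in>carrier (coh A n). \<exists>r. r : {..<k} \<rightarrow> carrier (H0 A) \<and> f \<odot>[coh A n] m = lincomb (coh A n) k b r) \<and>
   (\<forall>r. r : {..<k} \<rightarrow> carrier (H0 A) --> lincomb (coh A n) k b r = \<zero>[coh A n] --> (\<forall>i<k. r i : P))"
 have "\<forall>n\<in>{N..0}. \<exists>f. \<exists>k b. ?Q n f k b"
 proof
  fix n assume "n : {N..0}"
  then obtain G where G: "finite G" "G \<subseteq> carrier (coh A n)" "!!M. submodule M (H0 A) (coh A n) ==> G \<subseteq> M ==> M = carrier (coh A n)"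
   using fin[of n] by auto
  show "\<exists>f. \<exists>k b. ?Q n f k b" by (rule module.generic_freeness[OF A.coh_mod P s G])
 qed
 from bchoice[OF this] obtain g where g: "\<forall>n\<in>{N..0}. \<exists>k b. ?Q n (g n) k b" ..
 \<comment> \<open>The index N - 1 lies below the range of degrees and carries s, so that a prime
   avoiding f avoids s as well.\<close>
 have "\<exists>f\<in>carrier (H0 A) - P. \<forall>q. primeideal q (H0 A) \<and> f ~: q --> (\<forall>n\<in>insert (N - 1) {N..0}. (if n < N then s else g n) ~: q)"
  by (rule prime_avoid_finite[OF P]) (use g s(1) in auto)
 then obtain f where f: "f : carrier (H0 A) - P"
  "!!q. primeideal q (H0 A) ==> f ~: q ==> s ~: q \<and> (\<forall>n\<in>{N..0}. g n ~: q)" by auto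
 have fb: "\<exists>k b. free_basis (H0 B) (coh B n) k b"
  if p: "primeideal p (H0 A)" "f ~: p" and l: "coh_localization A B \<eta> (carrier (H0 A) - p)"
  for B :: "('b, 'y) dg_ring_scheme" and \<eta> p n
 proof -
  interpret l: coh_localization A B \<eta> "carrier (H0 A) - p" by (rule l)
  interpret M: module_localization "H0 A" "H0 B" "\<eta> 0" "carrier (H0 A) - p" "coh A n" "coh B n" "\<eta> n" by (rule l.loc)
  show ?thesis
  proof (cases "n : {N..0}")
   case False
   then have "carrier (coh A n) = {\<zero>[coh A n]}" using N[of n] A.coh_positive[of n] by auto
   then show ?thesis by (intro exI) (rule free_basis_trivial[OF l.B.coh_mod l.coh_trivial])
  next
   case True
   obtain k b where Q: "?Q n (g n) k b" using bspec[OF g True] by (elim exE)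
   note fq = f(2)[OF p]
   have zero: "\<eta> 0 a = \<zero>[H0 B]" if a: "a : P" for a
   proof -
    have ac: "a : carrier (H0 A)" using a ideal_facts(1)[OF primeideal_facts(1)[OF P]] by blast
    have sc: "s : carrier (H0 A) - p" using s(1) fq by simp
    have "\<eta> 0 (s \<otimes>[H0 A] a) = \<zero>[H0 B]" unfolding s(2)[OF a] by (rule l.f.hom_zero)
    then have "\<eta> 0 s \<otimes>[H0 B] \<eta> 0 a = \<eta> 0 s \<otimes>[H0 B] \<zero>[H0 B]"
     using ac s(1) l.fS_closed[OF sc] by simp
    then show ?thesis using l.cancel_unit[OF sc] ac by simp
   qed
   have "free_basis (H0 B) (coh B n) k (%i. \<eta> n (b i))"
   proof (rule M.localized_basis)
    show "g n : carrier (H0 A) - p" using Q fq True by simp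
    show "b : {..<k} \<rightarrow> carrier (coh A n)" using Q by simp
    show "\<exists>r. r : {..<k} \<rightarrow> carrier (H0 A) \<and> g n \<odot>[coh A n] m = lincomb (coh A n) k b r" if "m : carrier (coh A n)" for m
     using Q that by simp
    show "\<eta> 0 (r i) = \<zero>[H0 B]" if "r : {..<k} \<rightarrow> carrier (H0 A)" "lincomb (coh A n) k b r = \<zero>[coh A n]" "i < k" for r i
     using Q that by (intro zero) simp
   qed
   then show ?thesis by (intro exI)
  qed
 qed
 show ?thesis by (rule that[OF f(1) fb])
qed

text \<open>\<open>H0 B\<close> is at once a localization of \<open>H0 A\<close> and of a ring D of
  functions on the variety. From D comes a regular sequence generating the maximal ideal, from A the
  finiteness of the cohomology; freeness makes the sequence regular on every cohomology
  module.\<close>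

lemma sequence_regular_if_free:
 assumes l: "coh_localization A B \<eta> (carrier (H0 A) - p)" and p: "primeideal p (H0 A)"
  and A: "noetherian_dg_ring A" "bounded_cohomology A"
  and free: "!!n. \<exists>k b. free_basis (H0 B) (coh B n) k b"
  and D: "prime_localization D (H0 B) \<epsilon> q" "reg_at D q"
 shows "sequence_regular B"
proof -
 interpret l: coh_localization A B \<eta> "carrier (H0 A) - p" by (rule l)
 interpret D: prime_localization D "H0 B" \<epsilon> q by (rule D(1))
 obtain ys where ys: "set ys \<subseteq> D.extend q" "Idl\<^bsub>H0 B\<^esub> (set ys) = D.extend q" "strict_regseq (H0 B) {\<zero>[H0 B]} ys"
  by (rule D.regular_local[OF D(2)])
 show ?thesis
 proof (rule sequence_regular_criterion[of _ "D.extend q"])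
  show "noetherian_local_dg_ring B (D.extend q)"
   unfolding noetherian_local_dg_ring_def using l.noetherian_dg_transfer[OF A(1)] D.local D.extend_p_maximal by blast
  show "bounded_cohomology B" by (rule l.bounded_transfer[OF A(2)])
  show "set ys \<subseteq> D.extend q" "Idl\<^bsub>H0 B\<^esub> (set ys) = D.extend q" by (rule ys)+
  fix n
  obtain k b where fb: "free_basis (H0 B) (coh B n) k b" using free[of n] by (elim exE)
  have "D.extend q \<subseteq> carrier (H0 B)" unfolding D.extend_def by blast
  then show "module_regular (coh B n) {\<zero>[coh B n]} ys"
   using module.free_regular_zero[OF l.B.coh_mod fb _ ys(3)] ys(1) by blast
 qed
qed

text \<open>Over a disjoint union the sections form a product ring, so (1, 0) and (0, 1) are nonzero
  sections with product zero, which is impossible in a domain.\<close>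

lemma integral_scheme_irreducible:
 assumes Z: "kringed_space K Z" and int: "integral_scheme Z"
  and U: "openin (rsp Z) U" "U ~= {}" and V: "openin (rsp Z) V" "V ~= {}"
 shows "U \<inter> V ~= {}"
proof
 assume disj: "U \<inter> V = {}"
 let ?S = "%U. carrier (rsec Z U)" and ?r = "rres Z"
 obtain W0 where W0: "W0 = \<Union>{U, V}" by blast
 have dom: "domain (rsec Z W)" if "openin (rsp Z) W" "W ~= {}" for W using int that unfolding integral_scheme_def by blast
 have s: "sheaf_on (rsp Z) ?S ?r" using Z unfolding kringed_space_def by blast
 note glue = s[unfolded sheaf_on_def, THEN conjunct2, THEN conjunct2, THEN conjunct2, rule_format]
 have W: "openin (rsp Z) W0" "W0 ~= {}" "U \<subseteq> W0" "V \<subseteq> W0" using U V W0 by auto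
 have UV: "U ~= V" using disj U by auto
 interpret D: domain "rsec Z W0" by (rule dom[OF W(1,2)])
 interpret DU: domain "rsec Z U" by (rule dom[OF U])
 interpret DV: domain "rsec Z V" by (rule dom[OF V])
 have hom: "?r A B : ring_hom (rsec Z A) (rsec Z B)" if "openin (rsp Z) A" "openin (rsp Z) B" "B \<subseteq> A" for A B
  using Z that unfolding kringed_space_def kalg_hom_def by blast
 interpret rU: ring_hom_ring "rsec Z W0" "rsec Z U" "?r W0 U"
  by (rule ring_hom_ringI2[OF D.ring_axioms DU.ring_axioms hom[OF W(1) U(1) W(3)]])
 interpret rV: ring_hom_ring "rsec Z W0" "rsec Z V" "?r W0 V"
  by (rule ring_hom_ringI2[OF D.ring_axioms DV.ring_axioms hom[OF W(1) V(1) W(4)]])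
 \<comment> \<open>The empty cover of the empty set shows that there is exactly one section over it,
   so sections over U and V always agree on their overlap and can be glued.\<close>
 have "\<exists>!t. t : ?S (\<Union>{}) \<and> (\<forall>V\<in>{}. ?r (\<Union>{}) V t = undefined V)" by (rule glue) simp
 then have e1: "a = b" if "a : ?S {}" "b : ?S {}" for a b using that by auto
 have re: "?r A {} a : ?S {}" if "openin (rsp Z) A" "a : ?S A" for A a
  using ring_hom_closed[OF hom[OF that(1) openin_empty empty_subsetI] that(2)] .
 have ex: "\<exists>!t. t : ?S W0 \<and> (\<forall>A\<in>{U, V}. ?r W0 A t = (if A = U then a else b))" if "a : ?S U" "b : ?S V" for a b
  unfolding W0
 proof (rule glue, intro conjI ballI)
  fix A B assume AB: "A : {U, V}" "B : {U, V}"
  show A: "openin (rsp Z) A" "(if A = U then a else b) : ?S A" using AB(1) U V that UV by auto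
  have B: "openin (rsp Z) B" "(if B = U then a else b) : ?S B" using AB(2) U V that UV by auto
  show "?r A (A \<inter> B) (if A = U then a else b) = ?r B (A \<inter> B) (if B = U then a else b)"
  proof (cases "A = B")
   case False
   then have "A \<inter> B = {}" using AB disj by auto
   then show ?thesis using e1[OF re[OF A] re[OF B]] by simp
  qed simp
 qed
 have uniq: "t = \<zero>[rsec Z W0]" if "t : ?S W0" "?r W0 U t = \<zero>[rsec Z U]" "?r W0 V t = \<zero>[rsec Z V]" for t
 proof -
  let ?P = "%t. t : ?S W0 \<and> (\<forall>A\<in>{U, V}. ?r W0 A t = (if A = U then \<zero>[rsec Z U] else \<zero>[rsec Z V]))"
  have P: "?P t" "?P \<zero>[rsec Z W0]" using that UV by simp_all
  from ex[OF DU.zero_closed DV.zero_closed] show ?thesis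
  proof (rule ex1E)
   fix z assume z: "\<forall>y. ?P y --> y = z"
   show ?thesis using z[rule_format, OF P(1)] z[rule_format, OF P(2)] by simp
  qed
 qed
 obtain e where e: "e : ?S W0" "?r W0 U e = \<one>[rsec Z U]" "?r W0 V e = \<zero>[rsec Z V]"
  using ex1_implies_ex[OF ex[OF DU.one_closed DV.zero_closed]] UV by auto
 obtain e' where e': "e' : ?S W0" "?r W0 U e' = \<zero>[rsec Z U]" "?r W0 V e' = \<one>[rsec Z V]"
  using ex1_implies_ex[OF ex[OF DU.zero_closed DV.one_closed]] UV by auto
 have "e \<otimes>[rsec Z W0] e' = \<zero>[rsec Z W0]"
  using e e' rU.hom_mult[OF e(1) e'(1)] rV.hom_mult[OF e(1) e'(1)] by (intro uniq) simp_all
 then have "e = \<zero>[rsec Z W0] \<or> e' = \<zero>[rsec Z W0]" using D.integral e e' by blast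
 then show False using e(2) e'(3) rU.hom_zero rV.hom_zero DU.one_not_zero DV.one_not_zero by auto
qed

section \<open>An affine chart of the underlying variety\<close>

locale scheme_chart =
 fixes K :: "'k ring" and X :: "('p, 'a, 'k) dg_space" and U and R :: "('u, 'k) kalg" and h \<phi>
 assumes dgX: "dg_ringed_space K X" and Z_ringed: "kringed_space K (underlying_scheme X)"
  and integral: "integral_scheme (underlying_scheme X)"
  and U: "openin (dsp X) U" "U ~= {}" and R_alg: "kalgebra K R"
  and h: "homeomorphic_map (subtopology (dsp X) U) (zariski R) h"
  and \<phi>: "!!V. openin (zariski R) V ==> \<phi> V : kalg_hom K (rsec (spec_scheme R) V) (rsec (underlying_scheme X) {x : U. h x : V}) \<and>
      bij_betw (\<phi> V) (carrier (rsec (spec_scheme R) V)) (carrier (rsec (underlying_scheme X) {x : U. h x : V}))"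
  and \<phi>_nat: "!!V W s. openin (zariski R) V ==> openin (zariski R) W ==> W \<subseteq> V ==> s : carrier (rsec (spec_scheme R) V) ==>
    \<phi> W (restrict s W) = restrict (\<phi> V s) {x : U. h x : W}"
begin

abbreviation Z where "Z \<equiv> underlying_scheme X"
abbreviation T where "T \<equiv> zariski R"
abbreviation w where "w V \<equiv> {x : U. h x : V}"
abbreviation D where "D \<equiv> rsec Z U"
abbreviation G where "G V \<equiv> rsec (spec_scheme R) V"

lemma rsp_Z: "rsp Z = dsp X" by (simp add: underlying_scheme_def sheafify_def H0_presheaf_def)

sublocale R: cring R using R_alg unfolding kalgebra_def by blast
sublocale D: domain D using integral U unfolding integral_scheme_def rsp_Z by blast

lemmas chart = chart_facts[OF U(1) h]

lemma hx: "x : U ==> primeideal (h x) R"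
 using chart(1) R.topspace_zariski unfolding Spec_def by blast

lemma w_Spec: "w (Spec R) = U" using hx unfolding Spec_def by auto

lemma openin_Spec: "openin T (Spec R)" using openin_topspace[of T] R.topspace_zariski by simp

lemma spec: "openin T V ==> p : V ==> primeideal p R"
 using openin_subset[of T V] R.topspace_zariski unfolding Spec_def by auto

lemma mult_set: "primeideal p R ==> ring_mult_set R (carrier R - p)"
 using primeideal_facts(4,5)[of p R] R.is_cring by (auto simp: ring_mult_set_def ring_mult_set_axioms_def)

definition sg where "sg V a f = (\<lambda>p\<in>V. ring_frac R (carrier R - p) a f)"

lemma sg_mem:
 assumes "openin T V" "a : carrier R" "f : carrier R" "!!p. p : V ==> f ~: p"
 shows "sg V a f : carrier (G V)"
proof -
 have "\<exists>W a' f'. openin T W \<and> p : W \<and> W \<subseteq> V \<and> a' : carrier R \<and> f' : carrier R \<and>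
   (\<forall>q\<in>W. f' ~: q \<and> sg V a f q = ring_frac R (carrier R - q) a' f')" if "p : V" for p
  using assms that by (intro exI[of _ V] exI[of _ a] exI[of _ f]) (auto simp: sg_def)
 then show ?thesis by (auto simp: spec_scheme_def spec_sections_def sg_def)
qed

lemma one_notin: "openin T V ==> p : V ==> \<one>[R] ~: p"
 using primeideal_facts(4)[OF spec] .

lemma sg1: "openin T V ==> a : carrier R ==> sg V a \<one>[R] : carrier (G V)"
 by (rule sg_mem) (use one_notin in simp_all)

lemma sg_mult:
 assumes V: "openin T V" and a: "a : carrier R" "f : carrier R" "b : carrier R" "g : carrier R"
  and n: "!!p. p : V ==> f ~: p" "!!p. p : V ==> g ~: p"
 shows "sg V a f \<otimes>[G V] sg V b g = sg V (a \<otimes>[R] b) (f \<otimes>[R] g)"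
proof
 fix p show "(sg V a f \<otimes>[G V] sg V b g) p = sg V (a \<otimes>[R] b) (f \<otimes>[R] g) p"
  using ring_mult_set.fr_mult[OF mult_set[OF spec[OF V]] a(1) _ a(3), of p f g] a(2,4) n[of p]
  by (cases "p : V") (simp_all add: spec_scheme_def sg_def)
qed

lemma sg_add:
 assumes V: "openin T V" and a: "a : carrier R" "b : carrier R"
 shows "sg V a \<one>[R] \<oplus>[G V] sg V b \<one>[R] = sg V (a \<oplus>[R] b) \<one>[R]"
proof
 fix p show "(sg V a \<one>[R] \<oplus>[G V] sg V b \<one>[R]) p = sg V (a \<oplus>[R] b) \<one>[R] p"
  using ring_mult_set.fr_add[OF mult_set[OF spec[OF V]] a, of p] by (cases "p : V") (simp_all add: spec_scheme_def sg_def)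
qed

lemma sg_one: "\<one>[G V] = sg V \<one>[R] \<one>[R]"
 by (simp add: spec_scheme_def sg_def localization_def)

lemma sg_cancel:
 assumes V: "openin T V" and a: "a : carrier R" "f : carrier R" "b : carrier R" "!!p. p : V ==> f ~: p" and eq: "b = f \<otimes>[R] a"
 shows "sg V b f = sg V a \<one>[R]"
proof
 fix p show "sg V b f p = sg V a \<one>[R] p"
  using ring_mult_set.fr_eqI[OF mult_set[OF spec[OF V]] a(3) _ a(1), of p f "\<one>[R]" "\<one>[R]"] a one_notin[OF V, of p] eq
  by (cases "p : V") (simp_all add: sg_def)
qed

lemma \<phi>_hom: "openin T V ==> \<phi> V : ring_hom (G V) (rsec Z (w V))"
 using \<phi>[of V] unfolding kalg_hom_def by blast

definition \<psi> where "\<psi> a = \<phi> (Spec R) (sg (Spec R) a \<one>[R])"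

lemma \<psi>_hom: "\<psi> : ring_hom R D"
proof (rule ring_hom_memI)
 note p = \<phi>_hom[OF openin_Spec, unfolded w_Spec] and m = sg1[OF openin_Spec]
 show "\<psi> a : carrier D" if "a : carrier R" for a unfolding \<psi>_def by (rule ring_hom_closed[OF p m[OF that]])
 show "\<psi> (a \<otimes>[R] b) = \<psi> a \<otimes>[D] \<psi> b" if "a : carrier R" "b : carrier R" for a b
  unfolding \<psi>_def ring_hom_mult[OF p m[OF that(1)] m[OF that(2)], symmetric]
  using sg_mult[OF openin_Spec that(1) R.one_closed that(2) R.one_closed one_notin one_notin, OF openin_Spec _ openin_Spec] by simp
 show "\<psi> (a \<oplus>[R] b) = \<psi> a \<oplus>[D] \<psi> b" if "a : carrier R" "b : carrier R" for a b
  unfolding \<psi>_def ring_hom_add[OF p m[OF that(1)] m[OF that(2)], symmetric] sg_add[OF openin_Spec that] ..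
 show "\<psi> \<one>[R] = \<one>[D]" unfolding \<psi>_def sg_one[symmetric] by (rule ring_hom_one[OF p])
qed

sublocale \<psi>: ring_hom_cring R D \<psi> by unfold_locales (rule \<psi>_hom)

lemma \<psi>_restrict:
 assumes "openin T W" "a : carrier R" shows "\<phi> W (sg W a \<one>[R]) = restrict (\<psi> a) (w W)"
proof -
 have sub: "W \<subseteq> Spec R" using openin_subset[OF assms(1)] R.topspace_zariski by simp
 then have "restrict (sg (Spec R) a \<one>[R]) W = sg W a \<one>[R]" by (auto simp: sg_def restrict_def fun_eq_iff)
 then show ?thesis using \<phi>_nat[OF openin_Spec assms(1) sub sg1[OF openin_Spec assms(2)]] unfolding \<psi>_def by simp
qed

definition D' where "D' = D\<lparr>carrier := \<psi> ` carrier R\<rparr>"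

lemma D'_simps: "carrier D' = \<psi> ` carrier R" "monoid.mult D' = monoid.mult D" "ring.add D' = ring.add D"
 "one D' = one D" "ring.zero D' = ring.zero D"
 by (simp_all add: D'_def)

lemma \<psi>_subring: "subring (\<psi> ` carrier R) D"
 using ring_hom_ring.img_is_subring[OF ring_hom_ringI2[OF R.ring_axioms D.ring_axioms \<psi>_hom] R.carrier_is_subring] .

sublocale D': domain D' unfolding D'_def by (rule D.subring_is_domain[OF \<psi>_subring])

text \<open>The image of K is a subfield closed under p-th roots, since inverses and roots are
  transported by the homomorphism. A prime that annihilates 1 in D also does so in K because K maps
  injectively, so perfectness of K applies.\<close>

lemma gen_reg_D':
 assumes K: "perfect_field K" and S: "finite S" "S \<subseteq> carrier R" "generate_ring R (kstr R ` carrier K \<union> S) = carrier R"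
 shows "gen_reg D'"
proof -
 interpret K: field K using K unfolding perfect_field_def by blast
 have kR: "kstr R : ring_hom K R" using R_alg unfolding kalgebra_def by blast
 have kD: "(%c. \<psi> (kstr R c)) : ring_hom K D" using ring_hom_trans[OF kR \<psi>_hom] by (simp add: comp_def)
 interpret k: ring_hom_ring K D "%c. \<psi> (kstr R c)"
  by (rule ring_hom_ringI2[OF K.ring_axioms D.ring_axioms kD])
 let ?k = "(%c. \<psi> (kstr R c)) ` carrier K"
 have kc: "kstr R ` carrier K \<subseteq> carrier R" using ring_hom_closed[OF kR] by blast
 have sub: "?k \<union> \<psi> ` S \<subseteq> carrier D" using S(2) by auto
 have "\<psi> a : generate_ring D (?k \<union> \<psi> ` S)" if "a : generate_ring R (kstr R ` carrier K \<union> S)" for a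
  using that
 proof (induction rule: generate_ring.induct)
  case one show ?case by (simp add: generate_ring.one)
 next
  case (incl a) then show ?case by (intro generate_ring.incl) auto
 next
  case (a_inv a) then show ?case using R.generate_ring_in_carrier[OF Un_least[OF kc S(2)]] by (simp add: generate_ring.a_inv)
 next
  case (eng_add a b) then show ?case using R.generate_ring_in_carrier[OF Un_least[OF kc S(2)]] by (simp add: generate_ring.eng_add)
 next
  case (eng_mult a b) then show ?case using R.generate_ring_in_carrier[OF Un_least[OF kc S(2)]] by (simp add: generate_ring.eng_mult)
 qed
 moreover have "generate_ring D (?k \<union> \<psi> ` S) \<subseteq> \<psi> ` carrier R"
  by (rule D.generate_ring_min_subring1[OF sub \<psi>_subring]) (use kc S(2) in auto)
 ultimately have gen: "generate_ring D (?k \<union> \<psi> ` S) = \<psi> ` carrier R" unfolding S(3) by auto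
 have inj: "c = \<zero>[K]" if c: "c : carrier K" "\<psi> (kstr R c) = \<zero>[D]" for c
 proof (rule ccontr)
  assume n: "c ~= \<zero>[K]"
  then have i: "inv\<^bsub>K\<^esub> c : carrier K" "c \<otimes>[K] inv\<^bsub>K\<^esub> c = \<one>[K]" using K.field_Units c(1) by simp_all
  have "\<one>[D] = \<psi> (kstr R c) \<otimes>[D] \<psi> (kstr R (inv\<^bsub>K\<^esub> c))" using k.hom_mult[OF c(1) i(1)] i(2) k.hom_one by simp
  then show False using c(2) k.hom_closed[OF i(1)] by simp
 qed
 have "gen_reg (D\<lparr>carrier := generate_ring D (?k \<union> \<psi> ` S)\<rparr>)"
 proof (rule D.gen_reg_generate)
  show "subring ?k D" using k.img_is_subring[OF K.carrier_is_subring] .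
  show "finite (\<psi> ` S)" "\<psi> ` S \<subseteq> carrier D" using S by auto
  show "\<exists>b\<in>?k. a \<otimes>[D] b = \<one>[D]" if a: "a : ?k" "a ~= \<zero>[D]" for a
  proof -
   obtain c where c: "c : carrier K" "a = \<psi> (kstr R c)" using a by auto
   then have "c ~= \<zero>[K]" using a(2) k.hom_zero by auto
   then have i: "inv\<^bsub>K\<^esub> c : carrier K" "c \<otimes>[K] inv\<^bsub>K\<^esub> c = \<one>[K]" using K.field_Units c(1) by simp_all
   then show ?thesis using k.hom_mult[OF c(1) i(1)] k.hom_one c(2) by (intro bexI[of _ "\<psi> (kstr R (inv\<^bsub>K\<^esub> c))"]) auto
  qed
  show "\<exists>b\<in>?k. b [^]\<^bsub>D\<^esub> p = a" if p: "Factorial_Ring.prime p" "[p] \<cdot>\<^bsub>D\<^esub> \<one>[D] = \<zero>[D]" "a : ?k" for p :: nat and a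
  proof -
   have np: "\<psi> (kstr R ([n] \<cdot>\<^bsub>K\<^esub> \<one>[K])) = [n] \<cdot>\<^bsub>D\<^esub> \<one>[D]" for n :: nat
   proof (induction n)
    case 0 show ?case using k.hom_zero by simp
   next
    case (Suc n) then show ?case using k.hom_add[of "[n] \<cdot>\<^bsub>K\<^esub> \<one>[K]" "\<one>[K]"] k.hom_one by simp
   qed
   have "[p] \<cdot>\<^bsub>K\<^esub> \<one>[K] = \<zero>[K]" using inj np[of p] p(2) by simp
   then have perf: "\<forall>x\<in>carrier K. \<exists>y\<in>carrier K. y [^]\<^bsub>K\<^esub> p = x" using K p(1) unfolding perfect_field_def by blast
   obtain c where c: "c : carrier K" "a = \<psi> (kstr R c)" using p(3) by auto
   obtain y where y: "y : carrier K" "y [^]\<^bsub>K\<^esub> p = c" using perf c(1) by auto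
   have "\<psi> (kstr R (y [^]\<^bsub>K\<^esub> n)) = \<psi> (kstr R y) [^]\<^bsub>D\<^esub> n" for n :: nat
   proof (induction n)
    case 0 show ?case using k.hom_one by simp
   next
    case (Suc n) then show ?case using k.hom_mult[of "y [^]\<^bsub>K\<^esub> n" y] y(1) by simp
   qed
   then show ?thesis using y c by (intro bexI[of _ "\<psi> (kstr R y)"]) auto
  qed
 qed
 then show ?thesis unfolding gen D'_def .
qed

end

locale scheme_point = scheme_chart +
 fixes x assumes xU: "x : U"
begin

sublocale p: dg_space_at K X x
 using dgX xU openin_subset[OF U(1)] by unfold_locales auto

abbreviation L where "L \<equiv> H0 (dg_stalk X x)"

sublocale L: cring L by (rule p.L_cring)

lemma \<epsilon>: "openin T V ==> h x : V ==> p.\<epsilon> : ring_hom (rsec Z (w V)) L"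
 using p.\<epsilon>_hom[of "w V"] xU by simp

lemma \<epsilon>\<phi>: "openin T V ==> h x : V ==> (%s. p.\<epsilon> (\<phi> V s)) : ring_hom (G V) L"
 using ring_hom_trans[OF \<phi>_hom \<epsilon>] by (simp add: comp_def)

lemma \<epsilon>_restrict: "x : V ==> p.\<epsilon> (restrict s V) = p.\<epsilon> s" by (simp add: p.\<epsilon>_def)

lemma \<epsilon>_sg: "openin T V ==> h x : V ==> a : carrier R ==> p.\<epsilon> (\<phi> V (sg V a \<one>[R])) = p.\<epsilon> (\<psi> a)"
 using \<psi>_restrict[of V a] \<epsilon>_restrict[of "w V"] xU by simp

lemma \<epsilon>_D: "p.\<epsilon> : ring_hom D L" by (rule p.\<epsilon>_hom[OF xU])

text \<open>On the basic open set of r the fraction 1 / r is a section, and its image in L is the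
  inverse.\<close>

lemma \<epsilon>_unit:
 assumes r: "r : carrier R" "r ~: h x" shows "p.\<epsilon> (\<psi> r) : Units L"
proof -
 let ?V = "{q : Spec R. r ~: q}" and ?o = "\<one>[R]"
 have V: "openin T ?V" "h x : ?V" using R.openin_basic[OF r(1)] r hx[OF xU] by (simp_all add: Spec_def)
 note e = \<epsilon>\<phi>[OF V]
 have n: "!!p. p : ?V ==> r ~: p" by simp
 have m: "sg ?V r ?o : carrier (G ?V)" "sg ?V ?o r : carrier (G ?V)" using sg1[OF V(1) r(1)] sg_mem[OF V(1) _ r(1) n] by simp_all
 have "sg ?V r ?o \<otimes>[G ?V] sg ?V ?o r = sg ?V r r"
  using sg_mult[OF V(1) r(1) R.one_closed R.one_closed r(1) one_notin[OF V(1)] n] r(1) by simp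
 also have "\<dots> = \<one>[G ?V]" unfolding sg_one using sg_cancel[OF V(1) R.one_closed r(1) r(1) n] r(1) by simp
 finally have "p.\<epsilon> (\<psi> r) \<otimes>[L] p.\<epsilon> (\<phi> ?V (sg ?V ?o r)) = \<one>[L]"
  using ring_hom_mult[OF e m] ring_hom_one[OF e] \<epsilon>_sg[OF V r(1)] by simp
 moreover have k: "p.\<epsilon> (\<psi> r) : carrier L" "p.\<epsilon> (\<phi> ?V (sg ?V ?o r)) : carrier L"
  using ring_hom_closed[OF e m(2)] ring_hom_closed[OF e m(1)] \<epsilon>_sg[OF V r(1)] by simp_all
 ultimately show ?thesis using L.m_comm[OF k] unfolding Units_def by (metis (mono_tags, lifting) mem_Collect_eq)
qed

text \<open>An element of L comes from a section near x. The chart turns it into a section of the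
  structure sheaf of the spectrum of R, and such a section is locally a fraction a / f.\<close>

lemma chart_surj:
 assumes c: "c : carrier L"
 obtains f a where "f : carrier R" "f ~: h x" "a : carrier R" "p.\<epsilon> (\<psi> f) \<otimes>[L] c = p.\<epsilon> (\<psi> a)"
proof -
 have nU: "p.nb U" using U xU by simp
 obtain V s where V: "p.nb V" "V \<subseteq> U" "s : carrier (rsec Z V)" "p.\<epsilon> s = c" by (rule p.\<epsilon>_surj[OF c nU])
 let ?W = "h ` V" and ?o = "\<one>[R]"
 have W: "openin T ?W" using chart(4)[of V] V(1,2) by (simp add: Int_absorb2)
 have wW: "w ?W = V" using V(2) chart(2) by (auto simp: inj_on_def)
 have "s : \<phi> ?W ` carrier (G ?W)" using conjunct2[OF \<phi>[OF W]] V(3) unfolding wW bij_betw_def by simp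
 then obtain t where t: "s = \<phi> ?W t" "t : carrier (G ?W)" by (rule imageE)
 have "h x : ?W" using V(1) by simp
 moreover have "t : spec_sections R ?W" using t(2) by (simp add: spec_scheme_def)
 ultimately have "\<exists>W' a f. openin T W' \<and> h x : W' \<and> W' \<subseteq> ?W \<and> a : carrier R \<and> f : carrier R \<and>
    (\<forall>q\<in>W'. f ~: q \<and> t q = ring_frac R (carrier R - q) a f)" unfolding spec_sections_def by blast
 then obtain W' a f where o: "openin T W'" "h x : W'" "W' \<subseteq> ?W" "a : carrier R" "f : carrier R"
  and q: "\<forall>q\<in>W'. f ~: q \<and> t q = ring_frac R (carrier R - q) a f" by (elim exE conjE)
 have n: "!!q. q : W' ==> f ~: q" using q by simp
 have tr: "restrict t W' = sg W' a f" using q by (auto simp: sg_def restrict_def fun_eq_iff)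
 note e = \<epsilon>\<phi>[OF o(1,2)]
 have m: "sg W' f ?o : carrier (G W')" "sg W' a f : carrier (G W')" using sg1[OF o(1,5)] sg_mem[OF o(1,4,5) n] by simp_all
 have "sg W' f ?o \<otimes>[G W'] sg W' a f = sg W' (f \<otimes>[R] a) f"
  using sg_mult[OF o(1,5) R.one_closed o(4,5) one_notin[OF o(1)] n] o(5) by simp
 also have "\<dots> = sg W' a ?o" using sg_cancel[OF o(1,4,5) _ n refl] o(4,5) by simp
 finally have "p.\<epsilon> (\<psi> f) \<otimes>[L] p.\<epsilon> (\<phi> W' (sg W' a f)) = p.\<epsilon> (\<psi> a)"
  using ring_hom_mult[OF e m] \<epsilon>_sg[OF o(1,2)] o(4,5) by simp
 moreover have "p.\<epsilon> (\<phi> W' (sg W' a f)) = c"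
  using \<phi>_nat[OF W o(1,3) t(2)] \<epsilon>_restrict[of "w W'" s] xU o(2) V(4) t(1) unfolding tr by simp
 ultimately show ?thesis using that o(4,5) n[OF o(2)] by simp
qed

text \<open>If a vanishes in L, its section vanishes near x. Injectivity of the chart on sections
  turns this into equality of a / 1 and 0 / 1 as fractions at \<open>h x\<close>.\<close>

lemma chart_inj:
 assumes a: "a : carrier R" "p.\<epsilon> (\<psi> a) = \<zero>[L]"
 obtains g where "g : carrier R" "g ~: h x" "g \<otimes>[R] a = \<zero>[R]"
proof -
 obtain W where W: "p.nb W" "W \<subseteq> U" "restrict (\<psi> a) W = \<zero>[rsec Z W]"
  by (rule p.\<epsilon>_inj[OF \<psi>.hom_closed[OF a(1)] xU a(2)])
 let ?V = "h ` W" and ?o = "\<one>[R]"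
 have V: "openin T ?V" using chart(4)[of W] W(1,2) by (simp add: Int_absorb2)
 have wV: "w ?V = W" using W(2) chart(2) by (auto simp: inj_on_def)
 have "\<phi> ?V (sg ?V \<zero>[R] ?o) = restrict \<zero>[D] W" using \<psi>_restrict[OF V R.zero_closed] unfolding wV by simp
 also have "\<dots> = \<zero>[rsec Z W]" using W(2) by (auto simp: p.Z_simps restrict_def fun_eq_iff)
 finally have "\<phi> ?V (sg ?V \<zero>[R] ?o) = \<phi> ?V (sg ?V a ?o)" using \<psi>_restrict[OF V a(1)] W(3) unfolding wV by simp
 then have "sg ?V \<zero>[R] ?o = sg ?V a ?o"
  using conjunct2[OF \<phi>[OF V]] sg1[OF V R.zero_closed] sg1[OF V a(1)] unfolding bij_betw_def inj_on_def by simp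
 then have "sg ?V \<zero>[R] ?o (h x) = sg ?V a ?o (h x)" by (rule fun_cong)
 then have fr: "ring_frac R (carrier R - h x) \<zero>[R] ?o = ring_frac R (carrier R - h x) a ?o" using W(1) by (simp add: sg_def)
 interpret m: ring_mult_set R "carrier R - h x" by (rule mult_set[OF hx[OF xU]])
 have "(a, ?o) : m.fr \<zero>[R] ?o" using fr m.fr_self[OF a(1) m.S_one] by simp
 then obtain g where "g : carrier R - h x" "g \<otimes>[R] (?o \<otimes>[R] \<zero>[R]) = g \<otimes>[R] (?o \<otimes>[R] a)" unfolding m.fr_mem by auto
 then show ?thesis using that[of g] a(1) by simp
qed

text \<open>The prime is the preimage of the maximal ideal of L. That the units of L are the
  complement of that ideal is supplied by the derived chart, where L is a localization of
  \<open>H0 A\<close>; it makes the elements outside the preimage invertible in L.\<close>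

lemma chart_localization:
 assumes \<mm>: "primeideal \<mm> L" "!!c. c : carrier L ==> c : Units L \<longleftrightarrow> c ~: \<mm>"
 shows "prime_localization D' L p.\<epsilon> {c : carrier D'. p.\<epsilon> c : \<mm>}"
proof -
 let ?q = "{c : carrier D'. p.\<epsilon> c : \<mm>}"
 have hom: "p.\<epsilon> : ring_hom D' L" using \<epsilon>_D \<psi>.hom_closed unfolding ring_hom_def by (auto simp: D'_simps)
 have q: "primeideal ?q D'" by (rule primeideal_vimage[OF D'.is_cring L.is_cring hom \<mm>(1)])
 have S: "\<psi> f : carrier D' - ?q" if "f : carrier R" "f ~: h x" for f
  using \<epsilon>_unit[OF that] \<mm>(2)[of "p.\<epsilon> (\<psi> f)"] that ring_hom_closed[OF hom] by (auto simp: D'_simps)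
 have "ring_localization D' L p.\<epsilon> (carrier D' - ?q)"
 proof
  show "p.\<epsilon> : ring_hom D' L" by (rule hom)
  show "carrier D' - ?q \<subseteq> carrier D'" by blast
  show "\<one>[D'] : carrier D' - ?q" using primeideal_facts(4)[OF q] by simp
  show "s \<otimes>[D'] t : carrier D' - ?q" if "s : carrier D' - ?q" "t : carrier D' - ?q" for s t
   by (rule primeideal_facts(6)[OF q that])
  show "p.\<epsilon> s : Units L" if "s : carrier D' - ?q" for s
   using \<mm>(2)[of "p.\<epsilon> s"] that ring_hom_closed[OF hom, of s] by simp
  show "\<exists>s\<in>carrier D' - ?q. \<exists>a\<in>carrier D'. p.\<epsilon> s \<otimes>[L] c = p.\<epsilon> a" if c: "c : carrier L" for c
  proof -
   obtain f a where f: "f : carrier R" "f ~: h x" "a : carrier R" "p.\<epsilon> (\<psi> f) \<otimes>[L] c = p.\<epsilon> (\<psi> a)" by (rule chart_surj[OF c])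
   then show ?thesis using S[OF f(1,2)] by (intro bexI[of _ "\<psi> f"] bexI[of _ "\<psi> a"]) (simp_all add: D'_simps)
  qed
  show "\<exists>s\<in>carrier D' - ?q. s \<otimes>[D'] d = \<zero>[D']" if d: "d : carrier D'" "p.\<epsilon> d = \<zero>[L]" for d
  proof -
   obtain a where a: "a : carrier R" "d = \<psi> a" using d(1) unfolding D'_simps by auto
   obtain g where g: "g : carrier R" "g ~: h x" "g \<otimes>[R] a = \<zero>[R]" by (rule chart_inj[OF a(1) d(2)[unfolded a(2)]])
   have "\<psi> g \<otimes>[D'] d = \<zero>[D']" using \<psi>.hom_mult[OF g(1) a(1)] g(3) a(2) by (simp add: D'_simps)
   then show ?thesis using S[OF g(1,2)] by blast
  qed
 qed
 then show ?thesis using q by (simp add: prime_localization_def prime_localization_axioms_def)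
qed

end

section \<open>Intersection of the regular locus in a classical chart with the free locus in a
  derived chart\<close>

theorem theorem3:
  fixes K :: "'k ring" and Y :: "('p, 'a, 'k) dg_space"
  assumes "perfect_field K"
    and "dg_scheme TYPE('u) K Y"
    and "noetherian_eventually_coconnective TYPE('u) K Y"
    and "algebraic_variety TYPE('u) K (underlying_scheme Y)"
  shows "\<exists>U. openin (dsp Y) U \<and> dsp Y closure_of U = topspace (dsp Y) \<and>
           (\<forall>x \<in> U. sequence_regular (dg_stalk Y x))"
proof -
 let ?Z = "underlying_scheme Y"
 have ne_if: "A ~= {}" if "a : A" for a :: 'p and A using that by blast
 have Y: "dg_ringed_space K Y" using assms(2) unfolding dg_scheme_def by blast
 have Z: "kringed_space K ?Z" "integral_scheme ?Z" "finite_type_over TYPE('u) K ?Z"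
  using assms(4) unfolding algebraic_variety_def scheme_over_def by auto
 have rsp: "rsp ?Z = dsp Y" by (simp add: underlying_scheme_def sheafify_def H0_presheaf_def)
 have ne: "topspace (dsp Y) ~= {}" using Z(2) unfolding integral_scheme_def rsp by blast
 \<comment> \<open>Any two nonempty open sets meet. This provides a common point of the two charts
   and, at the end, the density of the open set.\<close>
 have irr: "V \<inter> W ~= {}" if "openin (dsp Y) V" "V ~= {}" "openin (dsp Y) W" "W ~= {}" for V W
  using integral_scheme_irreducible[OF Z(1,2)] that unfolding rsp by blast
 obtain C where C: "\<Union>C = topspace (dsp Y)"
  "\<forall>U\<in>C. \<exists>R :: ('u, 'k) kalg. affine_open_subscheme K ?Z U R \<and> fin_gen_algebra K R"
  using Z(3) unfolding finite_type_over_def rsp by auto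
 obtain U where U: "U : C" "U ~= {}" using C(1) ne by blast
 from bspec[OF C(2) U(1)] obtain R :: "('u, 'k) kalg" where R: "affine_open_subscheme K ?Z U R \<and> fin_gen_algebra K R" ..
 note aff = conjunct1[OF R, unfolded affine_open_subscheme_def rsp]
 have res: "rres (spec_scheme R) V W s = restrict s W" "rres ?Z V' W' s' = restrict s' W'" for V W s V' W' s'
  by (simp_all add: spec_scheme_def underlying_scheme_def sheafify_def)
 have "\<exists>h \<phi>. scheme_chart K Y U R h \<phi>" using aff
 proof (elim exE conjE)
  fix h \<phi>
  assume \<phi>: "openin (dsp Y) U" "kalgebra K R" "homeomorphic_map (subtopology (dsp Y) U) (zariski R) h"
   "\<forall>V. openin (zariski R) V -->
      \<phi> V : kalg_hom K (rsec (spec_scheme R) V) (rsec ?Z {x : U. h x : V}) \<and>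
      bij_betw (\<phi> V) (carrier (rsec (spec_scheme R) V)) (carrier (rsec ?Z {x : U. h x : V}))"
   "\<forall>V W. openin (zariski R) V \<and> openin (zariski R) W \<and> W \<subseteq> V -->
      (\<forall>s \<in> carrier (rsec (spec_scheme R) V).
       \<phi> W (rres (spec_scheme R) V W s) = rres ?Z {x : U. h x : V} {x : U. h x : W} (\<phi> V s))"
  have "scheme_chart K Y U R h \<phi>" by (rule scheme_chart.intro) (use \<phi> Y Z U(2) in \<open>simp_all add: res\<close>)
  then show ?thesis by (intro exI)
 qed
 then obtain h \<phi> where c: "scheme_chart K Y U R h \<phi>" by (elim exE)
 interpret c: scheme_chart K Y U R h \<phi> by (rule c)
 have "fin_gen_algebra K R" using R by blast
 then obtain S where "finite S" "S \<subseteq> carrier R" "generate_ring R (kstr R ` carrier K \<union> S) = carrier R"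
  unfolding fin_gen_algebra_def by auto
 from c.gen_reg_D'[OF assms(1) this] obtain g where g: "g : carrier c.D'" "g ~= \<zero>[c.D']"
  "!!q. primeideal q c.D' ==> g ~: q ==> reg_at c.D' q" unfolding gen_reg_def by auto
 obtain r where r: "r : carrier R" "g = c.\<psi> r" using g(1) unfolding c.D'_simps by auto
 \<comment> \<open>The kernel of the map from R to its image is prime, hence a point y of the chart:
   the generic one. As g is nonzero, r is not in the kernel, so the locus of r contains y and is
   nonempty.\<close>
 let ?ker = "{a : carrier R. c.\<psi> a : {\<zero>[c.D]}}"
 have ker: "primeideal ?ker R" by (rule primeideal_vimage[OF c.R.is_cring c.D.is_cring c.\<psi>_hom c.D.zeroprimeideal])
 define VR where "VR = {x : U. h x : {q : Spec R. r ~: q}}"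
 have VR: "openin (dsp Y) VR" unfolding VR_def by (rule c.chart(3)[OF c.R.openin_basic[OF r(1)]])
 have kerU: "?ker : h ` U" using c.chart(1) ker c.R.topspace_zariski by (simp add: Spec_def)
 have rker: "r ~: ?ker" using g(2) r by (simp add: c.D'_simps)
 obtain y where y: "?ker = h y" "y : U" using kerU by (rule imageE)
 have "y : VR" unfolding VR_def mem_Collect_eq y(1)[symmetric] using y(2) ker rker unfolding Spec_def by (simp only: mem_Collect_eq simp_thms)
 then have VR_ne: "VR ~= {}" by (rule ne_if)
 obtain C' where C': "\<Union>C' = topspace (dsp Y)"
  "\<forall>U\<in>C'. \<exists>A :: ('u, 'k) dg_alg. affine_open K Y U A \<and> noetherian_dg_ring A \<and> bounded_cohomology A"
  using assms(3) unfolding noetherian_eventually_coconnective_def by auto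
 obtain U' where U': "U' : C'" "U' ~= {}" using C'(1) ne by blast
 from bspec[OF C'(2) U'(1)] obtain A :: "('u, 'k) dg_alg" where
  "affine_open K Y U' A \<and> noetherian_dg_ring A \<and> bounded_cohomology A" ..
 then have A: "affine_open K Y U' A" "noetherian_dg_ring A" "bounded_cohomology A" by auto
 have U'o: "openin (dsp Y) U'" using A(1) unfolding affine_open_def by blast
 interpret A: dg_ring A using A(2) unfolding noetherian_dg_ring_def by blast
 interpret HA: cring "H0 A" by (rule A.H0_cring)
 obtain h' where h': "homeomorphic_map (subtopology (dsp Y) U') (zariski (H0 A)) h'"
  "dg_ringed_space K (affine_dg_scheme A)"
  "!!x. x : U' ==> \<exists>f. coh_iso (dg_stalk (affine_dg_scheme A) (h' x)) (dg_stalk Y x) f"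
  by (rule affine_open_stalks[OF Y A(1)]) blast
 note ch = chart_facts[OF U'o h'(1)]
 have spec: "h' x : Spec (H0 A)" if "x : U'" for x using ch(1) that HA.topspace_zariski by blast
 then have prime: "primeideal (h' x) (H0 A)" if "x : U'" for x using that unfolding Spec_def by simp
 have loc: "\<exists>f. coh_localization A (dg_stalk Y x) f (carrier (H0 A) - h' x)" if x: "x : U'" for x
 proof -
  interpret p: affine_point K A "h' x" by unfold_locales (use h'(2) spec[OF x] in auto)
  from p.affine_stalk_localization obtain f where f: "coh_localization A (dg_stalk (affine_dg_scheme A) (h' x)) f (carrier (H0 A) - h' x)" ..
  from h'(3)[OF x] obtain f' where f': "coh_iso (dg_stalk (affine_dg_scheme A) (h' x)) (dg_stalk Y x) f'" ..
  show ?thesis by (intro exI) (rule coh_localization_iso[OF f f'])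
 qed
 \<comment> \<open>The derived chart shows that \<open>H0\<close> of the stalk is local, and with
   this the classical chart exhibits the same ring as a localization of the domain of
   functions.\<close>
 have locD: "\<exists>\<epsilon> q. prime_localization c.D' (H0 (dg_stalk Y x)) \<epsilon> q \<and> (x : VR --> reg_at c.D' q)"
  if x: "x : U" "x : U'" for x
 proof -
  interpret p: scheme_point K Y U R h \<phi> x by unfold_locales (rule x(1))
  obtain f where f: "coh_localization A (dg_stalk Y x) f (carrier (H0 A) - h' x)" using loc[OF x(2)] by (elim exE)
  have m: "prime_localization (H0 A) (H0 (dg_stalk Y x)) (f 0) (h' x)"
   by (intro prime_localization.intro prime_localization_axioms.intro coh_localization.loc0[OF f] prime[OF x(2)])
  have "\<exists>m. maximalideal m (H0 (dg_stalk Y x)) \<and>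
    (\<forall>c\<in>carrier (H0 (dg_stalk Y x)). c : Units (H0 (dg_stalk Y x)) \<longleftrightarrow> c ~: m)"
   by (intro exI conjI ballI) (rule prime_localization.extend_p_maximal[OF m], rule prime_localization.unit_iff[OF m])
  then obtain m where m: "maximalideal m (H0 (dg_stalk Y x))"
   "!!c. c : carrier (H0 (dg_stalk Y x)) ==> c : Units (H0 (dg_stalk Y x)) \<longleftrightarrow> c ~: m" by (elim exE conjE) (rule that, simp_all)
  have mp: "primeideal m (H0 (dg_stalk Y x))" using p.L.maximalideal_prime[OF m(1)] .
  let ?q = "{c : carrier c.D'. p.p.\<epsilon> c : m}"
  have l: "prime_localization c.D' (H0 (dg_stalk Y x)) p.p.\<epsilon> ?q"
   by (rule p.chart_localization[OF mp]) (rule m(2))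
  have "reg_at c.D' ?q" if v: "x : VR"
  proof (rule g(3))
   show "primeideal ?q c.D'" using l unfolding prime_localization_def prime_localization_axioms_def by blast
   have u: "p.p.\<epsilon> g : Units (H0 (dg_stalk Y x))" using p.\<epsilon>_unit[OF r(1)] v r(2) unfolding VR_def by simp
   then show "g ~: ?q" using m(2)[OF p.L.Units_closed[OF u]] by simp
  qed
  then show ?thesis using l by blast
 qed
 \<comment> \<open>One common point suffices to find the generic prime of the derived chart: at x0
   the ring \<open>H0\<close> of the stalk is a localization of a domain, hence a domain, and P is
   the kernel of the map from \<open>H0 A\<close> to it.\<close>
 obtain x0 where x0: "x0 : U" "x0 : U'" using irr[OF _ U(2) U'o U'(2)] aff by blast
 obtain f0 where f0: "coh_localization A (dg_stalk Y x0) f0 (carrier (H0 A) - h' x0)" using loc[OF x0(2)] by (elim exE)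
 note r0 = coh_localization.loc0[OF f0]
 obtain \<epsilon>0 q0 where l0: "prime_localization c.D' (H0 (dg_stalk Y x0)) \<epsilon>0 q0" using locD[OF x0] by (elim exE conjE)
 have "domain (H0 (dg_stalk Y x0))"
  using ring_localization.domain_transfer[OF prime_localization.axioms(1)[OF l0] c.D'.domain_axioms]
   ideal_facts(2)[OF prime_localization.p_ideal[OF l0]] by simp
 then interpret L0: domain "H0 (dg_stalk Y x0)" .
 define P where "P = {a : carrier (H0 A). f0 0 a : {\<zero>[H0 (dg_stalk Y x0)]}}"
 have P: "primeideal P (H0 A)"
  unfolding P_def by (rule primeideal_vimage[OF HA.is_cring L0.is_cring ring_localization.f_hom[OF r0] L0.zeroprimeideal])
 have noeth: "noetherian_ring (H0 A)" using A(2) unfolding noetherian_dg_ring_def by blast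
 \<comment> \<open>Near x0 the ideal P is zero: one s outside the prime of x0 kills it. This s is
   not in P, since its image is a unit of a nonzero ring.\<close>
 have "\<exists>s\<in>carrier (H0 A) - h' x0. \<forall>a\<in>P. s \<otimes>[H0 A] a = \<zero>[H0 A]"
  by (rule ring_localization.kernel_annihilator[OF r0 noeth primeideal_facts(1)[OF P]]) (simp add: P_def)
 then obtain s where s: "s : carrier (H0 A) - h' x0" "!!a. a : P ==> s \<otimes>[H0 A] a = \<zero>[H0 A]" by auto
 have "f0 0 s ~= \<zero>[H0 (dg_stalk Y x0)]"
 proof
  assume "f0 0 s = \<zero>[H0 (dg_stalk Y x0)]"
  then show False using L0.Units_r_inv[OF ring_localization.f_unit[OF r0 s(1)]] L0.Units_inv_closed[OF ring_localization.f_unit[OF r0 s(1)]] by simp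
 qed
 then have sP: "s : carrier (H0 A) - P" using s(1) unfolding P_def by simp
 obtain f where f: "f : carrier (H0 A) - P"
  "!!(B :: (('p set \<times> 'a) set, 'k) dg_alg) \<eta> p n. primeideal p (H0 A) ==> f ~: p ==> coh_localization A B \<eta> (carrier (H0 A) - p) ==>
    \<exists>k b. free_basis (H0 B) (coh B n) k b"
  by (rule generic_freeness_coh[OF A(2,3) P sP s(2)]) blast+
 define VA where "VA = {x : U'. h' x : {q : Spec (H0 A). f ~: q}}"
 have VA: "openin (dsp Y) VA" unfolding VA_def using f(1) by (intro ch(3) HA.openin_basic) simp
 \<comment> \<open>The prime P is itself a point z of the derived chart, and f is outside P, so the
   locus of freeness contains z and is nonempty.\<close>
 have PU: "P : h' ` U'" using ch(1) P HA.topspace_zariski by (simp add: Spec_def)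
 obtain z where z: "P = h' z" "z : U'" using PU by (rule imageE)
 have "z : VA" unfolding VA_def mem_Collect_eq z(1)[symmetric] using z(2) P f(1) unfolding Spec_def by simp
 then have VA_ne: "VA ~= {}" by (rule ne_if)
 have "sequence_regular (dg_stalk Y x)" if x: "x : VA \<inter> VR" for x
 proof -
  have xU: "x : U" "x : U'" "x : VR" "f ~: h' x" using x unfolding VA_def VR_def by auto
  obtain \<eta> where l: "coh_localization A (dg_stalk Y x) \<eta> (carrier (H0 A) - h' x)" using loc[OF xU(2)] by (elim exE)
  obtain \<epsilon> q where d: "prime_localization c.D' (H0 (dg_stalk Y x)) \<epsilon> q \<and> (x : VR --> reg_at c.D' q)" using locD[OF xU(1,2)] by (elim exE)
  show ?thesis
   by (rule sequence_regular_if_free[OF l prime[OF xU(2)] A(2,3) f(2)[OF prime[OF xU(2)] xU(4) l]]) (use d xU(3) in blast)+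
 qed
 moreover have o: "openin (dsp Y) (VA \<inter> VR)" using VA VR by blast
 moreover have "dsp Y closure_of (VA \<inter> VR) = topspace (dsp Y)"
 proof (rule dense_intersects_open[THEN iffD2])
  show "\<forall>W. openin (dsp Y) W \<and> W ~= {} --> (VA \<inter> VR) \<inter> W ~= {}"
   using irr[OF o irr[OF VA VA_ne VR VR_ne]] by blast
 qed
 ultimately show ?thesis by blast
qed

end
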